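(* Let $(G,P)$ be a quasi-lattice ordered group, let $A$ be a $C^*$-algebra, and let $X$ be a compactly aligned product system over $P$ of right-Hilbert $A$--$A$ bimodules such that the homomorphisms $\widetilde{\phi}_q : A\to\mathcal{L}(\widetilde{X}_q)$, $q\in P$, are all injective. Then there exist a $C^*$-algebra $\mathcal{NO}_X$ and a CNP-covariant representation $j_X$ of $X$ in $\mathcal{NO}_X$ such that: (1) $\mathcal{NO}_X=\overline{\mathrm{span}}\{j_X(x)j_X(y)^*:x,y\in X\}$; and (2) the pair $(\mathcal{NO}_X,j_X)$ is universal in the sense that if $\psi:X\to B$ is any other CNP-covariant representation of $X$ in a $C^*$-algebra $B$, then there is a unique homomorphism $\Pi\psi:\mathcal{NO}_X\to B$ such that $\psi=\Pi\psi\circ j_X$. Moreover, the pair $(\mathcal{NO}_X,j_X)$ is unique up to canonical isomorphism: if $(C,\rho)$ is another pair, consisting of a $C^*$-algebra $C$ and a CNP-covariant representation $\rho$ of $X$ in $C$, with the same properties (1) and (2), then there is an isomorphism $\mathcal{NO}_X\to C$ carrying $j_X(x)$ to $\rho(x)$ for all $x\in X$.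
   Context: BIMODULES. A right-Hilbert $A$--$A$ bimodule over a $C^*$-algebra $A$ is a right Hilbert $A$-module $X$ (with $A$-valued inner product $\langle\cdot,\cdot\rangle_A$, linear in the second variable) together with a $*$-homomorphism $\phi:A\to\mathcal{L}(X)$ into the adjointable operators (not assumed injective or nondegenerate); write $a\cdot x=\phi(a)x$. $\mathcal{K}(X)=\overline{\mathrm{span}}\{x\otimes y^* : x,y\in X\}$, where $(x\otimes y^* )(z)=x\cdot\langle y,z\rangle_A$. ${}_AA_A$ denotes $A$ with $\langle a,b\rangle_A=a^*b$ and actions by multiplication; $\mathcal{K}({}_AA_A)\cong A$, with $a$ corresponding to left multiplication by $a$. $\otimes_A$ is the balanced (internal) tensor product, with left action $a\mapsto\phi(a)\otimes 1$. QUASI-LATTICE ORDERED GROUPS. $(G,P)$ is a quasi-lattice ordered group if $G$ is a discrete group, $P$ is a subsemigroup of $G$ with $P\cap P^{-1}=\{e\}$, and, for the partial order $p\le q \iff p^{-1}q\in P$, any two $p,q\in G$ having a common upper bound in $P$ have a least upper bound $p\vee q\in P$. Write $p\vee q=\infty$ if there is no common upper bound in $P$, and $p\vee q<\infty$ otherwise. PRODUCT SYSTEMS. A product system over $P$ of right-Hilbert $A$--$A$ bimodules is a semigroup $X=\bigsqcup_{p\in P}X_p$ such that: each $X_p$ is a right-Hilbert $A$--$A$ bimodule (left action $\phi_p:A\to\mathcal{L}(X_p)$, inner product $\langle\cdot,\cdot\rangle_A^p$); $X_e={}_AA_A$; for $p,q\in P\setminus\{e\}$ there is an isomorphism $M_{p,q}:X_p\otimes_A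 X_q\to X_{pq}$ with $M_{p,q}(x\otimes_A y)=xy$; and multiplication by elements of $X_e=A$ implements the left and right actions of $A$ on each $X_p$. For $p\neq e$ and $q\in P$, $\iota_p^{pq}:\mathcal{L}(X_p)\to\mathcal{L}(X_{pq})$ is the homomorphism characterised by $\iota_p^{pq}(S)(xy)=(Sx)y$ for $x\in X_p$, $y\in X_q$; $\iota_e^q:\mathcal{K}(X_e)\cong A\to\mathcal{L}(X_q)$ is $\phi_q$; and $\iota_p^r=0$ if $p\not\le r$. $X$ is compactly aligned if whenever $p\vee q<\infty$, $S\in\mathcal{K}(X_p)$ and $T\in\mathcal{K}(X_q)$, we have $\iota_p^{p\vee q}(S)\iota_q^{p\vee q}(T)\in\mathcal{K}(X_{p\vee q})$. THE MODULES $\widetilde{X}_q$. For a right Hilbert $A$-module $Y$ and an ideal $I$ of $A$, $Y\cdot I=\{y\cdot a:y\in Y,a\in I\}$, a closed sub-bimodule when $Y$ is a bimodule. Put $I_e=A$ and $I_p=\bigcap_{e<r\le p}\ker(\phi_r)$ for $p \in P\setminus\{e\}$. For $q\in P$, $\widetilde{X}_q=\bigoplus_{p\le q}X_p\cdot I_{p^{-1}q}$ (Hilbert module direct sum over $p\in P$, $p\le q$), with left action $\widetilde{\phi}_q:A\to\mathcal{L}(\widetilde{X}_q)$, $(\widetilde{\phi}_q(a)x)(p)=\phi_p(a)x(p)$. For $p\ne e$, $\widetilde{\iota}_p^{\,q}:\mathcal{L}(X_p)\to\mathcal{L}(\widetilde{X}_q)$ is given by $(\widetilde{\iota}_p^{\,q}(S)x)(r)=\iota_p^r(S)x(r)$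 for $r\le q$; and $\widetilde{\iota}_e^{\,q}:\mathcal{K}(X_e)\cong A\to\mathcal{L}(\widetilde{X}_q)$ is $\widetilde{\phi}_q$. REPRESENTATIONS. A representation of $X$ in a $C^*$-algebra $B$ is a map $\psi:X\to B$, with $\psi_p=\psi|_{X_p}$, such that each $\psi_p$ is linear and $\psi_e$ is a $*$-homomorphism; $\psi_p(x)\psi_q(y)=\psi_{pq}(xy)$ for $x\in X_p,y\in X_q$; and $\psi_e(\langle x,y\rangle_A^p)=\psi_p(x)^*\psi_p(y)$ for $x,y\in X_p$. Then $\psi^{(p)}:\mathcal{K}(X_p)\to B$ is the homomorphism with $\psi^{(p)}(x\otimes y^* )=\psi_p(x)\psi_p(y)^*$. $\psi$ is Nica covariant if for all $p,q\in P$, $S\in\mathcal{K}(X_p)$, $T\in\mathcal{K}(X_q)$: $\psi^{(p)}(S)\psi^{(q)}(T)=\psi^{(p\vee q)}(\iota_p^{p\vee q}(S)\iota_q^{p\vee q}(T))$ if $p\vee q<\infty$, and $=0$ otherwise. A statement $\mathcal{P}(s)$ ($s\in P$) holds for large $s$ if for every $q\in P$ there is $r\in P$ with $q\le r$ such that $\mathcal{P}(s)$ holds for all $s\ge r$. Assuming all $\widetilde{\phi}_q$ injective, $\psi$ satisfies (CP) if $\sum_{p\in F}\psi^{(p)}(T_p)=0$ for every finite $F\subset P$ and all $T_p\in\mathcal{K}(X_p)$ ($p\in F$) such that $\sum_{p\in F}\widetilde{\iota}_p^{\,s}(T_p)=0$ for large $s$. $\psi$ is CNP-covariant if it is Nica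 covariant and satisfies (CP). *)

theory Defs
  imports Complex_Main "HOL-Algebra.FiniteProduct" "HOL-Analysis.Abstract_Metric_Spaces"
begin

section \<open>C*-algebras and *-homomorphisms\<close>

text \<open>All structures are records with an explicit carrier, in the style of HOL-Algebra. Operations are
  only meaningful on the carrier; no axiom constrains their values elsewhere.\<close>

record 'v cvec = "'v partial_object" +
  vadd :: "'v \<Rightarrow> 'v \<Rightarrow> 'v" (infixl "\<boxplus>\<index>" 65)
  vzero :: 'v ("\<zero>\<^sub>v\<index>")
  vscale :: "complex \<Rightarrow> 'v \<Rightarrow> 'v" (infixr "\<cdot>\<index>" 75)

definition vgroup :: "('v, 'z) cvec_scheme \<Rightarrow> 'v monoid" where
  "vgroup V = \<lparr>carrier = carrier V, mult = vadd V, one = vzero V\<rparr>"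

definition vsum :: "('v, 'z) cvec_scheme \<Rightarrow> ('i \<Rightarrow> 'v) \<Rightarrow> 'i set \<Rightarrow> 'v" where
  "vsum V f F = finprod (vgroup V) f F"

definition vdiff :: "('v, 'z) cvec_scheme \<Rightarrow> 'v \<Rightarrow> 'v \<Rightarrow> 'v" where
  "vdiff V x y = x \<boxplus>\<^bsub>V\<^esub> (- 1) \<cdot>\<^bsub>V\<^esub> y"

definition vspan :: "('v, 'z) cvec_scheme \<Rightarrow> 'v set \<Rightarrow> 'v set" where
  "vspan V S = {vsum V (\<lambda>s. c s \<cdot>\<^bsub>V\<^esub> s) F | c F. finite F \<and> F \<subseteq> S}"

definition linear_map :: "('v, 'y) cvec_scheme \<Rightarrow> ('w, 'z) cvec_scheme \<Rightarrow> ('v \<Rightarrow> 'w) \<Rightarrow> bool" where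
  "linear_map V W f \<longleftrightarrow> f \<in> carrier V \<rightarrow> carrier W \<and>
     (\<forall>x\<in>carrier V. \<forall>y\<in>carrier V. f (x \<boxplus>\<^bsub>V\<^esub> y) = f x \<boxplus>\<^bsub>W\<^esub> f y) \<and>
     (\<forall>c. \<forall>x\<in>carrier V. f (c \<cdot>\<^bsub>V\<^esub> x) = c \<cdot>\<^bsub>W\<^esub> f x)"

locale cvector_space =
  fixes V (structure)
  assumes vgroup: "comm_group (vgroup V)"
    and scale_closed: "x \<in> carrier V \<Longrightarrow> c \<cdot> x \<in> carrier V"
    and scale_right_distrib: "x \<in> carrier V \<Longrightarrow> y \<in> carrier V \<Longrightarrow> c \<cdot> (x \<boxplus> y) = c \<cdot> x \<boxplus> c \<cdot> y"
    and scale_left_distrib: "x \<in> carrier V \<Longrightarrow> (c + d) \<cdot> x = c \<cdot> x \<boxplus> d \<cdot> x"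
    and scale_scale: "x \<in> carrier V \<Longrightarrow> c \<cdot> d \<cdot> x = (c * d) \<cdot> x"
    and scale_one: "x \<in> carrier V \<Longrightarrow> 1 \<cdot> x = x"

record 'a cstar = "'a cvec" +
  amult :: "'a \<Rightarrow> 'a \<Rightarrow> 'a" (infixl "\<odot>\<index>" 70)
  astar :: "'a \<Rightarrow> 'a" ("_\<^sup>\<star>\<index>" [1000] 999)
  anorm :: "'a \<Rightarrow> real"

text \<open>The distance is cut off outside the carrier because \<^locale>\<open>Metric_space\<close> demands symmetry and
  nonnegativity for all arguments.\<close>

definition cstar_dist :: "'a cstar \<Rightarrow> 'a \<Rightarrow> 'a \<Rightarrow> real" where
  "cstar_dist A a b =
     (if a \<in> carrier A \<and> b \<in> carrier A then anorm A (vdiff A a b) else 0)"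

abbreviation cstar_topology :: "'a cstar \<Rightarrow> 'a topology" where
  "cstar_topology A \<equiv> Metric_space.mtopology (carrier A) (cstar_dist A)"

locale cstar_algebra = cvector_space A for A :: "'a cstar" (structure) +
  assumes mult_closed: "a \<in> carrier A \<Longrightarrow> b \<in> carrier A \<Longrightarrow> a \<odot> b \<in> carrier A"
    and mult_assoc: "a \<in> carrier A \<Longrightarrow> b \<in> carrier A \<Longrightarrow> c \<in> carrier A \<Longrightarrow>
          (a \<odot> b) \<odot> c = a \<odot> (b \<odot> c)"
    and mult_add_right: "a \<in> carrier A \<Longrightarrow> b \<in> carrier A \<Longrightarrow> c \<in> carrier A \<Longrightarrow>
          a \<odot> (b \<boxplus> c) = a \<odot> b \<boxplus> a \<odot> c"
    and mult_add_left: "a \<in> carrier A \<Longrightarrow> b \<in> carrier A \<Longrightarrow> c \<in> carrier A \<Longrightarrow>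
          (a \<boxplus> b) \<odot> c = a \<odot> c \<boxplus> b \<odot> c"
    and mult_scale_right: "a \<in> carrier A \<Longrightarrow> b \<in> carrier A \<Longrightarrow> a \<odot> (z \<cdot> b) = z \<cdot> (a \<odot> b)"
    and mult_scale_left: "a \<in> carrier A \<Longrightarrow> b \<in> carrier A \<Longrightarrow> (z \<cdot> a) \<odot> b = z \<cdot> (a \<odot> b)"
    and star_closed: "a \<in> carrier A \<Longrightarrow> a\<^sup>\<star> \<in> carrier A"
    and star_star: "a \<in> carrier A \<Longrightarrow> (a\<^sup>\<star>)\<^sup>\<star> = a"
    and star_add: "a \<in> carrier A \<Longrightarrow> b \<in> carrier A \<Longrightarrow> (a \<boxplus> b)\<^sup>\<star> = a\<^sup>\<star> \<boxplus> b\<^sup>\<star>"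
    and star_scale: "a \<in> carrier A \<Longrightarrow> (z \<cdot> a)\<^sup>\<star> = cnj z \<cdot> a\<^sup>\<star>"
    and star_mult: "a \<in> carrier A \<Longrightarrow> b \<in> carrier A \<Longrightarrow> (a \<odot> b)\<^sup>\<star> = b\<^sup>\<star> \<odot> a\<^sup>\<star>"
    and norm_nonneg: "a \<in> carrier A \<Longrightarrow> 0 \<le> anorm A a"
    and norm_eq_zero: "a \<in> carrier A \<Longrightarrow> anorm A a = 0 \<longleftrightarrow> a = \<zero>\<^sub>v"
    and norm_scale: "a \<in> carrier A \<Longrightarrow> anorm A (z \<cdot> a) = cmod z * anorm A a"
    and norm_triangle: "a \<in> carrier A \<Longrightarrow> b \<in> carrier A \<Longrightarrow>
          anorm A (a \<boxplus> b) \<le> anorm A a + anorm A b"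
    and norm_mult: "a \<in> carrier A \<Longrightarrow> b \<in> carrier A \<Longrightarrow>
          anorm A (a \<odot> b) \<le> anorm A a * anorm A b"
    and cstar_identity: "a \<in> carrier A \<Longrightarrow> anorm A (a\<^sup>\<star> \<odot> a) = (anorm A a)\<^sup>2"
    and complete: "Metric_space.mcomplete (carrier A) (cstar_dist A)"

definition positive :: "'a cstar \<Rightarrow> 'a \<Rightarrow> bool" where
  "positive A a \<longleftrightarrow> (\<exists>b\<in>carrier A. a = b\<^sup>\<star>\<^bsub>A\<^esub> \<odot>\<^bsub>A\<^esub> b)"

text \<open>Homomorphisms between C*-algebras, as functions that are \<^const>\<open>undefined\<close> off the carrier, so that
  uniqueness statements about them make sense.\<close>

definition star_homs :: "'a cstar \<Rightarrow> 'b cstar \<Rightarrow> ('a \<Rightarrow> 'b) set" where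
  "star_homs A B = {h \<in> carrier A \<rightarrow>\<^sub>E carrier B. linear_map A B h \<and>
     (\<forall>a\<in>carrier A. \<forall>b\<in>carrier A. h (a \<odot>\<^bsub>A\<^esub> b) = h a \<odot>\<^bsub>B\<^esub> h b) \<and>
     (\<forall>a\<in>carrier A. h (a\<^sup>\<star>\<^bsub>A\<^esub>) = (h a)\<^sup>\<star>\<^bsub>B\<^esub>)}"

definition star_isos :: "'a cstar \<Rightarrow> 'b cstar \<Rightarrow> ('a \<Rightarrow> 'b) set" where
  "star_isos A B = {h \<in> star_homs A B. bij_betw h (carrier A) (carrier B)}"


section \<open>Right-Hilbert bimodules\<close>

record ('a, 'x) hbimod = "'x cvec" +
  ract :: "'x \<Rightarrow> 'a \<Rightarrow> 'x"
  hinner :: "'x \<Rightarrow> 'x \<Rightarrow> 'a"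
  lact :: "'a \<Rightarrow> 'x \<Rightarrow> 'x"

definition hnorm :: "'a cstar \<Rightarrow> ('a, 'x) hbimod \<Rightarrow> 'x \<Rightarrow> real" where
  "hnorm A X x = sqrt (anorm A (hinner X x x))"

definition hdist :: "'a cstar \<Rightarrow> ('a, 'x) hbimod \<Rightarrow> 'x \<Rightarrow> 'x \<Rightarrow> real" where
  "hdist A X x y = (if x \<in> carrier X \<and> y \<in> carrier X then hnorm A X (vdiff X x y) else 0)"

text \<open>A right Hilbert A-module; the field \<^const>\<open>lact\<close> plays no role here.\<close>

locale hilbert_module = A: cstar_algebra A + cvector_space X
  for A :: "'a cstar" and X :: "('a, 'x) hbimod" +
  assumes ract_closed: "x \<in> carrier X \<Longrightarrow> a \<in> carrier A \<Longrightarrow> ract X x a \<in> carrier X"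
    and ract_add_left: "x \<in> carrier X \<Longrightarrow> y \<in> carrier X \<Longrightarrow> a \<in> carrier A \<Longrightarrow>
          ract X (x \<boxplus>\<^bsub>X\<^esub> y) a = ract X x a \<boxplus>\<^bsub>X\<^esub> ract X y a"
    and ract_add_right: "x \<in> carrier X \<Longrightarrow> a \<in> carrier A \<Longrightarrow> b \<in> carrier A \<Longrightarrow>
          ract X x (a \<boxplus>\<^bsub>A\<^esub> b) = ract X x a \<boxplus>\<^bsub>X\<^esub> ract X x b"
    and ract_mult: "x \<in> carrier X \<Longrightarrow> a \<in> carrier A \<Longrightarrow> b \<in> carrier A \<Longrightarrow>
          ract X x (a \<odot>\<^bsub>A\<^esub> b) = ract X (ract X x a) b"
    and ract_scale_left: "x \<in> carrier X \<Longrightarrow> a \<in> carrier A \<Longrightarrow>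
          ract X (c \<cdot>\<^bsub>X\<^esub> x) a = c \<cdot>\<^bsub>X\<^esub> ract X x a"
    and ract_scale_right: "x \<in> carrier X \<Longrightarrow> a \<in> carrier A \<Longrightarrow>
          ract X x (c \<cdot>\<^bsub>A\<^esub> a) = c \<cdot>\<^bsub>X\<^esub> ract X x a"
    and inner_closed: "x \<in> carrier X \<Longrightarrow> y \<in> carrier X \<Longrightarrow> hinner X x y \<in> carrier A"
    and inner_add_right: "x \<in> carrier X \<Longrightarrow> y \<in> carrier X \<Longrightarrow> z \<in> carrier X \<Longrightarrow>
          hinner X x (y \<boxplus>\<^bsub>X\<^esub> z) = hinner X x y \<boxplus>\<^bsub>A\<^esub> hinner X x z"
    and inner_scale_right: "x \<in> carrier X \<Longrightarrow> y \<in> carrier X \<Longrightarrow>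
          hinner X x (c \<cdot>\<^bsub>X\<^esub> y) = c \<cdot>\<^bsub>A\<^esub> hinner X x y"
    and inner_ract_right: "x \<in> carrier X \<Longrightarrow> y \<in> carrier X \<Longrightarrow> a \<in> carrier A \<Longrightarrow>
          hinner X x (ract X y a) = hinner X x y \<odot>\<^bsub>A\<^esub> a"
    and inner_star: "x \<in> carrier X \<Longrightarrow> y \<in> carrier X \<Longrightarrow>
          (hinner X x y)\<^sup>\<star>\<^bsub>A\<^esub> = hinner X y x"
    and inner_positive: "x \<in> carrier X \<Longrightarrow> positive A (hinner X x x)"
    and inner_definite: "x \<in> carrier X \<Longrightarrow> hinner X x x = \<zero>\<^sub>v\<^bsub>A\<^esub> \<Longrightarrow> x = \<zero>\<^sub>v\<^bsub>X\<^esub>"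
    and complete: "Metric_space.mcomplete (carrier X) (hdist A X)"

definition is_adjoint :: "('a, 'x) hbimod \<Rightarrow> ('x \<Rightarrow> 'x) \<Rightarrow> ('x \<Rightarrow> 'x) \<Rightarrow> bool" where
  "is_adjoint X T S \<longleftrightarrow>
     (\<forall>x\<in>carrier X. \<forall>y\<in>carrier X. hinner X (T x) y = hinner X x (S y))"

definition adjointables :: "'a cstar \<Rightarrow> ('a, 'x) hbimod \<Rightarrow> ('x \<Rightarrow> 'x) cstar" where
  "adjointables A X =
    \<lparr>carrier = {T \<in> carrier X \<rightarrow>\<^sub>E carrier X. \<exists>S \<in> carrier X \<rightarrow>\<^sub>E carrier X. is_adjoint X T S},
     vadd = (\<lambda>S T. \<lambda>x\<in>carrier X. S x \<boxplus>\<^bsub>X\<^esub> T x),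
     vzero = (\<lambda>x\<in>carrier X. \<zero>\<^sub>v\<^bsub>X\<^esub>),
     vscale = (\<lambda>c T. \<lambda>x\<in>carrier X. c \<cdot>\<^bsub>X\<^esub> T x),
     amult = (\<lambda>S T. \<lambda>x\<in>carrier X. S (T x)),
     astar = (\<lambda>T. THE S. S \<in> carrier X \<rightarrow>\<^sub>E carrier X \<and> is_adjoint X T S),
     anorm = (\<lambda>T. Sup {hnorm A X (T x) | x. x \<in> carrier X \<and> hnorm A X x \<le> 1})\<rparr>"

text \<open>The rank-one operator \<open>x \<otimes> y*\<close>.\<close>

definition rank_one :: "('a, 'x) hbimod \<Rightarrow> 'x \<Rightarrow> 'x \<Rightarrow> 'x \<Rightarrow> 'x" where
  "rank_one X x y = (\<lambda>z\<in>carrier X. ract X x (hinner X y z))"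

definition compacts :: "'a cstar \<Rightarrow> ('a, 'x) hbimod \<Rightarrow> ('x \<Rightarrow> 'x) cstar" where
  "compacts A X = (adjointables A X)
    \<lparr>carrier := cstar_topology (adjointables A X) closure_of
       vspan (adjointables A X) {rank_one X x y | x y. x \<in> carrier X \<and> y \<in> carrier X}\<rparr>"

text \<open>The left action as a map into the adjointable operators.\<close>

definition left_hom :: "'a cstar \<Rightarrow> ('a, 'x) hbimod \<Rightarrow> 'a \<Rightarrow> 'x \<Rightarrow> 'x" where
  "left_hom A X = (\<lambda>a\<in>carrier A. \<lambda>x\<in>carrier X. lact X a x)"

locale hilbert_bimodule = hilbert_module A X
  for A :: "'a cstar" and X :: "('a, 'x) hbimod" +
  assumes left_hom: "left_hom A X \<in> star_homs A (adjointables A X)"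

definition self_bimodule :: "'a cstar \<Rightarrow> ('a, 'a) hbimod" where
  "self_bimodule A =
    \<lparr>carrier = carrier A, vadd = vadd A, vzero = vzero A, vscale = vscale A,
     ract = amult A, hinner = (\<lambda>a b. a\<^sup>\<star>\<^bsub>A\<^esub> \<odot>\<^bsub>A\<^esub> b), lact = amult A\<rparr>"

text \<open>The inverse of the isomorphism from \<open>A\<close> to the compacts on \<open>A\<close> taking \<open>a\<close> to left multiplication.\<close>

definition compact_symbol :: "'a cstar \<Rightarrow> ('a \<Rightarrow> 'a) \<Rightarrow> 'a" where
  "compact_symbol A = the_inv_into (carrier A) (left_hom A (self_bimodule A))"

definition bimodule_isos ::
    "'a cstar \<Rightarrow> ('a, 'x) hbimod \<Rightarrow> ('a, 'y) hbimod \<Rightarrow> ('x \<Rightarrow> 'y) set" where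
  "bimodule_isos A X Y = {M. bij_betw M (carrier X) (carrier Y) \<and> linear_map X Y M \<and>
     (\<forall>x\<in>carrier X. \<forall>a\<in>carrier A. M (ract X x a) = ract Y (M x) a \<and> M (lact X a x) = lact Y a (M x)) \<and>
     (\<forall>x\<in>carrier X. \<forall>x'\<in>carrier X. hinner Y (M x) (M x') = hinner X x x')}"


section \<open>The balanced tensor product\<close>

text \<open>Hausdorff completion of a semi-inner product module: Cauchy sequences modulo null sequences. The
  input need not satisfy any module axioms strictly (below, addition is concatenation of lists); they
  are only required up to vectors of seminorm zero.\<close>

definition hcauchy :: "'a cstar \<Rightarrow> ('a, 'v) hbimod \<Rightarrow> (nat \<Rightarrow> 'v) set" where
  "hcauchy A V = {s. (\<forall>n. s n \<in> carrier V) \<and>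
     (\<forall>\<epsilon>>0. \<exists>N. \<forall>m\<ge>N. \<forall>n\<ge>N. hdist A V (s m) (s n) < \<epsilon>)}"

definition hnull_rel :: "'a cstar \<Rightarrow> ('a, 'v) hbimod \<Rightarrow> ((nat \<Rightarrow> 'v) \<times> (nat \<Rightarrow> 'v)) set" where
  "hnull_rel A V = {(s, t). s \<in> hcauchy A V \<and> t \<in> hcauchy A V \<and>
     (\<lambda>n. hdist A V (s n) (t n)) \<longlonglongrightarrow> 0}"

definition hausdorff_completion ::
    "'a cstar \<Rightarrow> ('a, 'v) hbimod \<Rightarrow> ('a, (nat \<Rightarrow> 'v) set) hbimod" where
  "hausdorff_completion A V =
    (let cls = (\<lambda>s. hnull_rel A V `` {s}) in
    \<lparr>carrier = hcauchy A V // hnull_rel A V,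
     vadd = (\<lambda>U W. \<Union>s\<in>U. \<Union>t\<in>W. cls (\<lambda>n. s n \<boxplus>\<^bsub>V\<^esub> t n)),
     vzero = cls (\<lambda>n. \<zero>\<^sub>v\<^bsub>V\<^esub>),
     vscale = (\<lambda>c U. \<Union>s\<in>U. cls (\<lambda>n. c \<cdot>\<^bsub>V\<^esub> s n)),
     ract = (\<lambda>U a. \<Union>s\<in>U. cls (\<lambda>n. ract V (s n) a)),
     hinner = (\<lambda>U W. THE b. \<forall>s\<in>U. \<forall>t\<in>W.
       limitin (cstar_topology A) (\<lambda>n. hinner V (s n) (t n)) b sequentially),
     lact = (\<lambda>a U. \<Union>s\<in>U. cls (\<lambda>n. lact V a (s n)))\<rparr>)"

text \<open>The list \<open>[(x\<^sub>1,y\<^sub>1),\<dots>,(x\<^sub>k,y\<^sub>k)]\<close> stands for the sum of the elementary tensors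
  \<open>x\<^sub>i \<otimes> y\<^sub>i\<close>, with \<open>\<langle>x \<otimes> y, x' \<otimes> y'\<rangle> = \<langle>y, \<langle>x, x'\<rangle> \<cdot> y'\<rangle>\<close>. The bilinearity and balancing relations
  hold up to vectors of seminorm zero, hence in the completion.\<close>

definition formal_tensors ::
    "'a cstar \<Rightarrow> ('a, 'x) hbimod \<Rightarrow> ('a, 'y) hbimod \<Rightarrow> ('a, ('x \<times> 'y) list) hbimod" where
  "formal_tensors A X Y =
    \<lparr>carrier = lists (carrier X \<times> carrier Y),
     vadd = (@),
     vzero = [],
     vscale = (\<lambda>c. map (\<lambda>(x, y). (c \<cdot>\<^bsub>X\<^esub> x, y))),
     ract = (\<lambda>l a. map (\<lambda>(x, y). (x, ract Y y a)) l),
     hinner = (\<lambda>l l'. foldr (vadd A)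
       (map (\<lambda>((x, y), (x', y')). hinner Y y (lact Y (hinner X x x') y')) (List.product l l'))
       \<zero>\<^sub>v\<^bsub>A\<^esub>),
     lact = (\<lambda>a. map (\<lambda>(x, y). (lact X a x, y)))\<rparr>"

definition balanced_tensor ::
    "'a cstar \<Rightarrow> ('a, 'x) hbimod \<Rightarrow> ('a, 'y) hbimod \<Rightarrow> ('a, (nat \<Rightarrow> ('x \<times> 'y) list) set) hbimod" where
  "balanced_tensor A X Y = hausdorff_completion A (formal_tensors A X Y)"

definition elem_tensor ::
    "'a cstar \<Rightarrow> ('a, 'x) hbimod \<Rightarrow> ('a, 'y) hbimod \<Rightarrow> 'x \<Rightarrow> 'y \<Rightarrow> (nat \<Rightarrow> ('x \<times> 'y) list) set" where
  "elem_tensor A X Y x y = hnull_rel A (formal_tensors A X Y) `` {\<lambda>n. [(x, y)]}"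


section \<open>Quasi-lattice ordered groups\<close>

definition ple :: "'g monoid \<Rightarrow> 'g set \<Rightarrow> 'g \<Rightarrow> 'g \<Rightarrow> bool" where
  "ple G P p q \<longleftrightarrow> inv\<^bsub>G\<^esub> p \<otimes>\<^bsub>G\<^esub> q \<in> P"

definition has_ub :: "'g monoid \<Rightarrow> 'g set \<Rightarrow> 'g \<Rightarrow> 'g \<Rightarrow> bool" where
  "has_ub G P p q \<longleftrightarrow> (\<exists>r\<in>P. ple G P p r \<and> ple G P q r)"

definition is_join :: "'g monoid \<Rightarrow> 'g set \<Rightarrow> 'g \<Rightarrow> 'g \<Rightarrow> 'g \<Rightarrow> bool" where
  "is_join G P p q r \<longleftrightarrow> r \<in> P \<and> ple G P p r \<and> ple G P q r \<and>
     (\<forall>s\<in>P. ple G P p s \<longrightarrow> ple G P q s \<longrightarrow> ple G P r s)"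

definition join :: "'g monoid \<Rightarrow> 'g set \<Rightarrow> 'g \<Rightarrow> 'g \<Rightarrow> 'g" where
  "join G P p q = (THE r. is_join G P p q r)"

locale quasi_lattice_ordered = group G for G :: "'g monoid" (structure) +
  fixes P :: "'g set"
  assumes P_subset: "P \<subseteq> carrier G"
    and P_mult: "p \<in> P \<Longrightarrow> q \<in> P \<Longrightarrow> p \<otimes> q \<in> P"
    and P_inter_inverse: "P \<inter> m_inv G ` P = {\<one>}"
    and ex_join: "p \<in> carrier G \<Longrightarrow> q \<in> carrier G \<Longrightarrow> has_ub G P p q \<Longrightarrow> \<exists>r. is_join G P p q r"

definition for_large :: "'g monoid \<Rightarrow> 'g set \<Rightarrow> ('g \<Rightarrow> bool) \<Rightarrow> bool" where
  "for_large G P Q \<longleftrightarrow> (\<forall>q\<in>P. \<exists>r\<in>P. ple G P q r \<and> (\<forall>s\<in>P. ple G P r s \<longrightarrow> Q s))"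


section \<open>Product systems\<close>

text \<open>The semigroup is the disjoint union of the fibres: its elements are the pairs \<open>(p, x)\<close> with \<open>x\<close> in
  the fibre over \<open>p\<close>, and \<open>pmult X p q x y\<close> is the second component of the product of \<open>(p, x)\<close> and
  \<open>(q, y)\<close>. The fibres are subsets of the type that carries \<open>A\<close>, since the fibre over the identity
  is \<open>A\<close> itself.\<close>

record ('g, 'a) psys =
  fibre :: "'g \<Rightarrow> ('a, 'a) hbimod"
  pmult :: "'g \<Rightarrow> 'g \<Rightarrow> 'a \<Rightarrow> 'a \<Rightarrow> 'a"

locale product_system = quasi_lattice_ordered G P + cstar_algebra A
  for G :: "'g monoid" and P :: "'g set" and A :: "'a cstar" and X :: "('g, 'a) psys" +
  assumes fibre_bimodule: "p \<in> P \<Longrightarrow> hilbert_bimodule A (fibre X p)"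
    and fibre_one: "fibre X \<one>\<^bsub>G\<^esub> = self_bimodule A"
    and pmult_closed: "p \<in> P \<Longrightarrow> q \<in> P \<Longrightarrow> x \<in> carrier (fibre X p) \<Longrightarrow> y \<in> carrier (fibre X q) \<Longrightarrow>
          pmult X p q x y \<in> carrier (fibre X (p \<otimes>\<^bsub>G\<^esub> q))"
    and pmult_assoc: "p \<in> P \<Longrightarrow> q \<in> P \<Longrightarrow> r \<in> P \<Longrightarrow>
          x \<in> carrier (fibre X p) \<Longrightarrow> y \<in> carrier (fibre X q) \<Longrightarrow> z \<in> carrier (fibre X r) \<Longrightarrow>
          pmult X (p \<otimes>\<^bsub>G\<^esub> q) r (pmult X p q x y) z = pmult X p (q \<otimes>\<^bsub>G\<^esub> r) x (pmult X q r y z)"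
    and pmult_tensor: "p \<in> P - {\<one>\<^bsub>G\<^esub>} \<Longrightarrow> q \<in> P - {\<one>\<^bsub>G\<^esub>} \<Longrightarrow>
          \<exists>M \<in> bimodule_isos A (balanced_tensor A (fibre X p) (fibre X q)) (fibre X (p \<otimes>\<^bsub>G\<^esub> q)).
            \<forall>x\<in>carrier (fibre X p). \<forall>y\<in>carrier (fibre X q).
              M (elem_tensor A (fibre X p) (fibre X q) x y) = pmult X p q x y"
    and pmult_one_left: "p \<in> P \<Longrightarrow> a \<in> carrier A \<Longrightarrow> x \<in> carrier (fibre X p) \<Longrightarrow>
          pmult X \<one>\<^bsub>G\<^esub> p a x = lact (fibre X p) a x"
    and pmult_one_right: "p \<in> P \<Longrightarrow> a \<in> carrier A \<Longrightarrow> x \<in> carrier (fibre X p) \<Longrightarrow>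
          pmult X p \<one>\<^bsub>G\<^esub> x a = ract (fibre X p) x a"

definition iota ::
    "'g monoid \<Rightarrow> 'g set \<Rightarrow> 'a cstar \<Rightarrow> ('g, 'a) psys \<Rightarrow> 'g \<Rightarrow> 'g \<Rightarrow> ('a \<Rightarrow> 'a) \<Rightarrow> 'a \<Rightarrow> 'a" where
  "iota G P A X p r S =
    (if p = \<one>\<^bsub>G\<^esub> then left_hom A (fibre X r) (compact_symbol A S)
     else if ple G P p r then
       (THE R. R \<in> carrier (adjointables A (fibre X r)) \<and>
          (\<forall>x\<in>carrier (fibre X p). \<forall>y\<in>carrier (fibre X (inv\<^bsub>G\<^esub> p \<otimes>\<^bsub>G\<^esub> r)).
             R (pmult X p (inv\<^bsub>G\<^esub> p \<otimes>\<^bsub>G\<^esub> r) x y) = pmult X p (inv\<^bsub>G\<^esub> p \<otimes>\<^bsub>G\<^esub> r) (S x) y))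
     else \<zero>\<^sub>v\<^bsub>adjointables A (fibre X r)\<^esub>)"

text \<open>The product of \<open>\<iota>(S)\<close> and \<open>\<iota>(T)\<close> over the least upper bound of \<open>p\<close> and \<open>q\<close>.\<close>

definition iota_join ::
    "'g monoid \<Rightarrow> 'g set \<Rightarrow> 'a cstar \<Rightarrow> ('g, 'a) psys \<Rightarrow> 'g \<Rightarrow> 'g \<Rightarrow> ('a \<Rightarrow> 'a) \<Rightarrow> ('a \<Rightarrow> 'a) \<Rightarrow> 'a \<Rightarrow> 'a" where
  "iota_join G P A X p q S T =
     iota G P A X p (join G P p q) S \<odot>\<^bsub>adjointables A (fibre X (join G P p q))\<^esub>
     iota G P A X q (join G P p q) T"

definition compactly_aligned ::
    "'g monoid \<Rightarrow> 'g set \<Rightarrow> 'a cstar \<Rightarrow> ('g, 'a) psys \<Rightarrow> bool" where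
  "compactly_aligned G P A X \<longleftrightarrow>
     (\<forall>p\<in>P. \<forall>q\<in>P. has_ub G P p q \<longrightarrow>
        (\<forall>S\<in>carrier (compacts A (fibre X p)). \<forall>T\<in>carrier (compacts A (fibre X q)).
           iota_join G P A X p q S T \<in> carrier (compacts A (fibre X (join G P p q)))))"


section \<open>The augmented modules\<close>

definition ideal_I :: "'g monoid \<Rightarrow> 'g set \<Rightarrow> 'a cstar \<Rightarrow> ('g, 'a) psys \<Rightarrow> 'g \<Rightarrow> 'a set" where
  "ideal_I G P A X p = {a \<in> carrier A. p \<noteq> \<one>\<^bsub>G\<^esub> \<longrightarrow>
     (\<forall>r\<in>P. r \<noteq> \<one>\<^bsub>G\<^esub> \<longrightarrow> ple G P r p \<longrightarrow>
        left_hom A (fibre X r) a = \<zero>\<^sub>v\<^bsub>adjointables A (fibre X r)\<^esub>)}"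

definition times_ideal :: "('a, 'x) hbimod \<Rightarrow> 'a set \<Rightarrow> ('a, 'x) hbimod" where
  "times_ideal Y I = Y\<lparr>carrier := {ract Y y a | y a. y \<in> carrier Y \<and> a \<in> I}\<rparr>"

text \<open>Unordered summation in the norm of \<open>A\<close>.\<close>

definition cstar_has_sum :: "'a cstar \<Rightarrow> ('i \<Rightarrow> 'a) \<Rightarrow> 'a \<Rightarrow> 'i set \<Rightarrow> bool" where
  "cstar_has_sum A f a J \<longleftrightarrow>
     limitin (cstar_topology A) (\<lambda>F. vsum A f F) a (finite_subsets_at_top J)"

definition hilbert_sum ::
    "'a cstar \<Rightarrow> 'i set \<Rightarrow> ('i \<Rightarrow> ('a, 'x) hbimod) \<Rightarrow> ('a, 'i \<Rightarrow> 'x) hbimod" where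
  "hilbert_sum A J Y =
    \<lparr>carrier = {x \<in> (\<Pi>\<^sub>E i\<in>J. carrier (Y i)).
       \<exists>a. cstar_has_sum A (\<lambda>i. hinner (Y i) (x i) (x i)) a J},
     vadd = (\<lambda>x y. \<lambda>i\<in>J. x i \<boxplus>\<^bsub>Y i\<^esub> y i),
     vzero = (\<lambda>i\<in>J. \<zero>\<^sub>v\<^bsub>Y i\<^esub>),
     vscale = (\<lambda>c x. \<lambda>i\<in>J. c \<cdot>\<^bsub>Y i\<^esub> x i),
     ract = (\<lambda>x a. \<lambda>i\<in>J. ract (Y i) (x i) a),
     hinner = (\<lambda>x y. THE a. cstar_has_sum A (\<lambda>i. hinner (Y i) (x i) (y i)) a J),
     lact = (\<lambda>a x. \<lambda>i\<in>J. lact (Y i) a (x i))\<rparr>"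

definition below :: "'g monoid \<Rightarrow> 'g set \<Rightarrow> 'g \<Rightarrow> 'g set" where
  "below G P q = {p \<in> P. ple G P p q}"

definition Xtilde ::
    "'g monoid \<Rightarrow> 'g set \<Rightarrow> 'a cstar \<Rightarrow> ('g, 'a) psys \<Rightarrow> 'g \<Rightarrow> ('a, 'g \<Rightarrow> 'a) hbimod" where
  "Xtilde G P A X q = hilbert_sum A (below G P q)
     (\<lambda>p. times_ideal (fibre X p) (ideal_I G P A X (inv\<^bsub>G\<^esub> p \<otimes>\<^bsub>G\<^esub> q)))"

definition phi_tilde ::
    "'g monoid \<Rightarrow> 'g set \<Rightarrow> 'a cstar \<Rightarrow> ('g, 'a) psys \<Rightarrow> 'g \<Rightarrow> 'a \<Rightarrow> ('g \<Rightarrow> 'a) \<Rightarrow> 'g \<Rightarrow> 'a" where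
  "phi_tilde G P A X q = left_hom A (Xtilde G P A X q)"

definition iota_tilde ::
    "'g monoid \<Rightarrow> 'g set \<Rightarrow> 'a cstar \<Rightarrow> ('g, 'a) psys \<Rightarrow> 'g \<Rightarrow> 'g \<Rightarrow> ('a \<Rightarrow> 'a) \<Rightarrow> ('g \<Rightarrow> 'a) \<Rightarrow> 'g \<Rightarrow> 'a" where
  "iota_tilde G P A X p q S =
    (if p = \<one>\<^bsub>G\<^esub> then phi_tilde G P A X q (compact_symbol A S)
     else (\<lambda>x\<in>carrier (Xtilde G P A X q). \<lambda>r\<in>below G P q. iota G P A X p r S (x r)))"


section \<open>Representations\<close>

text \<open>A map \<open>\<psi>\<close> from the product system is given by the family of maps \<open>\<psi> p\<close> on the fibres.\<close>

definition representation ::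
    "'g monoid \<Rightarrow> 'g set \<Rightarrow> 'a cstar \<Rightarrow> ('g, 'a) psys \<Rightarrow> 'b cstar \<Rightarrow> ('g \<Rightarrow> 'a \<Rightarrow> 'b) \<Rightarrow> bool" where
  "representation G P A X B \<psi> \<longleftrightarrow>
     (\<forall>p\<in>P. linear_map (fibre X p) B (\<psi> p)) \<and>
     restrict (\<psi> \<one>\<^bsub>G\<^esub>) (carrier A) \<in> star_homs A B \<and>
     (\<forall>p\<in>P. \<forall>q\<in>P. \<forall>x\<in>carrier (fibre X p). \<forall>y\<in>carrier (fibre X q).
        \<psi> p x \<odot>\<^bsub>B\<^esub> \<psi> q y = \<psi> (p \<otimes>\<^bsub>G\<^esub> q) (pmult X p q x y)) \<and>
     (\<forall>p\<in>P. \<forall>x\<in>carrier (fibre X p). \<forall>y\<in>carrier (fibre X p).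
        \<psi> \<one>\<^bsub>G\<^esub> (hinner (fibre X p) x y) = (\<psi> p x)\<^sup>\<star>\<^bsub>B\<^esub> \<odot>\<^bsub>B\<^esub> \<psi> p y)"

text \<open>The homomorphism \<open>\<psi>\<^sup>(\<^sup>p\<^sup>)\<close> on the compact operators.\<close>

definition compact_rep ::
    "'a cstar \<Rightarrow> ('g, 'a) psys \<Rightarrow> 'b cstar \<Rightarrow> ('g \<Rightarrow> 'a \<Rightarrow> 'b) \<Rightarrow> 'g \<Rightarrow> ('a \<Rightarrow> 'a) \<Rightarrow> 'b" where
  "compact_rep A X B \<psi> p = (THE h. h \<in> star_homs (compacts A (fibre X p)) B \<and>
     (\<forall>x\<in>carrier (fibre X p). \<forall>y\<in>carrier (fibre X p).
        h (rank_one (fibre X p) x y) = \<psi> p x \<odot>\<^bsub>B\<^esub> (\<psi> p y)\<^sup>\<star>\<^bsub>B\<^esub>))"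

definition Nica_covariant ::
    "'g monoid \<Rightarrow> 'g set \<Rightarrow> 'a cstar \<Rightarrow> ('g, 'a) psys \<Rightarrow> 'b cstar \<Rightarrow> ('g \<Rightarrow> 'a \<Rightarrow> 'b) \<Rightarrow> bool" where
  "Nica_covariant G P A X B \<psi> \<longleftrightarrow>
     (\<forall>p\<in>P. \<forall>q\<in>P. \<forall>S\<in>carrier (compacts A (fibre X p)). \<forall>T\<in>carrier (compacts A (fibre X q)).
        compact_rep A X B \<psi> p S \<odot>\<^bsub>B\<^esub> compact_rep A X B \<psi> q T =
          (if has_ub G P p q
           then compact_rep A X B \<psi> (join G P p q) (iota_join G P A X p q S T)
           else \<zero>\<^sub>v\<^bsub>B\<^esub>))"

definition CP_covariant ::
    "'g monoid \<Rightarrow> 'g set \<Rightarrow> 'a cstar \<Rightarrow> ('g, 'a) psys \<Rightarrow> 'b cstar \<Rightarrow> ('g \<Rightarrow> 'a \<Rightarrow> 'b) \<Rightarrow> bool" where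
  "CP_covariant G P A X B \<psi> \<longleftrightarrow>
     (\<forall>F T. finite F \<longrightarrow> F \<subseteq> P \<longrightarrow> (\<forall>p\<in>F. T p \<in> carrier (compacts A (fibre X p))) \<longrightarrow>
        for_large G P (\<lambda>s.
          vsum (adjointables A (Xtilde G P A X s)) (\<lambda>p. iota_tilde G P A X p s (T p)) F =
            \<zero>\<^sub>v\<^bsub>adjointables A (Xtilde G P A X s)\<^esub>) \<longrightarrow>
        vsum B (\<lambda>p. compact_rep A X B \<psi> p (T p)) F = \<zero>\<^sub>v\<^bsub>B\<^esub>)"

definition CNP_covariant ::
    "'g monoid \<Rightarrow> 'g set \<Rightarrow> 'a cstar \<Rightarrow> ('g, 'a) psys \<Rightarrow> 'b cstar \<Rightarrow> ('g \<Rightarrow> 'a \<Rightarrow> 'b) \<Rightarrow> bool" where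
  "CNP_covariant G P A X B \<psi> \<longleftrightarrow> representation G P A X B \<psi> \<and>
     Nica_covariant G P A X B \<psi> \<and> CP_covariant G P A X B \<psi>"

definition generated ::
    "'g set \<Rightarrow> ('g, 'a) psys \<Rightarrow> 'b cstar \<Rightarrow> ('g \<Rightarrow> 'a \<Rightarrow> 'b) \<Rightarrow> bool" where
  "generated P X N j \<longleftrightarrow> carrier N = cstar_topology N closure_of
     vspan N {j p x \<odot>\<^bsub>N\<^esub> (j q y)\<^sup>\<star>\<^bsub>N\<^esub> | p q x y.
       p \<in> P \<and> q \<in> P \<and> x \<in> carrier (fibre X p) \<and> y \<in> carrier (fibre X q)}"

text \<open>The universal property with respect to all C*-algebras whose carrier is a subset of the type
  \<open>'b\<close>.\<close>

definition universal_over ::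
    "'b itself \<Rightarrow> 'g monoid \<Rightarrow> 'g set \<Rightarrow> 'a cstar \<Rightarrow> ('g, 'a) psys \<Rightarrow> 'n cstar \<Rightarrow> ('g \<Rightarrow> 'a \<Rightarrow> 'n) \<Rightarrow> bool" where
  "universal_over (_ :: 'b itself) G P A X N j \<longleftrightarrow>
     (\<forall>(B :: 'b cstar) \<psi>. cstar_algebra B \<longrightarrow> CNP_covariant G P A X B \<psi> \<longrightarrow>
        (\<exists>!h. h \<in> star_homs N B \<and> (\<forall>p\<in>P. \<forall>x\<in>carrier (fibre X p). \<psi> p x = h (j p x))))"

text \<open>A formula cannot quantify over types, so the universal algebra has to live on a fixed type that is
  large enough. In an algebra satisfying \<^const>\<open>generated\<close>, every element is the limit of a
  sequence of finite sums of elements \<open>j(x)j(y)*\<close>, so each such algebra has at most as many elements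
  as the following type and is isomorphic to one carried by a subset of it. The
  existence of a pair that is universal over this type, together with the fact that every such pair is
  universal over \<open>'b\<close> for each \<open>'b\<close>, says that one pair is universal for all C*-algebras.\<close>

type_synonym ('g, 'a) sum_seqs = "nat \<Rightarrow> (('g \<times> 'a) \<times> ('g \<times> 'a)) list"

end

theory Submission
  imports Defs "HOL-Analysis.Urysohn"
begin

text \<open>Each covariance condition is an identity between values of the homomorphisms \<open>\<psi>\<^sup>(\<^sup>p\<^sup>)\<close>. It is
  therefore preserved by composition with a homomorphism, and it can be checked after applying a
  family of homomorphisms that separates points. Nica covariance and compact alignment make the
  closed span of the elements \<open>\<psi>(x)\<psi>(y)*\<close> a C*-algebra, in which every element is the limit of a
  sequence of formal sums over the product system. So, up to isomorphism, the algebras generated by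
  a CNP-covariant representation form a set. The bounded families over all CNP-covariant
  representations on the type of such sequences form a C*-algebra, because \<open>\<parallel>\<psi>(x)\<parallel> \<le> \<parallel>x\<parallel>\<close> for every
  representation, and the subalgebra that the product representation generates is universal.

  The C*-algebraic facts behind this (contractivity of homomorphisms, positivity of \<open>b*b\<close>, existence of
  \<open>\<psi>\<^sup>(\<^sup>p\<^sup>)\<close>, density of elementary tensors) are obtained without spectral theory, from the square root
  iteration \<open>e \<mapsto> (k + e\<^sup>2)/2\<close>.\<close>

section \<open>Complex vector spaces\<close>

text \<open>A circularity shapes the order. The operators on a Hilbert module form a C*-algebra only
  once the Cauchy-Schwarz inequality is known, that inequality rests on positivity, and positivity
  is developed in a unital algebra. The circle is broken at \<open>A\<close> acting on itself: there
  Cauchy-Schwarz is submultiplicativity of the norm, and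
  \<open>adjointables A (self_bimodule A)\<close> is a unital algebra that contains \<open>A\<close>
  isometrically. The left actions are not assumed nondegenerate, so a vector cannot be factored on
  the left through \<open>A\<close>. Frames replace this: they make y a limit of vectors Ty with T
  of finite rank, and so let Nica covariance act on psi(y)*psi(z). The premise of (CP) speaks of the
  augmented modules but not of the target algebra, hence it is carried unchanged from one
  representation to another. The product of all representations lives on a type of functions, larger
  than the type of sequences; bringing its generated subalgebra back is what allows the universal
  property to be stated over one fixed type and then transferred to every other.\<close>

context cvector_space begin

lemma carrier_vgroup: "carrier (vgroup V) = carrier V"
  and mult_vgroup: "monoid.mult (vgroup V) = vadd V"
  and one_vgroup: "monoid.one (vgroup V) = vzero V"
  by (simp_all add: vgroup_def)

lemmas vgroup_simps = carrier_vgroup mult_vgroup one_vgroup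

lemma add_closed: "x \<in> carrier V \<Longrightarrow> y \<in> carrier V \<Longrightarrow> x \<boxplus> y \<in> carrier V"
  using comm_group.axioms(1)[OF vgroup] monoid.m_closed vgroup_simps
  by (metis comm_monoid.axioms(1))

lemma zero_closed: "\<zero>\<^sub>v \<in> carrier V"
  using comm_group.axioms(1)[OF vgroup] monoid.one_closed vgroup_simps
  by (metis comm_monoid.axioms(1))

lemma add_assoc: "x \<in> carrier V \<Longrightarrow> y \<in> carrier V \<Longrightarrow> z \<in> carrier V \<Longrightarrow>
    (x \<boxplus> y) \<boxplus> z = x \<boxplus> (y \<boxplus> z)"
  using comm_group.axioms(1)[OF vgroup] monoid.m_assoc vgroup_simps
  by (metis comm_monoid.axioms(1))

lemma add_commute: "x \<in> carrier V \<Longrightarrow> y \<in> carrier V \<Longrightarrow> x \<boxplus> y = y \<boxplus> x"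
  using comm_group.axioms(1)[OF vgroup] comm_monoid.m_comm vgroup_simps
  by metis

lemma add_left_commute: "x \<in> carrier V \<Longrightarrow> y \<in> carrier V \<Longrightarrow> z \<in> carrier V \<Longrightarrow>
    x \<boxplus> (y \<boxplus> z) = y \<boxplus> (x \<boxplus> z)"
  by (metis add_assoc add_commute)

lemma zero_add: "x \<in> carrier V \<Longrightarrow> \<zero>\<^sub>v \<boxplus> x = x"
  using comm_group.axioms(1)[OF vgroup] monoid.l_one vgroup_simps
  by (metis comm_monoid.axioms(1))

lemma add_zero: "x \<in> carrier V \<Longrightarrow> x \<boxplus> \<zero>\<^sub>v = x"
  using zero_add add_commute zero_closed by metis

lemma add_left_cancel: "x \<in> carrier V \<Longrightarrow> y \<in> carrier V \<Longrightarrow> z \<in> carrier V \<Longrightarrow>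
    x \<boxplus> y = x \<boxplus> z \<longleftrightarrow> y = z"
  using monoid.Units_l_cancel[OF group.is_monoid] group.Units_eq comm_group.axioms(2)[OF vgroup] vgroup_simps
  by metis

lemma scale_zero_left: "x \<in> carrier V \<Longrightarrow> 0 \<cdot> x = \<zero>\<^sub>v"
proof -
  assume x: "x \<in> carrier V"
  have "0 \<cdot> x \<boxplus> 0 \<cdot> x = 0 \<cdot> x \<boxplus> \<zero>\<^sub>v"
    using scale_left_distrib[OF x, of 0 0] add_zero scale_closed[OF x] by simp
  then show ?thesis using add_left_cancel scale_closed[OF x] zero_closed by metis
qed

lemma scale_zero_right: "c \<cdot> \<zero>\<^sub>v = \<zero>\<^sub>v"
  using scale_scale[OF zero_closed, of c 0] scale_zero_left zero_closed by simp

lemma diff_closed: "x \<in> carrier V \<Longrightarrow> y \<in> carrier V \<Longrightarrow> vdiff V x y \<in> carrier V"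
  by (simp add: vdiff_def add_closed scale_closed)

lemma diff_self: "x \<in> carrier V \<Longrightarrow> vdiff V x x = \<zero>\<^sub>v"
  using scale_left_distrib[of x 1 "-1"] scale_one scale_zero_left by (simp add: vdiff_def)

lemma diff_eq_zero: "x \<in> carrier V \<Longrightarrow> y \<in> carrier V \<Longrightarrow> vdiff V x y = \<zero>\<^sub>v \<longleftrightarrow> x = y"
proof
  assume x: "x \<in> carrier V" and y: "y \<in> carrier V" and "vdiff V x y = \<zero>\<^sub>v"
  then have "(-1) \<cdot> y \<boxplus> x = (-1) \<cdot> y \<boxplus> y"
    using diff_self[OF y] add_commute scale_closed by (simp add: vdiff_def)
  then show "x = y" using add_left_cancel x y scale_closed by metis
qed (simp add: diff_self)

lemma comm_monoid_vgroup: "comm_monoid (vgroup V)"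
  by (rule comm_group.axioms(1)[OF vgroup])

lemma vsum_empty: "vsum V f {} = \<zero>\<^sub>v"
  unfolding vsum_def comm_monoid.finprod_empty[OF comm_monoid_vgroup] by (rule one_vgroup)

lemma vsum_insert: "finite F \<Longrightarrow> a \<notin> F \<Longrightarrow> f \<in> insert a F \<rightarrow> carrier V \<Longrightarrow>
    vsum V f (insert a F) = f a \<boxplus> vsum V f F"
  unfolding vsum_def
  by (subst comm_monoid.finprod_insert[OF comm_monoid_vgroup]) (auto simp: vgroup_simps)

lemma vsum_closed: "f \<in> F \<rightarrow> carrier V \<Longrightarrow> vsum V f F \<in> carrier V"
  unfolding vsum_def
  using comm_monoid.finprod_closed[OF comm_monoid_vgroup, of f F] by (simp add: vgroup_simps)

end

text \<open>A list sum obeys its recursion without side conditions and may repeat a summand, so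
  linear combinations can be concatenated; \<open>vsum\<close> needs its values in the carrier, and
  \<open>vspan\<close> has one coefficient per vector.\<close>

definition vlsum :: "('v, 'z) cvec_scheme \<Rightarrow> 'v list \<Rightarrow> 'v" where
  "vlsum V xs = foldr (vadd V) xs (vzero V)"

lemma vlsum_simps [simp]: "vlsum V [] = \<zero>\<^sub>v\<^bsub>V\<^esub>" "vlsum V (x # xs) = x \<boxplus>\<^bsub>V\<^esub> vlsum V xs"
  by (simp_all add: vlsum_def)

context cvector_space begin

lemma vlsum_closed: "set xs \<subseteq> carrier V \<Longrightarrow> vlsum V xs \<in> carrier V"
  by (induction xs) (auto simp: zero_closed add_closed)

lemma vlsum_append: "set xs \<subseteq> carrier V \<Longrightarrow> set ys \<subseteq> carrier V \<Longrightarrow>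
    vlsum V (xs @ ys) = vlsum V xs \<boxplus> vlsum V ys"
  by (induction xs) (auto simp: zero_add vlsum_closed add_assoc)

lemma vlsum_scale: "set xs \<subseteq> carrier V \<Longrightarrow> vlsum V (map (vscale V c) xs) = c \<cdot> vlsum V xs"
  by (induction xs) (auto simp: scale_zero_right scale_right_distrib vlsum_closed)

lemma vsum_eq_vlsum:
  assumes "distinct xs" "f \<in> set xs \<rightarrow> carrier V"
  shows "vsum V f (set xs) = vlsum V (map f xs)"
  using assms by (induction xs) (auto simp: vsum_empty vsum_insert Pi_iff)

text \<open>Invariance under scalars moves every coefficient into its vector. Conversely, repeated
  entries of a list are merged by adding coefficients.\<close>

lemma vspan_eq_vlsum:
  assumes S: "S \<subseteq> carrier V" and sc: "\<And>c x. x \<in> S \<Longrightarrow> c \<cdot> x \<in> S"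
  shows "vspan V S = {vlsum V xs | xs. set xs \<subseteq> S}"
proof (intro subset_antisym subsetI)
  fix x assume "x \<in> vspan V S"
  then obtain c F where F: "finite F" "F \<subseteq> S" and x: "x = vsum V (\<lambda>s. c s \<cdot> s) F"
    unfolding vspan_def by blast
  obtain ys where ys: "set ys = F" "distinct ys" using finite_distinct_list[OF F(1)] by blast
  have "x = vlsum V (map (\<lambda>s. c s \<cdot> s) ys)"
    unfolding x using vsum_eq_vlsum[OF ys(2), of "\<lambda>s. c s \<cdot> s"] ys(1) F(2) S scale_closed by auto
  moreover have "set (map (\<lambda>s. c s \<cdot> s) ys) \<subseteq> S" using ys F sc by auto
  ultimately show "x \<in> {vlsum V xs | xs. set xs \<subseteq> S}" by blast
next
  fix x assume "x \<in> {vlsum V xs | xs. set xs \<subseteq> S}"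
  then obtain xs where xs: "set xs \<subseteq> S" and x: "x = vlsum V xs" by blast
  have "\<exists>c F. finite F \<and> F \<subseteq> S \<and> vlsum V xs = vsum V (\<lambda>s. c s \<cdot> s) F"
    using xs
  proof (induction xs)
    case Nil
    then show ?case using vsum_empty by (metis empty_subsetI finite.emptyI vlsum_simps(1))
  next
    case (Cons y ys)
    then obtain c F where F: "finite F" "F \<subseteq> S" and e: "vlsum V ys = vsum V (\<lambda>s. c s \<cdot> s) F" by auto
    have y: "y \<in> S" "y \<in> carrier V" using Cons.prems S by auto
    \<comment> \<open>The new entry may already occur in the finite set; \<open>d\<close> is its old
      coefficient, or 0, and becomes 1 + d.\<close>
    define F0 where "F0 = F - {y}"
    have F0: "finite F0" "F0 \<subseteq> S" "y \<notin> F0" using F by (auto simp: F0_def)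
    have cl: "\<And>c'. (\<lambda>s. c' s \<cdot> s) \<in> F0 \<rightarrow> carrier V" "\<And>c'. (\<lambda>s. c' s \<cdot> s) \<in> insert y F0 \<rightarrow> carrier V"
      using F0 S y scale_closed by blast+
    define d where "d = (if y \<in> F then c y else 0)"
    have "vsum V (\<lambda>s. c s \<cdot> s) F = d \<cdot> y \<boxplus> vsum V (\<lambda>s. c s \<cdot> s) F0"
    proof (cases "y \<in> F")
      case True
      then have "F = insert y F0" by (auto simp: F0_def)
      then show ?thesis using vsum_insert[OF F0(1,3) cl(2)] True by (simp add: d_def)
    next
      case False
      then show ?thesis using vsum_closed[OF cl(1)] y by (simp add: d_def F0_def scale_zero_left zero_add)
    qed
    then have "vlsum V (y # ys) = (1 + d) \<cdot> y \<boxplus> vsum V (\<lambda>s. c s \<cdot> s) F0"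
      using e y vsum_closed[OF cl(1)] scale_left_distrib[OF y(2)] scale_one[OF y(2)]
      by (simp add: add_assoc scale_closed)
    also have "vsum V (\<lambda>s. c s \<cdot> s) F0 = vsum V (\<lambda>s. (c(y := 1 + d)) s \<cdot> s) F0"
      unfolding vsum_def
      by (rule comm_monoid.finprod_cong'[OF comm_monoid_vgroup])
        (use cl F0 in \<open>auto simp: carrier_vgroup\<close>)
    also have "(1 + d) \<cdot> y \<boxplus> \<dots> = vsum V (\<lambda>s. (c(y := 1 + d)) s \<cdot> s) (insert y F0)"
      by (subst vsum_insert[OF F0(1,3) cl(2)]) simp
    finally show ?case using F0 y by (metis finite_insert insert_subset)
  qed
  then show "x \<in> vspan V S" unfolding vspan_def x by blast
qed

end

section \<open>Identities between noncommutative polynomials\<close>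

text \<open>A reflective decision procedure: both sides of an identity are polynomials in the list of
  elements \<open>xs\<close>, and the identity holds if all coefficients of the difference vanish.\<close>

datatype ncpoly = NVar nat ("#_" [100] 100)
  | NAdd ncpoly ncpoly (infixl "[+]" 65)
  | NScl complex ncpoly (infixr "[.]" 75)
  | NMul ncpoly ncpoly (infixl "[*]" 70)

abbreviation nsub (infixl "[-]" 65) where "a [-] b \<equiv> a [+] (- 1) [.] b"

primrec nc_terms :: "ncpoly \<Rightarrow> (complex \<times> nat list) list" where
  "nc_terms (#i) = [(1, [i])]"
| "nc_terms (a [+] b) = nc_terms a @ nc_terms b"
| "nc_terms (c [.] a) = map (\<lambda>(d, w). (c * d, w)) (nc_terms a)"
| "nc_terms (a [*] b) = concat (map (\<lambda>(c, u). map (\<lambda>(d, w). (c * d, u @ w)) (nc_terms b)) (nc_terms a))"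

primrec nc_insert :: "complex \<Rightarrow> 'k \<Rightarrow> (complex \<times> 'k) list \<Rightarrow> (complex \<times> 'k) list" where
  "nc_insert c w [] = [(c, w)]"
| "nc_insert c w (x # L) = (if w = snd x then (c + fst x, w) # L else x # nc_insert c w L)"

primrec nc_collect :: "(complex \<times> 'k) list \<Rightarrow> (complex \<times> 'k) list" where
  "nc_collect [] = []"
| "nc_collect (x # L) = nc_insert (fst x) (snd x) (nc_collect L)"

primrec nc_vars :: "ncpoly \<Rightarrow> nat set" where
  "nc_vars (#i) = {i}"
| "nc_vars (a [+] b) = nc_vars a \<union> nc_vars b"
| "nc_vars (c [.] a) = nc_vars a"
| "nc_vars (a [*] b) = nc_vars a \<union> nc_vars b"

section \<open>Evaluation and normal forms of noncommutative polynomials\<close>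

locale assoc_algebra = cvector_space V for V :: "('v, 'z) cvec_scheme" (structure) +
  fixes m :: "'v \<Rightarrow> 'v \<Rightarrow> 'v"
  assumes m_closed: "a \<in> carrier V \<Longrightarrow> b \<in> carrier V \<Longrightarrow> m a b \<in> carrier V"
    and m_assoc: "a \<in> carrier V \<Longrightarrow> b \<in> carrier V \<Longrightarrow> c \<in> carrier V \<Longrightarrow> m (m a b) c = m a (m b c)"
    and m_add_right: "a \<in> carrier V \<Longrightarrow> b \<in> carrier V \<Longrightarrow> c \<in> carrier V \<Longrightarrow>
          m a (b \<boxplus> c) = m a b \<boxplus> m a c"
    and m_add_left: "a \<in> carrier V \<Longrightarrow> b \<in> carrier V \<Longrightarrow> c \<in> carrier V \<Longrightarrow>
          m (a \<boxplus> b) c = m a c \<boxplus> m b c"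
    and m_scale_right: "a \<in> carrier V \<Longrightarrow> b \<in> carrier V \<Longrightarrow> m a (z \<cdot> b) = z \<cdot> (m a b)"
    and m_scale_left: "a \<in> carrier V \<Longrightarrow> b \<in> carrier V \<Longrightarrow> m (z \<cdot> a) b = z \<cdot> (m a b)"
begin

primrec nc_eval :: "'v list \<Rightarrow> ncpoly \<Rightarrow> 'v" where
  "nc_eval xs (#i) = xs ! i"
| "nc_eval xs (a [+] b) = nc_eval xs a \<boxplus> nc_eval xs b"
| "nc_eval xs (c [.] a) = c \<cdot> nc_eval xs a"
| "nc_eval xs (a [*] b) = m (nc_eval xs a) (nc_eval xs b)"

text \<open>The algebra need not have a unit, so an empty product has no natural value. The first
  equation is a filler, and \<open>nc_ok\<close> keeps empty words out; the one-letter equation ends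
  the recursion before the empty word is reached.\<close>

fun nc_word :: "'v list \<Rightarrow> nat list \<Rightarrow> 'v" where
  "nc_word xs [] = \<zero>\<^sub>v"
| "nc_word xs [i] = xs ! i"
| "nc_word xs (i # j # w) = m (xs ! i) (nc_word xs (j # w))"

definition nc_sum :: "'v list \<Rightarrow> (complex \<times> nat list) list \<Rightarrow> 'v" where
  "nc_sum xs L = vlsum V (map (\<lambda>(c, w). c \<cdot> nc_word xs w) L)"

lemma nc_sum_simps [simp]: "nc_sum xs [] = \<zero>\<^sub>v"
  "nc_sum xs (x # L) = fst x \<cdot> nc_word xs (snd x) \<boxplus> nc_sum xs L"
  by (simp_all add: nc_sum_def split: prod.splits)

context
  fixes xs :: "'v list" assumes xs: "set xs \<subseteq> carrier V"
begin

lemma nc_word_closed: "set w \<subseteq> {..<length xs} \<Longrightarrow> nc_word xs w \<in> carrier V"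
  using xs by (induction xs w rule: nc_word.induct) (auto simp: zero_closed intro!: m_closed)

lemma nc_word_append: "set u \<subseteq> {..<length xs} \<Longrightarrow> set w \<subseteq> {..<length xs} \<Longrightarrow> u \<noteq> [] \<Longrightarrow> w \<noteq> [] \<Longrightarrow>
    nc_word xs (u @ w) = m (nc_word xs u) (nc_word xs w)"
proof (induction u)
  case (Cons i u)
  have i: "xs ! i \<in> carrier V" using xs Cons.prems(1) by auto
  show ?case
  proof (cases u)
    case Nil
    then show ?thesis using Cons.prems by (cases w) auto
  next
    case (Cons j v)
    then show ?thesis
      using Cons.IH Cons.prems i nc_word_closed[of u] nc_word_closed[of w] by (simp add: m_assoc)
  qed
qed simp

definition nc_ok :: "(complex \<times> nat list) list \<Rightarrow> bool" where
  "nc_ok L \<longleftrightarrow> (\<forall>(c, w) \<in> set L. set w \<subseteq> {..<length xs} \<and> w \<noteq> [])"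

lemma nc_sum_closed: "nc_ok L \<Longrightarrow> nc_sum xs L \<in> carrier V"
  by (induction L) (auto simp: nc_ok_def zero_closed add_closed scale_closed nc_word_closed)

lemma nc_sum_append: "nc_ok L \<Longrightarrow> nc_ok M \<Longrightarrow> nc_sum xs (L @ M) = nc_sum xs L \<boxplus> nc_sum xs M"
proof (induction L)
  case (Cons x L)
  then show ?case
    using nc_sum_closed[of L] nc_sum_closed[of M]
    by (auto simp: nc_ok_def add_assoc scale_closed nc_word_closed)
qed (simp add: zero_add nc_sum_closed)

lemma nc_sum_scale: "nc_ok L \<Longrightarrow> nc_sum xs (map (\<lambda>(d, w). (c * d, w)) L) = c \<cdot> nc_sum xs L"
proof (induction L)
  case (Cons x L)
  then show ?case using nc_sum_closed[of L]
    by (auto simp: nc_ok_def scale_right_distrib scale_closed scale_scale nc_word_closed)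
qed (simp add: scale_zero_right)

lemma m_zero: "a \<in> carrier V \<Longrightarrow> m a \<zero>\<^sub>v = \<zero>\<^sub>v" "a \<in> carrier V \<Longrightarrow> m \<zero>\<^sub>v a = \<zero>\<^sub>v"
  using m_scale_right[of a "\<zero>\<^sub>v" 0] m_scale_left[of "\<zero>\<^sub>v" a 0]
  by (simp_all add: zero_closed scale_zero_left m_closed)

lemma nc_sum_word_mult:
  assumes "nc_ok [(c, u)]"
  shows "nc_ok L \<Longrightarrow> nc_sum xs (map (\<lambda>(d, w). (c * d, u @ w)) L) = m (c \<cdot> nc_word xs u) (nc_sum xs L)"
proof (induction L)
  case Nil
  then show ?case using assms by (auto simp: nc_ok_def m_zero scale_closed nc_word_closed)
next
  case (Cons x L)
  obtain d w where x: "x = (d, w)" by force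
  have u: "nc_word xs u \<in> carrier V" "set u \<subseteq> {..<length xs}" "u \<noteq> []"
    using assms by (auto simp: nc_ok_def nc_word_closed)
  have w: "nc_word xs w \<in> carrier V" "set w \<subseteq> {..<length xs}" "w \<noteq> []"
    using Cons.prems x by (auto simp: nc_ok_def nc_word_closed)
  have L: "nc_ok L" using Cons.prems by (auto simp: nc_ok_def)
  show ?case
    using Cons.IH[OF L] u w x nc_sum_closed[OF L]
    by (simp add: m_add_right scale_closed nc_word_append m_scale_left m_scale_right scale_scale m_closed mult.commute)
qed

lemma nc_sum_mult:
  assumes M: "nc_ok M"
  shows "nc_ok L \<Longrightarrow>
    nc_sum xs (concat (map (\<lambda>(c, u). map (\<lambda>(d, w). (c * d, u @ w)) M) L)) = m (nc_sum xs L) (nc_sum xs M)"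
proof (induction L)
  case Nil
  then show ?case by (simp add: m_zero nc_sum_closed M)
next
  case (Cons x L)
  obtain c u where x: "x = (c, u)" by force
  have u: "nc_ok [(c, u)]" and L: "nc_ok L" using Cons.prems x by (auto simp: nc_ok_def)
  have 1: "nc_ok (map (\<lambda>(d, w). (c * d, u @ w)) M)" using M u by (fastforce simp: nc_ok_def)
  have 2: "nc_ok (concat (map (\<lambda>(c, u). map (\<lambda>(d, w). (c * d, u @ w)) M) L))"
    using M L by (fastforce simp: nc_ok_def)
  have "nc_word xs u \<in> carrier V" using u by (auto simp: nc_ok_def nc_word_closed)
  then show ?case
    using Cons.IH[OF L] x nc_sum_append[OF 1 2] nc_sum_word_mult[OF u M] nc_sum_closed[OF L] nc_sum_closed[OF M]
    by (simp add: m_add_left scale_closed)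
qed

lemma nc_terms_ok: "nc_vars e \<subseteq> {..<length xs} \<Longrightarrow> nc_ok (nc_terms e)"
  by (induction e) (fastforce simp: nc_ok_def)+

lemma nc_eval_eq_sum: "nc_vars e \<subseteq> {..<length xs} \<Longrightarrow> nc_eval xs e = nc_sum xs (nc_terms e)"
proof (induction e)
  case (NVar i)
  then have "xs ! i \<in> carrier V" using xs by auto
  then show ?case by (simp add: scale_one add_zero)
next
  case (NAdd a b)
  then show ?case by (simp add: nc_sum_append nc_terms_ok)
next
  case (NScl c a)
  then show ?case by (simp add: nc_sum_scale nc_terms_ok)
next
  case (NMul a b)
  then show ?case by (simp add: nc_sum_mult nc_terms_ok)
qed

lemma nc_ok_insert: "nc_ok L \<Longrightarrow> nc_ok [(c, w)] \<Longrightarrow> nc_ok (nc_insert c w L)"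
  by (induction L) (auto simp: nc_ok_def)

lemma nc_sum_insert: "nc_ok L \<Longrightarrow> nc_ok [(c, w)] \<Longrightarrow> nc_sum xs (nc_insert c w L) = c \<cdot> nc_word xs w \<boxplus> nc_sum xs L"
proof (induction L)
  case (Cons x L)
  obtain d v where x: "x = (d, v)" by force
  have L: "nc_ok L" and w: "nc_word xs w \<in> carrier V" and v: "nc_word xs v \<in> carrier V"
    using Cons.prems x by (auto simp: nc_ok_def nc_word_closed)
  show ?case
  proof (cases "w = v")
    case True
    then show ?thesis using x v nc_sum_closed[OF L] by (simp add: scale_left_distrib add_assoc scale_closed)
  next
    case False
    then show ?thesis using x v w nc_sum_closed[OF L] Cons.IH[OF L Cons.prems(2)]
      by (simp add: add_left_commute scale_closed)
  qed
qed simp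

lemma nc_collect_ok: "nc_ok L \<Longrightarrow> nc_ok (nc_collect L)"
proof (induction L)
  case (Cons x L)
  then have "nc_ok L" "nc_ok [(fst x, snd x)]" by (auto simp: nc_ok_def)
  then show ?case using Cons.IH nc_ok_insert by simp
qed simp

lemma nc_sum_collect: "nc_ok L \<Longrightarrow> nc_sum xs (nc_collect L) = nc_sum xs L"
proof (induction L)
  case (Cons x L)
  then have "nc_ok L" "nc_ok [(fst x, snd x)]" by (auto simp: nc_ok_def)
  then show ?case using Cons.IH nc_sum_insert nc_collect_ok by simp
qed simp

lemma nc_sum_zero: "nc_ok L \<Longrightarrow> list_all (\<lambda>(c, w). c = 0) L \<Longrightarrow> nc_sum xs L = \<zero>\<^sub>v"
proof (induction L)
  case (Cons x L)
  obtain d v where x: "x = (d, v)" by force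
  have L: "nc_ok L" and v: "nc_word xs v \<in> carrier V"
    using Cons.prems x by (auto simp: nc_ok_def nc_word_closed)
  then show ?case using Cons x by (simp add: scale_zero_left add_zero zero_closed)
qed simp

lemma nc_eval_closed: "nc_vars e \<subseteq> {..<length xs} \<Longrightarrow> nc_eval xs e \<in> carrier V"
  by (simp add: nc_eval_eq_sum nc_sum_closed nc_terms_ok)

text \<open>For concrete polynomials the premises are closed recursive terms, which simplification
  evaluates. Symbolic scalars may remain in the coefficients and are then left to
  arithmetic.\<close>

theorem nc_identity:
  assumes vars: "nc_vars (a [-] b) \<subseteq> {..<length xs}"
    and coeffs: "list_all (\<lambda>(c, w). c = 0) (nc_collect (nc_terms (a [-] b)))"
  shows "nc_eval xs a = nc_eval xs b"
proof -
  have "vdiff V (nc_eval xs a) (nc_eval xs b) = nc_eval xs (a [-] b)" by (simp add: vdiff_def)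
  also have "\<dots> = nc_sum xs (nc_collect (nc_terms (a [-] b)))"
    using nc_eval_eq_sum[OF vars] nc_sum_collect[OF nc_terms_ok[OF vars]] by simp
  also have "\<dots> = \<zero>\<^sub>v" by (rule nc_sum_zero[OF nc_collect_ok[OF nc_terms_ok[OF vars]] coeffs])
  finally show ?thesis
    using diff_eq_zero nc_eval_closed vars by simp
qed

end
end

text \<open>For linear identities any multiplication will do.\<close>

sublocale cvector_space \<subseteq> lin: assoc_algebra V "\<lambda>_ _. \<zero>\<^sub>v"
  by unfold_locales (auto simp: zero_closed add_zero scale_zero_right)

sublocale cstar_algebra \<subseteq> alg: assoc_algebra A "amult A"
  by unfold_locales (simp_all add: mult_closed mult_assoc mult_add_right mult_add_left
      mult_scale_right mult_scale_left)

section \<open>Normed spaces\<close>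

text \<open>Common form of \<open>cstar_dist\<close> and \<open>hdist\<close>, including their
  cut-off at the carrier, so that completeness of algebras and of modules is handled by one
  locale.\<close>

definition ndist :: "('v, 'z) cvec_scheme \<Rightarrow> ('v \<Rightarrow> real) \<Rightarrow> 'v \<Rightarrow> 'v \<Rightarrow> real" where
  "ndist V nrm x y = (if x \<in> carrier V \<and> y \<in> carrier V then nrm (vdiff V x y) else 0)"

locale cnormed = cvector_space V for V :: "('v, 'z) cvec_scheme" (structure) +
  fixes nrm :: "'v \<Rightarrow> real"
  assumes nrm_nonneg: "x \<in> carrier V \<Longrightarrow> 0 \<le> nrm x"
    and nrm_eq_zero: "x \<in> carrier V \<Longrightarrow> nrm x = 0 \<longleftrightarrow> x = \<zero>\<^sub>v"
    and nrm_scale: "x \<in> carrier V \<Longrightarrow> nrm (z \<cdot> x) = cmod z * nrm x"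
    and nrm_triangle: "x \<in> carrier V \<Longrightarrow> y \<in> carrier V \<Longrightarrow> nrm (x \<boxplus> y) \<le> nrm x + nrm y"
begin

lemma nrm_zero: "nrm \<zero>\<^sub>v = 0"
  using nrm_eq_zero zero_closed by blast

lemma nrm_diff_commute: "x \<in> carrier V \<Longrightarrow> y \<in> carrier V \<Longrightarrow> nrm (vdiff V x y) = nrm (vdiff V y x)"
proof -
  assume c: "x \<in> carrier V" "y \<in> carrier V"
  then have "vdiff V x y = (-1) \<cdot> vdiff V y x"
    using lin.nc_identity[of "[x, y]" "#0 [-] #1" "(-1) [.] (#1 [-] #0)"] by (simp add: vdiff_def)
  then show ?thesis using nrm_scale diff_closed c by simp
qed

lemma nrm_diff_triangle:
  assumes "x \<in> carrier V" "y \<in> carrier V" "z \<in> carrier V"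
  shows "nrm (vdiff V x z) \<le> nrm (vdiff V x y) + nrm (vdiff V y z)"
proof -
  have "vdiff V x z = vdiff V x y \<boxplus> vdiff V y z"
    using lin.nc_identity[of "[x, y, z]" "#0 [-] #2" "(#0 [-] #1) [+] (#1 [-] #2)"] assms
    by (simp add: vdiff_def)
  then show ?thesis using nrm_triangle diff_closed assms by simp
qed

lemma nrm_le_diff:
  assumes "x \<in> carrier V" "y \<in> carrier V"
  shows "nrm x \<le> nrm y + nrm (vdiff V x y)"
proof -
  have "y \<boxplus> vdiff V x y = x"
    using lin.nc_identity[of "[x, y]" "#1 [+] (#0 [-] #1)" "#0"] assms by (simp add: vdiff_def)
  then show ?thesis using nrm_triangle[of y "vdiff V x y"] diff_closed[of x y] assms by simp
qed

lemma nrm_diff_le: "x \<in> carrier V \<Longrightarrow> y \<in> carrier V \<Longrightarrow> nrm (vdiff V x y) \<le> nrm x + nrm y"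
  using nrm_triangle[of x "(-1) \<cdot> y"] nrm_scale[of y "-1"] by (simp add: vdiff_def scale_closed)

lemma Metric_space_ndist: "Metric_space (carrier V) (ndist V nrm)"
proof
  fix x y z
  show "0 \<le> ndist V nrm x y" by (simp add: ndist_def nrm_nonneg diff_closed)
  show "ndist V nrm x y = ndist V nrm y x" by (auto simp: ndist_def nrm_diff_commute)
  show "x \<in> carrier V \<Longrightarrow> y \<in> carrier V \<Longrightarrow> (ndist V nrm x y = 0) = (x = y)"
    by (simp add: ndist_def nrm_eq_zero diff_closed diff_eq_zero)
  show "x \<in> carrier V \<Longrightarrow> y \<in> carrier V \<Longrightarrow> z \<in> carrier V \<Longrightarrow>
      ndist V nrm x z \<le> ndist V nrm x y + ndist V nrm y z"
    by (simp add: ndist_def nrm_diff_triangle)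
qed

section \<open>Convergence, closures and closed spans\<close>

abbreviation ntop :: "'v topology" where "ntop \<equiv> Metric_space.mtopology (carrier V) (ndist V nrm)"

abbreviation nclosure :: "'v set \<Rightarrow> 'v set" where "nclosure S \<equiv> ntop closure_of S"

lemma in_closure:
  assumes "S \<subseteq> carrier V"
  shows "x \<in> nclosure S \<longleftrightarrow> x \<in> carrier V \<and> (\<forall>\<epsilon>>0. \<exists>y\<in>S. nrm (vdiff V x y) < \<epsilon>)"
  unfolding Metric_space.metric_closure_of[OF Metric_space_ndist]
  using assms by (auto simp: Metric_space.in_mball[OF Metric_space_ndist] ndist_def) blast+

text \<open>Every term has to lie in the carrier, whereas \<open>limitin\<close> constrains only the
  eventual ones. The algebraic laws can thus be applied termwise.\<close>

definition conv :: "(nat \<Rightarrow> 'v) \<Rightarrow> 'v \<Rightarrow> bool" where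
  "conv s x \<longleftrightarrow> (\<forall>n. s n \<in> carrier V) \<and> x \<in> carrier V \<and> (\<lambda>n. nrm (vdiff V (s n) x)) \<longlonglongrightarrow> 0"

lemma convD: "conv s x \<Longrightarrow> s n \<in> carrier V" "conv s x \<Longrightarrow> x \<in> carrier V"
  by (simp_all add: conv_def)

lemma convI_bound:
  assumes "\<And>n. s n \<in> carrier V" "x \<in> carrier V" "\<And>n. nrm (vdiff V (s n) x) \<le> b n" "b \<longlonglongrightarrow> 0"
  shows "conv s x"
proof -
  have "(\<lambda>n. nrm (vdiff V (s n) x)) \<longlonglongrightarrow> 0"
    using assms(3) nrm_nonneg[OF diff_closed[OF assms(1,2)]]
    by (intro tendsto_sandwich[OF _ _ tendsto_const assms(4)] always_eventually allI)
  then show ?thesis using assms(1,2) by (simp add: conv_def)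
qed

lemma limitin_iff_conv:
  assumes "\<And>n. s n \<in> carrier V"
  shows "limitin ntop s x sequentially \<longleftrightarrow> conv s x"
  unfolding Metric_space.limit_metric_sequentially[OF Metric_space_ndist] conv_def LIMSEQ_def
  using assms by (auto simp: ndist_def dist_real_def nrm_nonneg diff_closed)

lemma conv_const: "x \<in> carrier V \<Longrightarrow> conv (\<lambda>_. x) x"
  by (simp add: conv_def diff_self nrm_zero)

lemma conv_unique: assumes "conv s x" "conv s y" shows "x = y"
proof -
  have c: "x \<in> carrier V" "y \<in> carrier V" "\<And>n. s n \<in> carrier V" using assms by (auto simp: conv_def)
  have "(\<lambda>n. nrm (vdiff V (s n) x) + nrm (vdiff V (s n) y)) \<longlonglongrightarrow> 0 + 0"
    using assms unfolding conv_def by (intro tendsto_add) auto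
  moreover have "nrm (vdiff V x y) \<le> nrm (vdiff V (s n) x) + nrm (vdiff V (s n) y)" for n
    using nrm_diff_triangle[of x "s n" y] nrm_diff_commute[of x "s n"] c by simp
  ultimately have "nrm (vdiff V x y) \<le> 0 + 0"
    by (intro tendsto_lowerbound[where f = "\<lambda>n. nrm (vdiff V (s n) x) + nrm (vdiff V (s n) y)"
        and F = sequentially]) auto
  then have "vdiff V x y = \<zero>\<^sub>v" using nrm_eq_zero nrm_nonneg diff_closed c by (metis add_0 order_antisym)
  then show ?thesis using diff_eq_zero c by simp
qed

lemma conv_add: assumes "conv s x" "conv t y" shows "conv (\<lambda>n. s n \<boxplus> t n) (x \<boxplus> y)"
proof (rule convI_bound)
  have c: "x \<in> carrier V" "y \<in> carrier V" "\<And>n. s n \<in> carrier V" "\<And>n. t n \<in> carrier V"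
    using assms by (auto simp: conv_def)
  show "s n \<boxplus> t n \<in> carrier V" "x \<boxplus> y \<in> carrier V" for n using c by (simp_all add: add_closed)
  show "nrm (vdiff V (s n \<boxplus> t n) (x \<boxplus> y)) \<le> nrm (vdiff V (s n) x) + nrm (vdiff V (t n) y)" for n
  proof -
    have "vdiff V (s n \<boxplus> t n) (x \<boxplus> y) = vdiff V (s n) x \<boxplus> vdiff V (t n) y"
      using lin.nc_identity[of "[s n, t n, x, y]" "(#0 [+] #1) [-] (#2 [+] #3)" "(#0 [-] #2) [+] (#1 [-] #3)"] c
      by (simp add: vdiff_def)
    then show ?thesis using nrm_triangle diff_closed c by simp
  qed
  show "(\<lambda>n. nrm (vdiff V (s n) x) + nrm (vdiff V (t n) y)) \<longlonglongrightarrow> 0"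
    using assms unfolding conv_def by (intro tendsto_add_zero) auto
qed

lemma conv_scale: assumes "conv s x" shows "conv (\<lambda>n. c \<cdot> s n) (c \<cdot> x)"
proof (rule convI_bound)
  have c: "x \<in> carrier V" "\<And>n. s n \<in> carrier V" using assms by (auto simp: conv_def)
  show "c \<cdot> s n \<in> carrier V" "c \<cdot> x \<in> carrier V" for n using c by (simp_all add: scale_closed)
  show "nrm (vdiff V (c \<cdot> s n) (c \<cdot> x)) \<le> cmod c * nrm (vdiff V (s n) x)" for n
  proof -
    have "vdiff V (c \<cdot> s n) (c \<cdot> x) = c \<cdot> vdiff V (s n) x"
      using lin.nc_identity[of "[s n, x]" "c [.] #0 [-] c [.] #1" "c [.] (#0 [-] #1)"] c
      by (simp add: vdiff_def)
    then show ?thesis using nrm_scale diff_closed c by simp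
  qed
  show "(\<lambda>n. cmod c * nrm (vdiff V (s n) x)) \<longlonglongrightarrow> 0"
    using assms unfolding conv_def by (intro tendsto_mult_right_zero) auto
qed

lemma conv_diff: "conv s x \<Longrightarrow> conv t y \<Longrightarrow> conv (\<lambda>n. vdiff V (s n) (t n)) (vdiff V x y)"
  unfolding vdiff_def by (intro conv_add conv_scale)

lemma conv_norm: assumes "conv s x" shows "(\<lambda>n. nrm (s n)) \<longlonglongrightarrow> nrm x"
proof -
  have c: "x \<in> carrier V" "\<And>n. s n \<in> carrier V" using assms by (auto simp: conv_def)
  have "norm (nrm (s n) - nrm x) \<le> nrm (vdiff V (s n) x)" for n
    using nrm_le_diff[of "s n" x] nrm_le_diff[of x "s n"] nrm_diff_commute[of x "s n"] c by auto
  then have le: "\<forall>\<^sub>F n in sequentially. norm (nrm (s n) - nrm x) \<le> nrm (vdiff V (s n) x)"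
    by (intro always_eventually allI)
  have "(\<lambda>n. nrm (vdiff V (s n) x)) \<longlonglongrightarrow> 0" using assms unfolding conv_def by blast
  from Lim_null_comparison[OF le this] show ?thesis by (rule LIM_zero_cancel)
qed

lemma conv_ignore: "conv s x \<Longrightarrow> filterlim f sequentially sequentially \<Longrightarrow> conv (\<lambda>n. s (f n)) x"
  unfolding conv_def using filterlim_compose[of "\<lambda>n. nrm (vdiff V (s n) x)"] by blast

definition ncauchy :: "(nat \<Rightarrow> 'v) \<Rightarrow> bool" where
  "ncauchy s \<longleftrightarrow> (\<forall>n. s n \<in> carrier V) \<and>
     (\<forall>\<epsilon>>0. \<exists>N. \<forall>m\<ge>N. \<forall>n\<ge>N. nrm (vdiff V (s m) (s n)) < \<epsilon>)"

lemma conv_ncauchy: assumes "conv s x" shows "ncauchy s"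
  unfolding ncauchy_def
proof (intro conjI allI impI)
  have c: "x \<in> carrier V" "\<And>n. s n \<in> carrier V" using assms by (auto simp: conv_def)
  then show "\<And>n. s n \<in> carrier V" by blast
  fix \<epsilon> :: real assume "\<epsilon> > 0"
  then obtain N where N: "\<And>n. n \<ge> N \<Longrightarrow> nrm (vdiff V (s n) x) < \<epsilon> / 2"
    using assms unfolding conv_def LIMSEQ_def by (fastforce dest: spec[of _ "\<epsilon> / 2"])
  show "\<exists>N. \<forall>m\<ge>N. \<forall>n\<ge>N. nrm (vdiff V (s m) (s n)) < \<epsilon>"
  proof (intro exI allI impI)
    fix m n assume "N \<le> m" "N \<le> n"
    then show "nrm (vdiff V (s m) (s n)) < \<epsilon>"
      using N[of m] N[of n] nrm_diff_triangle[of "s m" x "s n"] nrm_diff_commute[of x "s n"] c by simp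
  qed
qed

lemma ncauchy_bounded: assumes "ncauchy s" shows "\<exists>B>0. \<forall>n. nrm (s n) \<le> B"
proof -
  have c: "\<And>n. s n \<in> carrier V" using assms by (auto simp: ncauchy_def)
  obtain N where N: "\<And>m n. m \<ge> N \<Longrightarrow> n \<ge> N \<Longrightarrow> nrm (vdiff V (s m) (s n)) < 1"
    using assms unfolding ncauchy_def by (meson zero_less_one)
  define B where "B = Max (insert 1 ((\<lambda>n. nrm (s n)) ` {..N})) + 1"
  have B: "nrm (s n) \<le> B - 1" if "n \<le> N" for n
    unfolding B_def using that by (simp add: Max_ge max.coboundedI2)
  have "nrm (s n) \<le> B" for n
  proof (cases "n \<le> N")
    case False
    then show ?thesis using B[of N] N[of n N] nrm_le_diff[of "s n" "s N"] c by simp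
  qed (use B in fastforce)
  moreover have "B \<ge> 1 + 1" unfolding B_def by (intro add_right_mono Max_ge) auto
  ultimately show ?thesis by (intro exI[of _ B]) auto
qed

lemma closure_conv:
  assumes "S \<subseteq> carrier V" "x \<in> nclosure S"
  shows "\<exists>s. (\<forall>n. s n \<in> S) \<and> conv s x"
proof -
  have x: "x \<in> carrier V" using assms in_closure by blast
  have "\<forall>n. \<exists>y\<in>S. nrm (vdiff V x y) < inverse (real (Suc n))"
    using assms in_closure by simp
  then obtain s where s: "\<And>n. s n \<in> S" "\<And>n. nrm (vdiff V x (s n)) < inverse (real (Suc n))" by metis
  have "conv s x"
  proof (rule convI_bound)
    show "s n \<in> carrier V" for n using s assms by blast
    then show "nrm (vdiff V (s n) x) \<le> inverse (real (Suc n))" for n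
      using s(2)[of n] nrm_diff_commute[OF x, of "s n"] by simp
  qed (use x LIMSEQ_inverse_real_of_nat in auto)
  then show ?thesis using s by blast
qed

definition csubspace :: "'v set \<Rightarrow> bool" where
  "csubspace S \<longleftrightarrow> S \<subseteq> carrier V \<and> \<zero>\<^sub>v \<in> S \<and> (\<forall>x\<in>S. \<forall>y\<in>S. x \<boxplus> y \<in> S) \<and> (\<forall>c. \<forall>x\<in>S. c \<cdot> x \<in> S)"

definition nclosed :: "'v set \<Rightarrow> bool" where
  "nclosed S \<longleftrightarrow> (\<forall>x\<in>carrier V. (\<forall>\<epsilon>>0. \<exists>y\<in>S. nrm (vdiff V x y) < \<epsilon>) \<longrightarrow> x \<in> S)"

lemma nclosed_conv:
  assumes "nclosed S" "\<And>n. s n \<in> S" "conv s x"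
  shows "x \<in> S"
proof -
  have c: "x \<in> carrier V" "\<And>n. s n \<in> carrier V" using assms by (auto simp: conv_def)
  have "\<exists>y\<in>S. nrm (vdiff V x y) < \<epsilon>" if "\<epsilon> > 0" for \<epsilon>
  proof -
    have "\<forall>\<^sub>F n in sequentially. nrm (vdiff V (s n) x) < \<epsilon>"
      using assms(3) \<open>\<epsilon> > 0\<close> unfolding conv_def by (auto intro: order_tendstoD)
    then obtain n where "nrm (vdiff V (s n) x) < \<epsilon>" by (auto simp: eventually_sequentially)
    then have "nrm (vdiff V x (s n)) < \<epsilon>" unfolding nrm_diff_commute[OF c(1) c(2)] .
    then show ?thesis using assms(2)[of n] by (rule bexI)
  qed
  then show ?thesis using assms(1) c unfolding nclosed_def by blast
qed

lemma nclosedI: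
  assumes "S \<subseteq> carrier V" "\<And>s x. (\<And>n. s n \<in> S) \<Longrightarrow> conv s x \<Longrightarrow> x \<in> S"
  shows "nclosed S"
  unfolding nclosed_def
proof (intro ballI impI)
  fix x assume "x \<in> carrier V" "\<forall>\<epsilon>>0. \<exists>y\<in>S. nrm (vdiff V x y) < \<epsilon>"
  then have "x \<in> nclosure S" using in_closure[OF assms(1)] by simp
  then obtain s where "\<forall>n. s n \<in> S" "conv s x" using closure_conv[OF assms(1)] by blast
  then show "x \<in> S" using assms(2)[of s x] by simp
qed

lemma closure_nclosed:
  assumes "S \<subseteq> carrier V" shows "nclosed (nclosure S)"
proof (unfold nclosed_def, intro ballI impI)
  fix x assume x: "x \<in> carrier V" and h: "\<forall>\<epsilon>>0. \<exists>y\<in>nclosure S. nrm (vdiff V x y) < \<epsilon>"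
  have "\<exists>y\<in>S. nrm (vdiff V x y) < \<epsilon>" if \<epsilon>: "\<epsilon> > 0" for \<epsilon>
  proof -
    obtain y where y: "y \<in> nclosure S" "nrm (vdiff V x y) < \<epsilon> / 2" using h \<epsilon> half_gt_zero by blast
    then obtain z where z: "z \<in> S" "nrm (vdiff V y z) < \<epsilon> / 2" using in_closure[OF assms] \<epsilon> half_gt_zero by blast
    then show ?thesis
      using y nrm_diff_triangle[OF x, of y z] in_closure[OF assms] assms
      by (intro bexI[of _ z]) auto
  qed
  then show "x \<in> nclosure S" using in_closure[OF assms] x by blast
qed

lemma closure_minimal: "S \<subseteq> T \<Longrightarrow> T \<subseteq> carrier V \<Longrightarrow> nclosed T \<Longrightarrow> nclosure S \<subseteq> T"
  using in_closure[of S] unfolding nclosed_def by blast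

lemma closure_superset: "S \<subseteq> carrier V \<Longrightarrow> S \<subseteq> nclosure S"
proof
  fix x assume S: "S \<subseteq> carrier V" and x: "x \<in> S"
  then have "nrm (vdiff V x x) = 0" by (auto simp: diff_self nrm_zero)
  then show "x \<in> nclosure S" using in_closure[OF S] x S by fastforce
qed

lemma csubspace_closure:
  assumes "csubspace S" shows "csubspace (nclosure S)"
proof -
  have S: "S \<subseteq> carrier V" using assms by (simp add: csubspace_def)
  note cl = closure_nclosed[OF S]
  have sub: "x \<in> S \<Longrightarrow> x \<in> nclosure S" for x using closure_superset[OF S] by (rule subsetD)
  have "x \<boxplus> y \<in> nclosure S" if xy: "x \<in> nclosure S" "y \<in> nclosure S" for x y
  proof -
    obtain s t where s: "\<And>n. s n \<in> S" "conv s x" and t: "\<And>n. t n \<in> S" "conv t y"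
      using closure_conv[OF S xy(1)] closure_conv[OF S xy(2)] by metis
    have "s n \<boxplus> t n \<in> S" for n using s t assms by (simp add: csubspace_def)
    then show ?thesis using nclosed_conv[OF cl sub conv_add[OF s(2) t(2)]] by simp
  qed
  moreover have "c \<cdot> x \<in> nclosure S" if x: "x \<in> nclosure S" for c x
  proof -
    obtain s where s: "\<And>n. s n \<in> S" "conv s x" using closure_conv[OF S x] by metis
    have "c \<cdot> s n \<in> S" for n using s assms by (simp add: csubspace_def)
    then show ?thesis using nclosed_conv[OF cl sub conv_scale[OF s(2)]] by simp
  qed
  moreover have "nclosure S \<subseteq> carrier V" using in_closure[OF S] by blast
  ultimately show ?thesis using assms closure_superset[OF S] unfolding csubspace_def by blast
qed

lemma csubspace_vlsum: "csubspace S \<Longrightarrow> set xs \<subseteq> S \<Longrightarrow> vlsum V xs \<in> S"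
  by (induction xs) (auto simp: csubspace_def)

definition cspan :: "'v set \<Rightarrow> 'v set" where
  "cspan S = nclosure (vspan V S)"

text \<open>The generating sets used here, such as the rank-one operators and the products
  psi(x)psi(y)*, absorb scalars, so that their spans consist of list sums by
  \<open>vspan_eq_vlsum\<close>.\<close>

definition scale_invariant :: "'v set \<Rightarrow> bool" where
  "scale_invariant S \<longleftrightarrow> S \<subseteq> carrier V \<and> (\<forall>c. \<forall>x\<in>S. c \<cdot> x \<in> S)"

context
  fixes S :: "'v set"
  assumes inv: "scale_invariant S"
begin

lemma scale_invariantD: "S \<subseteq> carrier V" "x \<in> S \<Longrightarrow> c \<cdot> x \<in> S"
  using inv by (auto simp: scale_invariant_def)

lemma vspan_eq: "vspan V S = {vlsum V xs | xs. set xs \<subseteq> S}"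
  using scale_invariantD by (intro vspan_eq_vlsum)

lemma csubspace_vspan: "csubspace (vspan V S)"
  unfolding vspan_eq csubspace_def
proof (intro conjI ballI allI)
  show "{vlsum V xs |xs. set xs \<subseteq> S} \<subseteq> carrier V" using vlsum_closed scale_invariantD by blast
  show "\<zero>\<^sub>v \<in> {vlsum V xs |xs. set xs \<subseteq> S}" by (auto intro!: exI[of _ "[]"])
  fix x y assume x: "x \<in> {vlsum V xs |xs. set xs \<subseteq> S}" and y: "y \<in> {vlsum V xs |xs. set xs \<subseteq> S}"
  obtain xs ys where xs: "set xs \<subseteq> S" "x = vlsum V xs" "set ys \<subseteq> S" "y = vlsum V ys" using x y by blast
  show "x \<boxplus> y \<in> {vlsum V xs |xs. set xs \<subseteq> S}"
    using xs vlsum_append[of xs ys] scale_invariantD by (auto intro!: exI[of _ "xs @ ys"])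
next
  fix c x assume x: "x \<in> {vlsum V xs |xs. set xs \<subseteq> S}"
  obtain xs where xs: "set xs \<subseteq> S" "x = vlsum V xs" using x by blast
  have "set (map (vscale V c) xs) \<subseteq> S" using xs(1) scale_invariantD(2) by auto
  moreover have "c \<cdot> x = vlsum V (map (vscale V c) xs)"
    using vlsum_scale[of xs c] xs scale_invariantD(1) by auto
  ultimately show "c \<cdot> x \<in> {vlsum V xs |xs. set xs \<subseteq> S}" by blast
qed

lemma vspan_superset: "S \<subseteq> vspan V S"
proof
  fix x assume "x \<in> S"
  then show "x \<in> vspan V S" unfolding vspan_eq
    using scale_invariantD add_zero[of x] by (auto intro!: exI[of _ "[x]"])
qed

lemma csubspace_cspan: "csubspace (cspan S)" and nclosed_cspan: "nclosed (cspan S)"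
  and cspan_superset: "S \<subseteq> cspan S"
  using csubspace_closure[OF csubspace_vspan] closure_nclosed[of "vspan V S"]
    closure_superset[of "vspan V S"] csubspace_vspan vspan_superset
  unfolding cspan_def csubspace_def by auto

text \<open>Serves as an induction principle: a property passes from the generators to the whole
  closed span once the elements with that property form a closed subspace.\<close>

lemma cspan_minimal:
  assumes "S \<subseteq> T" "csubspace T" "nclosed T"
  shows "cspan S \<subseteq> T"
proof -
  have "vspan V S \<subseteq> T" unfolding vspan_eq using csubspace_vlsum assms by blast
  then show ?thesis unfolding cspan_def using closure_minimal assms by (auto simp: csubspace_def)
qed

end

end

section \<open>Banach spaces\<close>

locale cbanach = cnormed +
  assumes mcomplete_ndist: "Metric_space.mcomplete (carrier V) (ndist V nrm)"
begin

lemma ncauchy_conv: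
  assumes "ncauchy s" shows "\<exists>x. conv s x"
proof -
  have c: "\<And>n. s n \<in> carrier V" using assms by (auto simp: ncauchy_def)
  have "Metric_space.MCauchy (carrier V) (ndist V nrm) s"
    using assms unfolding Metric_space.MCauchy_def[OF Metric_space_ndist] ncauchy_def by (auto simp: ndist_def)
  then obtain x where "limitin ntop s x sequentially"
    using mcomplete_ndist unfolding Metric_space.mcomplete_def[OF Metric_space_ndist] by blast
  then show ?thesis using limitin_iff_conv c by blast
qed

text \<open>If the increments are majorised by those of a convergent real sequence, the limit exists.\<close>

lemma majorised_conv:
  assumes c: "\<And>n. s n \<in> carrier V" and inc: "\<And>n. nrm (vdiff V (s (Suc n)) (s n)) \<le> r (Suc n) - r n"
    and conv: "convergent r"
  shows "\<exists>x. conv s x"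
proof (rule ncauchy_conv)
  have le: "nrm (vdiff V (s (n + k)) (s n)) \<le> r (n + k) - r n" for n k
  proof (induction k)
    case (Suc k)
    then show ?case
      using nrm_diff_triangle[of "s (Suc (n + k))" "s (n + k)" "s n"] inc[of "n + k"] c by simp
  qed (simp add: diff_self c nrm_zero)
  have le': "nrm (vdiff V (s m) (s n)) \<le> \<bar>r m - r n\<bar>" for m n
  proof (cases "n \<le> m")
    case True
    then show ?thesis using le[of n "m - n"] by auto
  next
    case False
    then show ?thesis using le[of m "n - m"] nrm_diff_commute[of "s m" "s n"] c by auto
  qed
  show "ncauchy s"
    unfolding ncauchy_def
  proof (intro conjI allI impI)
    fix \<epsilon> :: real assume "\<epsilon> > 0"
    then obtain N where "\<forall>m\<ge>N. \<forall>n\<ge>N. \<bar>r m - r n\<bar> < \<epsilon>"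
      using convergent_Cauchy[OF conv] unfolding Cauchy_def dist_real_def by blast
    then show "\<exists>N. \<forall>m\<ge>N. \<forall>n\<ge>N. nrm (vdiff V (s m) (s n)) < \<epsilon>"
      using le' by (meson le_less_trans)
  qed (rule c)
qed

end

lemma cbanachI:
  assumes "cnormed V nrm"
    and "\<And>s. cnormed.ncauchy V nrm s \<Longrightarrow> \<exists>x. cnormed.conv V nrm s x"
  shows "cbanach V nrm"
proof -
  interpret cnormed V nrm by fact
  show ?thesis
  proof
    show "Metric_space.mcomplete (carrier V) (ndist V nrm)"
      unfolding Metric_space.mcomplete_def[OF Metric_space_ndist]
    proof (intro allI impI)
      fix s assume C: "Metric_space.MCauchy (carrier V) (ndist V nrm) s"
      then have c: "\<And>n. s n \<in> carrier V" unfolding Metric_space.MCauchy_def[OF Metric_space_ndist] by blast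
      then have "ncauchy s"
        using C unfolding Metric_space.MCauchy_def[OF Metric_space_ndist] ncauchy_def by (simp add: ndist_def)
      then obtain x where "conv s x" using assms(2) by blast
      then show "\<exists>x. limitin ntop s x sequentially" using limitin_iff_conv c by blast
    qed
  qed
qed

text \<open>The law for the scalar 0 replaces an axiom for negatives: together with distributivity
  it makes (-1)x an additive inverse of x.\<close>

lemma cvector_spaceI:
  assumes "\<And>x y. x \<in> carrier V \<Longrightarrow> y \<in> carrier V \<Longrightarrow> x \<boxplus>\<^bsub>V\<^esub> y \<in> carrier V"
    and "\<zero>\<^sub>v\<^bsub>V\<^esub> \<in> carrier V"
    and "\<And>x y z. x \<in> carrier V \<Longrightarrow> y \<in> carrier V \<Longrightarrow> z \<in> carrier V \<Longrightarrow>
          (x \<boxplus>\<^bsub>V\<^esub> y) \<boxplus>\<^bsub>V\<^esub> z = x \<boxplus>\<^bsub>V\<^esub> (y \<boxplus>\<^bsub>V\<^esub> z)"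
    and "\<And>x y. x \<in> carrier V \<Longrightarrow> y \<in> carrier V \<Longrightarrow> x \<boxplus>\<^bsub>V\<^esub> y = y \<boxplus>\<^bsub>V\<^esub> x"
    and "\<And>x. x \<in> carrier V \<Longrightarrow> \<zero>\<^sub>v\<^bsub>V\<^esub> \<boxplus>\<^bsub>V\<^esub> x = x"
    and "\<And>x. x \<in> carrier V \<Longrightarrow> 0 \<cdot>\<^bsub>V\<^esub> x = \<zero>\<^sub>v\<^bsub>V\<^esub>"
    and sc: "\<And>c x. x \<in> carrier V \<Longrightarrow> c \<cdot>\<^bsub>V\<^esub> x \<in> carrier V"
    and "\<And>c x y. x \<in> carrier V \<Longrightarrow> y \<in> carrier V \<Longrightarrow> c \<cdot>\<^bsub>V\<^esub> (x \<boxplus>\<^bsub>V\<^esub> y) = c \<cdot>\<^bsub>V\<^esub> x \<boxplus>\<^bsub>V\<^esub> c \<cdot>\<^bsub>V\<^esub> y"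
    and dist: "\<And>c d x. x \<in> carrier V \<Longrightarrow> (c + d) \<cdot>\<^bsub>V\<^esub> x = c \<cdot>\<^bsub>V\<^esub> x \<boxplus>\<^bsub>V\<^esub> d \<cdot>\<^bsub>V\<^esub> x"
    and "\<And>c d x. x \<in> carrier V \<Longrightarrow> c \<cdot>\<^bsub>V\<^esub> d \<cdot>\<^bsub>V\<^esub> x = (c * d) \<cdot>\<^bsub>V\<^esub> x"
    and "\<And>x. x \<in> carrier V \<Longrightarrow> 1 \<cdot>\<^bsub>V\<^esub> x = x"
  shows "cvector_space V"
proof (rule cvector_space.intro)
  show "comm_group (vgroup V)"
  proof (rule comm_groupI)
    show "\<exists>y\<in>carrier (vgroup V). y \<otimes>\<^bsub>vgroup V\<^esub> x = \<one>\<^bsub>vgroup V\<^esub>" if "x \<in> carrier (vgroup V)" for x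
      using that dist[of x "-1" 1] sc[of x "-1"] assms by (auto simp: vgroup_def intro!: bexI[of _ "(-1) \<cdot>\<^bsub>V\<^esub> x"])
  qed (use assms in \<open>auto simp: vgroup_def\<close>)
qed (use assms in auto)

section \<open>C*-algebras\<close>

lemma cstar_dist_eq: "cstar_dist A = ndist A (anorm A)"
  by (auto simp: cstar_dist_def ndist_def fun_eq_iff)

sublocale cstar_algebra \<subseteq> nv: cbanach A "anorm A"
  by unfold_locales
    (use norm_nonneg norm_eq_zero norm_scale norm_triangle complete in \<open>auto simp: cstar_dist_eq\<close>)

context cstar_algebra begin

lemmas cl = mult_closed add_closed scale_closed star_closed diff_closed zero_closed

lemma mult_zero: "a \<in> carrier A \<Longrightarrow> a \<odot> \<zero>\<^sub>v = \<zero>\<^sub>v" "a \<in> carrier A \<Longrightarrow> \<zero>\<^sub>v \<odot> a = \<zero>\<^sub>v"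
  using mult_scale_right[of a "\<zero>\<^sub>v" 0] mult_scale_left[of "\<zero>\<^sub>v" a 0]
  by (simp_all add: zero_closed scale_zero_left mult_closed)

lemma star_zero: "\<zero>\<^sub>v\<^sup>\<star> = \<zero>\<^sub>v"
  using star_scale[OF zero_closed, of 0] by (simp add: scale_zero_left cl)

lemma star_diff: "a \<in> carrier A \<Longrightarrow> b \<in> carrier A \<Longrightarrow> (vdiff A a b)\<^sup>\<star> = vdiff A (a\<^sup>\<star>) (b\<^sup>\<star>)"
  by (simp add: vdiff_def star_add star_scale cl)

lemmas star_simps = star_add star_scale star_mult star_star star_diff star_zero

lemma mult_diff_right: "a \<in> carrier A \<Longrightarrow> b \<in> carrier A \<Longrightarrow> c \<in> carrier A \<Longrightarrow>
    a \<odot> vdiff A b c = vdiff A (a \<odot> b) (a \<odot> c)"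
  by (simp add: vdiff_def mult_add_right mult_scale_right cl)

lemma mult_diff_left: "a \<in> carrier A \<Longrightarrow> b \<in> carrier A \<Longrightarrow> c \<in> carrier A \<Longrightarrow>
    vdiff A b c \<odot> a = vdiff A (b \<odot> a) (c \<odot> a)"
  by (simp add: vdiff_def mult_add_left mult_scale_left cl)

text \<open>Submultiplicativity and the C*-identity bound the norm of an element by that of its
  adjoint; the reverse follows because the involution has order two.\<close>

lemma norm_star: assumes "a \<in> carrier A" shows "anorm A (a\<^sup>\<star>) = anorm A a"
proof -
  have le: "anorm A a \<le> anorm A (a\<^sup>\<star>)" if "a \<in> carrier A" for a
  proof (cases "anorm A a = 0")
    case True
    then show ?thesis using norm_nonneg[OF star_closed[OF that]] by simp
  next
    case False
    have "anorm A a * anorm A a \<le> anorm A (a\<^sup>\<star>) * anorm A a"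
      using cstar_identity[OF that] norm_mult[OF star_closed[OF that] that] by (simp add: power2_eq_square)
    then show ?thesis using False norm_nonneg[OF that] by simp
  qed
  show ?thesis using le[OF assms] le[OF star_closed[OF assms]] star_star[OF assms] by simp
qed

lemma norm_square: "a \<in> carrier A \<Longrightarrow> a\<^sup>\<star> = a \<Longrightarrow> anorm A (a \<odot> a) = (anorm A a)\<^sup>2"
  using cstar_identity[of a] by simp

lemma conv_mult:
  assumes "nv.conv s x" "nv.conv t y" shows "nv.conv (\<lambda>n. s n \<odot> t n) (x \<odot> y)"
proof (rule nv.convI_bound)
  have c: "x \<in> carrier A" "y \<in> carrier A" "\<And>n. s n \<in> carrier A" "\<And>n. t n \<in> carrier A"
    using assms by (auto simp: nv.conv_def)
  show "s n \<odot> t n \<in> carrier A" "x \<odot> y \<in> carrier A" for n using c by (simp_all add: cl)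
  show "anorm A (vdiff A (s n \<odot> t n) (x \<odot> y)) \<le>
      anorm A (s n) * anorm A (vdiff A (t n) y) + anorm A (vdiff A (s n) x) * anorm A y" for n
  proof -
    have "vdiff A (s n \<odot> t n) (x \<odot> y) = s n \<odot> vdiff A (t n) y \<boxplus> vdiff A (s n) x \<odot> y"
      using alg.nc_identity[of "[s n, t n, x, y]" "#0 [*] #1 [-] #2 [*] #3" "#0 [*] (#1 [-] #3) [+] (#0 [-] #2) [*] #3"] c
      by (simp add: vdiff_def)
    then show ?thesis
      using norm_triangle[of "s n \<odot> vdiff A (t n) y" "vdiff A (s n) x \<odot> y"]
        norm_mult[of "s n" "vdiff A (t n) y"] norm_mult[of "vdiff A (s n) x" y] c by (simp add: cl)
  qed
  have "(\<lambda>n. anorm A (s n) * anorm A (vdiff A (t n) y) + anorm A (vdiff A (s n) x) * anorm A y) \<longlonglongrightarrow>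
      anorm A x * 0 + 0 * anorm A y"
    using assms nv.conv_norm[OF assms(1)] unfolding nv.conv_def
    by (intro tendsto_add tendsto_mult tendsto_const) auto
  then show "(\<lambda>n. anorm A (s n) * anorm A (vdiff A (t n) y) + anorm A (vdiff A (s n) x) * anorm A y) \<longlonglongrightarrow> 0"
    by simp
qed

lemma conv_star:
  assumes "nv.conv s x" shows "nv.conv (\<lambda>n. (s n)\<^sup>\<star>) (x\<^sup>\<star>)"
  using assms unfolding nv.conv_def by (simp add: star_closed star_diff[symmetric] norm_star diff_closed)

text \<open>The solution \<open>e\<close> of \<open>2e = k + e\<^sup>2\<close> makes \<open>1 - e\<close> a square root of \<open>1 - k\<close>; stating it this way
  avoids a unit. The iteration \<open>e \<mapsto> (k + e\<^sup>2)/2\<close> is majorised by the scalar one with \<open>k = 1\<close>.\<close>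

lemma square_root_exists:
  assumes k: "k \<in> carrier A" "k\<^sup>\<star> = k" "anorm A k \<le> 1"
  shows "\<exists>e\<in>carrier A. e\<^sup>\<star> = e \<and> anorm A e \<le> 1 \<and> 2 \<cdot> e = k \<boxplus> e \<odot> e \<and>
    (\<forall>z\<in>carrier A. z \<odot> k = k \<odot> z \<longrightarrow> z \<odot> e = e \<odot> z)"
proof -
  define e where "e = rec_nat \<zero>\<^sub>v (\<lambda>_ x. (1/2) \<cdot> (k \<boxplus> x \<odot> x))"
  \<comment> \<open>The same iteration for the scalar k = 1. It increases within [0, 1], and its
    increments dominate those of \<open>e\<close>.\<close>
  define r where "r = rec_nat (0::real) (\<lambda>_ x. (1 + x\<^sup>2) / 2)"
  have e0: "e 0 = \<zero>\<^sub>v" and eS: "e (Suc n) = (1/2) \<cdot> (k \<boxplus> e n \<odot> e n)" for n by (simp_all add: e_def)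
  have r0: "r 0 = 0" and rS: "r (Suc n) = (1 + (r n)\<^sup>2) / 2" for n by (simp_all add: r_def)
  have ec: "e n \<in> carrier A" for n by (induction n) (simp_all add: e0 eS cl k)
  have r: "0 \<le> r n \<and> r n \<le> 1" for n
  proof (induction n)
    case (Suc n)
    then have "(r n)\<^sup>2 \<le> 1" by (simp add: power_le_one)
    then show ?case by (simp add: rS)
  qed (simp add: r0)
  have "incseq r"
  proof (rule incseq_SucI)
    fix n
    have "0 \<le> (1 - r n)\<^sup>2" by simp
    then show "r n \<le> r (Suc n)" by (simp add: rS power2_eq_square algebra_simps)
  qed
  then have rconv: "convergent r"
    using r by (intro Bseq_monoseq_convergent incseq_imp_monoseq BseqI'[where K = 1]) auto
  have en: "anorm A (e n) \<le> r n" for n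
  proof (induction n)
    case (Suc n)
    have "anorm A (k \<boxplus> e n \<odot> e n) \<le> 1 + r n * r n"
      using norm_triangle[of k "e n \<odot> e n"] norm_mult[of "e n" "e n"] Suc k ec norm_nonneg[OF ec[of n]]
        mult_mono[of "anorm A (e n)" "r n" "anorm A (e n)" "r n"] r[of n] by (auto simp: cl)
    then show ?case using norm_scale[of "k \<boxplus> e n \<odot> e n" "1/2"] k ec
      by (simp add: eS rS cl power2_eq_square)
  qed (simp add: e0 r0 nv.nrm_zero)
  have inc: "anorm A (vdiff A (e (Suc n)) (e n)) \<le> r (Suc n) - r n" for n
  proof (induction n)
    case 0
    have "vdiff A (e (Suc 0)) (e 0) = (1/2) \<cdot> k"
      using k by (simp add: eS e0 mult_zero cl add_zero scale_zero_right vdiff_def)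
    then show ?case using k norm_scale[of k "1/2"] by (simp add: rS r0)
  next
    case (Suc n)
    define d where "d = vdiff A (e (Suc n)) (e n)"
    have d: "d \<in> carrier A" by (simp add: d_def cl ec)
    \<comment> \<open>Half of x^2 - y^2, factored as x(x - y) + (x - y)y so that x and y need not
      commute.\<close>
    have "vdiff A (e (Suc (Suc n))) (e (Suc n)) = (1/2) \<cdot> (e (Suc n) \<odot> d \<boxplus> d \<odot> e n)"
      using alg.nc_identity[of "[e (Suc n), e n, k]"
          "(1/2) [.] (#2 [+] #0 [*] #0) [-] (1/2) [.] (#2 [+] #1 [*] #1)"
          "(1/2) [.] (#0 [*] (#0 [-] #1) [+] (#0 [-] #1) [*] #1)"] ec k
      by (simp add: eS[of "Suc n"] eS[of n, symmetric] vdiff_def d_def)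
    then have "anorm A (vdiff A (e (Suc (Suc n))) (e (Suc n))) \<le> (1/2) * (anorm A (e (Suc n)) * anorm A d + anorm A d * anorm A (e n))"
      using norm_scale[of "e (Suc n) \<odot> d \<boxplus> d \<odot> e n" "1/2"] norm_triangle[of "e (Suc n) \<odot> d" "d \<odot> e n"]
        norm_mult[of "e (Suc n)" d] norm_mult[of d "e n"] d ec by (simp add: cl)
    also have "\<dots> = (1/2) * anorm A d * (anorm A (e (Suc n)) + anorm A (e n))" by (simp add: algebra_simps)
    also have "\<dots> \<le> (1/2) * (r (Suc n) - r n) * (r (Suc n) + r n)"
      using Suc en norm_nonneg ec d incseqD[OF \<open>incseq r\<close>, of n "Suc n"]
      by (intro mult_mono add_mono) (auto simp: d_def)
    also have "\<dots> = r (Suc (Suc n)) - r (Suc n)"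
    proof -
      have "r (Suc (Suc n)) - r (Suc n) = ((r (Suc n))\<^sup>2 - (r n)\<^sup>2) / 2"
        using arg_cong2[where f = "(-)", OF rS[of "Suc n"] rS[of n]] by (simp add: diff_divide_distrib add_divide_distrib)
      also have "\<dots> = (1/2) * (r (Suc n) - r n) * (r (Suc n) + r n)"
        by (simp only: power2_eq_square square_diff_square_factored) (simp add: mult.commute)
      finally show ?thesis ..
    qed
    finally show ?case .
  qed
  obtain x where x: "nv.conv e x" using nv.majorised_conv[OF ec inc rconv] by blast
  have xc: "x \<in> carrier A" using x by (simp add: nv.conv_def)
  have "e n \<in> carrier A \<and> (e n)\<^sup>\<star> = e n" for n
    by (induction n) (simp_all add: e0 eS star_simps cl k)
  then have "nv.conv e (x\<^sup>\<star>)" using conv_star[OF x] by simp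
  then have "x\<^sup>\<star> = x" using x by (rule nv.conv_unique)
  moreover have "anorm A x \<le> 1"
    using nv.conv_norm[OF x] en r by (intro LIMSEQ_le_const2[of _ _ 1]) (auto intro: order_trans)
  moreover have "2 \<cdot> x = k \<boxplus> x \<odot> x"
  proof -
    have "nv.conv (\<lambda>n. 2 \<cdot> e (Suc n)) (2 \<cdot> x)"
      by (rule nv.conv_scale[OF nv.conv_ignore[OF x]]) (rule filterlim_Suc)
    moreover have "2 \<cdot> e (Suc n) = k \<boxplus> e n \<odot> e n" for n
      by (simp add: eS scale_scale cl k ec scale_one)
    moreover have "nv.conv (\<lambda>n. k \<boxplus> e n \<odot> e n) (k \<boxplus> x \<odot> x)"
      by (intro nv.conv_add nv.conv_const conv_mult x k)
    ultimately show ?thesis by (simp add: nv.conv_unique)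
  qed
  moreover have "z \<odot> x = x \<odot> z" if z: "z \<in> carrier A" "z \<odot> k = k \<odot> z" for z
  proof -
    have "z \<odot> e n = e n \<odot> z" for n
    proof (induction n)
      case (Suc n)
      have "z \<odot> (e n \<odot> e n) = (z \<odot> e n) \<odot> e n" using z ec by (simp add: mult_assoc)
      also have "\<dots> = e n \<odot> (z \<odot> e n)" using Suc z ec by (simp add: mult_assoc)
      also have "\<dots> = (e n \<odot> e n) \<odot> z" using Suc z ec by (simp add: mult_assoc)
      finally show ?case using z k ec
        by (simp add: eS mult_scale_left mult_scale_right mult_add_left mult_add_right cl)
    qed (simp add: e0 mult_zero z)
    then have "nv.conv (\<lambda>n. e n \<odot> z) (z \<odot> x)" using conv_mult[OF nv.conv_const[OF z(1)] x] by simp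
    then show ?thesis using conv_mult[OF x nv.conv_const[OF z(1)]] by (rule nv.conv_unique)
  qed
  ultimately show ?thesis using xc by blast
qed

text \<open>The hypothesis says that \<open>x + \<i>(1 - d)\<close> is unitary.\<close>

lemma norm_le_one:
  assumes x: "x \<in> carrier A" "x\<^sup>\<star> = x" and d: "d \<in> carrier A" "d\<^sup>\<star> = d"
    and comm: "x \<odot> d = d \<odot> x" and eq: "x \<odot> x \<boxplus> d \<odot> d = 2 \<cdot> d"
  shows "anorm A x \<le> 1"
proof -
  \<comment> \<open>Left multiplication by the unitary x + i(1 - d), written out without a unit, is
    isometric. The hypotheses are repeated because the fact is also applied to -x.\<close>
  have iso: "anorm A (x \<odot> z \<boxplus> \<i> \<cdot> vdiff A z (d \<odot> z)) = anorm A z"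
    if x: "x \<in> carrier A" "x\<^sup>\<star> = x" and comm: "x \<odot> d = d \<odot> x" and eq: "x \<odot> x \<boxplus> d \<odot> d = 2 \<cdot> d"
      and z: "z \<in> carrier A" for x z
  proof -
    let ?p = "x \<odot> z \<boxplus> \<i> \<cdot> vdiff A z (d \<odot> z)"
    have "?p\<^sup>\<star> = z\<^sup>\<star> \<odot> x \<boxplus> (- \<i>) \<cdot> vdiff A (z\<^sup>\<star>) (z\<^sup>\<star> \<odot> d)"
      using x z d by (simp add: star_simps cl)
    then have "?p\<^sup>\<star> \<odot> ?p = z\<^sup>\<star> \<odot> vdiff A (x \<odot> x \<boxplus> d \<odot> d) (2 \<cdot> d) \<odot> z \<boxplus>
        (- \<i>) \<cdot> (z\<^sup>\<star> \<odot> vdiff A (x \<odot> d) (d \<odot> x) \<odot> z) \<boxplus> z\<^sup>\<star> \<odot> z"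
      using alg.nc_identity[of "[z\<^sup>\<star>, x, d, z]"
          "(#0 [*] #1 [+] (- \<i>) [.] (#0 [-] #0 [*] #2)) [*] (#1 [*] #3 [+] \<i> [.] (#3 [-] #2 [*] #3))"
          "#0 [*] ((#1 [*] #1 [+] #2 [*] #2) [-] 2 [.] #2) [*] #3 [+] (- \<i>) [.] (#0 [*] (#1 [*] #2 [-] #2 [*] #1) [*] #3) [+] #0 [*] #3"]
        x z d by (simp add: vdiff_def cl)
    also have "\<dots> = z\<^sup>\<star> \<odot> z"
      using x z d by (simp add: eq comm diff_self cl mult_zero scale_zero_right zero_add add_zero)
    finally have "anorm A (?p\<^sup>\<star> \<odot> ?p) = anorm A (z\<^sup>\<star> \<odot> z)" by simp
    moreover have "?p \<in> carrier A" using x z d by (simp add: cl)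
    ultimately show ?thesis
      using cstar_identity norm_nonneg z by (simp add: power2_eq_iff_nonneg)
  qed
  have nx: "((-1) \<cdot> x)\<^sup>\<star> = (-1) \<cdot> x" "((-1) \<cdot> x) \<odot> d = d \<odot> ((-1) \<cdot> x)"
    "((-1) \<cdot> x) \<odot> ((-1) \<cdot> x) \<boxplus> d \<odot> d = 2 \<cdot> d"
    using x d comm eq by (simp_all add: star_simps mult_scale_left mult_scale_right scale_scale cl scale_one)
  \<comment> \<open>With U = x + i(1 - d) and V = -x + i(1 - d), both isometric from the left, 2x =
    U - V. Applied to x, this gives 2 norm(x)^2 <= 2 norm(x).\<close>
  have "2 \<cdot> (x \<odot> x) = (x \<odot> x \<boxplus> \<i> \<cdot> vdiff A x (d \<odot> x)) \<boxplus>
      (-1) \<cdot> (((-1) \<cdot> x) \<odot> x \<boxplus> \<i> \<cdot> vdiff A x (d \<odot> x))"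
    using alg.nc_identity[of "[x, d]" "2 [.] (#0 [*] #0)" "(#0 [*] #0 [+] \<i> [.] (#0 [-] #1 [*] #0)) [+]
      (-1) [.] (((-1) [.] #0) [*] #0 [+] \<i> [.] (#0 [-] #1 [*] #0))"] x d
    by (simp add: vdiff_def)
  then have "anorm A (2 \<cdot> (x \<odot> x)) \<le> anorm A x + anorm A x"
    using norm_triangle[of "x \<odot> x \<boxplus> \<i> \<cdot> vdiff A x (d \<odot> x)" "(-1) \<cdot> (((-1) \<cdot> x) \<odot> x \<boxplus> \<i> \<cdot> vdiff A x (d \<odot> x))"]
      norm_scale[of "((-1) \<cdot> x) \<odot> x \<boxplus> \<i> \<cdot> vdiff A x (d \<odot> x)" "-1"]
      iso[OF x comm eq x(1)] iso[OF _ nx x(1)] x d by (simp add: cl)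
  then have "(anorm A x)\<^sup>2 \<le> anorm A x"
    using norm_scale[of "x \<odot> x" 2] norm_square[OF x] x by (simp add: cl)
  then have le: "anorm A x * anorm A x \<le> anorm A x * 1" by (simp add: power2_eq_square)
  show ?thesis
  proof (cases "anorm A x > 0")
    case True
    then show ?thesis using le by (simp only: mult_le_cancel_left_pos)
  qed simp
qed

lemma subalgebra_cstar:
  assumes T: "nv.csubspace T" "nv.nclosed T"
    and m: "\<And>a b. a \<in> T \<Longrightarrow> b \<in> T \<Longrightarrow> a \<odot> b \<in> T" and s: "\<And>a. a \<in> T \<Longrightarrow> a\<^sup>\<star> \<in> T"
  shows "cstar_algebra (A\<lparr>carrier := T\<rparr>)"
proof -
  let ?B = "A\<lparr>carrier := T\<rparr>"
  have c: "a \<in> carrier A" if "a \<in> T" for a using T that by (auto simp: nv.csubspace_def)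
  have vd: "vdiff ?B a b = vdiff A a b" for a b by (simp add: vdiff_def)
  have B: "cvector_space ?B"
    by (rule cvector_spaceI) (use c T in \<open>auto simp: nv.csubspace_def add_assoc add_left_commute add_commute zero_add add_zero
        scale_zero_left scale_right_distrib scale_left_distrib scale_scale scale_one\<close>)
  then have N: "cnormed ?B (anorm A)"
    by (intro cnormed.intro cnormed_axioms.intro)
      (use c norm_nonneg norm_eq_zero norm_scale norm_triangle in auto)
  interpret N: cnormed ?B "anorm A" by (rule N)
  have "cbanach ?B (anorm A)"
  proof (rule cbanachI[OF N])
    fix t assume "N.ncauchy t"
    then have t: "\<And>n. t n \<in> T" and "nv.ncauchy t" using c by (auto simp: N.ncauchy_def nv.ncauchy_def vd)
    then obtain x where x: "nv.conv t x" using nv.ncauchy_conv by blast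
    then have "N.conv t x" using t nv.nclosed_conv[OF T(2) t x] by (simp add: N.conv_def nv.conv_def vd)
    then show "\<exists>x. N.conv t x" by blast
  qed
  then have comp: "Metric_space.mcomplete (carrier ?B) (cstar_dist ?B)"
    using cbanach.mcomplete_ndist by (fastforce simp: cstar_dist_eq)
  show ?thesis
    by (intro cstar_algebra.intro cstar_algebra_axioms.intro B comp)
      (use c m s norm_nonneg norm_eq_zero norm_scale norm_triangle norm_mult cstar_identity in
        \<open>auto simp: mult_assoc mult_add_left mult_add_right mult_scale_left mult_scale_right star_simps\<close>)
qed

end

section \<open>Homomorphisms of C*-algebras\<close>

lemma star_homsD:
  assumes "h \<in> star_homs A B"
  shows "a \<in> carrier A \<Longrightarrow> h a \<in> carrier B"
    and "a \<in> carrier A \<Longrightarrow> b \<in> carrier A \<Longrightarrow> h (a \<boxplus>\<^bsub>A\<^esub> b) = h a \<boxplus>\<^bsub>B\<^esub> h b"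
    and "a \<in> carrier A \<Longrightarrow> h (c \<cdot>\<^bsub>A\<^esub> a) = c \<cdot>\<^bsub>B\<^esub> h a"
    and "a \<in> carrier A \<Longrightarrow> b \<in> carrier A \<Longrightarrow> h (a \<odot>\<^bsub>A\<^esub> b) = h a \<odot>\<^bsub>B\<^esub> h b"
    and "a \<in> carrier A \<Longrightarrow> h (a\<^sup>\<star>\<^bsub>A\<^esub>) = (h a)\<^sup>\<star>\<^bsub>B\<^esub>"
    and "a \<notin> carrier A \<Longrightarrow> h a = undefined"
  using assms by (auto simp: star_homs_def linear_map_def)

lemma star_homsI:
  assumes "\<And>a. a \<in> carrier A \<Longrightarrow> h a \<in> carrier B"
    and "\<And>a b. a \<in> carrier A \<Longrightarrow> b \<in> carrier A \<Longrightarrow> h (a \<boxplus>\<^bsub>A\<^esub> b) = h a \<boxplus>\<^bsub>B\<^esub> h b"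
    and "\<And>a c. a \<in> carrier A \<Longrightarrow> h (c \<cdot>\<^bsub>A\<^esub> a) = c \<cdot>\<^bsub>B\<^esub> h a"
    and "\<And>a b. a \<in> carrier A \<Longrightarrow> b \<in> carrier A \<Longrightarrow> h (a \<odot>\<^bsub>A\<^esub> b) = h a \<odot>\<^bsub>B\<^esub> h b"
    and "\<And>a. a \<in> carrier A \<Longrightarrow> h (a\<^sup>\<star>\<^bsub>A\<^esub>) = (h a)\<^sup>\<star>\<^bsub>B\<^esub>"
    and "\<And>a. a \<notin> carrier A \<Longrightarrow> h a = undefined"
  shows "h \<in> star_homs A B"
  using assms by (auto simp: star_homs_def linear_map_def PiE_def extensional_def)

locale star_hom = A: cstar_algebra A + B: cstar_algebra B for A :: "'a cstar" and B :: "'b cstar" +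
  fixes h :: "'a \<Rightarrow> 'b"
  assumes hom: "h \<in> star_homs A B"
begin

lemmas hom_closed = star_homsD(1)[OF hom]
  and hom_add = star_homsD(2)[OF hom]
  and hom_scale = star_homsD(3)[OF hom]
  and hom_mult = star_homsD(4)[OF hom]
  and hom_star = star_homsD(5)[OF hom]

lemma hom_diff: "a \<in> carrier A \<Longrightarrow> b \<in> carrier A \<Longrightarrow> h (vdiff A a b) = vdiff B (h a) (h b)"
  by (simp add: vdiff_def hom_add hom_scale A.cl)

lemma hom_zero: "h \<zero>\<^sub>v\<^bsub>A\<^esub> = \<zero>\<^sub>v\<^bsub>B\<^esub>"
  using hom_scale[OF A.zero_closed, of 0] A.scale_zero_left B.scale_zero_left A.zero_closed hom_closed by simp

lemma hom_vlsum: "set xs \<subseteq> carrier A \<Longrightarrow> h (vlsum A xs) = vlsum B (map h xs)"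
  by (induction xs) (auto simp: hom_zero hom_add A.vlsum_closed)

text \<open>For a self-adjoint contraction a, the equation 2e = a^2 + e^2 is solved in the domain
  and preserved by \<open>h\<close>; in the codomain \<open>norm_le_one\<close> turns it into a norm
  bound. The general case follows by scaling and the C*-identity.\<close>

lemma norm_hom_le:
  assumes a: "a \<in> carrier A"
  shows "anorm B (h a) \<le> anorm A a"
proof -
  have unit: "anorm B (h a) \<le> 1" if a: "a \<in> carrier A" "a\<^sup>\<star>\<^bsub>A\<^esub> = a" "anorm A a \<le> 1" for a
  proof -
    have "anorm A (a \<odot>\<^bsub>A\<^esub> a) \<le> 1"
      using A.norm_square[OF a(1,2)] a(3) A.norm_nonneg[OF a(1)] by (simp add: power_le_one)
    then obtain e where e: "e \<in> carrier A" "e\<^sup>\<star>\<^bsub>A\<^esub> = e" "2 \<cdot>\<^bsub>A\<^esub> e = a \<odot>\<^bsub>A\<^esub> a \<boxplus>\<^bsub>A\<^esub> e \<odot>\<^bsub>A\<^esub> e"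
        "a \<odot>\<^bsub>A\<^esub> e = e \<odot>\<^bsub>A\<^esub> a"
      using A.square_root_exists[of "a \<odot>\<^bsub>A\<^esub> a"] a by (auto simp: A.cl A.star_simps A.mult_assoc)
    show ?thesis
    proof (rule B.norm_le_one)
      show "h a \<in> carrier B" "h e \<in> carrier B" using a e hom_closed by auto
      show "(h a)\<^sup>\<star>\<^bsub>B\<^esub> = h a" "(h e)\<^sup>\<star>\<^bsub>B\<^esub> = h e" using a e hom_star by metis+
      show "h a \<odot>\<^bsub>B\<^esub> h e = h e \<odot>\<^bsub>B\<^esub> h a" using a e hom_mult by metis
      show "h a \<odot>\<^bsub>B\<^esub> h a \<boxplus>\<^bsub>B\<^esub> h e \<odot>\<^bsub>B\<^esub> h e = 2 \<cdot>\<^bsub>B\<^esub> h e"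
        using arg_cong[OF e(3), of h] a e(1) by (simp add: hom_add hom_mult hom_scale A.cl)
    qed
  qed
  have sa: "anorm B (h a) \<le> anorm A a" if a: "a \<in> carrier A" "a\<^sup>\<star>\<^bsub>A\<^esub> = a" for a
  proof (cases "anorm A a = 0")
    case True
    then show ?thesis using A.norm_eq_zero[OF a(1)] hom_zero B.nv.nrm_zero by simp
  next
    case False
    define t where "t = anorm A a"
    have t: "t > 0" using False A.norm_nonneg[OF a(1)] by (simp add: t_def)
    have "anorm B (h (complex_of_real (1/t) \<cdot>\<^bsub>A\<^esub> a)) \<le> 1"
      using a t by (intro unit) (simp_all add: A.cl A.star_simps A.norm_scale t_def norm_divide)
    then show ?thesis using a t
      by (simp add: hom_scale B.norm_scale hom_closed norm_divide t_def[symmetric] field_simps)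
  qed
  have "(anorm B (h a))\<^sup>2 = anorm B (h (a\<^sup>\<star>\<^bsub>A\<^esub> \<odot>\<^bsub>A\<^esub> a))"
    using B.cstar_identity[OF hom_closed[OF a]] a by (simp add: hom_mult hom_star A.cl)
  also have "\<dots> \<le> (anorm A a)\<^sup>2"
    using sa[of "a\<^sup>\<star>\<^bsub>A\<^esub> \<odot>\<^bsub>A\<^esub> a"] A.cstar_identity[OF a] a by (simp add: A.cl A.star_simps)
  finally show ?thesis using A.norm_nonneg[OF a] by (rule power2_le_imp_le)
qed

lemma hom_conv: assumes "A.nv.conv s x" shows "B.nv.conv (\<lambda>n. h (s n)) (h x)"
proof (rule B.nv.convI_bound)
  have c: "x \<in> carrier A" "\<And>n. s n \<in> carrier A" using assms by (auto simp: A.nv.conv_def)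
  show "h (s n) \<in> carrier B" "h x \<in> carrier B" for n using c hom_closed by auto
  show "anorm B (vdiff B (h (s n)) (h x)) \<le> anorm A (vdiff A (s n) x)" for n
    using norm_hom_le[of "vdiff A (s n) x"] hom_diff[of "s n" x] A.diff_closed[of "s n" x] c by simp
  show "(\<lambda>n. anorm A (vdiff A (s n) x)) \<longlonglongrightarrow> 0" using assms by (simp add: A.nv.conv_def)
qed

end

lemma star_hom_compose:
  assumes "cstar_algebra A" "h \<in> star_homs A B" "g \<in> star_homs B C"
  shows "compose (carrier A) g h \<in> star_homs A C"
proof -
  interpret A: cstar_algebra A by fact
  show ?thesis
    by (rule star_homsI) (auto simp: compose_def star_homsD[OF assms(2)] star_homsD[OF assms(3)] A.cl)
qed

lemma star_homs_eq_dense: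
  assumes A: "cstar_algebra A" and B: "cstar_algebra B" and h: "h \<in> star_homs A B" and g: "g \<in> star_homs A B"
    and D: "D \<subseteq> carrier A" "\<And>x \<epsilon>. x \<in> carrier A \<Longrightarrow> 0 < \<epsilon> \<Longrightarrow> \<exists>y\<in>D. anorm A (vdiff A x y) < \<epsilon>"
    and eq: "\<And>x. x \<in> D \<Longrightarrow> h x = g x"
  shows "h = g"
proof -
  interpret H: star_hom A B h using A B h by (simp add: star_hom_def star_hom_axioms_def)
  interpret G: star_hom A B g using A B g by (simp add: star_hom_def star_hom_axioms_def)
  let ?T = "{x \<in> carrier A. h x = g x}"
  have cl: "H.A.nv.nclosed ?T"
  proof (rule H.A.nv.nclosedI)
    fix s x assume s: "\<And>n. s n \<in> ?T" and x: "H.A.nv.conv s x"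
    have "H.B.nv.conv (\<lambda>n. h (s n)) (g x)" using G.hom_conv[OF x] s by simp
    with H.hom_conv[OF x] have "h x = g x" by (rule H.B.nv.conv_unique)
    then show "x \<in> ?T" using x by (simp add: H.A.nv.conv_def)
  qed auto
  have "x \<in> ?T" if x: "x \<in> carrier A" for x
  proof -
    have "\<exists>y\<in>?T. anorm A (vdiff A x y) < \<epsilon>" if "\<epsilon> > 0" for \<epsilon> using D(2)[OF x that] D(1) eq by blast
    then show ?thesis using cl x unfolding H.A.nv.nclosed_def by blast
  qed
  moreover have "h x = g x" if "x \<notin> carrier A" for x
    using star_homsD(6)[OF h that] star_homsD(6)[OF g that] by simp
  ultimately show ?thesis by blast
qed

section \<open>Positivity in unital C*-algebras\<close>

text \<open>In unital identities the element with index 0 is the unit.\<close>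

definition nc_strip :: "nat list \<Rightarrow> nat list" where
  "nc_strip w = (if filter (\<lambda>i. i \<noteq> 0) w = [] then [0] else filter (\<lambda>i. i \<noteq> 0) w)"

locale unital_cstar = cstar_algebra A for A :: "'a cstar" (structure) +
  fixes u :: 'a
  assumes u_closed: "u \<in> carrier A"
    and u_left: "a \<in> carrier A \<Longrightarrow> u \<odot> a = a"
    and u_right: "a \<in> carrier A \<Longrightarrow> a \<odot> u = a"
begin

lemmas ucl = cl u_closed

lemma u_star: "u\<^sup>\<star> = u"
  using star_mult[of "u\<^sup>\<star>" u] u_closed by (simp add: u_left u_right star_star cl)

lemma norm_u_le: "anorm A u \<le> 1"
proof -
  have "anorm A u * anorm A u = anorm A u * 1"
    using cstar_identity[OF u_closed] u_closed by (simp add: u_star u_left power2_eq_square)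
  then show ?thesis by (simp only: mult_cancel_left) auto
qed

lemma nc_word_strip:
  assumes ys: "set ys \<subseteq> carrier A"
  shows "set w \<subseteq> {..<Suc (length ys)} \<Longrightarrow> w \<noteq> [] \<Longrightarrow> alg.nc_word (u # ys) (nc_strip w) = alg.nc_word (u # ys) w"
proof (induction w)
  case (Cons i w)
  let ?xs = "u # ys"
  have xs: "set ?xs \<subseteq> carrier A" using ys u_closed by simp
  have i: "?xs ! i \<in> carrier A" using Cons.prems(1) nth_mem[of i ?xs] xs by auto
  show ?case
  proof (cases "w = []")
    case True
    then show ?thesis by (simp add: nc_strip_def)
  next
    case False
    then have IH: "alg.nc_word ?xs (nc_strip w) = alg.nc_word ?xs w" using Cons by simp
    have w: "alg.nc_word ?xs w \<in> carrier A" using alg.nc_word_closed[OF xs] Cons.prems by simp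
    have e: "alg.nc_word ?xs (i # w) = ?xs ! i \<odot> alg.nc_word ?xs w"
      using alg.nc_word_append[OF xs, of "[i]" w] Cons.prems False by simp
    show ?thesis
    proof (cases "i = 0")
      case True
      then have "nc_strip (i # w) = nc_strip w" by (simp add: nc_strip_def)
      then show ?thesis using e IH w True by (simp add: u_left)
    next
      case i0: False
      show ?thesis
      proof (cases "filter (\<lambda>i. i \<noteq> 0) w = []")
        case True
        then have "alg.nc_word ?xs w = u" "nc_strip (i # w) = [i]" using IH i0 by (simp_all add: nc_strip_def)
        then show ?thesis using e i by (simp add: u_right)
      next
        case False
        then have s: "nc_strip (i # w) = [i] @ nc_strip w" "nc_strip w \<noteq> []" using i0 by (simp_all add: nc_strip_def)
        have "set (nc_strip w) \<subseteq> {..<length ?xs}" using Cons.prems by (auto simp: nc_strip_def)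
        then have "alg.nc_word ?xs ([i] @ nc_strip w) = ?xs ! i \<odot> alg.nc_word ?xs (nc_strip w)"
          using alg.nc_word_append[OF xs, of "[i]" "nc_strip w"] Cons.prems s by simp
        then show ?thesis using e IH s by simp
      qed
    qed
  qed
qed simp

theorem unit_identity:
  assumes ys: "set ys \<subseteq> carrier A" and vars: "nc_vars (a [-] b) \<subseteq> {..<Suc (length ys)}"
    and coeffs: "list_all (\<lambda>(c, w). c = 0)
      (nc_collect (map (\<lambda>(c, w). (c, nc_strip w)) (nc_terms (a [-] b))))"
  shows "alg.nc_eval (u # ys) a = alg.nc_eval (u # ys) b"
proof -
  let ?xs = "u # ys"
  let ?L = "nc_terms (a [-] b)"
  have xs: "set ?xs \<subseteq> carrier A" using ys u_closed by simp
  have vars': "nc_vars (a [-] b) \<subseteq> {..<length ?xs}" using vars by simp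
  note ok = alg.nc_terms_ok[OF xs vars']
  have strip: "set (nc_strip w) \<subseteq> {..<length ?xs} \<and> nc_strip w \<noteq> []" if "set w \<subseteq> {..<length ?xs}" for w
    using that by (auto simp: nc_strip_def)
  have "alg.nc_ok ?xs (map (\<lambda>(c, w). (c, nc_strip w)) L)" if "alg.nc_ok ?xs L" for L
    using that strip unfolding alg.nc_ok_def[OF xs] by (induction L) auto
  from this[OF ok] have ok': "alg.nc_ok ?xs (map (\<lambda>(c, w). (c, nc_strip w)) ?L)" .
  have "alg.nc_sum ?xs (map (\<lambda>(c, w). (c, nc_strip w)) L) = alg.nc_sum ?xs L" if "alg.nc_ok ?xs L" for L
    using that
  proof (induction L)
    case (Cons x L)
    obtain c w where x: "x = (c, w)" by force
    have "alg.nc_ok ?xs L" "set w \<subseteq> {..<Suc (length ys)}" "w \<noteq> []"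
      using Cons.prems x unfolding alg.nc_ok_def[OF xs] by auto
    then show ?case using Cons.IH x nc_word_strip[OF ys] by simp
  qed simp
  from this[OF ok] have "alg.nc_sum ?xs ?L = alg.nc_sum ?xs (nc_collect (map (\<lambda>(c, w). (c, nc_strip w)) ?L))"
    using alg.nc_sum_collect[OF xs ok'] by simp
  also have "\<dots> = \<zero>\<^sub>v" by (rule alg.nc_sum_zero[OF xs alg.nc_collect_ok[OF xs ok'] coeffs])
  finally have "vdiff A (alg.nc_eval ?xs a) (alg.nc_eval ?xs b) = \<zero>\<^sub>v"
    using alg.nc_eval_eq_sum[OF xs vars'] by (simp add: vdiff_def)
  then show ?thesis using diff_eq_zero alg.nc_eval_closed[OF xs] vars' by simp
qed

text \<open>Squares of self-adjoint elements are what the root lemmas below produce; that every b*b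
  is of this form is the content of \<open>star_mult_pos\<close>.\<close>

definition pos :: "'a \<Rightarrow> bool" where
  "pos h \<longleftrightarrow> (\<exists>g\<in>carrier A. g\<^sup>\<star> = g \<and> h = g \<odot> g)"

lemma commuting_square:
  assumes "x \<in> carrier A" "y \<in> carrier A" "x \<odot> y = y \<odot> x"
  shows "(x \<odot> y) \<odot> (x \<odot> y) = (x \<odot> x) \<odot> (y \<odot> y)"
proof -
  have "(x \<odot> y) \<odot> (x \<odot> y) = x \<odot> (y \<odot> x) \<odot> y" using assms(1,2) by (simp add: mult_assoc cl)
  also have "\<dots> = x \<odot> (x \<odot> y) \<odot> y" by (simp only: assms(3))
  also have "\<dots> = (x \<odot> x) \<odot> (y \<odot> y)" using assms(1,2) by (simp add: mult_assoc cl)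
  finally show ?thesis .
qed

lemma posD: "pos h \<Longrightarrow> h \<in> carrier A" "pos h \<Longrightarrow> h\<^sup>\<star> = h"
  by (auto simp: pos_def cl star_simps)

text \<open>The root is 1 - e with \<open>e\<close> from \<open>square_root_exists\<close>, so 1 - c
  = e has norm at most 1. The commutation clause stands in for the functional calculus.\<close>

lemma root_one_minus:
  assumes k: "k \<in> carrier A" "k\<^sup>\<star> = k" "anorm A k \<le> 1"
  shows "\<exists>c\<in>carrier A. c\<^sup>\<star> = c \<and> c \<odot> c = vdiff A u k \<and> anorm A (vdiff A u c) \<le> 1 \<and>
    (\<forall>z\<in>carrier A. z \<odot> k = k \<odot> z \<longrightarrow> z \<odot> c = c \<odot> z)"
proof -
  obtain e where e: "e \<in> carrier A" "e\<^sup>\<star> = e" "anorm A e \<le> 1" "2 \<cdot> e = k \<boxplus> e \<odot> e"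
    and comm: "\<And>z. z \<in> carrier A \<Longrightarrow> z \<odot> k = k \<odot> z \<Longrightarrow> z \<odot> e = e \<odot> z"
    using square_root_exists[OF k] by blast
  let ?c = "vdiff A u e"
  have "?c \<odot> ?c = vdiff A (u \<boxplus> e \<odot> e) (2 \<cdot> e)"
    using unit_identity[of "[e]" "(#0 [-] #1) [*] (#0 [-] #1)" "(#0 [+] #1 [*] #1) [-] 2 [.] #1"] e(1)
    by (simp add: vdiff_def nc_strip_def)
  also have "\<dots> = vdiff A u k"
    unfolding e(4) using unit_identity[of "[e, k]" "(#0 [+] #1 [*] #1) [-] (#2 [+] #1 [*] #1)" "#0 [-] #2"] e(1) k
    by (simp add: vdiff_def nc_strip_def)
  finally have "?c \<odot> ?c = vdiff A u k" .
  moreover have "vdiff A u ?c = e"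
    using unit_identity[of "[e]" "#0 [-] (#0 [-] #1)" "#1"] e(1) by (simp add: vdiff_def nc_strip_def)
  moreover have "?c \<in> carrier A" "?c\<^sup>\<star> = ?c" using e by (simp_all add: ucl star_simps u_star)
  moreover have "z \<odot> ?c = ?c \<odot> z" if "z \<in> carrier A" "z \<odot> k = k \<odot> z" for z
    using comm[OF that] that e by (simp add: mult_diff_left mult_diff_right ucl u_left u_right)
  ultimately show ?thesis using e(3) by metis
qed

text \<open>Here x + iy is unitary; the substitution d = 1 - y leads to the unit-free
  \<open>norm_le_one\<close>.\<close>

lemma norm_le_one_unital:
  assumes x: "x \<in> carrier A" "x\<^sup>\<star> = x" and y: "y \<in> carrier A" "y\<^sup>\<star> = y"
    and comm: "x \<odot> y = y \<odot> x" and eq: "x \<odot> x \<boxplus> y \<odot> y = u"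
  shows "anorm A x \<le> 1"
proof (rule norm_le_one)
  let ?d = "vdiff A u y"
  have "x \<odot> x \<boxplus> ?d \<odot> ?d = vdiff A ((x \<odot> x \<boxplus> y \<odot> y) \<boxplus> u) (2 \<cdot> y)"
    using unit_identity[of "[x, y]" "#1 [*] #1 [+] (#0 [-] #2) [*] (#0 [-] #2)"
        "((#1 [*] #1 [+] #2 [*] #2) [+] #0) [-] 2 [.] #2"] x y
    by (simp add: vdiff_def nc_strip_def)
  also have "\<dots> = 2 \<cdot> ?d"
    unfolding eq using unit_identity[of "[y]" "(#0 [+] #0) [-] 2 [.] #1" "2 [.] (#0 [-] #1)"] y
    by (simp add: vdiff_def nc_strip_def)
  finally show "x \<odot> x \<boxplus> ?d \<odot> ?d = 2 \<cdot> ?d" .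
qed (use x y comm in \<open>auto simp: ucl star_simps u_star mult_diff_left mult_diff_right u_left u_right\<close>)

text \<open>If c is the root of 1 - g^2, then c^2 + g^2 = 1 bounds the norm of c, hence that of
  c^2.\<close>

lemma norm_one_minus_square:
  assumes g: "g \<in> carrier A" "g\<^sup>\<star> = g" "anorm A g \<le> 1"
  shows "anorm A (vdiff A u (g \<odot> g)) \<le> 1"
proof -
  have k: "anorm A (g \<odot> g) \<le> 1" using norm_square[OF g(1,2)] g norm_nonneg by (simp add: power_le_one)
  obtain c where c: "c \<in> carrier A" "c\<^sup>\<star> = c" "c \<odot> c = vdiff A u (g \<odot> g)" "g \<odot> c = c \<odot> g"
    using root_one_minus[OF _ _ k] g by (metis cl(1) star_mult mult_assoc)
  have "c \<odot> c \<boxplus> g \<odot> g = u"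
    unfolding c(3) using unit_identity[of "[g]" "(#0 [-] #1 [*] #1) [+] #1 [*] #1" "#0"] g
    by (simp add: vdiff_def nc_strip_def)
  then have "anorm A c \<le> 1" using norm_le_one_unital[of c g] c g by simp
  then show ?thesis using norm_square[OF c(1,2)] norm_nonneg[OF c(1)] by (simp add: c(3)[symmetric] power_le_one)
qed

text \<open>Together with \<open>posI\<close>, this turns positivity in the unit ball into the
  convex and closed condition norm(1 - h) <= 1, which is how sums and limits of positive elements
  are treated.\<close>

lemma pos_norm_one_minus:
  assumes "pos h" "anorm A h \<le> 1" shows "anorm A (vdiff A u h) \<le> 1"
proof -
  obtain g where g: "g \<in> carrier A" "g\<^sup>\<star> = g" "h = g \<odot> g" using assms by (auto simp: pos_def)
  have "(anorm A g)\<^sup>2 \<le> 1\<^sup>2" using norm_square[OF g(1,2)] assms g by simp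
  then have "anorm A g \<le> 1" by (rule power2_le_imp_le) simp
  then show ?thesis using norm_one_minus_square g by simp
qed

lemma pos_of_norm_one_minus:
  assumes h: "h \<in> carrier A" "h\<^sup>\<star> = h" "anorm A (vdiff A u h) \<le> 1"
  shows "\<exists>c\<in>carrier A. c\<^sup>\<star> = c \<and> c \<odot> c = h \<and> anorm A (vdiff A u c) \<le> 1 \<and>
    (\<forall>z\<in>carrier A. z \<odot> h = h \<odot> z \<longrightarrow> z \<odot> c = c \<odot> z)"
proof -
  have "vdiff A u h \<in> carrier A" "(vdiff A u h)\<^sup>\<star> = vdiff A u h"
    using h by (simp_all add: ucl star_simps u_star)
  then obtain c where c: "c \<in> carrier A" "c\<^sup>\<star> = c" "c \<odot> c = vdiff A u (vdiff A u h)" "anorm A (vdiff A u c) \<le> 1"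
    and comm: "\<And>z. z \<in> carrier A \<Longrightarrow> z \<odot> vdiff A u h = vdiff A u h \<odot> z \<Longrightarrow> z \<odot> c = c \<odot> z"
    using root_one_minus[of "vdiff A u h"] h(3) by blast
  have "vdiff A u (vdiff A u h) = h"
    using unit_identity[of "[h]" "#0 [-] (#0 [-] #1)" "#1"] h by (simp add: vdiff_def nc_strip_def)
  moreover have "z \<odot> c = c \<odot> z" if "z \<in> carrier A" "z \<odot> h = h \<odot> z" for z
    using comm[OF that(1)] that h by (simp add: mult_diff_left mult_diff_right ucl u_left u_right)
  ultimately show ?thesis using c by metis
qed

lemma posI: "h \<in> carrier A \<Longrightarrow> h\<^sup>\<star> = h \<Longrightarrow> anorm A (vdiff A u h) \<le> 1 \<Longrightarrow> pos h"
  using pos_of_norm_one_minus unfolding pos_def by metis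

lemma pos_scale:
  assumes "pos h" "0 \<le> t" shows "pos (complex_of_real t \<cdot> h)"
proof -
  obtain g where g: "g \<in> carrier A" "g\<^sup>\<star> = g" "h = g \<odot> g" using assms by (auto simp: pos_def)
  have "complex_of_real t \<cdot> h = (complex_of_real (sqrt t) \<cdot> g) \<odot> (complex_of_real (sqrt t) \<cdot> g)"
    using g assms(2)
    by (simp add: mult_scale_left mult_scale_right scale_scale cl of_real_mult[symmetric] del: of_real_mult)
  moreover have "(complex_of_real (sqrt t) \<cdot> g)\<^sup>\<star> = complex_of_real (sqrt t) \<cdot> g"
    using g by (simp add: star_simps)
  ultimately show ?thesis unfolding pos_def using g cl(3) by metis
qed

lemma scale_inverse: "h \<in> carrier A \<Longrightarrow> t \<noteq> 0 \<Longrightarrow> complex_of_real t \<cdot> complex_of_real (1 / t) \<cdot> h = h"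
  by (simp add: scale_scale scale_one)

lemma norm_scale_inverse: "h \<in> carrier A \<Longrightarrow> 0 < t \<Longrightarrow> anorm A (complex_of_real (1 / t) \<cdot> h) = anorm A h / t"
  by (simp add: norm_scale norm_divide)

lemma pos_root:
  assumes "pos h"
  shows "\<exists>c\<in>carrier A. pos c \<and> c \<odot> c = h \<and> (\<forall>z\<in>carrier A. z \<odot> h = h \<odot> z \<longrightarrow> z \<odot> c = c \<odot> z)"
proof -
  note h = posD[OF assms]
  define t where "t = anorm A h + 1"
  have t: "t > 0" using norm_nonneg[OF h(1)] by (simp add: t_def)
  let ?h = "complex_of_real (1 / t) \<cdot> h"
  have "pos ?h" by (rule pos_scale[OF assms]) (use t in simp)
  moreover have "anorm A ?h \<le> 1" using norm_scale_inverse[OF h(1) t] t by (simp add: t_def)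
  ultimately obtain c where c: "c \<in> carrier A" "c\<^sup>\<star> = c" "c \<odot> c = ?h" "anorm A (vdiff A u c) \<le> 1"
    and comm: "\<And>z. z \<in> carrier A \<Longrightarrow> z \<odot> ?h = ?h \<odot> z \<Longrightarrow> z \<odot> c = c \<odot> z"
    using pos_of_norm_one_minus[of ?h] pos_norm_one_minus posD by metis
  let ?c = "complex_of_real (sqrt t) \<cdot> c"
  have "pos ?c" by (rule pos_scale[OF posI[OF c(1,2,4)]]) (use t in simp)
  moreover have "?c \<odot> ?c = h"
    using c(1) t scale_inverse[OF h(1), of t]
    by (simp add: mult_scale_left mult_scale_right scale_scale cl c(3) h of_real_mult[symmetric] del: of_real_mult of_real_divide)
  moreover have "z \<odot> ?c = ?c \<odot> z" if "z \<in> carrier A" "z \<odot> h = h \<odot> z" for z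
    using comm[OF that(1)] that c(1) h by (simp add: mult_scale_left mult_scale_right)
  ultimately show ?thesis using posD(1) by blast
qed

text \<open>After scaling both summands into the unit ball, their midpoint satisfies the norm
  condition of \<open>posI\<close>.\<close>

lemma pos_add: assumes h: "pos h" and k: "pos k" shows "pos (h \<boxplus> k)"
proof -
  note hc = posD[OF h] and kc = posD[OF k]
  define t where "t = anorm A h + anorm A k + 1"
  have t: "t > 0" "anorm A h \<le> t" "anorm A k \<le> t"
    using norm_nonneg[OF hc(1)] norm_nonneg[OF kc(1)] by (simp_all add: t_def)
  let ?h = "complex_of_real (1 / t) \<cdot> h" and ?k = "complex_of_real (1 / t) \<cdot> k"
  have n: "anorm A (vdiff A u ?h) \<le> 1" "anorm A (vdiff A u ?k) \<le> 1"
    using pos_scale[OF h, of "1/t"] pos_scale[OF k, of "1/t"] t norm_scale_inverse[OF hc(1) t(1)] norm_scale_inverse[OF kc(1) t(1)]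
    by (auto intro!: pos_norm_one_minus)
  have c: "?h \<in> carrier A" "?k \<in> carrier A" using hc kc by (simp_all add: cl)
  have "vdiff A u ((1/2) \<cdot> (?h \<boxplus> ?k)) = (1/2) \<cdot> (vdiff A u ?h \<boxplus> vdiff A u ?k)"
    using unit_identity[of "[?h, ?k]" "#0 [-] (1/2) [.] (#1 [+] #2)" "(1/2) [.] ((#0 [-] #1) [+] (#0 [-] #2))"] c
    by (simp add: vdiff_def nc_strip_def)
  then have "anorm A (vdiff A u ((1/2) \<cdot> (?h \<boxplus> ?k))) \<le> 1"
    using norm_scale[of "vdiff A u ?h \<boxplus> vdiff A u ?k" "1/2"] norm_triangle[of "vdiff A u ?h" "vdiff A u ?k"] n c
    by (simp add: ucl)
  moreover have "((1/2) \<cdot> (?h \<boxplus> ?k))\<^sup>\<star> = (1/2) \<cdot> (?h \<boxplus> ?k)" using hc kc by (simp add: star_simps cl)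
  ultimately have "pos ((1/2) \<cdot> (?h \<boxplus> ?k))" using c by (intro posI) (simp_all add: cl)
  then have "pos (complex_of_real (2 * t) \<cdot> (1/2) \<cdot> (?h \<boxplus> ?k))" by (rule pos_scale) (use t in simp)
  moreover have "complex_of_real (2 * t) \<cdot> (1/2) \<cdot> (?h \<boxplus> ?k) = h \<boxplus> k"
    using hc kc t by (simp add: scale_right_distrib scale_scale cl scale_one)
  ultimately show ?thesis by simp
qed

lemma pos_zero: "pos \<zero>\<^sub>v"
  unfolding pos_def by (intro bexI[of _ "\<zero>\<^sub>v"]) (simp_all add: mult_zero star_zero cl)

lemma pos_norm_minus:
  assumes h: "pos h" and t: "0 < t" "anorm A h \<le> t"
  shows "pos (vdiff A (complex_of_real t \<cdot> u) h)"
proof -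
  note hc = posD[OF h]
  let ?h = "complex_of_real (1 / t) \<cdot> h"
  have "anorm A ?h \<le> 1" using norm_scale_inverse[OF hc(1) t(1)] t by simp
  moreover have "?h \<in> carrier A" "?h\<^sup>\<star> = ?h" using hc by (simp_all add: cl star_simps)
  ultimately have "pos (vdiff A u ?h)" using root_one_minus unfolding pos_def by metis
  then have "pos (complex_of_real t \<cdot> vdiff A u ?h)" by (rule pos_scale) (use t in simp)
  moreover have "complex_of_real t \<cdot> vdiff A u ?h = vdiff A (complex_of_real t \<cdot> u) h"
    using unit_identity[of "[h]" "complex_of_real t [.] (#0 [-] complex_of_real (1 / t) [.] #1)" "complex_of_real t [.] #0 [-] #1"] hc t
    by (simp add: vdiff_def nc_strip_def)
  ultimately show ?thesis by simp
qed

text \<open>For t above norm(h + k), the element t - h = (t - (h + k)) + k is positive. Its root c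
  commutes with a self-adjoint g whose square is h, and (g^2 + c^2)/t = 1 bounds norm(g) by sqrt
  t.\<close>

lemma pos_norm_mono: assumes h: "pos h" and k: "pos k" shows "anorm A h \<le> anorm A (h \<boxplus> k)"
proof (rule dense_ge)
  fix t assume "anorm A (h \<boxplus> k) < t"
  note hc = posD[OF h] and kc = posD[OF k]
  then have t: "0 < t" "anorm A (h \<boxplus> k) \<le> t"
    using norm_nonneg[OF add_closed[OF hc(1) kc(1)]] \<open>anorm A (h \<boxplus> k) < t\<close> by linarith+
  have "pos (vdiff A (complex_of_real t \<cdot> u) (h \<boxplus> k) \<boxplus> k)"
    by (rule pos_add[OF pos_norm_minus[OF pos_add[OF h k] t] k])
  moreover have "vdiff A (complex_of_real t \<cdot> u) (h \<boxplus> k) \<boxplus> k = vdiff A (complex_of_real t \<cdot> u) h"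
    using unit_identity[of "[h, k]" "(complex_of_real t [.] #0 [-] (#1 [+] #2)) [+] #2" "complex_of_real t [.] #0 [-] #1"] hc kc
    by (simp add: vdiff_def nc_strip_def)
  ultimately obtain c where c: "c \<in> carrier A" "pos c" "c \<odot> c = vdiff A (complex_of_real t \<cdot> u) h"
    and comm: "\<And>z. z \<in> carrier A \<Longrightarrow> z \<odot> vdiff A (complex_of_real t \<cdot> u) h = vdiff A (complex_of_real t \<cdot> u) h \<odot> z \<Longrightarrow> z \<odot> c = c \<odot> z"
    using pos_root by metis
  obtain g where g: "g \<in> carrier A" "g\<^sup>\<star> = g" "h = g \<odot> g" using h by (auto simp: pos_def)
  let ?s = "complex_of_real (1 / sqrt t)"
  have st: "?s * ?s = complex_of_real (1 / t)" using t by (simp add: of_real_mult[symmetric] del: of_real_mult of_real_divide)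
  have gc: "g \<odot> c = c \<odot> g"
    using g by (intro comm) (simp_all add: mult_diff_left mult_diff_right ucl mult_scale_left mult_scale_right u_left u_right mult_assoc)
  have "anorm A (?s \<cdot> g) \<le> 1"
  proof (rule norm_le_one_unital[where y = "?s \<cdot> c"])
    have "(?s \<cdot> g) \<odot> (?s \<cdot> g) \<boxplus> (?s \<cdot> c) \<odot> (?s \<cdot> c) = (?s * ?s) \<cdot> (h \<boxplus> vdiff A (complex_of_real t \<cdot> u) h)"
      using g c hc by (simp add: mult_scale_left mult_scale_right scale_scale cl scale_right_distrib ucl)
    also have "\<dots> = u"
      unfolding st using unit_identity[of "[h]" "complex_of_real (1 / t) [.] (#1 [+] (complex_of_real t [.] #0 [-] #1))" "#0"] hc t
      by (simp add: vdiff_def nc_strip_def)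
    finally show "(?s \<cdot> g) \<odot> (?s \<cdot> g) \<boxplus> (?s \<cdot> c) \<odot> (?s \<cdot> c) = u" .
  qed (use g c gc posD[OF c(2)] in \<open>auto simp: cl star_simps mult_scale_left mult_scale_right\<close>)
  moreover have "0 < sqrt t" using t by simp
  ultimately have "anorm A g \<le> sqrt t" unfolding norm_scale_inverse[OF g(1) \<open>0 < sqrt t\<close>] by simp
  then have "(anorm A g)\<^sup>2 \<le> (sqrt t)\<^sup>2" using norm_nonneg[OF g(1)] by (intro power_mono) auto
  then show "anorm A h \<le> t" using norm_square[OF g(1,2)] t g(3) by simp
qed

text \<open>Since \<open>cc* + c*c\<close> is a sum of squares of self-adjoint elements, \<open>q = cc*\<close> is positive if
  \<open>c*c = -m\<close>. Comparing norms in \<open>c*q(1 - q)c = m\<^sup>2 + m\<^sup>3 \<ge> 2m\<^sup>3\<close> then yields \<open>m = 0\<close>.\<close>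

lemma negative_square_zero:
  assumes c: "c \<in> carrier A" and m: "pos m" and eq: "c\<^sup>\<star> \<odot> c = (- 1) \<cdot> m"
  shows "m = \<zero>\<^sub>v"
proof -
  have unit: False if c: "c \<in> carrier A" and m: "pos m" and eq: "c\<^sup>\<star> \<odot> c = (- 1) \<cdot> m" and m1: "anorm A m = 1" for c m
  proof -
    note mc = posD[OF m]
    \<comment> \<open>With x and y the real and imaginary parts of c, up to sign, cc* + c*c = 2(x^2
      + y^2). Since -c*c = m, this makes q positive.\<close>
    define q where "q = c \<odot> c\<^sup>\<star>"
    define x where "x = (1/2) \<cdot> (c \<boxplus> c\<^sup>\<star>)"
    define y where "y = (\<i>/2) \<cdot> vdiff A c (c\<^sup>\<star>)"
    have qc: "q \<in> carrier A" using c by (simp add: q_def cl)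
    have xy: "x \<in> carrier A" "x\<^sup>\<star> = x" "y \<in> carrier A"
      using c add_commute[of c "c\<^sup>\<star>"] by (simp_all add: x_def y_def cl star_simps)
    have "y\<^sup>\<star> = y"
      using lin.nc_identity[of "[c, c\<^sup>\<star>]" "(- (\<i>/2)) [.] (#1 [-] #0)" "(\<i>/2) [.] (#0 [-] #1)"] c
      by (simp add: y_def cl star_simps vdiff_def)
    then have px: "pos (x \<odot> x)" "pos (y \<odot> y)" using xy by (auto simp: pos_def)
    have "q = 2 \<cdot> (x \<odot> x \<boxplus> y \<odot> y) \<boxplus> (-1) \<cdot> (c\<^sup>\<star> \<odot> c)"
      using alg.nc_identity[of "[c, c\<^sup>\<star>]" "#0 [*] #1"
          "2 [.] ((1/2) [.] (#0 [+] #1) [*] (1/2) [.] (#0 [+] #1) [+] (\<i>/2) [.] (#0 [-] #1) [*] (\<i>/2) [.] (#0 [-] #1)) [+] (-1) [.] (#1 [*] #0)"] c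
      by (simp add: q_def x_def y_def cl vdiff_def)
    also have "\<dots> = 2 \<cdot> (x \<odot> x \<boxplus> y \<odot> y) \<boxplus> m"
      using mc by (simp add: eq scale_scale scale_one)
    finally have "pos q" using pos_add[OF pos_scale[OF pos_add[OF px], of 2] m] by simp
    have c2: "(anorm A c)\<^sup>2 = 1" using cstar_identity[OF c] norm_scale[OF mc(1), of "-1"] by (simp add: eq m1)
    then have c1: "anorm A c = 1" using norm_nonneg[OF c] by (simp add: power2_eq_1_iff)
    have q1: "anorm A q = 1" using cstar_identity[OF star_closed[OF c]] c by (simp add: q_def star_star norm_star c1)
    have "anorm A (c\<^sup>\<star> \<odot> (q \<odot> vdiff A u q) \<odot> c) \<le> (anorm A (c\<^sup>\<star>) * (anorm A q * anorm A (vdiff A u q))) * anorm A c"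
      using c qc norm_nonneg
      by (intro order_trans[OF norm_mult] mult_mono order_refl mult_nonneg_nonneg) (auto simp: ucl)
    also have "\<dots> \<le> 1" using pos_norm_one_minus[OF \<open>pos q\<close>] c by (simp add: norm_star c1 q1)
    finally have le: "anorm A (c\<^sup>\<star> \<odot> (q \<odot> vdiff A u q) \<odot> c) \<le> 1" .
    have "c\<^sup>\<star> \<odot> (q \<odot> vdiff A u q) \<odot> c =
        vdiff A ((c\<^sup>\<star> \<odot> c) \<odot> (c\<^sup>\<star> \<odot> c)) ((c\<^sup>\<star> \<odot> c) \<odot> (c\<^sup>\<star> \<odot> c) \<odot> (c\<^sup>\<star> \<odot> c))"
      using unit_identity[of "[c, c\<^sup>\<star>]" "#2 [*] (#1 [*] #2 [*] (#0 [-] #1 [*] #2)) [*] #1"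
          "(#2 [*] #1) [*] (#2 [*] #1) [-] (#2 [*] #1) [*] (#2 [*] #1) [*] (#2 [*] #1)"] c
      by (simp add: q_def cl vdiff_def nc_strip_def)
    also have "\<dots> = m \<odot> m \<boxplus> m \<odot> m \<odot> m"
      using alg.nc_identity[of "[m]" "(-1) [.] #0 [*] (-1) [.] #0 [-] (-1) [.] #0 [*] (-1) [.] #0 [*] (-1) [.] #0"
          "#0 [*] #0 [+] #0 [*] #0 [*] #0"] mc
      by (simp add: eq vdiff_def)
    finally have le: "anorm A (m \<odot> m \<boxplus> m \<odot> m \<odot> m) \<le> 1" using le by simp
    obtain w where w: "w \<in> carrier A" "w\<^sup>\<star> = w" "w \<odot> w = vdiff A u m" "m \<odot> w = w \<odot> m"
      using root_one_minus[OF mc] m1 mc by fastforce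
    \<comment> \<open>The square of wm is m^2 - m^3, so m^2 + m^3 = 2m^3 + (wm)^2 dominates 2m^3 in
      norm.\<close>
    have "(w \<odot> m) \<odot> (w \<odot> m) = (w \<odot> w) \<odot> (m \<odot> m)"
      by (rule commuting_square[OF w(1) mc(1) w(4)[symmetric]])
    also have "\<dots> = vdiff A (m \<odot> m) (m \<odot> m \<odot> m)"
      unfolding w(3) using mc by (simp add: mult_diff_left ucl u_left mult_assoc)
    finally have "pos (vdiff A (m \<odot> m) (m \<odot> m \<odot> m))"
      using w mc unfolding pos_def by (intro bexI[of _ "w \<odot> m"]) (simp_all add: cl star_simps)
    moreover obtain g where g: "g \<in> carrier A" "g\<^sup>\<star> = g" "m = g \<odot> g" using m by (auto simp: pos_def)
    have "pos (m \<odot> m \<odot> m)"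
      using g unfolding pos_def by (intro bexI[of _ "g \<odot> g \<odot> g"]) (simp_all add: cl star_simps mult_assoc)
    ultimately have "anorm A (2 \<cdot> (m \<odot> m \<odot> m)) \<le> anorm A (2 \<cdot> (m \<odot> m \<odot> m) \<boxplus> vdiff A (m \<odot> m) (m \<odot> m \<odot> m))"
      using pos_norm_mono[OF pos_scale[of "m \<odot> m \<odot> m" 2]] by simp
    also have "2 \<cdot> (m \<odot> m \<odot> m) \<boxplus> vdiff A (m \<odot> m) (m \<odot> m \<odot> m) = m \<odot> m \<boxplus> m \<odot> m \<odot> m"
      using alg.nc_identity[of "[m]" "2 [.] (#0 [*] #0 [*] #0) [+] (#0 [*] #0 [-] #0 [*] #0 [*] #0)" "#0 [*] #0 [+] #0 [*] #0 [*] #0"] mc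
      by (simp add: vdiff_def)
    finally have "2 * anorm A (m \<odot> m \<odot> m) \<le> 1" using le norm_scale[of "m \<odot> m \<odot> m" 2] mc by (simp add: cl)
    \<comment> \<open>The C*-identity computes norms of squares, not of cubes: norm(m^4) = 1, and
      norm(m^4) <= norm(m^3) norm(m).\<close>
    moreover have "1 \<le> anorm A (m \<odot> m \<odot> m)"
    proof -
      have m2: "anorm A (m \<odot> m) = 1" using norm_square[OF mc] m1 by simp
      then have "1 = anorm A ((m \<odot> m) \<odot> (m \<odot> m))" using norm_square[of "m \<odot> m"] mc by (simp add: cl star_simps)
      also have "\<dots> = anorm A ((m \<odot> m \<odot> m) \<odot> m)" using mc by (simp add: mult_assoc cl)
      also have "\<dots> \<le> anorm A (m \<odot> m \<odot> m) * anorm A m" using mc by (intro norm_mult cl)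
      finally show ?thesis using m1 by simp
    qed
    ultimately show False by simp
  qed
  note mc = posD[OF m]
  show ?thesis
  proof (rule ccontr)
    assume "m \<noteq> \<zero>\<^sub>v"
    then have t: "anorm A m > 0" using norm_eq_zero[OF mc(1)] norm_nonneg[OF mc(1)] by simp
    let ?t = "anorm A m"
    \<comment> \<open>Dividing c by the square root of norm(m) divides m by its norm, which reduces
      to the normalised case.\<close>
    let ?s = "complex_of_real (1 / sqrt ?t)"
    have st: "cnj ?s * ?s = complex_of_real (1 / ?t)" using t by (simp add: of_real_mult[symmetric] del: of_real_mult of_real_divide)
    have "(?s \<cdot> c)\<^sup>\<star> \<odot> (?s \<cdot> c) = (cnj ?s * ?s) \<cdot> (c\<^sup>\<star> \<odot> c)"
      using c by (simp add: star_simps mult_scale_left mult_scale_right scale_scale cl)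
    also have "\<dots> = (-1) \<cdot> (complex_of_real (1 / ?t) \<cdot> m)"
      unfolding eq st using mc by (simp add: scale_scale)
    finally have 1: "(?s \<cdot> c)\<^sup>\<star> \<odot> (?s \<cdot> c) = (-1) \<cdot> (complex_of_real (1 / ?t) \<cdot> m)" .
    have 2: "anorm A (complex_of_real (1 / ?t) \<cdot> m) = 1" using norm_scale_inverse[OF mc(1) t] t by simp
    have 3: "pos (complex_of_real (1 / ?t) \<cdot> m)" by (rule pos_scale[OF m]) (use t in simp)
    show False by (rule unit[OF scale_closed[OF c] 3 1 2])
  qed
qed

text \<open>Here \<open>z\<close> is twice the negative part \<open>|h| - h\<close> of \<open>h\<close>, and \<open>w\<^sup>2 = |h|z\<^sup>2\<close>.\<close>

lemma negative_part:
  assumes h: "h \<in> carrier A" "h\<^sup>\<star> = h"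
  shows "\<exists>z\<in>carrier A. \<exists>w\<in>carrier A. z\<^sup>\<star> = z \<and> w\<^sup>\<star> = w \<and> z \<odot> h \<odot> z = (-1) \<cdot> (w \<odot> w) \<and>
    (w \<odot> w = \<zero>\<^sub>v \<longrightarrow> pos h)"
proof -
  have "pos (h \<odot> h)" using h by (auto simp: pos_def)
  then obtain a where a: "a \<in> carrier A" "pos a" "a \<odot> a = h \<odot> h" "h \<odot> a = a \<odot> h"
    using pos_root[of "h \<odot> h"] h by (auto simp: mult_assoc)
  obtain r where r: "r \<in> carrier A" "pos r" "r \<odot> r = a" "h \<odot> r = r \<odot> h" "a \<odot> r = r \<odot> a"
    using pos_root[OF a(2)] h a by metis
  note as = posD(2)[OF a(2)] and rs = posD(2)[OF r(2)]
  let ?z = "vdiff A a h"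
  let ?w = "r \<odot> ?z"
  have zc: "?z \<in> carrier A" "?z\<^sup>\<star> = ?z" using a h as by (simp_all add: cl star_simps)
  have zr: "?z \<odot> r = r \<odot> ?z" using a h r by (simp add: mult_diff_left mult_diff_right)
  have ww: "?w \<odot> ?w = a \<odot> ?z \<odot> ?z"
    unfolding commuting_square[OF r(1) zc(1) zr[symmetric]] r(3) using a zc by (simp add: mult_assoc)
  have e1: "?z \<odot> h = vdiff A (a \<odot> h) (a \<odot> a)" using a(1) h(1) by (simp add: mult_diff_left a(3))
  have e2: "a \<odot> ?z = vdiff A (a \<odot> a) (a \<odot> h)" using a(1) h(1) by (simp add: mult_diff_right)
  have e3: "?z \<odot> ?z = vdiff A (vdiff A (a \<odot> a) (a \<odot> h)) (vdiff A (a \<odot> h) (a \<odot> a))"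
    using a(1) h(1) by (simp add: mult_diff_left mult_diff_right a(3,4) cl)
  \<comment> \<open>From a^2 = h^2 and ah = ha one has (a - h)h = -a(a - h) and (a - h)^2 = 2a(a -
    h).\<close>
  have zh: "?z \<odot> h = (-1) \<cdot> (a \<odot> ?z)"
    unfolding e1 e2
    using lin.nc_identity[of "[a \<odot> h, a \<odot> a]" "#0 [-] #1" "(-1) [.] (#1 [-] #0)"] a(1) h(1)
    by (simp add: cl vdiff_def)
  have zz: "?z \<odot> ?z = 2 \<cdot> (a \<odot> ?z)"
    unfolding e3 e2
    using lin.nc_identity[of "[a \<odot> h, a \<odot> a]" "(#1 [-] #0) [-] (#0 [-] #1)" "2 [.] (#1 [-] #0)"] a(1) h(1)
    by (simp add: cl vdiff_def)
  have "?z \<odot> h \<odot> ?z = (-1) \<cdot> (?w \<odot> ?w)"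
    unfolding ww zh using a zc by (simp add: mult_scale_left cl)
  moreover have "?w\<^sup>\<star> = ?w" using r rs zc zr by (simp add: star_simps)
  moreover have "pos h" if "?w \<odot> ?w = \<zero>\<^sub>v"
  proof -
    \<comment> \<open>Here z^3 = 2az^2 = 2w^2 = 0, so z^4 = 0, and two uses of the C*-identity give
      z = 0.\<close>
    have "?z \<odot> ?z \<odot> ?z = \<zero>\<^sub>v" using that a(1) zc unfolding ww zz by (simp add: mult_scale_left cl scale_zero_right)
    then have "(?z \<odot> ?z) \<odot> (?z \<odot> ?z) = \<zero>\<^sub>v" using zc by (simp add: mult_assoc[symmetric] mult_zero cl)
    then have "anorm A (?z \<odot> ?z) = 0" using norm_square[of "?z \<odot> ?z"] zc by (simp add: star_simps cl nv.nrm_zero)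
    then have "?z = \<zero>\<^sub>v" using norm_square[OF zc] norm_eq_zero[OF zc(1)] by simp
    then show ?thesis using diff_eq_zero a h by metis
  qed
  ultimately show ?thesis using r zc by (meson cl(1))
qed

text \<open>With z and w from the negative part of b*b, the element c = bz satisfies c*c = -w^2,
  which \<open>negative_square_zero\<close> allows only for w^2 = 0.\<close>

theorem star_mult_pos: assumes b: "b \<in> carrier A" shows "pos (b\<^sup>\<star> \<odot> b)"
proof -
  obtain z w where z: "z \<in> carrier A" "z\<^sup>\<star> = z" and w: "w \<in> carrier A" "w\<^sup>\<star> = w"
    and eq: "z \<odot> (b\<^sup>\<star> \<odot> b) \<odot> z = (-1) \<cdot> (w \<odot> w)" and p: "w \<odot> w = \<zero>\<^sub>v \<longrightarrow> pos (b\<^sup>\<star> \<odot> b)"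
    using negative_part[of "b\<^sup>\<star> \<odot> b"] b by (auto simp: cl star_simps)
  have "(b \<odot> z)\<^sup>\<star> \<odot> (b \<odot> z) = (-1) \<cdot> (w \<odot> w)"
    using b z eq by (simp add: star_simps cl mult_assoc)
  moreover have "pos (w \<odot> w)" using w by (auto simp: pos_def)
  ultimately have "w \<odot> w = \<zero>\<^sub>v" using negative_square_zero[of "b \<odot> z"] b z by (simp add: cl)
  then show ?thesis using p by blast
qed

section \<open>Commuting products and approximate units\<close>

lemma pos_mult:
  assumes a: "pos a" and b: "pos b" and comm: "a \<odot> b = b \<odot> a"
  shows "pos (a \<odot> b)"
proof -
  note ac = posD[OF a] and bc = posD[OF b]
  obtain c where c: "c \<in> carrier A" "pos c" "c \<odot> c = a" "b \<odot> c = c \<odot> b"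
    using pos_root[OF a] bc comm by metis
  obtain d where d: "d \<in> carrier A" "pos d" "d \<odot> d = b" "c \<odot> d = d \<odot> c"
    using pos_root[OF b] c by metis
  have "(c \<odot> d) \<odot> (c \<odot> d) = a \<odot> b"
    unfolding commuting_square[OF c(1) d(1,4)] c(3) d(3) ..
  then show ?thesis
    unfolding pos_def using c d posD[OF c(2)] posD[OF d(2)]
    by (intro bexI[of _ "c \<odot> d"]) (simp_all add: star_simps cl)
qed

text \<open>With \<open>k = 1 - h\<close>, the average \<open>M\<close> of \<open>1, k, \<dots>, k\<^sup>n\<^sup>-\<^sup>1\<close> satisfies \<open>hM = (1 - k\<^sup>n)/n\<close>, and \<open>1 - M\<close> is
  \<open>h\<close> times a positive polynomial in \<open>k\<close>, of which \<open>w\<close> is the square root.\<close>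

lemma approximate_unit:
  assumes h: "pos h" "anorm A h \<le> 1" and e: "0 < e"
  shows "\<exists>w\<in>carrier A. w\<^sup>\<star> = w \<and>
    anorm A (vdiff A u (w \<odot> h \<odot> w) \<odot> h \<odot> vdiff A u (w \<odot> h \<odot> w)) \<le> e"
proof -
  note hc = posD[OF h(1)]
  define k where "k = vdiff A u h"
  have kc: "k \<in> carrier A" "k\<^sup>\<star> = k" using hc by (simp_all add: k_def ucl star_simps u_star)
  have k1: "anorm A k \<le> 1" unfolding k_def by (rule pos_norm_one_minus[OF h])
  have uk: "vdiff A u k = h"
    using unit_identity[of "[h]" "#0 [-] (#0 [-] #1)" "#1"] hc by (simp add: k_def vdiff_def nc_strip_def)
  then have kp: "pos k" using posI[OF kc] h(2) by simp
  \<comment> \<open>\<open>p n\<close> is the n-th power of k, \<open>s n\<close> the sum of the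
    powers below n, and \<open>r n\<close> the sum of the \<open>s i\<close> for i < n. Telescoping
    twice gives h times \<open>s n\<close> = 1 - k^n and h times \<open>r n\<close> = n -
    \<open>s n\<close>.\<close>
  define p where "p = rec_nat u (\<lambda>_ x. k \<odot> x)"
  have p0: "p 0 = u" and pS: "p (Suc n) = k \<odot> p n" for n by (simp_all add: p_def)
  define s where "s = rec_nat \<zero>\<^sub>v (\<lambda>n x. x \<boxplus> p n)"
  have s0: "s 0 = \<zero>\<^sub>v" and sS: "s (Suc n) = s n \<boxplus> p n" for n by (simp_all add: s_def)
  define r where "r = rec_nat \<zero>\<^sub>v (\<lambda>n x. x \<boxplus> s n)"
  have r0: "r 0 = \<zero>\<^sub>v" and rS: "r (Suc n) = r n \<boxplus> s n" for n by (simp_all add: r_def)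
  have pc: "p n \<in> carrier A" for n by (induction n) (simp_all add: p0 pS kc ucl)
  have sc: "s n \<in> carrier A" for n by (induction n) (simp_all add: s0 sS pc cl)
  have rc: "r n \<in> carrier A" for n by (induction n) (simp_all add: r0 rS sc cl)
  have kp_comm: "k \<odot> p n = p n \<odot> k" for n
  proof (induction n)
    case (Suc n)
    have "k \<odot> p (Suc n) = k \<odot> (p n \<odot> k)" unfolding pS by (simp only: Suc)
    also have "\<dots> = p (Suc n) \<odot> k" using kc pc by (simp add: pS mult_assoc)
    finally show ?case .
  qed (simp add: p0 kc u_left u_right)
  have pp: "pos (p n) \<and> anorm A (p n) \<le> 1" for n
  proof (induction n)
    case 0
    have "pos u" unfolding pos_def using u_closed u_star u_left by (intro bexI[of _ u]) auto
    then show ?case by (simp add: p0 norm_u_le)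
  next
    case (Suc n)
    then have "anorm A k * anorm A (p n) \<le> 1"
      using k1 norm_nonneg[OF kc(1)] norm_nonneg[OF pc[of n]] by (simp add: mult_le_one)
    then show ?case using Suc pos_mult[OF kp _ kp_comm] norm_mult[OF kc(1) pc[of n]] by (simp add: pS)
  qed
  have sp: "pos (s n)" for n by (induction n) (use pp pos_add pos_zero in \<open>auto simp: s0 sS\<close>)
  have rp: "pos (r n)" for n by (induction n) (use sp pos_add pos_zero in \<open>auto simp: r0 rS\<close>)
  have sn: "anorm A (s n) \<le> real n" for n
  proof (induction n)
    case (Suc n)
    then show ?case using norm_triangle[OF sc[of n] pc[of n]] pp[of n] by (simp add: sS)
  qed (simp add: s0 nv.nrm_zero)
  have hp: "h \<odot> p n = vdiff A (p n) (p (Suc n))" for n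
    unfolding uk[symmetric] using pc kc by (simp add: mult_diff_left ucl u_left pS)
  have ph: "p n \<odot> h = h \<odot> p n" for n
    unfolding hp unfolding uk[symmetric] using pc kc by (simp add: mult_diff_right ucl u_right pS kp_comm)
  have hs: "h \<odot> s n = vdiff A u (p n)" and sh: "s n \<odot> h = h \<odot> s n" for n
  proof (induction n)
    case 0
    case 1 show ?case using hc by (simp add: s0 p0 mult_zero diff_self u_closed)
    case 2 show ?case using hc by (simp add: s0 mult_zero)
  next
    case (Suc n)
    case 1 show ?case
      using lin.nc_identity[of "[u, p n, p (Suc n)]" "(#0 [-] #1) [+] (#1 [-] #2)" "#0 [-] #2"] Suc hc sc pc u_closed
      by (simp add: sS mult_add_right hp) (simp add: vdiff_def)
    case 2 show ?case using Suc hc sc pc by (simp add: sS mult_add_right mult_add_left ph)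
  qed
  have hr: "h \<odot> r n = vdiff A (complex_of_nat n \<cdot> u) (s n)" and rh: "r n \<odot> h = h \<odot> r n" for n
  proof (induction n)
    case 0
    case 1 show ?case using hc u_closed by (simp add: r0 s0 mult_zero diff_self scale_zero_left cl)
    case 2 show ?case using hc by (simp add: r0 mult_zero)
  next
    case (Suc n)
    case 1 show ?case
      using lin.nc_identity[of "[u, s n, p n]" "(complex_of_nat n [.] #0 [-] #1) [+] (#0 [-] #2)" "complex_of_nat (Suc n) [.] #0 [-] (#1 [+] #2)"] Suc hc sc rc pc u_closed
      by (simp add: rS sS mult_add_right hs) (simp add: vdiff_def)
    case 2 show ?case using Suc hc sc rc by (simp add: rS mult_add_right mult_add_left sh)
  qed
  \<comment> \<open>The quantity to be made small is norm(hM) = norm(1 - k^n)/n <= 2/n.\<close>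
  obtain n where n: "0 < n" "2 / real n \<le> e"
  proof -
    obtain m where m: "2 / e < real m" using reals_Archimedean2 by blast
    then have "0 < real m" using e by (smt (verit) divide_pos_pos)
    then show ?thesis using that[of m] m e by (simp add: field_simps)
  qed
  let ?t = "complex_of_real (1 / real n)"
  have tn: "?t * complex_of_nat n = 1" using n by simp
  have qp: "pos (?t \<cdot> r n)" by (rule pos_scale[OF rp]) (use n in simp)
  \<comment> \<open>As the root of \<open>r n\<close> divided by n, w satisfies whw = 1 - M for the
    contraction M, which is \<open>s n\<close> divided by n.\<close>
  obtain w where w: "w \<in> carrier A" "pos w" "w \<odot> w = ?t \<cdot> r n" "h \<odot> w = w \<odot> h"
    using pos_root[OF qp] hc rc[of n] rh[of n] by (auto simp: mult_scale_left mult_scale_right)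
  let ?M = "?t \<cdot> s n"
  have "w \<odot> h \<odot> w = h \<odot> (w \<odot> w)" using mult_assoc[OF hc(1) w(1) w(1)] by (simp only: w(4))
  also have "\<dots> = ?t \<cdot> vdiff A (complex_of_nat n \<cdot> u) (s n)" unfolding w(3) using hc rc by (simp add: mult_scale_right hr)
  also have "\<dots> = vdiff A u ?M"
    using lin.nc_identity[of "[u, s n]" "?t [.] (complex_of_nat n [.] #0 [-] #1)" "#0 [-] ?t [.] #1"] sc u_closed tn
    by (simp add: vdiff_def)
  finally have "vdiff A u (w \<odot> h \<odot> w) = ?M"
    using lin.nc_identity[of "[u, ?M]" "#0 [-] (#0 [-] #1)" "#1"] sc u_closed by (simp add: vdiff_def cl)
  moreover have "anorm A (?M \<odot> h \<odot> ?M) \<le> e"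
  proof -
    have M1: "anorm A ?M \<le> 1" using norm_scale_inverse[OF sc[of n], of "real n"] sn[of n] n by simp
    have "anorm A (h \<odot> ?M) = anorm A (vdiff A u (p n)) / real n"
      using norm_scale_inverse[of "vdiff A u (p n)" "real n"] n hc sc pc by (simp add: mult_scale_right hs ucl)
    also have "\<dots> \<le> 2 / real n"
      using nv.nrm_diff_le[OF u_closed pc[of n]] norm_u_le pp[of n] n by (intro divide_right_mono) auto
    finally have hM: "anorm A (h \<odot> ?M) \<le> e" using n by simp
    have "anorm A (?M \<odot> h \<odot> ?M) \<le> anorm A ?M * anorm A (h \<odot> ?M)"
      using norm_mult[of ?M "h \<odot> ?M"] sc hc by (simp add: mult_assoc cl)
    also have "\<dots> \<le> 1 * e" using M1 hM norm_nonneg sc hc e by (intro mult_mono) (auto simp: cl)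
    finally show ?thesis by simp
  qed
  ultimately show ?thesis using w posD[OF w(2)] by auto
qed

end

section \<open>Adjointable operators\<close>

lemma hdist_eq: "hdist A X = ndist X (hnorm A X)"
  by (auto simp: hdist_def ndist_def fun_eq_iff)

context hilbert_module begin

lemma inner_add_left:
  assumes "x \<in> carrier X" "y \<in> carrier X" "z \<in> carrier X"
  shows "hinner X (x \<boxplus>\<^bsub>X\<^esub> y) z = hinner X x z \<boxplus>\<^bsub>A\<^esub> hinner X y z"
  using inner_star[of z "x \<boxplus>\<^bsub>X\<^esub> y"] inner_add_right[of z x y] assms
  by (simp add: A.star_add inner_star inner_closed add_closed)

lemma inner_scale_left:
  assumes "x \<in> carrier X" "y \<in> carrier X"
  shows "hinner X (c \<cdot>\<^bsub>X\<^esub> x) y = cnj c \<cdot>\<^bsub>A\<^esub> hinner X x y"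
  using inner_star[of y "c \<cdot>\<^bsub>X\<^esub> x"] inner_scale_right[of y x c] assms
  by (simp add: A.star_scale inner_star inner_closed scale_closed)

lemma inner_ract_left:
  assumes "x \<in> carrier X" "y \<in> carrier X" "a \<in> carrier A"
  shows "hinner X (ract X x a) y = a\<^sup>\<star>\<^bsub>A\<^esub> \<odot>\<^bsub>A\<^esub> hinner X x y"
  using inner_star[of y "ract X x a"] inner_ract_right[of y x a] assms
  by (simp add: A.star_mult inner_star inner_closed ract_closed)

lemma inner_diff_right: "x \<in> carrier X \<Longrightarrow> y \<in> carrier X \<Longrightarrow> z \<in> carrier X \<Longrightarrow>
    hinner X x (vdiff X y z) = vdiff A (hinner X x y) (hinner X x z)"
  by (simp add: vdiff_def inner_add_right inner_scale_right scale_closed)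

lemma inner_diff_left: "x \<in> carrier X \<Longrightarrow> y \<in> carrier X \<Longrightarrow> z \<in> carrier X \<Longrightarrow>
    hinner X (vdiff X y z) x = vdiff A (hinner X y x) (hinner X z x)"
  by (simp add: vdiff_def inner_add_left inner_scale_left scale_closed)

lemma inner_zero: "x \<in> carrier X \<Longrightarrow> hinner X x \<zero>\<^sub>v\<^bsub>X\<^esub> = \<zero>\<^sub>v\<^bsub>A\<^esub>"
  "x \<in> carrier X \<Longrightarrow> hinner X \<zero>\<^sub>v\<^bsub>X\<^esub> x = \<zero>\<^sub>v\<^bsub>A\<^esub>"
  using inner_scale_right[of x "\<zero>\<^sub>v\<^bsub>X\<^esub>" 0] inner_scale_left[of "\<zero>\<^sub>v\<^bsub>X\<^esub>" x 0]
  by (simp_all add: zero_closed inner_closed A.scale_zero_left scale_zero_left)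

lemma inner_eqI:
  assumes "x \<in> carrier X" "x' \<in> carrier X" "\<And>y. y \<in> carrier X \<Longrightarrow> hinner X y x = hinner X y x'"
  shows "x = x'"
proof -
  have "hinner X (vdiff X x x') (vdiff X x x') = \<zero>\<^sub>v\<^bsub>A\<^esub>"
    using assms by (simp add: inner_diff_right diff_closed A.diff_self inner_closed)
  then show ?thesis using inner_definite diff_eq_zero diff_closed assms by metis
qed

lemma hnorm_nonneg: "0 \<le> hnorm A X x" if "x \<in> carrier X"
  using A.norm_nonneg[OF inner_closed[OF that that]] by (simp add: hnorm_def)

lemma hnorm_square: "x \<in> carrier X \<Longrightarrow> (hnorm A X x)\<^sup>2 = anorm A (hinner X x x)"
  using A.norm_nonneg[OF inner_closed] by (simp add: hnorm_def)

end

lemma self_bimodule_simps: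
  "carrier (self_bimodule A) = carrier A" "vadd (self_bimodule A) = vadd A"
  "vzero (self_bimodule A) = vzero A" "vscale (self_bimodule A) = vscale A"
  "ract (self_bimodule A) = amult A" "hinner (self_bimodule A) = (\<lambda>a b. a\<^sup>\<star>\<^bsub>A\<^esub> \<odot>\<^bsub>A\<^esub> b)"
  "lact (self_bimodule A) = amult A" "vdiff (self_bimodule A) = vdiff A"
  by (simp_all add: self_bimodule_def vdiff_def fun_eq_iff)

text \<open>Every Hilbert module satisfies the Cauchy-Schwarz inequality. It is an assumption here because its
  proof uses the adjointable operators on \<open>A\<close> itself, where the inequality is obvious.\<close>

locale hilbert_cs = hilbert_module A X
  for A :: "'a cstar" and X :: "('a, 'x) hbimod" +
  assumes cauchy_schwarz: "x \<in> carrier X \<Longrightarrow> y \<in> carrier X \<Longrightarrow>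
    anorm A (hinner X x y) \<le> hnorm A X x * hnorm A X y"
begin

lemma cnormed_hnorm: "cnormed X (hnorm A X)"
proof (intro cnormed.intro cnormed_axioms.intro)
  show "cvector_space X" ..
  fix x y and z :: complex assume x: "x \<in> carrier X"
  then show "0 \<le> hnorm A X x" by (rule hnorm_nonneg)
  show "hnorm A X x = 0 \<longleftrightarrow> x = \<zero>\<^sub>v\<^bsub>X\<^esub>"
    using x inner_definite inner_zero A.norm_eq_zero[OF inner_closed[OF x x]] by (auto simp: hnorm_def)
  have "hinner X (z \<cdot>\<^bsub>X\<^esub> x) (z \<cdot>\<^bsub>X\<^esub> x) = (cnj z * z) \<cdot>\<^bsub>A\<^esub> hinner X x x"
    using x by (simp add: inner_scale_left inner_scale_right A.scale_scale inner_closed scale_closed mult.commute)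
  then show "hnorm A X (z \<cdot>\<^bsub>X\<^esub> x) = cmod z * hnorm A X x"
    using x by (simp add: hnorm_def A.norm_scale inner_closed real_sqrt_mult norm_mult)
  assume y: "y \<in> carrier X"
  have "(hnorm A X (x \<boxplus>\<^bsub>X\<^esub> y))\<^sup>2 =
      anorm A ((hinner X x x \<boxplus>\<^bsub>A\<^esub> hinner X y x) \<boxplus>\<^bsub>A\<^esub> (hinner X x y \<boxplus>\<^bsub>A\<^esub> hinner X y y))"
    using x y by (simp add: hnorm_square add_closed inner_add_left inner_add_right)
  also have "\<dots> \<le> (anorm A (hinner X x x) + anorm A (hinner X y x)) + (anorm A (hinner X x y) + anorm A (hinner X y y))"
    using x y by (intro order_trans[OF A.norm_triangle] add_mono A.norm_triangle A.add_closed inner_closed)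
  also have "\<dots> \<le> (hnorm A X x + hnorm A X y)\<^sup>2"
    using cauchy_schwarz[OF x y] cauchy_schwarz[OF y x] hnorm_square[OF x] hnorm_square[OF y]
    by (simp add: power2_eq_square algebra_simps)
  finally show "hnorm A X (x \<boxplus>\<^bsub>X\<^esub> y) \<le> hnorm A X x + hnorm A X y"
    by (rule power2_le_imp_le) (use hnorm_nonneg[OF x] hnorm_nonneg[OF y] in simp)
qed

end

sublocale hilbert_cs \<subseteq> hn: cbanach X "hnorm A X"
  using cnormed_hnorm complete by (simp add: cbanach_def cbanach_axioms_def hdist_eq)

context hilbert_cs begin

abbreviation L :: "('x \<Rightarrow> 'x) cstar" where "L \<equiv> adjointables A X"

lemma inner_conv:
  assumes "hn.conv s x" "hn.conv t y"
  shows "A.nv.conv (\<lambda>n. hinner X (s n) (t n)) (hinner X x y)"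
proof (rule A.nv.convI_bound)
  have c: "x \<in> carrier X" "y \<in> carrier X" "\<And>n. s n \<in> carrier X" "\<And>n. t n \<in> carrier X"
    using assms by (auto simp: hn.conv_def)
  show "hinner X (s n) (t n) \<in> carrier A" "hinner X x y \<in> carrier A" for n using c by (simp_all add: inner_closed)
  show "anorm A (vdiff A (hinner X (s n) (t n)) (hinner X x y)) \<le>
      hnorm A X (s n) * hnorm A X (vdiff X (t n) y) + hnorm A X (vdiff X (s n) x) * hnorm A X y" for n
  proof -
    have "vdiff A (hinner X (s n) (t n)) (hinner X x y) =
        hinner X (s n) (vdiff X (t n) y) \<boxplus>\<^bsub>A\<^esub> hinner X (vdiff X (s n) x) y"
      using A.lin.nc_identity[of "[hinner X (s n) (t n), hinner X (s n) y, hinner X x y]"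
          "#0 [-] #2" "(#0 [-] #1) [+] (#1 [-] #2)"] c
      by (simp add: inner_diff_left inner_diff_right inner_closed) (simp add: vdiff_def)
    then show ?thesis
      using A.norm_triangle[of "hinner X (s n) (vdiff X (t n) y)" "hinner X (vdiff X (s n) x) y"]
        cauchy_schwarz[of "s n" "vdiff X (t n) y"] cauchy_schwarz[of "vdiff X (s n) x" y] c
      by (simp add: inner_closed diff_closed)
  qed
  have "(\<lambda>n. hnorm A X (s n) * hnorm A X (vdiff X (t n) y) + hnorm A X (vdiff X (s n) x) * hnorm A X y) \<longlonglongrightarrow>
      hnorm A X x * 0 + 0 * hnorm A X y"
    using assms hn.conv_norm[OF assms(1)] unfolding hn.conv_def
    by (intro tendsto_add tendsto_mult tendsto_const) auto
  then show "(\<lambda>n. hnorm A X (s n) * hnorm A X (vdiff X (t n) y) + hnorm A X (vdiff X (s n) x) * hnorm A X y) \<longlonglongrightarrow> 0"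
    by simp
qed

text \<open>Converse of the Cauchy-Schwarz bound, tested at y = v/norm(v). It lets bounds on inner
  products control vectors, as \<open>L_bounded\<close> requires.\<close>

lemma hnorm_le_dual:
  assumes v: "v \<in> carrier X" and C: "\<And>y. y \<in> carrier X \<Longrightarrow> hnorm A X y \<le> 1 \<Longrightarrow> anorm A (hinner X y v) \<le> C"
  shows "hnorm A X v \<le> C"
proof (cases "hnorm A X v = 0")
  case True
  then show ?thesis
    using C[of v] A.norm_nonneg[OF inner_closed[OF v v]] v by simp
next
  case False
  let ?t = "hnorm A X v"
  have t: "?t > 0" using False hnorm_nonneg[OF v] by simp
  let ?y = "complex_of_real (1 / ?t) \<cdot>\<^bsub>X\<^esub> v"
  have "anorm A (hinner X ?y v) \<le> C"
    using v t by (intro C) (simp_all add: scale_closed hn.nrm_scale norm_divide)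
  then have "anorm A (hinner X v v) / ?t \<le> C"
    using v t by (simp add: inner_scale_left A.norm_scale inner_closed norm_divide)
  then show ?thesis using t hnorm_square[OF v] by (simp add: power2_eq_square flip: hnorm_square[OF v])
qed

section \<open>The algebra of adjointable operators\<close>

lemma L_simps:
  "carrier L = {T \<in> carrier X \<rightarrow>\<^sub>E carrier X. \<exists>S \<in> carrier X \<rightarrow>\<^sub>E carrier X. is_adjoint X T S}"
  "vadd L S T = (\<lambda>x\<in>carrier X. S x \<boxplus>\<^bsub>X\<^esub> T x)"
  "vzero L = (\<lambda>x\<in>carrier X. \<zero>\<^sub>v\<^bsub>X\<^esub>)"
  "vscale L c T = (\<lambda>x\<in>carrier X. c \<cdot>\<^bsub>X\<^esub> T x)"
  "amult L S T = (\<lambda>x\<in>carrier X. S (T x))"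
  "astar L T = (THE S. S \<in> carrier X \<rightarrow>\<^sub>E carrier X \<and> is_adjoint X T S)"
  "anorm L T = Sup {hnorm A X (T x) | x. x \<in> carrier X \<and> hnorm A X x \<le> 1}"
  by (simp_all add: adjointables_def)

lemma L_apply:
  assumes "x \<in> carrier X"
  shows "vadd L S T x = S x \<boxplus>\<^bsub>X\<^esub> T x" "vzero L x = \<zero>\<^sub>v\<^bsub>X\<^esub>" "vscale L c T x = c \<cdot>\<^bsub>X\<^esub> T x"
    "amult L S T x = S (T x)" "vdiff L S T x = vdiff X (S x) (T x)"
  using assms by (simp_all add: L_simps vdiff_def)

lemma L_closed: "T \<in> carrier L \<Longrightarrow> x \<in> carrier X \<Longrightarrow> T x \<in> carrier X"
  by (auto simp: L_simps)

lemma L_ext: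
  assumes "S \<in> carrier X \<rightarrow>\<^sub>E carrier X" "T \<in> carrier X \<rightarrow>\<^sub>E carrier X" "\<And>x. x \<in> carrier X \<Longrightarrow> S x = T x"
  shows "S = T"
  using assms by (rule PiE_ext)

lemma L_PiE: "T \<in> carrier L \<Longrightarrow> T \<in> carrier X \<rightarrow>\<^sub>E carrier X"
  by (simp add: L_simps)

lemma is_adjoint_sym:
  assumes "is_adjoint X T S" "T \<in> carrier X \<rightarrow>\<^sub>E carrier X" "S \<in> carrier X \<rightarrow>\<^sub>E carrier X"
  shows "is_adjoint X S T"
  unfolding is_adjoint_def
proof (intro ballI)
  fix x y assume x: "x \<in> carrier X" and y: "y \<in> carrier X"
  have m: "T y \<in> carrier X" "S x \<in> carrier X" using assms x y by auto
  have "hinner X (S x) y = (hinner X y (S x))\<^sup>\<star>\<^bsub>A\<^esub>" using inner_star y m by simp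
  also have "\<dots> = (hinner X (T y) x)\<^sup>\<star>\<^bsub>A\<^esub>" using assms(1) x y by (simp add: is_adjoint_def)
  also have "\<dots> = hinner X x (T y)" using inner_star x m by simp
  finally show "hinner X (S x) y = hinner X x (T y)" .
qed

lemma adjoint_unique:
  assumes "is_adjoint X T S" "is_adjoint X T S'" "T \<in> carrier X \<rightarrow>\<^sub>E carrier X"
    "S \<in> carrier X \<rightarrow>\<^sub>E carrier X" "S' \<in> carrier X \<rightarrow>\<^sub>E carrier X"
  shows "S = S'"
proof (rule L_ext[OF assms(4,5)])
  fix x assume x: "x \<in> carrier X"
  show "S x = S' x"
  proof (rule inner_eqI)
    show "S x \<in> carrier X" "S' x \<in> carrier X" using assms x by auto
    show "hinner X y (S x) = hinner X y (S' x)" if "y \<in> carrier X" for y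
      using assms(1,2) x that unfolding is_adjoint_def by metis
  qed
qed

lemma L_I:
  assumes "is_adjoint X T S" "T \<in> carrier X \<rightarrow>\<^sub>E carrier X" "S \<in> carrier X \<rightarrow>\<^sub>E carrier X"
  shows "T \<in> carrier L" "astar L T = S"
proof -
  show "T \<in> carrier L" using assms by (auto simp: L_simps)
  show "astar L T = S"
    unfolding L_simps using assms adjoint_unique by (intro the_equality) auto
qed

lemma L_star:
  assumes "T \<in> carrier L"
  shows "is_adjoint X T (astar L T)" "astar L T \<in> carrier L"
proof -
  obtain S where S: "S \<in> carrier X \<rightarrow>\<^sub>E carrier X" "is_adjoint X T S" using assms by (auto simp: L_simps)
  then show "is_adjoint X T (astar L T)" "astar L T \<in> carrier L"
    using L_I[OF S(2) L_PiE[OF assms] S(1)] L_I(1)[OF is_adjoint_sym[OF S(2) L_PiE[OF assms] S(1)] S(1) L_PiE[OF assms]] by auto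
qed

lemma inner_adjoint_left: "T \<in> carrier L \<Longrightarrow> x \<in> carrier X \<Longrightarrow> y \<in> carrier X \<Longrightarrow>
    hinner X (T x) y = hinner X x (astar L T y)"
  using L_star(1) unfolding is_adjoint_def by blast

lemma inner_adjoint_right: "T \<in> carrier L \<Longrightarrow> x \<in> carrier X \<Longrightarrow> y \<in> carrier X \<Longrightarrow>
    hinner X x (T y) = hinner X (astar L T x) y"
  using is_adjoint_sym[OF L_star(1) L_PiE L_PiE[OF L_star(2)]] unfolding is_adjoint_def by simp

text \<open>The carrier of \<open>adjointables\<close> does not ask for linearity; it follows by
  moving T across the inner product, which is linear in its second argument.\<close>

lemma L_linear:
  assumes T: "T \<in> carrier L" and x: "x \<in> carrier X"
  shows "y \<in> carrier X \<Longrightarrow> T (x \<boxplus>\<^bsub>X\<^esub> y) = T x \<boxplus>\<^bsub>X\<^esub> T y"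
    and "T (c \<cdot>\<^bsub>X\<^esub> x) = c \<cdot>\<^bsub>X\<^esub> T x"
    and "a \<in> carrier A \<Longrightarrow> T (ract X x a) = ract X (T x) a"
proof -
  note c = x L_closed[OF T] L_closed[OF L_star(2)[OF T]]
  note adj = inner_adjoint_right[OF T]
  show "T (x \<boxplus>\<^bsub>X\<^esub> y) = T x \<boxplus>\<^bsub>X\<^esub> T y" if "y \<in> carrier X"
    by (rule inner_eqI) (use c that in \<open>simp_all add: adj add_closed inner_add_right\<close>)
  show "T (c \<cdot>\<^bsub>X\<^esub> x) = c \<cdot>\<^bsub>X\<^esub> T x"
    by (rule inner_eqI) (use c in \<open>simp_all add: adj scale_closed inner_scale_right\<close>)
  show "T (ract X x a) = ract X (T x) a" if "a \<in> carrier A"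
    by (rule inner_eqI) (use c that in \<open>simp_all add: adj ract_closed inner_ract_right\<close>)
qed

lemma L_zero: "T \<in> carrier L \<Longrightarrow> T \<zero>\<^sub>v\<^bsub>X\<^esub> = \<zero>\<^sub>v\<^bsub>X\<^esub>"
proof -
  assume T: "T \<in> carrier L"
  have "T (0 \<cdot>\<^bsub>X\<^esub> \<zero>\<^sub>v\<^bsub>X\<^esub>) = 0 \<cdot>\<^bsub>X\<^esub> T \<zero>\<^sub>v\<^bsub>X\<^esub>" by (rule L_linear(2)[OF T zero_closed])
  then show ?thesis
    by (simp only: scale_zero_left[OF zero_closed] scale_zero_left[OF L_closed[OF T zero_closed]])
qed

text \<open>Uniform boundedness, by Baire's theorem applied to the sets where \<open>\<langle>T*y, x\<rangle>\<close> is bounded by \<open>n\<close>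
  for all \<open>y\<close> in the unit ball.\<close>

lemma L_bounded:
  assumes T: "T \<in> carrier L"
  shows "\<exists>C\<ge>0. \<forall>x\<in>carrier X. hnorm A X (T x) \<le> C * hnorm A X x"
proof -
  let ?S = "astar L T"
  define E where "E n = {x \<in> carrier X. \<forall>y\<in>carrier X. hnorm A X y \<le> 1 \<longrightarrow> anorm A (hinner X (?S y) x) \<le> real n}" for n
  note S = L_star(2)[OF T]
  have sub: "E n \<subseteq> carrier X" for n by (auto simp: E_def)
  have cl: "closedin hn.ntop (E n)" for n
  proof -
    have "hn.nclosed (E n)"
    proof (rule hn.nclosedI[OF sub])
      fix s x assume s: "\<And>k. s k \<in> E n" and x: "hn.conv s x"
      have "anorm A (hinner X (?S y) x) \<le> real n" if y: "y \<in> carrier X" "hnorm A X y \<le> 1" for y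
      proof (rule LIMSEQ_le_const2)
        show "(\<lambda>k. anorm A (hinner X (?S y) (s k))) \<longlonglongrightarrow> anorm A (hinner X (?S y) x)"
          by (intro A.nv.conv_norm inner_conv hn.conv_const x L_closed[OF S] y)
        show "\<exists>N. \<forall>k\<ge>N. anorm A (hinner X (?S y) (s k)) \<le> real n" using s y by (auto simp: E_def)
      qed
      then show "x \<in> E n" using x by (simp add: E_def hn.conv_def)
    qed
    then have "hn.nclosure (E n) \<subseteq> E n" using hn.closure_minimal[OF order_refl sub] by blast
    then show ?thesis
      using sub closure_of_subset_eq[of "E n" hn.ntop] Metric_space.topspace_mtopology[OF hn.Metric_space_ndist]
      by simp
  qed
  have "\<exists>n. hn.ntop interior_of (E n) \<noteq> {}"
  proof (rule ccontr)
    assume "\<nexists>n. hn.ntop interior_of (E n) \<noteq> {}"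
    then have "hn.ntop interior_of (\<Union>(range E)) = {}"
      using cl by (intro Metric_space.metric_Baire_category_alt[OF hn.Metric_space_ndist hn.mcomplete_ndist]) auto
    \<comment> \<open>Since <T*y, x> = <y, Tx>, any n above norm(Tx) bounds this inner product on
      the unit ball.\<close>
    moreover have "\<Union>(range E) = carrier X"
    proof (intro subset_antisym subsetI)
      fix x assume x: "x \<in> carrier X"
      obtain n where n: "hnorm A X (T x) \<le> real n" using real_arch_simple by blast
      have "anorm A (hinner X (?S y) x) \<le> real n" if y: "y \<in> carrier X" "hnorm A X y \<le> 1" for y
      proof -
        have "anorm A (hinner X (?S y) x) = anorm A (hinner X y (T x))" using inner_adjoint_right[OF T y(1) x] by simp
        also have "\<dots> \<le> hnorm A X y * hnorm A X (T x)" using cauchy_schwarz y x L_closed[OF T] by simp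
        also have "\<dots> \<le> 1 * real n" using y n hnorm_nonneg x L_closed[OF T] by (intro mult_mono) auto
        finally show ?thesis by simp
      qed
      then show "x \<in> \<Union>(range E)" using x by (auto simp: E_def)
    qed (use sub in auto)
    ultimately show False
      using zero_closed interior_of_topspace[of hn.ntop] Metric_space.topspace_mtopology[OF hn.Metric_space_ndist]
      by auto
  qed
  then obtain n x0 r where r: "0 < r" "x0 \<in> carrier X"
      and ball: "\<And>x. x \<in> carrier X \<Longrightarrow> ndist X (hnorm A X) x0 x < r \<Longrightarrow> x \<in> E n"
    unfolding Metric_space.metric_interior_of[OF hn.Metric_space_ndist]
    using sub by (auto simp: Metric_space.in_mball[OF hn.Metric_space_ndist] subset_iff) blast
  \<comment> \<open>Write x = (x0 + x) - x0 with both terms in \<open>E n\<close>; this accounts for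
    the bound n + n.\<close>
  have small: "hnorm A X (T x) \<le> 2 * real n" if x: "x \<in> carrier X" "hnorm A X x < r" for x
  proof (rule hnorm_le_dual[OF L_closed[OF T x(1)]])
    fix y assume y: "y \<in> carrier X" "hnorm A X y \<le> 1"
    have "vdiff X x0 (x0 \<boxplus>\<^bsub>X\<^esub> x) = (-1) \<cdot>\<^bsub>X\<^esub> x"
      using lin.nc_identity[of "[x0, x]" "#0 [-] (#0 [+] #1)" "(-1) [.] #1"] x r by (simp add: vdiff_def)
    then have "x0 \<boxplus>\<^bsub>X\<^esub> x \<in> E n"
      using x r hn.nrm_scale[OF x(1), of "-1"] by (intro ball) (simp_all add: add_closed ndist_def)
    moreover have "x0 \<in> E n" using r by (intro ball) (simp_all add: ndist_def diff_self hn.nrm_zero)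
    moreover have "hinner X y (T x) = vdiff A (hinner X (?S y) (x0 \<boxplus>\<^bsub>X\<^esub> x)) (hinner X (?S y) x0)"
      using A.lin.nc_identity[of "[hinner X (?S y) x0, hinner X (?S y) x]" "#1" "(#0 [+] #1) [-] #0"] x r y L_closed[OF S]
      by (simp add: inner_adjoint_right[OF T] inner_add_right inner_closed) (simp add: vdiff_def)
    moreover have "anorm A (vdiff A (hinner X (?S y) (x0 \<boxplus>\<^bsub>X\<^esub> x)) (hinner X (?S y) x0)) \<le>
        anorm A (hinner X (?S y) (x0 \<boxplus>\<^bsub>X\<^esub> x)) + anorm A (hinner X (?S y) x0)"
      using x r y L_closed[OF S] by (intro A.nv.nrm_diff_le) (simp_all add: inner_closed add_closed)
    moreover have "anorm A (hinner X (?S y) (x0 \<boxplus>\<^bsub>X\<^esub> x)) \<le> real n" "anorm A (hinner X (?S y) x0) \<le> real n"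
      using calculation(1,2) y by (simp_all add: E_def)
    ultimately show "anorm A (hinner X y (T x)) \<le> 2 * real n" by simp
  qed
  have "hnorm A X (T x) \<le> (2 * real n) * (2 / r) * hnorm A X x" if x: "x \<in> carrier X" for x
  proof (cases "hnorm A X x = 0")
    case True
    then show ?thesis using hn.nrm_eq_zero[OF x] L_zero[OF T] hn.nrm_zero by simp
  next
    case False
    then have p: "hnorm A X x > 0" using hnorm_nonneg[OF x] by simp
    \<comment> \<open>Scaling to norm r/2 places the vector strictly inside the ball; hence the
      factor 2/r.\<close>
    let ?t = "r / (2 * hnorm A X x)"
    have "hnorm A X (complex_of_real ?t \<cdot>\<^bsub>X\<^esub> x) = r / 2"
      using hn.nrm_scale[OF x, of "complex_of_real ?t"] p r by (simp add: norm_divide norm_mult)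
    then have "hnorm A X (T (complex_of_real ?t \<cdot>\<^bsub>X\<^esub> x)) \<le> 2 * real n"
      using small[of "complex_of_real ?t \<cdot>\<^bsub>X\<^esub> x"] x r by (simp add: scale_closed)
    then have "?t * hnorm A X (T x) \<le> 2 * real n"
      using hn.nrm_scale[OF L_closed[OF T x], of "complex_of_real ?t"] p r L_linear(2)[OF T x] by (simp add: norm_divide norm_mult)
    then show ?thesis using p r by (simp add: field_simps)
  qed
  then show ?thesis using r by (intro exI[of _ "(2 * real n) * (2 / r)"]) auto
qed

text \<open>Boundedness enters here: the operator norm is a real \<open>Sup\<close>, which is
  informative only for a set that is bounded above.\<close>

lemma op_le:
  assumes T: "T \<in> carrier L" and x: "x \<in> carrier X"
  shows "hnorm A X (T x) \<le> anorm L T * hnorm A X x"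
proof (cases "hnorm A X x = 0")
  case True
  then show ?thesis using hn.nrm_eq_zero[OF x] L_zero[OF T] hn.nrm_zero by simp
next
  case False
  then have p: "hnorm A X x > 0" using hnorm_nonneg[OF x] by simp
  obtain C where C: "C \<ge> 0" "\<And>x. x \<in> carrier X \<Longrightarrow> hnorm A X (T x) \<le> C * hnorm A X x"
    using L_bounded[OF T] by blast
  let ?B = "{hnorm A X (T x) | x. x \<in> carrier X \<and> hnorm A X x \<le> 1}"
  have bdd: "bdd_above ?B"
  proof (rule bdd_aboveI)
    fix b assume "b \<in> ?B"
    then obtain y where y: "y \<in> carrier X" "hnorm A X y \<le> 1" "b = hnorm A X (T y)" by blast
    then show "b \<le> C" using C(2)[OF y(1)] C(1) mult_left_le[of "hnorm A X y" C] by simp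
  qed
  let ?y = "complex_of_real (1 / hnorm A X x) \<cdot>\<^bsub>X\<^esub> x"
  have y: "?y \<in> carrier X" "hnorm A X ?y \<le> 1"
    using x p hn.nrm_scale[OF x, of "complex_of_real (1 / hnorm A X x)"] by (simp_all add: scale_closed norm_divide)
  then have "hnorm A X (T ?y) \<le> anorm L T" unfolding L_simps by (intro cSup_upper[OF _ bdd]) blast
  then have "hnorm A X (T x) / hnorm A X x \<le> anorm L T"
    using hn.nrm_scale[OF L_closed[OF T x], of "complex_of_real (1 / hnorm A X x)"] p L_linear(2)[OF T x] by (simp add: norm_divide)
  then show ?thesis using p by (simp add: field_simps)
qed

lemma op_leI:
  assumes "0 \<le> C" "\<And>x. x \<in> carrier X \<Longrightarrow> hnorm A X (T x) \<le> C * hnorm A X x"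
  shows "anorm L T \<le> C"
  unfolding L_simps
proof (rule cSup_least)
  show "{hnorm A X (T x) |x. x \<in> carrier X \<and> hnorm A X x \<le> 1} \<noteq> {}"
    using zero_closed hn.nrm_zero by fastforce
  fix b assume "b \<in> {hnorm A X (T x) |x. x \<in> carrier X \<and> hnorm A X x \<le> 1}"
  then obtain y where y: "y \<in> carrier X" "hnorm A X y \<le> 1" "b = hnorm A X (T y)" by blast
  then show "b \<le> C" using assms(2)[OF y(1)] assms(1) mult_left_le[of "hnorm A X y" C] by simp
qed

lemma op_nonneg: "T \<in> carrier L \<Longrightarrow> 0 \<le> anorm L T"
proof -
  assume T: "T \<in> carrier L"
  obtain C where C: "C \<ge> 0" "\<And>x. x \<in> carrier X \<Longrightarrow> hnorm A X (T x) \<le> C * hnorm A X x"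
    using L_bounded[OF T] by blast
  have bdd: "bdd_above {hnorm A X (T x) | x. x \<in> carrier X \<and> hnorm A X x \<le> 1}"
  proof (rule bdd_aboveI)
    fix b assume "b \<in> {hnorm A X (T x) | x. x \<in> carrier X \<and> hnorm A X x \<le> 1}"
    then obtain y where y: "y \<in> carrier X" "hnorm A X y \<le> 1" "b = hnorm A X (T y)" by blast
    then show "b \<le> C" using C(2)[OF y(1)] C(1) mult_left_le[of "hnorm A X y" C] by simp
  qed
  have "hnorm A X (T \<zero>\<^sub>v\<^bsub>X\<^esub>) \<le> anorm L T"
    unfolding L_simps by (rule cSup_upper[OF _ bdd]) (use zero_closed hn.nrm_zero in fastforce)
  then show ?thesis using L_zero[OF T] hn.nrm_zero by simp
qed

lemma L_ops:
  assumes S: "S \<in> carrier L" and T: "T \<in> carrier L"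
  shows "vadd L S T \<in> carrier L" "astar L (vadd L S T) = vadd L (astar L S) (astar L T)"
    and "vscale L c S \<in> carrier L" "astar L (vscale L c S) = vscale L (cnj c) (astar L S)"
    and "amult L S T \<in> carrier L" "astar L (amult L S T) = amult L (astar L T) (astar L S)"
    and "astar L (astar L S) = S"
proof -
  note cS = L_closed[OF S] L_closed[OF L_star(2)[OF S]] and cT = L_closed[OF T] L_closed[OF L_star(2)[OF T]]
  note adj = inner_adjoint_left[OF S] inner_adjoint_left[OF T]
  have "is_adjoint X (vadd L S T) (vadd L (astar L S) (astar L T))"
    using cS cT by (simp add: is_adjoint_def L_apply inner_add_left inner_add_right adj)
  from L_I[OF this] show "vadd L S T \<in> carrier L" "astar L (vadd L S T) = vadd L (astar L S) (astar L T)"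
    using cS cT by (auto simp: L_simps add_closed)
  have "is_adjoint X (vscale L c S) (vscale L (cnj c) (astar L S))"
    using cS by (simp add: is_adjoint_def L_apply inner_scale_left inner_scale_right adj)
  from L_I[OF this] show "vscale L c S \<in> carrier L" "astar L (vscale L c S) = vscale L (cnj c) (astar L S)"
    using cS by (auto simp: L_simps scale_closed)
  have "is_adjoint X (amult L S T) (amult L (astar L T) (astar L S))"
    using cS cT by (simp add: is_adjoint_def L_apply adj)
  from L_I[OF this] show "amult L S T \<in> carrier L" "astar L (amult L S T) = amult L (astar L T) (astar L S)"
    using cS cT by (auto simp: L_simps)
  show "astar L (astar L S) = S"
    using L_I(2)[OF is_adjoint_sym[OF L_star(1)[OF S] L_PiE[OF S] L_PiE[OF L_star(2)[OF S]]] L_PiE[OF L_star(2)[OF S]] L_PiE[OF S]] .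
qed

lemma L_zero_mem: "vzero L \<in> carrier L"
proof -
  have "is_adjoint X (vzero L) (vzero L)" by (simp add: is_adjoint_def L_apply inner_zero)
  from L_I(1)[OF this] show ?thesis by (auto simp: L_simps zero_closed)
qed

lemma L_eqI: "S \<in> carrier L \<Longrightarrow> T \<in> carrier L \<Longrightarrow> (\<And>x. x \<in> carrier X \<Longrightarrow> S x = T x) \<Longrightarrow> S = T"
  using L_ext[OF L_PiE L_PiE] .

text \<open>The vector y = T*x satisfies norm(y)^2 = norm(<Ty, x>) <= norm(T) norm(y) norm(x), and
  one factor norm(y) cancels.\<close>

lemma op_norm_star: assumes T: "T \<in> carrier L" shows "anorm L (astar L T) \<le> anorm L T"
proof (rule op_leI[OF op_nonneg[OF T]])
  note S = L_star(2)[OF T]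
  fix x assume x: "x \<in> carrier X"
  let ?y = "astar L T x"
  have y: "?y \<in> carrier X" by (rule L_closed[OF S x])
  have "(hnorm A X ?y)\<^sup>2 = anorm A (hinner X (T ?y) x)"
    unfolding hnorm_square[OF y] using inner_adjoint_left[OF T y x] by simp
  also have "\<dots> \<le> hnorm A X (T ?y) * hnorm A X x" by (rule cauchy_schwarz[OF L_closed[OF T y] x])
  also have "\<dots> \<le> anorm L T * hnorm A X ?y * hnorm A X x"
    by (rule mult_right_mono[OF op_le[OF T y] hnorm_nonneg[OF x]])
  finally have "hnorm A X ?y * hnorm A X ?y \<le> (anorm L T * hnorm A X x) * hnorm A X ?y"
    by (simp add: power2_eq_square algebra_simps)
  then show "hnorm A X ?y \<le> anorm L T * hnorm A X x"
    using hnorm_nonneg[OF y] op_nonneg[OF T] hnorm_nonneg[OF x]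
    by (cases "hnorm A X ?y = 0") auto
qed

lemma op_cstar: assumes T: "T \<in> carrier L" shows "anorm L (amult L (astar L T) T) = (anorm L T)\<^sup>2"
proof (rule antisym)
  note S = L_star(2)[OF T]
  note ST = L_ops(5)[OF S T]
  show "anorm L (amult L (astar L T) T) \<le> (anorm L T)\<^sup>2"
  proof (rule op_leI)
    fix x assume x: "x \<in> carrier X"
    have "hnorm A X (astar L T (T x)) \<le> anorm L (astar L T) * hnorm A X (T x)"
      by (rule op_le[OF S L_closed[OF T x]])
    also have "\<dots> \<le> anorm L T * (anorm L T * hnorm A X x)"
      using op_norm_star[OF T] op_le[OF T x] op_nonneg[OF T] hnorm_nonneg[OF L_closed[OF T x]] by (intro mult_mono) auto
    finally show "hnorm A X (amult L (astar L T) T x) \<le> (anorm L T)\<^sup>2 * hnorm A X x"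
      using x by (simp add: L_apply power2_eq_square)
  qed simp
  have "anorm L T \<le> sqrt (anorm L (amult L (astar L T) T))"
  proof (rule op_leI)
    fix x assume x: "x \<in> carrier X"
    have "(hnorm A X (T x))\<^sup>2 = anorm A (hinner X x (amult L (astar L T) T x))"
      using x inner_adjoint_left[OF T x L_closed[OF T x]] by (simp add: hnorm_square L_closed[OF T] L_apply)
    also have "\<dots> \<le> hnorm A X x * hnorm A X (amult L (astar L T) T x)"
      by (rule cauchy_schwarz[OF x L_closed[OF ST x]])
    also have "\<dots> \<le> hnorm A X x * (anorm L (amult L (astar L T) T) * hnorm A X x)"
      by (rule mult_left_mono[OF op_le[OF ST x] hnorm_nonneg[OF x]])
    also have "\<dots> = (sqrt (anorm L (amult L (astar L T) T)) * hnorm A X x)\<^sup>2"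
      using op_nonneg[OF ST] by (simp add: power2_eq_square mult.commute mult.left_commute)
    finally show "hnorm A X (T x) \<le> sqrt (anorm L (amult L (astar L T) T)) * hnorm A X x"
      by (rule power2_le_imp_le) (use op_nonneg[OF ST] hnorm_nonneg[OF x] in simp)
  qed (use op_nonneg[OF ST] in simp)
  then have "(anorm L T)\<^sup>2 \<le> (sqrt (anorm L (amult L (astar L T) T)))\<^sup>2"
    using op_nonneg[OF T] by (intro power_mono)
  then show "(anorm L T)\<^sup>2 \<le> anorm L (amult L (astar L T) T)" using op_nonneg[OF ST] by simp
qed

lemma cvector_space_L: "cvector_space L"
  by (rule cvector_spaceI) (auto intro!: L_eqI L_ops L_zero_mem simp: L_apply L_closed add_assoc add_left_commute add_commute zero_add scale_zero_left
      scale_right_distrib scale_left_distrib scale_scale scale_one)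

lemma cnormed_L: "cnormed L (anorm L)"
proof (intro cnormed.intro cnormed_axioms.intro cvector_space_L op_nonneg)
  fix S T and z :: complex assume S: "S \<in> carrier L"
  show "anorm L S = 0 \<longleftrightarrow> S = vzero L"
  proof
    assume "anorm L S = 0"
    then have "hnorm A X (S x) = 0" if "x \<in> carrier X" for x
      using op_le[OF S that] hnorm_nonneg[OF L_closed[OF S that]] by simp
    then show "S = vzero L"
      using S hn.nrm_eq_zero L_closed[OF S] by (intro L_eqI L_zero_mem) (auto simp: L_apply)
  next
    assume "S = vzero L"
    then have "anorm L S \<le> 0" by (intro op_leI) (auto simp: L_apply hn.nrm_zero)
    then show "anorm L S = 0" using op_nonneg[OF S] by simp
  qed
  have le: "anorm L (vscale L z S) \<le> cmod z * anorm L S" if S: "S \<in> carrier L" for z S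
    using op_nonneg[OF S] op_le[OF S] L_closed[OF S]
    by (intro op_leI) (auto simp: L_apply hn.nrm_scale mult.assoc intro!: mult_left_mono)
  show "anorm L (vscale L z S) = cmod z * anorm L S"
  proof (cases "z = 0")
    case True
    then show ?thesis using le[OF S, of z] op_nonneg[OF L_ops(3)[OF S S, of z]] by simp
  next
    case False
    have "anorm L S = anorm L (vscale L (1/z) (vscale L z S))"
      using False cvector_space.scale_scale[OF cvector_space_L S] cvector_space.scale_one[OF cvector_space_L S] by simp
    also have "\<dots> \<le> cmod (1/z) * anorm L (vscale L z S)" by (rule le[OF L_ops(3)[OF S S]])
    finally have "cmod z * anorm L S \<le> anorm L (vscale L z S)" using False by (simp add: norm_divide field_simps)
    then show ?thesis using le[OF S, of z] by simp
  qed
  assume T: "T \<in> carrier L"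
  show "anorm L (vadd L S T) \<le> anorm L S + anorm L T"
  proof (rule op_leI)
    fix x assume x: "x \<in> carrier X"
    have "hnorm A X (S x \<boxplus>\<^bsub>X\<^esub> T x) \<le> hnorm A X (S x) + hnorm A X (T x)"
      by (rule hn.nrm_triangle[OF L_closed[OF S x] L_closed[OF T x]])
    then show "hnorm A X (vadd L S T x) \<le> (anorm L S + anorm L T) * hnorm A X x"
      using op_le[OF S x] op_le[OF T x] x by (simp add: L_apply distrib_right)
  qed (use op_nonneg S T in auto)
qed

text \<open>Pointwise limits of the operators and of their adjoints are formed separately;
  continuity of the inner product makes them adjoint to each other, so that the limit is again
  adjointable.\<close>

lemma cbanach_L: "cbanach L (anorm L)"
proof (rule cbanachI[OF cnormed_L])
  interpret N: cnormed L "anorm L" by (rule cnormed_L)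
  fix s assume s: "N.ncauchy s"
  then have sL: "s n \<in> carrier L" for n by (simp add: N.ncauchy_def)
  have lim: "\<exists>v. hn.conv (\<lambda>n. t n x) v"
    if t: "\<And>n. t n \<in> carrier L" "\<And>m n. anorm L (vdiff L (t m) (t n)) \<le> anorm L (vdiff L (s m) (s n))"
      and x: "x \<in> carrier X" for t x
  proof (rule hn.ncauchy_conv)
    show "hn.ncauchy (\<lambda>n. t n x)"
      unfolding hn.ncauchy_def
    proof (intro conjI allI impI)
      show "t n x \<in> carrier X" for n by (rule L_closed[OF t(1) x])
      fix \<epsilon> :: real assume e: "\<epsilon> > 0"
      let ?d = "\<epsilon> / (hnorm A X x + 1)"
      have d: "?d > 0" using e hnorm_nonneg[OF x] by simp
      then obtain N where N: "\<And>m n. m \<ge> N \<Longrightarrow> n \<ge> N \<Longrightarrow> anorm L (vdiff L (s m) (s n)) < ?d"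
        using s unfolding N.ncauchy_def by meson
      have "hnorm A X (vdiff X (t m x) (t n x)) < \<epsilon>" if "m \<ge> N" "n \<ge> N" for m n
      proof -
        have "hnorm A X (vdiff X (t m x) (t n x)) \<le> anorm L (vdiff L (t m) (t n)) * hnorm A X x"
          using op_le[OF N.diff_closed[OF t(1) t(1)] x, of m n] x by (simp add: L_apply)
        also have "\<dots> \<le> ?d * hnorm A X x"
          using t(2)[of m n] N[OF that] hnorm_nonneg[OF x] by (intro mult_right_mono) auto
        also have "\<dots> < \<epsilon>" using e hnorm_nonneg[OF x] by (simp add: field_simps)
        finally show ?thesis .
      qed
      then show "\<exists>N. \<forall>m\<ge>N. \<forall>n\<ge>N. hnorm A X (vdiff X (t m x) (t n x)) < \<epsilon>" by blast
    qed
  qed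
  have star_le: "anorm L (vdiff L (astar L (s m)) (astar L (s n))) \<le> anorm L (vdiff L (s m) (s n))" for m n
    using op_norm_star[OF N.diff_closed[OF sL sL, of m n]] L_ops(2)[OF sL[of m] L_ops(3)[OF sL[of n] sL[of n], of "-1"]]
      L_ops(4)[OF sL[of n] sL[of n], of "-1"] by (simp add: vdiff_def)
  have "\<forall>x\<in>carrier X. \<exists>v. hn.conv (\<lambda>n. s n x) v" using lim[of s] sL by blast
  then obtain f where f: "\<And>x. x \<in> carrier X \<Longrightarrow> hn.conv (\<lambda>n. s n x) (f x)" by metis
  have "\<forall>x\<in>carrier X. \<exists>v. hn.conv (\<lambda>n. astar L (s n) x) v"
    using lim[of "\<lambda>n. astar L (s n)"] L_star(2)[OF sL] star_le by blast
  then obtain g where g: "\<And>x. x \<in> carrier X \<Longrightarrow> hn.conv (\<lambda>n. astar L (s n) x) (g x)" by metis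
  define T where "T = restrict f (carrier X)"
  define S where "S = restrict g (carrier X)"
  have "is_adjoint X T S"
    unfolding is_adjoint_def
  proof (intro ballI)
    fix x y assume x: "x \<in> carrier X" and y: "y \<in> carrier X"
    have "A.nv.conv (\<lambda>n. hinner X (s n x) y) (hinner X (f x) y)"
      by (rule inner_conv[OF f[OF x] hn.conv_const[OF y]])
    moreover have "A.nv.conv (\<lambda>n. hinner X x (astar L (s n) y)) (hinner X x (g y))"
      by (rule inner_conv[OF hn.conv_const[OF x] g[OF y]])
    ultimately show "hinner X (T x) y = hinner X x (S y)"
      using inner_adjoint_left[OF sL x y] x y by (simp add: T_def S_def A.nv.conv_unique)
  qed
  moreover have "T \<in> carrier X \<rightarrow>\<^sub>E carrier X" "S \<in> carrier X \<rightarrow>\<^sub>E carrier X"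
    using hn.convD(2)[OF f] hn.convD(2)[OF g] by (auto simp: T_def S_def)
  ultimately have T: "T \<in> carrier L" by (rule L_I)
  have "(\<lambda>n. anorm L (vdiff L (s n) T)) \<longlonglongrightarrow> 0"
  proof (rule LIMSEQ_I)
    fix \<epsilon> :: real assume e: "0 < \<epsilon>"
    then obtain N where N: "\<And>m n. m \<ge> N \<Longrightarrow> n \<ge> N \<Longrightarrow> anorm L (vdiff L (s m) (s n)) < \<epsilon> / 2"
      using s unfolding N.ncauchy_def by (meson half_gt_zero)
    have "anorm L (vdiff L (s n) T) \<le> \<epsilon> / 2" if n: "n \<ge> N" for n
    proof (rule op_leI)
      fix x assume x: "x \<in> carrier X"
      have "(\<lambda>m. hnorm A X (vdiff X (s n x) (s m x))) \<longlonglongrightarrow> hnorm A X (vdiff X (s n x) (f x))"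
        by (intro hn.conv_norm hn.conv_diff hn.conv_const f x L_closed[OF sL])
      moreover have "hnorm A X (vdiff X (s n x) (s m x)) \<le> \<epsilon> / 2 * hnorm A X x" if "m \<ge> N" for m
      proof -
        have "hnorm A X (vdiff X (s n x) (s m x)) \<le> anorm L (vdiff L (s n) (s m)) * hnorm A X x"
          using op_le[OF N.diff_closed[OF sL sL] x, of n m] x by (simp add: L_apply)
        also have "\<dots> \<le> \<epsilon> / 2 * hnorm A X x" using N[OF n that] hnorm_nonneg[OF x] by (intro mult_right_mono) auto
        finally show ?thesis .
      qed
      ultimately have "hnorm A X (vdiff X (s n x) (f x)) \<le> \<epsilon> / 2 * hnorm A X x"
        by (intro LIMSEQ_le_const2) auto
      then show "hnorm A X (vdiff L (s n) T x) \<le> \<epsilon> / 2 * hnorm A X x" using x by (simp add: L_apply T_def)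
    qed (use e in simp)
    then show "\<exists>N. \<forall>n\<ge>N. norm (anorm L (vdiff L (s n) T) - 0) < \<epsilon>"
      using e N.nrm_nonneg[OF N.diff_closed[OF sL T]] by (intro exI[of _ N]) fastforce
  qed
  then show "\<exists>T. N.conv s T" using sL T unfolding N.conv_def by blast
qed

definition op_id :: "'x \<Rightarrow> 'x" where "op_id = (\<lambda>x\<in>carrier X. x)"

lemma unital_cstar_L: "unital_cstar L op_id"
proof -
  have id: "op_id \<in> carrier L"
    by (rule L_I[where S = op_id]) (auto simp: is_adjoint_def op_id_def)
  have "cstar_algebra L"
  proof (intro cstar_algebra.intro cstar_algebra_axioms.intro cvector_space_L)
    show "Metric_space.mcomplete (carrier L) (cstar_dist L)"
      using cbanach.mcomplete_ndist[OF cbanach_L] by (simp add: cstar_dist_eq)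
    fix S T and z :: complex assume S: "S \<in> carrier L"
    show "0 \<le> anorm L S" "anorm L S = 0 \<longleftrightarrow> S = vzero L" "anorm L (vscale L z S) = cmod z * anorm L S"
      using cnormed.nrm_nonneg[OF cnormed_L S] cnormed.nrm_eq_zero[OF cnormed_L S] cnormed.nrm_scale[OF cnormed_L S] by blast+
    show "anorm L (amult L (astar L S) S) = (anorm L S)\<^sup>2" by (rule op_cstar[OF S])
    show "astar L S \<in> carrier L" by (rule L_star(2)[OF S])
    assume T: "T \<in> carrier L"
    show "anorm L (vadd L S T) \<le> anorm L S + anorm L T" by (rule cnormed.nrm_triangle[OF cnormed_L S T])
    show "anorm L (amult L S T) \<le> anorm L S * anorm L T"
    proof (rule op_leI)
      fix x assume x: "x \<in> carrier X"
      have "hnorm A X (S (T x)) \<le> anorm L S * hnorm A X (T x)" by (rule op_le[OF S L_closed[OF T x]])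
      also have "\<dots> \<le> anorm L S * (anorm L T * hnorm A X x)" by (rule mult_left_mono[OF op_le[OF T x] op_nonneg[OF S]])
      finally show "hnorm A X (amult L S T x) \<le> anorm L S * anorm L T * hnorm A X x" using x by (simp add: L_apply)
    qed (use op_nonneg S T in simp)
  qed (auto intro!: L_eqI L_ops L_star simp: L_apply L_closed L_ops(2,4,6,7) L_linear)
  then show ?thesis
    by (intro unital_cstar.intro unital_cstar_axioms.intro id)
      (auto intro!: L_eqI L_ops id[unfolded op_id_def] simp: L_apply L_closed op_id_def)
qed

end

sublocale hilbert_cs \<subseteq> op: unital_cstar "adjointables A X" op_id
  by (rule unital_cstar_L)

lemma (in cvector_space) scale_diff:
  "x \<in> carrier V \<Longrightarrow> y \<in> carrier V \<Longrightarrow> c \<cdot> vdiff V x y = vdiff V (c \<cdot> x) (c \<cdot> y)"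
  by (simp add: vdiff_def scale_right_distrib scale_scale scale_closed)

context unital_cstar begin

lemma pos_conj:
  assumes "pos a" "c \<in> carrier A" shows "pos (c\<^sup>\<star> \<odot> a \<odot> c)"
proof -
  obtain g where g: "g \<in> carrier A" "g\<^sup>\<star> = g" "a = g \<odot> g" using assms by (auto simp: pos_def)
  have "c\<^sup>\<star> \<odot> a \<odot> c = (g \<odot> c)\<^sup>\<star> \<odot> (g \<odot> c)" using g assms(2) by (simp add: star_simps mult_assoc cl)
  then show ?thesis using star_mult_pos[of "g \<odot> c"] g assms(2) by (simp add: cl)
qed

text \<open>The scaled condition norm(1 - b/t) <= 1 passes from the approximants to the
  limit.\<close>

lemma pos_limit:
  assumes a: "a \<in> carrier A" "a\<^sup>\<star> = a" and lim: "\<And>\<epsilon>. \<epsilon> > 0 \<Longrightarrow> \<exists>b. pos b \<and> anorm A (vdiff A a b) < \<epsilon>"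
  shows "pos a"
proof -
  \<comment> \<open>Approximants within distance 1 of \<open>a\<close> have norm at most t as well,
    which is the reason for the \<open>min 1\<close> below.\<close>
  define t where "t = anorm A a + 1"
  have t: "t > 0" "t \<noteq> 0" using norm_nonneg[OF a(1)] by (simp_all add: t_def)
  let ?s = "complex_of_real (1 / t)"
  have "anorm A (vdiff A u (?s \<cdot> a)) \<le> 1 + \<epsilon>" if e: "0 < \<epsilon>" for \<epsilon>
  proof -
    obtain b where b: "pos b" "anorm A (vdiff A a b) < min 1 (\<epsilon> * t)"
      using lim[of "min 1 (\<epsilon> * t)"] e t by auto
    note bc = posD[OF b(1)]
    have "anorm A b \<le> t"
      using nv.nrm_le_diff[OF bc(1) a(1)] nv.nrm_diff_commute[OF bc(1) a(1)] b(2) by (simp add: t_def)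
    then have "anorm A (?s \<cdot> b) \<le> 1" using norm_scale_inverse[OF bc(1) t(1)] t by simp
    moreover have "pos (?s \<cdot> b)" by (rule pos_scale[OF b(1)]) (use t in simp)
    ultimately have 1: "anorm A (vdiff A u (?s \<cdot> b)) \<le> 1" by (rule pos_norm_one_minus[rotated])
    have "vdiff A u (?s \<cdot> a) = vdiff A u (?s \<cdot> b) \<boxplus> ?s \<cdot> vdiff A b a"
      using lin.nc_identity[of "[u, a, b]" "#0 [-] ?s [.] #1" "(#0 [-] ?s [.] #2) [+] ?s [.] (#2 [-] #1)"] a bc u_closed
      by (simp add: vdiff_def)
    then have "anorm A (vdiff A u (?s \<cdot> a)) \<le> anorm A (vdiff A u (?s \<cdot> b)) + anorm A (vdiff A b a) / t"
      using norm_triangle[of "vdiff A u (?s \<cdot> b)" "?s \<cdot> vdiff A b a"] norm_scale_inverse[of "vdiff A b a" t] a bc u_closed t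
      by (simp add: cl)
    also have "\<dots> \<le> 1 + \<epsilon>"
      using 1 b(2) nv.nrm_diff_commute[OF bc(1) a(1)] t(1) by (intro add_mono) (simp_all add: pos_divide_le_eq)
    finally show ?thesis .
  qed
  then have "anorm A (vdiff A u (?s \<cdot> a)) \<le> 1" by (rule field_le_epsilon)
  moreover have "(?s \<cdot> a)\<^sup>\<star> = ?s \<cdot> a" using a by (simp add: star_simps)
  ultimately have "pos (?s \<cdot> a)" using a by (intro posI) (simp_all add: cl)
  then have "pos (complex_of_real t \<cdot> ?s \<cdot> a)" by (rule pos_scale) (use t in simp)
  then show ?thesis using scale_inverse[OF a(1) t(2)] by simp
qed

end

section \<open>Positive elements and the Cauchy-Schwarz inequality\<close>

context cstar_algebra begin

lemma mult_vlsum: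
  assumes "a \<in> carrier A" "set xs \<subseteq> carrier A"
  shows "a \<odot> vlsum A xs = vlsum A (map (amult A a) xs)" "vlsum A xs \<odot> a = vlsum A (map (\<lambda>x. x \<odot> a) xs)"
  using assms(2) by (induction xs) (auto simp: mult_zero mult_add_right mult_add_left assms(1) vlsum_closed)

lemma cspan_star:
  assumes S: "nv.scale_invariant S" and Z: "nv.csubspace Z" "nv.nclosed Z"
    and st: "\<And>s. s \<in> S \<Longrightarrow> s\<^sup>\<star> \<in> Z" and a: "a \<in> nv.cspan S"
  shows "a\<^sup>\<star> \<in> Z"
proof -
  let ?T = "{x \<in> carrier A. x\<^sup>\<star> \<in> Z}"
  have "nv.csubspace ?T" using Z(1) by (auto simp: nv.csubspace_def cl star_simps)
  moreover have "nv.nclosed ?T"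
  proof (rule nv.nclosedI)
    fix s x assume s: "\<And>n. s n \<in> ?T" and x: "nv.conv s x"
    have "x\<^sup>\<star> \<in> Z" by (rule nv.nclosed_conv[OF Z(2) _ conv_star[OF x]]) (use s in blast)
    then show "x \<in> ?T" using nv.convD(2)[OF x] by blast
  qed blast
  ultimately have "nv.cspan S \<subseteq> ?T" using S st by (intro nv.cspan_minimal) (auto simp: nv.scale_invariant_def)
  then show ?thesis using a by blast
qed

text \<open>Closed-span induction in each factor: first in the right one for a fixed generator on
  the left, then in the left one.\<close>

lemma cspan_mult:
  assumes S: "nv.scale_invariant S" and T: "nv.scale_invariant T" and Z: "nv.csubspace Z" "nv.nclosed Z"
    and st: "\<And>s t. s \<in> S \<Longrightarrow> t \<in> T \<Longrightarrow> s \<odot> t \<in> Z" and a: "a \<in> nv.cspan S" and b: "b \<in> nv.cspan T"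
  shows "a \<odot> b \<in> Z"
proof -
  have left: "s \<odot> b \<in> Z" if s: "s \<in> S" and b: "b \<in> nv.cspan T" for s b
  proof -
    have sc: "s \<in> carrier A" using s S by (auto simp: nv.scale_invariant_def)
    let ?U = "{x \<in> carrier A. s \<odot> x \<in> Z}"
    have "nv.csubspace ?U"
      using Z(1) sc by (auto simp: nv.csubspace_def cl mult_zero mult_add_right mult_scale_right)
    moreover have "nv.nclosed ?U"
    proof (rule nv.nclosedI)
      fix t x assume t: "\<And>n. t n \<in> ?U" and x: "nv.conv t x"
      have "s \<odot> x \<in> Z"
        by (rule nv.nclosed_conv[OF Z(2) _ conv_mult[OF nv.conv_const[OF sc] x]]) (use t in blast)
      then show "x \<in> ?U" using nv.convD(2)[OF x] by blast
    qed blast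
    ultimately have "nv.cspan T \<subseteq> ?U" using T st s by (intro nv.cspan_minimal) (auto simp: nv.scale_invariant_def)
    then show ?thesis using b by blast
  qed
  have bc: "b \<in> carrier A" using b nv.csubspace_cspan[OF T] by (auto simp: nv.csubspace_def)
  let ?U = "{x \<in> carrier A. x \<odot> b \<in> Z}"
  have "nv.csubspace ?U"
    using Z(1) bc by (auto simp: nv.csubspace_def cl mult_zero mult_add_left mult_scale_left)
  moreover have "nv.nclosed ?U"
  proof (rule nv.nclosedI)
    fix t x assume t: "\<And>n. t n \<in> ?U" and x: "nv.conv t x"
    have "x \<odot> b \<in> Z"
      by (rule nv.nclosed_conv[OF Z(2) _ conv_mult[OF x nv.conv_const[OF bc]]]) (use t in blast)
    then show "x \<in> ?U" using nv.convD(2)[OF x] by blast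
  qed blast
  ultimately have "nv.cspan S \<subseteq> ?U" using S left b by (intro nv.cspan_minimal) (auto simp: nv.scale_invariant_def)
  then show ?thesis using a by blast
qed

lemma hnorm_self: "a \<in> carrier A \<Longrightarrow> hnorm A (self_bimodule A) a = anorm A a"
  using norm_nonneg by (simp add: hnorm_def self_bimodule_simps cstar_identity)

lemma self_hilbert_cs: "hilbert_cs A (self_bimodule A)"
proof -
  have "hdist A (self_bimodule A) = cstar_dist A"
    by (auto simp: fun_eq_iff hdist_def cstar_dist_def self_bimodule_simps hnorm_self diff_closed)
  then have comp: "Metric_space.mcomplete (carrier (self_bimodule A)) (hdist A (self_bimodule A))"
    using complete by (simp add: self_bimodule_simps)
  have vs: "cvector_space (self_bimodule A)"
    by (rule cvector_spaceI) (auto simp: self_bimodule_simps cl add_assoc add_left_commute add_commute zero_add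
        add_zero scale_zero_left scale_right_distrib scale_left_distrib scale_scale scale_one)
  have "hilbert_module A (self_bimodule A)"
  proof (intro hilbert_module.intro hilbert_module_axioms.intro vs comp)
    show "cstar_algebra A" ..
    fix x assume x: "x \<in> carrier (self_bimodule A)"
    show "positive A (hinner (self_bimodule A) x x)" using x by (auto simp: positive_def self_bimodule_simps)
    show "x = \<zero>\<^sub>v\<^bsub>self_bimodule A\<^esub>" if "hinner (self_bimodule A) x x = \<zero>\<^sub>v"
      using x that cstar_identity[of x] nv.nrm_zero norm_eq_zero[of x] by (simp add: self_bimodule_simps)
  qed (simp_all add: self_bimodule_simps cl mult_add_left mult_add_right mult_assoc mult_scale_left
      mult_scale_right star_simps)
  then show ?thesis
    by (intro hilbert_cs.intro hilbert_cs_axioms.intro)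
      (use norm_mult norm_star in \<open>auto simp: hnorm_self self_bimodule_simps cl intro: order_trans[OF norm_mult]\<close>)
qed

interpretation S: hilbert_cs A "self_bimodule A" by (rule self_hilbert_cs)

text \<open>The left regular representation embeds A, which may lack a unit, isometrically into the
  unital algebra of operators on A. In \<open>lmul_norm\<close> the adjoint of the element is the
  test vector.\<close>

definition lmul :: "'a \<Rightarrow> 'a \<Rightarrow> 'a" where "lmul a = (\<lambda>x\<in>carrier A. a \<odot> x)"

lemma lmul_mem: assumes "a \<in> carrier A"
  shows "lmul a \<in> carrier S.L" "astar S.L (lmul a) = lmul (a\<^sup>\<star>)"
proof -
  have "is_adjoint (self_bimodule A) (lmul a) (lmul (a\<^sup>\<star>))"
    using assms by (auto simp: is_adjoint_def self_bimodule_simps lmul_def cl star_simps mult_assoc)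
  from S.L_I[OF this] show "lmul a \<in> carrier S.L" "astar S.L (lmul a) = lmul (a\<^sup>\<star>)"
    using assms by (auto simp: lmul_def self_bimodule_simps cl)
qed

lemma lmul_ops:
  assumes "a \<in> carrier A" "b \<in> carrier A"
  shows "lmul (a \<boxplus> b) = vadd S.L (lmul a) (lmul b)" "lmul (c \<cdot> a) = vscale S.L c (lmul a)"
    "lmul (a \<odot> b) = amult S.L (lmul a) (lmul b)" "lmul (vdiff A a b) = vdiff S.L (lmul a) (lmul b)"
  using assms
  by (auto simp: fun_eq_iff lmul_def S.L_simps vdiff_def self_bimodule_simps mult_add_left mult_scale_left mult_assoc cl)

lemma lmul_norm: assumes a: "a \<in> carrier A" shows "anorm S.L (lmul a) = anorm A a"
proof (rule antisym)
  show "anorm S.L (lmul a) \<le> anorm A a"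
    using a norm_nonneg norm_mult by (intro S.op_leI) (auto simp: hnorm_self self_bimodule_simps lmul_def cl)
  have "anorm A (a \<odot> a\<^sup>\<star>) \<le> anorm S.L (lmul a) * anorm A (a\<^sup>\<star>)"
    using S.op_le[OF lmul_mem(1)[OF a], of "a\<^sup>\<star>"] a by (simp add: hnorm_self self_bimodule_simps lmul_def cl)
  then have "anorm A a * anorm A a \<le> anorm S.L (lmul a) * anorm A a"
    using cstar_identity[of "a\<^sup>\<star>"] a by (simp add: star_star norm_star cl power2_eq_square)
  then show "anorm A a \<le> anorm S.L (lmul a)"
    using norm_nonneg[OF a] S.op_nonneg[OF lmul_mem(1)[OF a]] by (cases "anorm A a = 0") auto
qed

text \<open>Roots are taken among all operators on A, so positivity of \<open>a\<close> makes no
  claim that its root is a left multiplication.\<close>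

definition apos :: "'a \<Rightarrow> bool" where
  "apos a \<longleftrightarrow> a \<in> carrier A \<and> S.op.pos (lmul a)"

lemma apos_closed: "apos a \<Longrightarrow> a \<in> carrier A"
  by (simp add: apos_def)

lemma apos_star_mult: "b \<in> carrier A \<Longrightarrow> apos (b\<^sup>\<star> \<odot> b)"
  using S.op.star_mult_pos[OF lmul_mem(1)[of b]] by (simp add: apos_def lmul_ops lmul_mem cl)

lemma apos_add: "apos a \<Longrightarrow> apos b \<Longrightarrow> apos (a \<boxplus> b)"
  using S.op.pos_add by (auto simp: apos_def lmul_ops cl)

lemma apos_scale: "apos a \<Longrightarrow> 0 \<le> t \<Longrightarrow> apos (complex_of_real t \<cdot> a)"
  using S.op.pos_scale by (auto simp: apos_def lmul_ops cl)

lemma apos_zero: "apos \<zero>\<^sub>v"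
  using apos_star_mult[OF zero_closed] by (simp add: mult_zero cl)

lemma apos_norm_mono: assumes "apos a" "apos b" shows "anorm A a \<le> anorm A (a \<boxplus> b)"
proof -
  have "anorm S.L (lmul a) \<le> anorm S.L (vadd S.L (lmul a) (lmul b))"
    using assms by (intro S.op.pos_norm_mono) (auto simp: apos_def)
  then show ?thesis using assms lmul_norm[of a] lmul_norm[of "a \<boxplus> b"] by (simp add: apos_closed lmul_ops cl)
qed

lemma apos_limit:
  assumes a: "a \<in> carrier A" "a\<^sup>\<star> = a" and lim: "\<And>\<epsilon>. \<epsilon> > 0 \<Longrightarrow> \<exists>b. apos b \<and> anorm A (vdiff A a b) < \<epsilon>"
  shows "apos a"
proof -
  have "S.op.pos (lmul a)"
  proof (rule S.op.pos_limit)
    show "lmul a \<in> carrier S.L" "astar S.L (lmul a) = lmul a" using a lmul_mem[OF a(1)] by simp_all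
    fix \<epsilon> :: real assume "\<epsilon> > 0"
    then obtain b where b: "apos b" "anorm A (vdiff A a b) < \<epsilon>" using lim by blast
    then have "anorm S.L (vdiff S.L (lmul a) (lmul b)) < \<epsilon>"
      using a apos_closed[OF b(1)] lmul_norm[of "vdiff A a b"] by (simp add: lmul_ops cl)
    then show "\<exists>T. S.op.pos T \<and> anorm S.L (vdiff S.L (lmul a) T) < \<epsilon>" using b by (auto simp: apos_def)
  qed
  then show ?thesis using a by (simp add: apos_def)
qed

text \<open>The operator inequality q <= t, conjugated by c. It is obtained for left
  multiplications, where a unit is available to form t - q.\<close>

lemma apos_conj_norm_minus:
  assumes q: "apos q" and t: "0 < t" "anorm A q \<le> t" and c: "c \<in> carrier A"
  shows "apos (vdiff A (complex_of_real t \<cdot> (c\<^sup>\<star> \<odot> c)) (c\<^sup>\<star> \<odot> q \<odot> c))"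
proof -
  let ?c = "lmul c" and ?q = "lmul q"
  note qc = apos_closed[OF q]
  note m = lmul_mem[OF c] lmul_mem(1)[OF qc]
  have "S.op.pos (vdiff S.L (vscale S.L (complex_of_real t) S.op_id) ?q)"
    using q t lmul_norm[OF qc] by (intro S.op.pos_norm_minus) (auto simp: apos_def)
  from S.op.pos_conj[OF this m(1)]
  have "S.op.pos (vdiff S.L (vscale S.L (complex_of_real t) (amult S.L (lmul (c\<^sup>\<star>)) ?c)) (amult S.L (amult S.L (lmul (c\<^sup>\<star>)) ?q) ?c))"
    using S.op.unit_identity[of "[lmul (c\<^sup>\<star>), ?q, ?c]" "#1 [*] (complex_of_real t [.] #0 [-] #2) [*] #3"
        "complex_of_real t [.] (#1 [*] #3) [-] #1 [*] #2 [*] #3"] m c lmul_mem(1)[OF star_closed[OF c]]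
    by (simp add: vdiff_def nc_strip_def)
  then show ?thesis using c qc by (simp add: apos_def lmul_ops cl)
qed

text \<open>For p = <x,x>, q = <y,y> and r = <x,y>, the positive element is <z,z> with z = x - s y
  r*. The abstract form serves Hilbert modules as well as the semi-inner product of formal
  tensors.\<close>

lemma cauchy_schwarz_general:
  assumes p: "p \<in> carrier A" and q: "apos q" and r: "r \<in> carrier A"
    and pos: "\<And>s. 0 < s \<Longrightarrow> apos (vdiff A p (complex_of_real (2 * s) \<cdot> (r \<odot> r\<^sup>\<star>)) \<boxplus> complex_of_real (s\<^sup>2) \<cdot> (r \<odot> q \<odot> r\<^sup>\<star>))"
  shows "(anorm A r)\<^sup>2 \<le> anorm A p * anorm A q"
proof -
  note qc = apos_closed[OF q]
  have le: "(anorm A r)\<^sup>2 \<le> anorm A p * Q" if Q: "anorm A q < Q" for Q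
  proof -
    have Q0: "0 < Q" using norm_nonneg[OF qc] Q by simp
    \<comment> \<open>With s^2 Q = s, the element p becomes the sum of s rr*, the given positive
      element, and s^2 times the positive difference of Q rr* and r q r*; hence s norm(r)^2 <=
      norm(p).\<close>
    define s where "s = 1 / Q"
    have s: "0 < s" "s * Q = 1" using Q0 by (simp_all add: s_def)
    let ?s = "complex_of_real s" and ?Q = "complex_of_real Q"
    have sQ: "?s * (?s * ?Q) = ?s" using s(2) by (simp add: of_real_mult[symmetric] del: of_real_mult)
    let ?E = "vdiff A p (complex_of_real (2 * s) \<cdot> (r \<odot> r\<^sup>\<star>)) \<boxplus> complex_of_real (s\<^sup>2) \<cdot> (r \<odot> q \<odot> r\<^sup>\<star>)"
    let ?F = "complex_of_real (s\<^sup>2) \<cdot> vdiff A (?Q \<cdot> (r \<odot> r\<^sup>\<star>)) (r \<odot> q \<odot> r\<^sup>\<star>)"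
    have "apos (?Q \<cdot> (r \<odot> r\<^sup>\<star>) \<boxplus> (- 1) \<cdot> (r \<odot> q \<odot> r\<^sup>\<star>))"
      using apos_conj_norm_minus[OF q Q0 less_imp_le[OF Q] star_closed[OF r]] r by (simp add: star_star vdiff_def)
    then have F: "apos ?F" unfolding vdiff_def by (rule apos_scale) simp
    have R: "apos (?s \<cdot> (r \<odot> r\<^sup>\<star>))"
      using apos_scale[OF apos_star_mult[OF star_closed[OF r]], of s] s r by (simp add: star_star)
    have "?s \<cdot> (r \<odot> r\<^sup>\<star>) \<boxplus> (?E \<boxplus> ?F) = p"
      using lin.nc_identity[of "[p, r \<odot> r\<^sup>\<star>, r \<odot> q \<odot> r\<^sup>\<star>]"
          "?s [.] #1 [+] ((#0 [-] complex_of_real (2 * s) [.] #1 [+] complex_of_real (s\<^sup>2) [.] #2) [+]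
            complex_of_real (s\<^sup>2) [.] (?Q [.] #1 [-] #2))" "#0"] p qc r sQ
      by (simp add: vdiff_def cl power2_eq_square)
    then have "anorm A (?s \<cdot> (r \<odot> r\<^sup>\<star>)) \<le> anorm A p" using apos_norm_mono[OF R apos_add[OF pos[OF s(1)] F]] by simp
    then have "s * (anorm A r)\<^sup>2 \<le> anorm A p"
      using norm_scale[of "r \<odot> r\<^sup>\<star>" ?s] cstar_identity[OF star_closed[OF r]] r s by (simp add: star_star norm_star cl)
    then show ?thesis using Q0 by (simp add: s_def field_simps)
  qed
  show ?thesis
  proof (cases "anorm A p = 0")
    case True
    then show ?thesis using le[of "anorm A q + 1"] by simp
  next
    case False
    then have p0: "anorm A p > 0" using norm_nonneg[OF p] by simp
    have "(anorm A r)\<^sup>2 / anorm A p \<le> anorm A q"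
    proof (rule dense_ge)
      fix Q assume "anorm A q < Q"
      then show "(anorm A r)\<^sup>2 / anorm A p \<le> Q" using le p0 by (simp add: field_simps)
    qed
    then show ?thesis using p0 by (simp add: field_simps)
  qed
qed

end

text \<open>Closes the circle: the assumption of \<open>hilbert_cs\<close> holds for all Hilbert
  modules, so the operator theory above applies to each of them.\<close>

sublocale hilbert_module \<subseteq> hilbert_cs
proof
  fix x y assume x: "x \<in> carrier X" and y: "y \<in> carrier X"
  have ap: "A.apos (hinner X z z)" if "z \<in> carrier X" for z
    using inner_positive[OF that] A.apos_star_mult by (auto simp: positive_def)
  let ?r = "hinner X x y"
  have rc: "?r \<in> carrier A" "?r\<^sup>\<star>\<^bsub>A\<^esub> = hinner X y x" using x y by (simp_all add: inner_closed inner_star)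
  have "(anorm A ?r)\<^sup>2 \<le> anorm A (hinner X x x) * anorm A (hinner X y y)"
  proof (rule A.cauchy_schwarz_general)
    fix s :: real assume s: "0 < s"
    let ?s = "complex_of_real s"
    let ?v = "ract X y (?s \<cdot>\<^bsub>A\<^esub> hinner X y x)"
    have v: "?v \<in> carrier X" using x y by (simp add: ract_closed A.cl inner_closed)
    have "hinner X (vdiff X x ?v) (vdiff X x ?v) = vdiff A (vdiff A (hinner X x x) (?s \<cdot>\<^bsub>A\<^esub> (?r \<odot>\<^bsub>A\<^esub> hinner X y x)))
        (vdiff A (?s \<cdot>\<^bsub>A\<^esub> (?r \<odot>\<^bsub>A\<^esub> hinner X y x)) ((?s * ?s) \<cdot>\<^bsub>A\<^esub> (?r \<odot>\<^bsub>A\<^esub> hinner X y y \<odot>\<^bsub>A\<^esub> hinner X y x)))"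
      using x y v by (simp add: inner_diff_left inner_diff_right inner_ract_left inner_ract_right diff_closed A.cl inner_closed
          A.star_simps inner_star A.mult_scale_left A.mult_scale_right A.scale_scale A.mult_assoc
          A.mult_diff_left A.scale_diff)
    also have "\<dots> = vdiff A (hinner X x x) (complex_of_real (2 * s) \<cdot>\<^bsub>A\<^esub> (?r \<odot>\<^bsub>A\<^esub> ?r\<^sup>\<star>\<^bsub>A\<^esub>)) \<boxplus>\<^bsub>A\<^esub>
        complex_of_real (s\<^sup>2) \<cdot>\<^bsub>A\<^esub> (?r \<odot>\<^bsub>A\<^esub> hinner X y y \<odot>\<^bsub>A\<^esub> ?r\<^sup>\<star>\<^bsub>A\<^esub>)"
      unfolding rc(2)
      using A.lin.nc_identity[of "[hinner X x x, ?r \<odot>\<^bsub>A\<^esub> hinner X y x, ?r \<odot>\<^bsub>A\<^esub> hinner X y y \<odot>\<^bsub>A\<^esub> hinner X y x]"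
          "(#0 [-] ?s [.] #1) [-] (?s [.] #1 [-] (?s * ?s) [.] #2)"
          "(#0 [-] complex_of_real (2 * s) [.] #1) [+] complex_of_real (s\<^sup>2) [.] #2"] x y
      by (simp add: vdiff_def A.cl inner_closed power2_eq_square)
    finally show "A.apos (vdiff A (hinner X x x) (complex_of_real (2 * s) \<cdot>\<^bsub>A\<^esub> (?r \<odot>\<^bsub>A\<^esub> ?r\<^sup>\<star>\<^bsub>A\<^esub>)) \<boxplus>\<^bsub>A\<^esub>
        complex_of_real (s\<^sup>2) \<cdot>\<^bsub>A\<^esub> (?r \<odot>\<^bsub>A\<^esub> hinner X y y \<odot>\<^bsub>A\<^esub> ?r\<^sup>\<star>\<^bsub>A\<^esub>))"
      using ap[OF diff_closed[OF x v]] by simp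
  qed (use x y ap in \<open>simp_all add: inner_closed\<close>)
  also have "\<dots> = (hnorm A X x * hnorm A X y)\<^sup>2" using x y by (simp add: power_mult_distrib hnorm_square)
  finally show "anorm A ?r \<le> hnorm A X x * hnorm A X y"
    by (rule power2_le_imp_le) (use hnorm_nonneg x y in simp)
qed

section \<open>Compact operators\<close>

context hilbert_module begin

lemma inner_apos: "z \<in> carrier X \<Longrightarrow> A.apos (hinner X z z)"
  using inner_positive[of z] A.apos_star_mult by (auto simp: positive_def)

text \<open>Let z and w come from the negative part of T. Evaluated at zy, the hypothesis makes
  -<wy, wy> positive; it cancels the positive <wy, wy>, so w = 0.\<close>

lemma op_posI:
  assumes T: "T \<in> carrier L" "astar L T = T" and ap: "\<And>y. y \<in> carrier X \<Longrightarrow> A.apos (hinner X y (T y))"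
  shows "op.pos T"
proof -
  obtain z w where z: "z \<in> carrier L" "astar L z = z" and w: "w \<in> carrier L" "astar L w = w"
    and eq: "amult L (amult L z T) z = vscale L (-1) (amult L w w)" and p: "amult L w w = vzero L \<longrightarrow> op.pos T"
    using op.negative_part[OF T] by blast
  have "w = vzero L"
  proof (rule L_eqI[OF w(1) L_zero_mem])
    fix y assume y: "y \<in> carrier X"
    have wy: "w y \<in> carrier X" and zy: "z y \<in> carrier X" using L_closed w z y by auto
    have "hinner X (z y) (T (z y)) = hinner X y (amult L (amult L z T) z y)"
      using inner_adjoint_left[OF z(1) y, of "T (z y)"] z(2) L_closed[OF T(1) zy] y zy by (simp add: L_apply)
    also have "\<dots> = (-1) \<cdot>\<^bsub>A\<^esub> hinner X (w y) (w y)"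
      unfolding eq using inner_adjoint_left[OF w(1) y wy] w(2) y wy L_closed[OF w(1) wy]
      by (simp add: L_apply inner_scale_right)
    finally have "hinner X (w y) (w y) \<boxplus>\<^bsub>A\<^esub> hinner X (z y) (T (z y)) = vdiff A (hinner X (w y) (w y)) (hinner X (w y) (w y))"
      by (simp add: vdiff_def)
    also have "\<dots> = \<zero>\<^sub>v\<^bsub>A\<^esub>" using wy by (simp add: A.diff_self inner_closed)
    finally have "anorm A (hinner X (w y) (w y)) \<le> 0"
      using A.apos_norm_mono[OF inner_apos[OF wy] ap[OF zy]] A.nv.nrm_zero by simp
    then have "hnorm A X (w y) = 0" using A.norm_nonneg[OF inner_closed[OF wy wy]] by (simp add: hnorm_def)
    then show "w y = vzero L y" using hn.nrm_eq_zero[OF wy] y by (simp add: L_apply)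
  qed
  then show ?thesis using p op.mult_zero w(1) by simp
qed

lemma rank_one_mem:
  assumes x: "x \<in> carrier X" and y: "y \<in> carrier X"
  shows "rank_one X x y \<in> carrier L" "astar L (rank_one X x y) = rank_one X y x"
proof -
  have "is_adjoint X (rank_one X x y) (rank_one X y x)"
    using x y by (auto simp: is_adjoint_def rank_one_def inner_ract_left inner_ract_right inner_closed inner_star)
  from L_I[OF this] show "rank_one X x y \<in> carrier L" "astar L (rank_one X x y) = rank_one X y x"
    using x y by (auto simp: rank_one_def ract_closed inner_closed)
qed

lemma rank_one_apply: "z \<in> carrier X \<Longrightarrow> rank_one X x y z = ract X x (hinner X y z)"
  by (simp add: rank_one_def)

lemma rank_one_mult:
  assumes "T \<in> carrier L" "x \<in> carrier X" "y \<in> carrier X"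
  shows "amult L T (rank_one X x y) = rank_one X (T x) y"
    "amult L (rank_one X x y) T = rank_one X x (astar L T y)"
proof -
  note c = assms(2,3) L_closed[OF assms(1)] L_closed[OF L_star(2)[OF assms(1)]]
  show "amult L T (rank_one X x y) = rank_one X (T x) y"
    by (rule L_eqI) (use assms c in \<open>simp_all add: op.mult_closed rank_one_mem L_apply rank_one_apply L_linear inner_closed\<close>)
  show "amult L (rank_one X x y) T = rank_one X x (astar L T y)"
    by (rule L_eqI) (use assms c in \<open>simp_all add: op.mult_closed rank_one_mem L_apply rank_one_apply inner_adjoint_right\<close>)
qed

lemma rank_one_scale:
  assumes "x \<in> carrier X" "y \<in> carrier X"
  shows "vscale L c (rank_one X x y) = rank_one X (c \<cdot>\<^bsub>X\<^esub> x) y"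
    "rank_one X x (c \<cdot>\<^bsub>X\<^esub> y) = vscale L (cnj c) (rank_one X x y)"
proof -
  show "vscale L c (rank_one X x y) = rank_one X (c \<cdot>\<^bsub>X\<^esub> x) y"
    by (rule L_eqI) (use assms in \<open>simp_all add: op.scale_closed rank_one_mem scale_closed L_apply rank_one_apply
      ract_scale_left inner_closed\<close>)
  show "rank_one X x (c \<cdot>\<^bsub>X\<^esub> y) = vscale L (cnj c) (rank_one X x y)"
    by (rule L_eqI) (use assms in \<open>simp_all add: op.scale_closed rank_one_mem scale_closed L_apply rank_one_apply
      ract_scale_right inner_closed inner_scale_left\<close>)
qed

lemma rank_one_pos: assumes x: "x \<in> carrier X" shows "op.pos (rank_one X x x)"
proof (rule op_posI)
  fix y assume y: "y \<in> carrier X"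
  have "hinner X y (rank_one X x x y) = (hinner X x y)\<^sup>\<star>\<^bsub>A\<^esub> \<odot>\<^bsub>A\<^esub> hinner X x y"
    using x y by (simp add: rank_one_apply inner_ract_right inner_closed inner_star)
  then show "A.apos (hinner X y (rank_one X x x y))" using A.apos_star_mult inner_closed x y by simp
qed (use rank_one_mem x in auto)

text \<open>Test on x itself: xx* sends x to xh with h = <x,x>, and <xh, xh> = h^3. This vector is
  long enough because norm(h)^4 = norm(h^4) <= norm(h^3) norm(h).\<close>

lemma rank_one_norm_ge: assumes x: "x \<in> carrier X" shows "(hnorm A X x)\<^sup>2 \<le> anorm L (rank_one X x x)"
proof (cases "hnorm A X x = 0")
  case True
  then show ?thesis using op_nonneg rank_one_mem x by simp
next
  case False
  let ?h = "hinner X x x" and ?N = "anorm L (rank_one X x x)"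
  have h: "?h \<in> carrier A" "?h\<^sup>\<star>\<^bsub>A\<^esub> = ?h" using x by (simp_all add: inner_closed inner_star)
  have n: "hnorm A X x > 0" using False hnorm_nonneg[OF x] by simp
  have xh: "ract X x ?h \<in> carrier X" using x h by (simp add: ract_closed)
  have h4: "(anorm A ?h)\<^sup>2 * (anorm A ?h)\<^sup>2 \<le> anorm A (hinner X (ract X x ?h) (ract X x ?h)) * anorm A ?h"
  proof -
    have "(anorm A ?h)\<^sup>2 * (anorm A ?h)\<^sup>2 = anorm A ((?h \<odot>\<^bsub>A\<^esub> ?h) \<odot>\<^bsub>A\<^esub> (?h \<odot>\<^bsub>A\<^esub> ?h))"
      using A.norm_square[OF h] A.norm_square[of "?h \<odot>\<^bsub>A\<^esub> ?h"] h by (simp add: A.cl A.star_simps power2_eq_square)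
    also have "\<dots> = anorm A (hinner X (ract X x ?h) (ract X x ?h) \<odot>\<^bsub>A\<^esub> ?h)"
      using x h by (simp add: inner_ract_left inner_ract_right inner_closed ract_closed A.mult_assoc A.cl)
    also have "\<dots> \<le> anorm A (hinner X (ract X x ?h) (ract X x ?h)) * anorm A ?h"
      by (rule A.norm_mult[OF inner_closed[OF xh xh] h(1)])
    finally show ?thesis .
  qed
  have "hnorm A X (ract X x ?h) \<le> ?N * hnorm A X x"
    using op_le[OF rank_one_mem(1)[OF x x] x] by (simp add: rank_one_apply x)
  then have "(hnorm A X (ract X x ?h))\<^sup>2 \<le> (?N * hnorm A X x)\<^sup>2"
    using hnorm_nonneg[OF xh] by (intro power_mono)
  then have "(hnorm A X (ract X x ?h))\<^sup>2 * (hnorm A X x)\<^sup>2 \<le> (?N * hnorm A X x)\<^sup>2 * (hnorm A X x)\<^sup>2"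
    by (rule mult_right_mono) simp
  with h4 have "((hnorm A X x)\<^sup>2)\<^sup>2 * ((hnorm A X x)\<^sup>2)\<^sup>2 \<le> (?N * hnorm A X x)\<^sup>2 * (hnorm A X x)\<^sup>2"
    using hnorm_square[OF x] hnorm_square[OF xh] by simp
  also have "\<dots> = ?N\<^sup>2 * ((hnorm A X x)\<^sup>2)\<^sup>2" by (simp add: power2_eq_square)
  finally have "((hnorm A X x)\<^sup>2)\<^sup>2 \<le> ?N\<^sup>2" by (rule mult_right_le_imp_le) (use n in simp)
  then show ?thesis by (rule power2_le_imp_le) (use op_nonneg rank_one_mem x in simp)
qed

lemma L_vlsum_apply: "set Ts \<subseteq> carrier L \<Longrightarrow> z \<in> carrier X \<Longrightarrow> vlsum L Ts z = vlsum X (map (\<lambda>T. T z) Ts)"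
  by (induction Ts) (simp_all add: L_apply)

text \<open>Approximation of finitely many vectors by means of the positive operator \<open>h = \<Sum>x x*\<close>, rescaled: the
  operator \<open>w h w\<close> provided by \<open>approximate_unit\<close> is again of this form.\<close>

theorem frame:
  assumes xs: "set xs \<subseteq> carrier X" and e: "0 < \<epsilon>"
  shows "\<exists>us. set us \<subseteq> carrier X \<and>
    (\<forall>x\<in>set xs. hnorm A X (vdiff X x (vlsum X (map (\<lambda>u. ract X u (hinner X u x)) us))) \<le> \<epsilon>)"
proof -
  let ?Th = "map (\<lambda>x. rank_one X x x) xs"
  define h0 where "h0 = vlsum L ?Th"
  have Th: "set ?Th \<subseteq> carrier L" using xs rank_one_mem by auto
  have pos_list: "op.pos (vlsum L (map (\<lambda>x. rank_one X x x) ys))" if "set ys \<subseteq> carrier X" for ys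
    using that by (induction ys) (simp_all add: op.pos_zero op.pos_add rank_one_pos)
  have p0: "op.pos h0" unfolding h0_def by (rule pos_list[OF xs])
  note h0c = op.posD[OF p0]
  \<comment> \<open>\<open>approximate_unit\<close> needs norm at most 1. The factor reappears in
    the tolerance, since h contains each xx* only with weight s.\<close>
  define s where "s = 1 / (anorm L h0 + 1)"
  have s: "0 < s" using op_nonneg[OF h0c(1)] by (simp add: s_def)
  let ?s = "complex_of_real s"
  define h where "h = vscale L ?s h0"
  have hp: "op.pos h" unfolding h_def by (rule op.pos_scale[OF p0]) (use s in simp)
  have "anorm L h = s * anorm L h0" using op.norm_scale[OF h0c(1), of ?s] s by (simp add: h_def)
  then have h1: "anorm L h \<le> 1" using op_nonneg[OF h0c(1)] by (simp add: s_def)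
  obtain w where w: "w \<in> carrier L" "astar L w = w"
    and le: "anorm L (amult L (amult L (vdiff L op_id (amult L (amult L w h) w)) h) (vdiff L op_id (amult L (amult L w h) w))) \<le> s * \<epsilon>\<^sup>2"
    using op.approximate_unit[OF hp h1, of "s * \<epsilon>\<^sup>2"] s e by auto
  define K where "K = amult L (amult L w h) w"
  define M where "M = vdiff L op_id K"
  note hc = op.posD[OF hp]
  have Kc: "K \<in> carrier L" "astar L K = K" using w hc by (simp_all add: K_def op.cl op.star_simps op.mult_assoc)
  then have Mc: "M \<in> carrier L" "astar L M = M" by (simp_all add: M_def op.ucl op.star_simps op.u_star)
  \<comment> \<open>The weight s is split evenly between the two factors, so that whw becomes the
    sum of the operators uu*.\<close>
  define us where "us = map (\<lambda>x. complex_of_real (sqrt s) \<cdot>\<^bsub>X\<^esub> w x) xs"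
  have us: "set us \<subseteq> carrier X" using xs L_closed[OF w(1)] by (auto simp: us_def scale_closed)
  have K: "K = vlsum L (map (\<lambda>u. rank_one X u u) us)"
  proof -
    have step: "vscale L ?s (amult L (amult L w (rank_one X x x)) w) = rank_one X (complex_of_real (sqrt s) \<cdot>\<^bsub>X\<^esub> w x) (complex_of_real (sqrt s) \<cdot>\<^bsub>X\<^esub> w x)"
      if x: "x \<in> carrier X" for x
    proof -
      have wx: "w x \<in> carrier X" using L_closed[OF w(1) x] .
      have "amult L (amult L w (rank_one X x x)) w = rank_one X (w x) (w x)"
        using rank_one_mult[OF w(1)] x wx w(2) by simp
      then show ?thesis
        using wx s by (simp add: rank_one_scale scale_closed scale_scale of_real_mult[symmetric] del: of_real_mult)
    qed
    have K': "K = vscale L ?s (amult L (amult L w h0) w)"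
      using w(1) h0c(1) by (simp add: K_def h_def op.mult_scale_left op.mult_scale_right op.cl)
    have "vscale L ?s (amult L (amult L w (vlsum L (map (\<lambda>x. rank_one X x x) ys))) w) =
        vlsum L (map (\<lambda>u. rank_one X u u) (map (\<lambda>x. complex_of_real (sqrt s) \<cdot>\<^bsub>X\<^esub> w x) ys))"
      if "set ys \<subseteq> carrier X" for ys
      using that
    proof (induction ys)
      case Nil
      then show ?case using w(1) by (simp add: op.mult_zero op.scale_zero_right)
    next
      case (Cons y ys)
      then have "rank_one X y y \<in> carrier L" "vlsum L (map (\<lambda>x. rank_one X x x) ys) \<in> carrier L"
        using rank_one_mem op.posD(1)[OF pos_list] by auto
      then show ?case
        using Cons step[of y] w(1) by (simp add: op.mult_add_right op.mult_add_left op.scale_right_distrib op.cl)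
    qed
    then show ?thesis unfolding K' h0_def us_def using xs by blast
  qed
  have "hnorm A X (vdiff X x (vlsum X (map (\<lambda>u. ract X u (hinner X u x)) us))) \<le> \<epsilon>" if x: "x \<in> set xs" for x
  proof -
    have xc: "x \<in> carrier X" using x xs by blast
    \<comment> \<open>Splitting off the summand of x leaves a positive remainder. By
      \<open>pos_norm_mono\<close>, the part of MhM that belongs to x, which is s times the rank-one
      operator of Mx, is no larger in norm than MhM.\<close>
    have "\<exists>R. op.pos R \<and> vlsum L (map (\<lambda>x. rank_one X x x) ys) = vadd L (rank_one X x x) R"
      if "set ys \<subseteq> carrier X" "x \<in> set ys" for ys
      using that
    proof (induction ys)
      case (Cons y ys)
      show ?case
      proof (cases "x = y")
        case True
        then show ?thesis using pos_list[of ys] Cons.prems by auto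
      next
        case False
        then obtain R where R: "op.pos R" "vlsum L (map (\<lambda>x. rank_one X x x) ys) = vadd L (rank_one X x x) R"
          using Cons by auto
        have "op.pos (vadd L (rank_one X y y) R)" using R(1) Cons.prems by (intro op.pos_add rank_one_pos) auto
        moreover have "vlsum L (map (\<lambda>x. rank_one X x x) (y # ys)) = vadd L (rank_one X x x) (vadd L (rank_one X y y) R)"
          using R op.posD(1)[OF R(1)] Cons.prems rank_one_mem xc by (simp add: op.add_left_commute)
        ultimately show ?thesis by blast
      qed
    qed simp
    then obtain R where R: "op.pos R" "h0 = vadd L (rank_one X x x) R" using x xs unfolding h0_def by blast
    have Mx: "M x \<in> carrier X" by (rule L_closed[OF Mc(1) xc])
    let ?a = "amult L (amult L M (vscale L ?s (rank_one X x x))) M" and ?b = "amult L (amult L M (vscale L ?s R)) M"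
    note rc = rank_one_mem(1)[OF xc xc] op.posD(1)[OF R(1)]
    have "op.pos ?a" "op.pos ?b"
      using op.pos_conj[OF op.pos_scale[OF rank_one_pos[OF xc], of s] Mc(1)]
        op.pos_conj[OF op.pos_scale[OF R(1), of s] Mc(1)] s Mc(2) by simp_all
    then have "anorm L ?a \<le> anorm L (vadd L ?a ?b)" by (rule op.pos_norm_mono)
    also have "vadd L ?a ?b = amult L (amult L M h) M"
      using rc Mc(1) by (simp add: h_def R(2) op.scale_right_distrib op.mult_add_right op.mult_add_left op.cl)
    finally have "anorm L ?a \<le> s * \<epsilon>\<^sup>2" using le by (simp add: M_def K_def)
    moreover have "?a = vscale L ?s (rank_one X (M x) (M x))"
      using rank_one_mult[OF Mc(1)] xc Mx rc(1) rank_one_mem(1)[OF Mx xc] Mc by (simp add: op.mult_scale_left op.mult_scale_right op.cl)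
    ultimately have "s * anorm L (rank_one X (M x) (M x)) \<le> s * \<epsilon>\<^sup>2"
      using op.norm_scale[OF rank_one_mem(1)[OF Mx Mx], of ?s] s by simp
    then have "(hnorm A X (M x))\<^sup>2 \<le> \<epsilon>\<^sup>2" using rank_one_norm_ge[OF Mx] s by simp
    then have "hnorm A X (M x) \<le> \<epsilon>" by (rule power2_le_imp_le) (use e in simp)
    moreover have "M x = vdiff X x (vlsum X (map (\<lambda>u. ract X u (hinner X u x)) us))"
    proof -
      have "K x = vlsum X (map (\<lambda>u. ract X u (hinner X u x)) us)"
        unfolding K using L_vlsum_apply[of "map (\<lambda>u. rank_one X u u) us" x] us xc rank_one_mem
        by (auto simp: rank_one_apply o_def)
      then show ?thesis using xc by (simp add: M_def L_apply op_id_def)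
    qed
    ultimately show ?thesis by simp
  qed
  then show ?thesis using us by blast
qed

section \<open>The C*-algebra of compact operators\<close>

abbreviation rank_ones :: "('x \<Rightarrow> 'x) set" where
  "rank_ones \<equiv> {rank_one X x y | x y. x \<in> carrier X \<and> y \<in> carrier X}"

lemma scale_invariant_rank_ones: "op.nv.scale_invariant rank_ones"
  unfolding op.nv.scale_invariant_def using rank_one_mem rank_one_scale scale_closed by fastforce

lemma carrier_compacts: "carrier (compacts A X) = op.nv.cspan rank_ones"
  by (simp add: compacts_def op.nv.cspan_def cstar_dist_eq)

lemma compacts_eq: "compacts A X = L\<lparr>carrier := op.nv.cspan rank_ones\<rparr>"
  by (simp add: compacts_def op.nv.cspan_def cstar_dist_eq)

lemma rank_one_compact: "x \<in> carrier X \<Longrightarrow> y \<in> carrier X \<Longrightarrow> rank_one X x y \<in> carrier (compacts A X)"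
  unfolding carrier_compacts using op.nv.cspan_superset[OF scale_invariant_rank_ones] by blast

lemma compacts_cstar: "cstar_algebra (compacts A X)"
  unfolding compacts_eq
proof (rule op.subalgebra_cstar)
  note inv = scale_invariant_rank_ones
  note sub = op.nv.csubspace_cspan[OF inv] op.nv.nclosed_cspan[OF inv]
  show "op.nv.csubspace (op.nv.cspan rank_ones)" "op.nv.nclosed (op.nv.cspan rank_ones)" by (rule sub)+
  show "amult L S T \<in> op.nv.cspan rank_ones" if ST: "S \<in> op.nv.cspan rank_ones" "T \<in> op.nv.cspan rank_ones" for S T
  proof (rule op.cspan_mult[OF inv inv sub _ ST])
    fix s t assume "s \<in> rank_ones" "t \<in> rank_ones"
    then obtain x y x' y' where xy: "x \<in> carrier X" "y \<in> carrier X" "s = rank_one X x y"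
      "x' \<in> carrier X" "y' \<in> carrier X" "t = rank_one X x' y'" by blast
    have "amult L s t = rank_one X (s x') y'" using rank_one_mult(1)[OF rank_one_mem(1)] xy by simp
    moreover have "s x' \<in> carrier X" using L_closed rank_one_mem(1) xy by simp
    ultimately show "amult L s t \<in> op.nv.cspan rank_ones" using op.nv.cspan_superset[OF inv] xy by blast
  qed
  show "astar L S \<in> op.nv.cspan rank_ones" if S: "S \<in> op.nv.cspan rank_ones" for S
  proof (rule op.cspan_star[OF inv sub _ S])
    fix s assume "s \<in> rank_ones"
    then show "astar L s \<in> op.nv.cspan rank_ones" using rank_one_mem(2) op.nv.cspan_superset[OF inv] by fastforce
  qed
qed

end

section \<open>Extension of homomorphisms to closures\<close>

text \<open>A contractive homomorphism is given by its graph \<open>R\<close>; this spares a proof that it is well defined.\<close>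

lemma extend_graph:
  assumes A: "cstar_algebra A" and B: "cstar_algebra B" and R: "R \<subseteq> carrier A \<times> carrier B"
    and zero: "(\<zero>\<^sub>v\<^bsub>A\<^esub>, \<zero>\<^sub>v\<^bsub>B\<^esub>) \<in> R"
    and add: "\<And>a b a' b'. (a, b) \<in> R \<Longrightarrow> (a', b') \<in> R \<Longrightarrow> (a \<boxplus>\<^bsub>A\<^esub> a', b \<boxplus>\<^bsub>B\<^esub> b') \<in> R"
    and scale: "\<And>a b c. (a, b) \<in> R \<Longrightarrow> (c \<cdot>\<^bsub>A\<^esub> a, c \<cdot>\<^bsub>B\<^esub> b) \<in> R"
    and mult: "\<And>a b a' b'. (a, b) \<in> R \<Longrightarrow> (a', b') \<in> R \<Longrightarrow> (a \<odot>\<^bsub>A\<^esub> a', b \<odot>\<^bsub>B\<^esub> b') \<in> R"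
    and star: "\<And>a b. (a, b) \<in> R \<Longrightarrow> (a\<^sup>\<star>\<^bsub>A\<^esub>, b\<^sup>\<star>\<^bsub>B\<^esub>) \<in> R"
    and le: "\<And>a b. (a, b) \<in> R \<Longrightarrow> anorm B b \<le> anorm A a"
  shows "\<exists>h\<in>star_homs (A\<lparr>carrier := cstar_topology A closure_of (fst ` R)\<rparr>) B. \<forall>(a, b)\<in>R. h a = b"
proof -
  interpret A: cstar_algebra A by fact
  interpret B: cstar_algebra B by fact
  define D where "D = A.nv.nclosure (fst ` R)"
  have D: "D = cstar_topology A closure_of (fst ` R)" by (simp add: D_def cstar_dist_eq)
  have fR: "fst ` R \<subseteq> carrier A" using R by auto
  \<comment> \<open>The closure of the graph. It is single-valued because the norm bound passes to
    limits and applies to differences.\<close>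
  define rel where "rel x y \<longleftrightarrow> (\<exists>s t. (\<forall>n. (s n, t n) \<in> R) \<and> A.nv.conv s x \<and> B.nv.conv t y)" for x y
  have relI: "rel x y" if "\<And>n. (s n, t n) \<in> R" "A.nv.conv s x" "B.nv.conv t y" for s t x y
    using that unfolding rel_def by blast
  have relE: "\<exists>s t. (\<forall>n. (s n, t n) \<in> R) \<and> A.nv.conv s x \<and> B.nv.conv t y" if "rel x y" for x y
    using that unfolding rel_def .
  have diff: "(vdiff A a a', vdiff B b b') \<in> R" if "(a, b) \<in> R" "(a', b') \<in> R" for a b a' b'
    using add[OF that(1) scale[OF that(2), of "-1"]] by (simp add: vdiff_def)
  have rel_D: "x \<in> D" "y \<in> carrier B" if "rel x y" for x y
  proof -
    obtain s t where s: "\<And>n. (s n, t n) \<in> R" "A.nv.conv s x" "B.nv.conv t y" using relE[OF \<open>rel x y\<close>] by blast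
    have "s n \<in> D" for n using s(1)[of n] A.nv.closure_superset[OF fR] unfolding D_def by force
    then show "x \<in> D" using A.nv.nclosed_conv[OF A.nv.closure_nclosed[OF fR]] s(2) unfolding D_def by blast
    show "y \<in> carrier B" by (rule B.nv.convD(2)[OF s(3)])
  qed
  have rel_total: "\<exists>y. rel x y" if x: "x \<in> D" for x
  proof -
    obtain s where s: "\<And>n. s n \<in> fst ` R" "A.nv.conv s x"
      using A.nv.closure_conv[OF fR, of x] x by (auto simp: D_def)
    then have "\<forall>n. \<exists>b. (s n, b) \<in> R" by force
    then obtain t where t: "\<And>n. (s n, t n) \<in> R" by metis
    have "B.nv.ncauchy t"
      unfolding B.nv.ncauchy_def
    proof (intro conjI allI impI)
      show "t n \<in> carrier B" for n using t[of n] R by blast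
      fix \<epsilon> :: real assume "\<epsilon> > 0"
      then obtain N where "\<forall>m\<ge>N. \<forall>n\<ge>N. anorm A (vdiff A (s m) (s n)) < \<epsilon>"
        using A.nv.conv_ncauchy[OF s(2)] unfolding A.nv.ncauchy_def by blast
      then show "\<exists>N. \<forall>m\<ge>N. \<forall>n\<ge>N. anorm B (vdiff B (t m) (t n)) < \<epsilon>"
        using le[OF diff[OF t t]] by (meson le_less_trans)
    qed
    then obtain y where "B.nv.conv t y" using B.nv.ncauchy_conv by blast
    then show ?thesis using relI[OF t s(2)] by blast
  qed
  have rel_ops: "rel (x \<boxplus>\<^bsub>A\<^esub> x') (y \<boxplus>\<^bsub>B\<^esub> y')" "rel (c \<cdot>\<^bsub>A\<^esub> x) (c \<cdot>\<^bsub>B\<^esub> y)"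
      "rel (x \<odot>\<^bsub>A\<^esub> x') (y \<odot>\<^bsub>B\<^esub> y')" "rel (x\<^sup>\<star>\<^bsub>A\<^esub>) (y\<^sup>\<star>\<^bsub>B\<^esub>)" "rel (vdiff A x x') (vdiff B y y')"
    if r: "rel x y" "rel x' y'" for x y x' y' c
  proof -
    obtain s t where s: "\<And>n. (s n, t n) \<in> R" "A.nv.conv s x" "B.nv.conv t y" using relE[OF r(1)] by blast
    obtain s' t' where s': "\<And>n. (s' n, t' n) \<in> R" "A.nv.conv s' x'" "B.nv.conv t' y'" using relE[OF r(2)] by blast
    show "rel (x \<boxplus>\<^bsub>A\<^esub> x') (y \<boxplus>\<^bsub>B\<^esub> y')"
      by (rule relI[OF add[OF s(1) s'(1)] A.nv.conv_add[OF s(2) s'(2)] B.nv.conv_add[OF s(3) s'(3)]])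
    show "rel (c \<cdot>\<^bsub>A\<^esub> x) (c \<cdot>\<^bsub>B\<^esub> y)"
      by (rule relI[OF scale[OF s(1)] A.nv.conv_scale[OF s(2)] B.nv.conv_scale[OF s(3)]])
    show "rel (x \<odot>\<^bsub>A\<^esub> x') (y \<odot>\<^bsub>B\<^esub> y')"
      by (rule relI[OF mult[OF s(1) s'(1)] A.conv_mult[OF s(2) s'(2)] B.conv_mult[OF s(3) s'(3)]])
    show "rel (x\<^sup>\<star>\<^bsub>A\<^esub>) (y\<^sup>\<star>\<^bsub>B\<^esub>)"
      by (rule relI[OF star[OF s(1)] A.conv_star[OF s(2)] B.conv_star[OF s(3)]])
    show "rel (vdiff A x x') (vdiff B y y')"
      by (rule relI[OF diff[OF s(1) s'(1)] A.nv.conv_diff[OF s(2) s'(2)] B.nv.conv_diff[OF s(3) s'(3)]])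
  qed
  have rel_le: "anorm B y \<le> anorm A x" if r: "rel x y" for x y
  proof -
    obtain s t where s: "\<And>n. (s n, t n) \<in> R" "A.nv.conv s x" "B.nv.conv t y" using relE[OF r] by blast
    show ?thesis
      by (rule LIMSEQ_le[OF B.nv.conv_norm[OF s(3)] A.nv.conv_norm[OF s(2)]]) (use le[OF s(1)] in blast)
  qed
  have rel_unique: "y = y'" if "rel x y" "rel x y'" for x y y'
  proof -
    have "x \<in> carrier A" using rel_D(1)[OF that(1)] A.nv.in_closure[OF fR] unfolding D_def by blast
    then have "anorm B (vdiff B y y') \<le> 0"
      using rel_le[OF rel_ops(5)[OF that]] by (simp add: A.diff_self A.nv.nrm_zero)
    then have "anorm B (vdiff B y y') = 0" using B.norm_nonneg B.diff_closed rel_D(2) that by (meson order_antisym)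
    then show ?thesis using B.norm_eq_zero B.diff_closed B.diff_eq_zero rel_D(2) that by metis
  qed
  define h where "h = (\<lambda>x\<in>D. THE y. rel x y)"
  have h: "h x = y" if "rel x y" for x y
  proof -
    have "(THE y. rel x y) = y" by (rule the_equality[where P = "rel x", OF that]) (rule rel_unique[OF _ that])
    then show ?thesis using rel_D(1)[OF that] by (simp add: h_def)
  qed
  have hrel: "rel x (h x)" if "x \<in> D" for x using rel_total[OF that] h by auto
  have "h \<in> star_homs (A\<lparr>carrier := D\<rparr>) B"
  proof (rule star_homsI)
    fix a b c assume "a \<in> carrier (A\<lparr>carrier := D\<rparr>)"
    then have a: "rel a (h a)" by (simp add: hrel)
    show "h a \<in> carrier B" by (rule rel_D(2)[OF a])
    show "h (c \<cdot>\<^bsub>A\<lparr>carrier := D\<rparr>\<^esub> a) = c \<cdot>\<^bsub>B\<^esub> h a" using h[OF rel_ops(2)[OF a a]] by simp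
    show "h (a\<^sup>\<star>\<^bsub>A\<lparr>carrier := D\<rparr>\<^esub>) = (h a)\<^sup>\<star>\<^bsub>B\<^esub>" using h[OF rel_ops(4)[OF a a]] by simp
    assume "b \<in> carrier (A\<lparr>carrier := D\<rparr>)"
    then have b: "rel b (h b)" by (simp add: hrel)
    show "h (a \<boxplus>\<^bsub>A\<lparr>carrier := D\<rparr>\<^esub> b) = h a \<boxplus>\<^bsub>B\<^esub> h b" using h[OF rel_ops(1)[OF a b]] by simp
    show "h (a \<odot>\<^bsub>A\<lparr>carrier := D\<rparr>\<^esub> b) = h a \<odot>\<^bsub>B\<^esub> h b" using h[OF rel_ops(3)[OF a b]] by simp
  qed (simp add: h_def)
  moreover have "h a = b" if "(a, b) \<in> R" for a b
  proof (rule h)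
    have "a \<in> carrier A" "b \<in> carrier B" using that R by auto
    then show "rel a b" using that by (intro relI[of "\<lambda>_. a" "\<lambda>_. b"] A.nv.conv_const B.nv.conv_const)
  qed
  ultimately show ?thesis unfolding D by blast
qed

section \<open>The representation of the compact operators\<close>

text \<open>A single fibre of a representation together with the coefficient map
  \<open>\<pi>\<close>: the data from which the homomorphism on the compacts is built.\<close>

locale module_rep = hilbert_module A X + B: cstar_algebra B
  for A :: "'a cstar" and X :: "('a, 'x) hbimod" and B :: "'b cstar" +
  fixes \<psi> :: "'x \<Rightarrow> 'b" and \<pi> :: "'a \<Rightarrow> 'b"
  assumes lin_psi: "linear_map X B \<psi>"
    and pi_hom: "\<pi> \<in> star_homs A B"
    and psi_ract: "x \<in> carrier X \<Longrightarrow> a \<in> carrier A \<Longrightarrow> \<psi> (ract X x a) = \<psi> x \<odot>\<^bsub>B\<^esub> \<pi> a"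
    and psi_inner: "x \<in> carrier X \<Longrightarrow> y \<in> carrier X \<Longrightarrow> \<pi> (hinner X x y) = (\<psi> x)\<^sup>\<star>\<^bsub>B\<^esub> \<odot>\<^bsub>B\<^esub> \<psi> y"
begin

lemma psi_closed: "x \<in> carrier X \<Longrightarrow> \<psi> x \<in> carrier B"
  and psi_add: "x \<in> carrier X \<Longrightarrow> y \<in> carrier X \<Longrightarrow> \<psi> (x \<boxplus>\<^bsub>X\<^esub> y) = \<psi> x \<boxplus>\<^bsub>B\<^esub> \<psi> y"
  and psi_scale: "x \<in> carrier X \<Longrightarrow> \<psi> (c \<cdot>\<^bsub>X\<^esub> x) = c \<cdot>\<^bsub>B\<^esub> \<psi> x"
  using lin_psi by (auto simp: linear_map_def)

lemma psi_zero: "\<psi> \<zero>\<^sub>v\<^bsub>X\<^esub> = \<zero>\<^sub>v\<^bsub>B\<^esub>"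
proof -
  have "\<psi> (0 \<cdot>\<^bsub>X\<^esub> \<zero>\<^sub>v\<^bsub>X\<^esub>) = 0 \<cdot>\<^bsub>B\<^esub> \<psi> \<zero>\<^sub>v\<^bsub>X\<^esub>" by (rule psi_scale[OF zero_closed])
  then show ?thesis by (simp only: scale_zero_left[OF zero_closed] B.scale_zero_left[OF psi_closed[OF zero_closed]])
qed

lemma psi_diff: "x \<in> carrier X \<Longrightarrow> y \<in> carrier X \<Longrightarrow> \<psi> (vdiff X x y) = vdiff B (\<psi> x) (\<psi> y)"
  by (simp add: vdiff_def psi_add psi_scale scale_closed)

lemma psi_vlsum: "set xs \<subseteq> carrier X \<Longrightarrow> \<psi> (vlsum X xs) = vlsum B (map \<psi> xs)"
  by (induction xs) (simp_all add: psi_zero psi_add vlsum_closed)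

lemma psi_norm_le: assumes x: "x \<in> carrier X" shows "anorm B (\<psi> x) \<le> hnorm A X x"
proof (rule power2_le_imp_le)
  interpret pi: star_hom A B \<pi> by unfold_locales (rule pi_hom)
  show "(anorm B (\<psi> x))\<^sup>2 \<le> (hnorm A X x)\<^sup>2"
    using pi.norm_hom_le[OF inner_closed[OF x x]] B.cstar_identity[OF psi_closed[OF x]] psi_inner[OF x x] hnorm_square[OF x]
    by simp
qed (rule hnorm_nonneg[OF x])

text \<open>A list of pairs \<open>(x, y)\<close> stands for the operator \<open>\<Sum>x y*\<close>.\<close>

abbreviation pairs :: "('x \<times> 'x) list \<Rightarrow> bool" where "pairs l \<equiv> set l \<subseteq> carrier X \<times> carrier X"

definition rk :: "('x \<times> 'x) list \<Rightarrow> 'x \<Rightarrow> 'x" where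
  "rk l = vlsum L (map (\<lambda>(x, y). rank_one X x y) l)"

definition tau :: "('x \<times> 'x) list \<Rightarrow> 'b" where
  "tau l = vlsum B (map (\<lambda>(x, y). \<psi> x \<odot>\<^bsub>B\<^esub> (\<psi> y)\<^sup>\<star>\<^bsub>B\<^esub>) l)"

definition lact_pairs :: "('x \<Rightarrow> 'x) \<Rightarrow> ('x \<times> 'x) list \<Rightarrow> ('x \<times> 'x) list" where
  "lact_pairs T l = map (\<lambda>(x, y). (T x, y)) l"

lemma rk_simps: "rk [] = vzero L" "rk (p # l) = vadd L (rank_one X (fst p) (snd p)) (rk l)"
  by (simp_all add: rk_def split: prod.splits)

lemma tau_simps: "tau [] = \<zero>\<^sub>v\<^bsub>B\<^esub>" "tau (p # l) = (\<psi> (fst p) \<odot>\<^bsub>B\<^esub> (\<psi> (snd p))\<^sup>\<star>\<^bsub>B\<^esub>) \<boxplus>\<^bsub>B\<^esub> tau l"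
  by (simp_all add: tau_def split: prod.splits)

lemma lact_pairs_simps: "lact_pairs T [] = []" "lact_pairs T (p # l) = (T (fst p), snd p) # lact_pairs T l"
  by (simp_all add: lact_pairs_def split: prod.splits)

lemma rk_closed: "pairs l \<Longrightarrow> rk l \<in> carrier L"
  by (induction l) (auto simp: rk_simps L_zero_mem op.add_closed rank_one_mem)

lemma tau_closed: "pairs l \<Longrightarrow> tau l \<in> carrier B"
  by (induction l) (auto simp: tau_simps B.cl psi_closed)

lemma rk_append: "pairs l \<Longrightarrow> pairs m \<Longrightarrow> rk (l @ m) = vadd L (rk l) (rk m)"
  by (induction l) (auto simp: rk_simps op.zero_add rk_closed op.add_assoc rank_one_mem)

lemma tau_append: "pairs l \<Longrightarrow> pairs m \<Longrightarrow> tau (l @ m) = tau l \<boxplus>\<^bsub>B\<^esub> tau m"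
  by (induction l) (auto simp: tau_simps B.zero_add tau_closed B.add_assoc B.cl psi_closed)

lemma pairs_lact: "T \<in> carrier L \<Longrightarrow> pairs l \<Longrightarrow> pairs (lact_pairs T l)"
  by (auto simp: lact_pairs_def L_closed)

lemma rk_lact: "T \<in> carrier L \<Longrightarrow> pairs l \<Longrightarrow> rk (lact_pairs T l) = amult L T (rk l)"
  by (induction l) (auto simp: rk_simps lact_pairs_simps op.mult_zero op.mult_add_right rank_one_mem rk_closed rank_one_mult)

lemma rk_scale: "pairs l \<Longrightarrow> rk (map (\<lambda>(x, y). (c \<cdot>\<^bsub>X\<^esub> x, y)) l) = vscale L c (rk l)"
  by (induction l) (auto simp: rk_simps op.scale_zero_right op.scale_right_distrib rank_one_mem rk_closed rank_one_scale)

lemma tau_scale: "pairs l \<Longrightarrow> tau (map (\<lambda>(x, y). (c \<cdot>\<^bsub>X\<^esub> x, y)) l) = c \<cdot>\<^bsub>B\<^esub> tau l"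
  by (induction l) (auto simp: tau_simps B.scale_zero_right B.scale_right_distrib tau_closed psi_closed B.cl psi_scale B.mult_scale_left)

lemma rk_swap: "pairs l \<Longrightarrow> rk (map (\<lambda>(x, y). (y, x)) l) = astar L (rk l)"
  by (induction l) (auto simp: rk_simps op.star_zero op.star_add rank_one_mem rk_closed)

lemma tau_swap: "pairs l \<Longrightarrow> tau (map (\<lambda>(x, y). (y, x)) l) = (tau l)\<^sup>\<star>\<^bsub>B\<^esub>"
  by (induction l) (auto simp: tau_simps B.star_zero B.star_add tau_closed psi_closed B.cl B.star_mult B.star_star)

lemma psi_rk: "pairs l \<Longrightarrow> z \<in> carrier X \<Longrightarrow> \<psi> (rk l z) = tau l \<odot>\<^bsub>B\<^esub> \<psi> z"
proof (induction l)
  case Nil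
  then show ?case by (simp add: rk_simps tau_simps L_apply psi_zero B.mult_zero psi_closed)
next
  case (Cons p l)
  obtain x y where p: "p = (x, y)" by force
  have c: "x \<in> carrier X" "y \<in> carrier X" "pairs l" using Cons.prems p by auto
  have "\<psi> (rk (p # l) z) = \<psi> x \<odot>\<^bsub>B\<^esub> \<pi> (hinner X y z) \<boxplus>\<^bsub>B\<^esub> \<psi> (rk l z)"
    using c Cons.prems L_closed[OF rk_closed[OF c(3)]]
    by (simp add: p rk_simps L_apply rank_one_apply psi_add ract_closed inner_closed psi_ract)
  then show ?case
    using c Cons by (simp add: p tau_simps psi_inner psi_closed B.mult_add_left tau_closed B.mult_assoc B.cl)
qed

lemma tau_lact: assumes l: "pairs l" shows "pairs m \<Longrightarrow> tau (lact_pairs (rk l) m) = tau l \<odot>\<^bsub>B\<^esub> tau m"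
  by (induction m) (auto simp: lact_pairs_simps tau_simps B.mult_zero tau_closed l psi_rk B.mult_add_right psi_closed
      B.cl B.mult_assoc)

text \<open>The constant, a sum of products norm(x) norm(y), is independent of T; taking powers
  removes it later. The bound M is kept apart from norm(T) so that a power of norm(S) can be
  inserted.\<close>

lemma tau_lact_norm_le:
  assumes "pairs m"
  shows "\<exists>C\<ge>0. \<forall>T M. T \<in> carrier L \<longrightarrow> anorm L T \<le> M \<longrightarrow> anorm B (tau (lact_pairs T m)) \<le> M * C"
  using assms
proof (induction m)
  case Nil
  then show ?case by (intro exI[of _ 0]) (simp add: lact_pairs_simps tau_simps B.nv.nrm_zero)
next
  case (Cons p m)
  obtain x y where p: "p = (x, y)" by force
  have c: "x \<in> carrier X" "y \<in> carrier X" "pairs m" using Cons.prems p by auto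
  obtain C where C: "C \<ge> 0" "\<And>T M. T \<in> carrier L \<Longrightarrow> anorm L T \<le> M \<Longrightarrow> anorm B (tau (lact_pairs T m)) \<le> M * C"
    using Cons.IH[OF c(3)] by blast
  have "anorm B (tau (lact_pairs T (p # m))) \<le> M * (hnorm A X x * hnorm A X y + C)"
    if T: "T \<in> carrier L" "anorm L T \<le> M" for T M
  proof -
    have Tx: "T x \<in> carrier X" by (rule L_closed[OF T(1) c(1)])
    have "anorm B (\<psi> (T x)) \<le> M * hnorm A X x"
      using psi_norm_le[OF Tx] op_le[OF T(1) c(1)] mult_right_mono[OF T(2) hnorm_nonneg[OF c(1)]] by linarith
    then have "anorm B (\<psi> (T x)) * anorm B ((\<psi> y)\<^sup>\<star>\<^bsub>B\<^esub>) \<le> (M * hnorm A X x) * hnorm A X y"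
      using psi_norm_le[OF c(2)] psi_closed[OF c(2)] B.norm_nonneg op_nonneg[OF T(1)] T(2) hnorm_nonneg[OF c(1)] psi_closed[OF Tx]
      by (intro mult_mono) (auto simp: B.norm_star)
    then have "anorm B (\<psi> (T x) \<odot>\<^bsub>B\<^esub> (\<psi> y)\<^sup>\<star>\<^bsub>B\<^esub>) \<le> (M * hnorm A X x) * hnorm A X y"
      using B.norm_mult[OF psi_closed[OF Tx] B.star_closed[OF psi_closed[OF c(2)]]] by linarith
    moreover have "anorm B (tau (lact_pairs T (p # m))) \<le> anorm B (\<psi> (T x) \<odot>\<^bsub>B\<^esub> (\<psi> y)\<^sup>\<star>\<^bsub>B\<^esub>) + anorm B (tau (lact_pairs T m))"
      using Tx c T pairs_lact[OF T(1) c(3)] by (simp add: p lact_pairs_simps tau_simps B.norm_triangle B.cl psi_closed tau_closed)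
    ultimately show ?thesis using C(2)[OF T] by (simp add: algebra_simps)
  qed
  moreover have "0 \<le> hnorm A X x * hnorm A X y + C" using C(1) hnorm_nonneg c by simp
  ultimately show ?case by blast
qed

text \<open>If \<open>t = tau m\<close> corresponds to \<open>S = rk m\<close> then \<open>t\<^sup>k\<^sup>+\<^sup>1\<close> is \<open>\<Sum>\<psi>(S\<^sup>kx)\<psi>(y)*\<close>, whose norm is at most a
  constant times \<open>\<parallel>S\<parallel>\<^sup>k\<close>. For self-adjoint \<open>t\<close> and \<open>k + 1 = 2\<^sup>n\<close> the left side has norm \<open>\<parallel>t\<parallel>\<^sup>k\<^sup>+\<^sup>1\<close>.\<close>

lemma tau_norm_le_self_adjoint:
  assumes m: "pairs m" and sa: "(tau m)\<^sup>\<star>\<^bsub>B\<^esub> = tau m"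
  shows "anorm B (tau m) \<le> anorm L (rk m)"
proof (rule ccontr)
  assume neg: "\<not> ?thesis"
  define t where "t = tau m"
  define S where "S = rk m"
  have tc: "t \<in> carrier B" and Sc: "S \<in> carrier L" using m by (simp_all add: t_def S_def tau_closed rk_closed)
  \<comment> \<open>\<open>p k\<close> is the power of t with exponent k + 1, since \<open>B\<close>
    may have no unit to start from; \<open>Q k\<close> is the k-th power of S and can start from the
    identity operator.\<close>
  define p where "p = rec_nat t (\<lambda>_ x. t \<odot>\<^bsub>B\<^esub> x)"
  have p0: "p 0 = t" and pS: "p (Suc k) = t \<odot>\<^bsub>B\<^esub> p k" for k by (simp_all add: p_def)
  have pc: "p k \<in> carrier B" for k by (induction k) (simp_all add: p0 pS tc B.cl)
  have padd: "p (Suc (i + j)) = p i \<odot>\<^bsub>B\<^esub> p j" for i j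
    by (induction i) (simp_all add: p0 pS tc pc B.mult_assoc)
  define Q where "Q = rec_nat op_id (\<lambda>_ T. amult L S T)"
  have Q0: "Q 0 = op_id" and QS: "Q (Suc k) = amult L S (Q k)" for k by (simp_all add: Q_def)
  have Qc: "Q k \<in> carrier L" for k by (induction k) (simp_all add: Q0 QS Sc op.ucl)
  have Qn: "anorm L (Q k) \<le> (anorm L S) ^ k" for k
  proof (induction k)
    case (Suc k)
    have "anorm L (Q (Suc k)) \<le> anorm L S * anorm L (Q k)" unfolding QS by (rule op.norm_mult[OF Sc Qc])
    also have "\<dots> \<le> anorm L S * (anorm L S) ^ k" by (rule mult_left_mono[OF Suc op_nonneg[OF Sc]])
    finally show ?case by simp
  qed (simp add: Q0 op.norm_u_le)
  have pQ: "p k = tau (lact_pairs (Q k) m)" for k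
  proof (induction k)
    case 0
    have "lact_pairs op_id m = m" using m by (induction m) (auto simp: lact_pairs_simps op_id_def)
    then show ?case by (simp add: p0 Q0 t_def)
  next
    case (Suc k)
    have "p (Suc k) = tau (lact_pairs S (lact_pairs (Q k) m))"
      unfolding pS Suc S_def t_def by (rule tau_lact[OF m pairs_lact[OF Qc m], symmetric])
    also have "lact_pairs S (lact_pairs (Q k) m) = lact_pairs (Q (Suc k)) m"
      using m by (induction m) (auto simp: lact_pairs_simps QS L_apply)
    finally show ?case .
  qed
  obtain C where C: "C \<ge> 0" "\<And>T M. T \<in> carrier L \<Longrightarrow> anorm L T \<le> M \<Longrightarrow> anorm B (tau (lact_pairs T m)) \<le> M * C"
    using tau_lact_norm_le[OF m] by blast
  \<comment> \<open>The exponent 2^n - 1 compensates for the shift in \<open>p\<close>, so that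
    \<open>q n\<close> is the power of t with exponent 2^n, reached by repeated squaring.\<close>
  define q where "q n = p (2 ^ n - 1)" for n :: nat
  have qS: "q (Suc n) = q n \<odot>\<^bsub>B\<^esub> q n" for n
  proof -
    obtain k where "(2::nat) ^ n = Suc k" using not0_implies_Suc[of "2 ^ n"] by auto
    then have "(2::nat) ^ Suc n - 1 = Suc ((2 ^ n - 1) + (2 ^ n - 1))" by simp
    then show ?thesis unfolding q_def using padd by metis
  qed
  have qn: "(q n)\<^sup>\<star>\<^bsub>B\<^esub> = q n \<and> anorm B (q n) = anorm B t ^ (2 ^ n)" for n
  proof (induction n)
    case 0
    then show ?case using sa by (simp add: q_def p0 t_def)
  next
    case (Suc n)
    have "q n \<in> carrier B" by (simp add: q_def pc)
    then show ?case using Suc B.norm_square[of "q n"]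
      by (simp add: qS B.star_simps power_mult[symmetric] mult.commute)
  qed
  have le: "anorm B t ^ (2 ^ n) \<le> anorm L S ^ (2 ^ n - 1) * C" for n :: nat
    using C(2)[OF Qc Qn, of "2 ^ n - 1"] qn[of n] by (simp add: q_def pQ)
  have lt: "anorm L S < anorm B t" using neg by (simp add: t_def S_def)
  show False
  proof (cases "anorm L S = 0")
    case True
    then have "(anorm B t)\<^sup>2 \<le> 0" using le[of 1] by simp
    then show False using lt True by simp
  next
    case False
    then have S0: "anorm L S > 0" using op_nonneg[OF Sc] by simp
    define r where "r = anorm B t / anorm L S"
    have r: "1 < r" using lt S0 by (simp add: r_def)
    have bound: "r ^ (2 ^ n) \<le> C / anorm L S" for n :: nat
    proof -
      have "anorm L S ^ (2 ^ n) = anorm L S ^ (2 ^ n - 1) * anorm L S"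
        using power_Suc2[of "anorm L S" "2 ^ n - 1"] by simp
      then show ?thesis using le[of n] S0 by (simp add: r_def power_divide field_simps)
    qed
    \<comment> \<open>The powers of r > 1 are unbounded, whereas those with exponents 2^n have just
      been bounded.\<close>
    obtain n where "C / anorm L S < r ^ n" using real_arch_pow[OF r] by blast
    also have "r ^ n \<le> r ^ (2 ^ n)" using r by (intro power_increasing) (simp_all add: less_imp_le)
    finally show False using bound[of n] by simp
  qed
qed

text \<open>A list for S*S yields the self-adjoint element t*t, and the C*-identities on both sides
  reduce to the self-adjoint case.\<close>

lemma tau_norm_le: assumes l: "pairs l" shows "anorm B (tau l) \<le> anorm L (rk l)"
proof (rule power2_le_imp_le)
  let ?l' = "map (\<lambda>(x, y). (y, x)) l"
  let ?m = "lact_pairs (rk ?l') l"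
  have l': "pairs ?l'" using l by auto
  have m: "pairs ?m" by (rule pairs_lact[OF rk_closed[OF l'] l])
  have t: "tau ?m = (tau l)\<^sup>\<star>\<^bsub>B\<^esub> \<odot>\<^bsub>B\<^esub> tau l" using tau_lact[OF l' l] tau_swap[OF l] by simp
  have r: "rk ?m = amult L (astar L (rk l)) (rk l)" using rk_lact[OF rk_closed[OF l'] l] rk_swap[OF l] by simp
  have "anorm B (tau ?m) \<le> anorm L (rk ?m)"
    by (rule tau_norm_le_self_adjoint[OF m]) (use tau_closed[OF l] in \<open>simp add: t B.star_simps B.cl\<close>)
  then show "(anorm B (tau l))\<^sup>2 \<le> (anorm L (rk l))\<^sup>2"
    unfolding t r using B.cstar_identity[OF tau_closed[OF l]] op.cstar_identity[OF rk_closed[OF l]] by simp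
qed (rule op_nonneg[OF rk_closed[OF l]])

lemma range_rk: "{rk l | l. pairs l} = vspan L rank_ones"
proof -
  have iff: "(\<exists>l. pairs l \<and> xs = map (\<lambda>(x, y). rank_one X x y) l) \<longleftrightarrow> set xs \<subseteq> rank_ones" for xs
  proof
    assume "set xs \<subseteq> rank_ones"
    then show "\<exists>l. pairs l \<and> xs = map (\<lambda>(x, y). rank_one X x y) l"
    proof (induction xs)
      case (Cons a xs)
      then obtain l x y where "pairs l" "xs = map (\<lambda>(x, y). rank_one X x y) l" "x \<in> carrier X" "y \<in> carrier X" "a = rank_one X x y"
        by auto
      then show ?case by (intro exI[of _ "(x, y) # l"]) simp
    qed simp
  next
    assume "\<exists>l. pairs l \<and> xs = map (\<lambda>(x, y). rank_one X x y) l"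
    then obtain l where "pairs l" "xs = map (\<lambda>(x, y). rank_one X x y) l" by blast
    then show "set xs \<subseteq> rank_ones" by fastforce
  qed
  show ?thesis unfolding op.nv.vspan_eq[OF scale_invariant_rank_ones] rk_def iff[symmetric] by blast
qed

lemma rk_compact: assumes "pairs l" shows "rk l \<in> carrier (compacts A X)"
proof -
  have "vspan L rank_ones \<subseteq> carrier L"
    using op.nv.csubspace_vspan[OF scale_invariant_rank_ones] by (simp add: op.nv.csubspace_def)
  moreover have "rk l \<in> vspan L rank_ones" unfolding range_rk[symmetric] using assms by blast
  ultimately show ?thesis unfolding carrier_compacts op.nv.cspan_def using op.nv.closure_superset by blast
qed

lemma rk_dense:
  assumes "T \<in> carrier (compacts A X)" "0 < \<epsilon>"
  shows "\<exists>l. pairs l \<and> anorm L (vdiff L T (rk l)) < \<epsilon>"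
proof -
  have "vspan L rank_ones \<subseteq> carrier L"
    using op.nv.csubspace_vspan[OF scale_invariant_rank_ones] by (simp add: op.nv.csubspace_def)
  from op.nv.in_closure[OF this, of T] assms obtain y where "y \<in> vspan L rank_ones" "anorm L (vdiff L T y) < \<epsilon>"
    unfolding carrier_compacts op.nv.cspan_def by blast
  then have "y \<in> {rk l | l. pairs l}" unfolding range_rk by blast
  then show ?thesis using \<open>anorm L (vdiff L T y) < \<epsilon>\<close> by blast
qed

lemma compacts_simps: "vadd (compacts A X) = vadd L" "vzero (compacts A X) = vzero L" "vscale (compacts A X) = vscale L"
  "amult (compacts A X) = amult L" "astar (compacts A X) = astar L" "anorm (compacts A X) = anorm L"
  "vdiff (compacts A X) = vdiff L"
  by (simp_all add: compacts_def vdiff_def fun_eq_iff)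

lemma compacts_hom_rk:
  assumes h: "h \<in> star_homs (compacts A X) B"
    and rank: "\<And>x y. x \<in> carrier X \<Longrightarrow> y \<in> carrier X \<Longrightarrow> h (rank_one X x y) = \<psi> x \<odot>\<^bsub>B\<^esub> (\<psi> y)\<^sup>\<star>\<^bsub>B\<^esub>"
  shows "pairs l \<Longrightarrow> h (rk l) = tau l"
proof (induction l)
  case Nil
  interpret h: star_hom "compacts A X" B h
    using compacts_cstar B.cstar_algebra_axioms h by (simp add: star_hom_def star_hom_axioms_def)
  show ?case using h.hom_zero by (simp add: rk_simps tau_simps compacts_simps)
next
  case (Cons p l)
  then show ?case
    using star_homsD(2)[OF h, of "rank_one X (fst p) (snd p)" "rk l"] rank_one_compact rk_compact rank
    by (auto simp: rk_simps tau_simps compacts_simps)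
qed

text \<open>This gives the description in \<open>compact_rep\<close> a definite value. For
  existence, \<open>tau_norm_le\<close> makes the passage from \<open>rk l\<close> to
  \<open>tau l\<close> contractive, hence independent of the list; uniqueness is density of the
  finite sums.\<close>

theorem compact_rep_ex1:
  "\<exists>!h. h \<in> star_homs (compacts A X) B \<and>
     (\<forall>x\<in>carrier X. \<forall>y\<in>carrier X. h (rank_one X x y) = \<psi> x \<odot>\<^bsub>B\<^esub> (\<psi> y)\<^sup>\<star>\<^bsub>B\<^esub>)"
proof (rule ex_ex1I)
  define R where "R = {(rk l, tau l) | l. pairs l}"
  have I: "(rk l, tau l) \<in> R" if "pairs l" for l using that by (auto simp: R_def)
  have E: "\<exists>l. pairs l \<and> a = rk l \<and> b = tau l" if "(a, b) \<in> R" for a b using that by (auto simp: R_def)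
  have "\<exists>h\<in>star_homs (L\<lparr>carrier := cstar_topology L closure_of (fst ` R)\<rparr>) B. \<forall>(a, b)\<in>R. h a = b"
  proof (rule extend_graph)
    show "cstar_algebra L" "cstar_algebra B" ..
    show "R \<subseteq> carrier L \<times> carrier B" using rk_closed tau_closed by (auto simp: R_def)
    show "(vzero L, vzero B) \<in> R" using I[of "[]"] by (simp add: rk_simps tau_simps)
    fix a b c assume "(a, b) \<in> R"
    then obtain l where l: "pairs l" "a = rk l" "b = tau l" using E by blast
    show "anorm B b \<le> anorm L a" using tau_norm_le l by simp
    have "pairs (map (\<lambda>(x, y). (c \<cdot>\<^bsub>X\<^esub> x, y)) l)" using l(1) scale_closed by auto
    from I[OF this] show "(vscale L c a, vscale B c b) \<in> R" using l by (simp add: rk_scale tau_scale)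
    have "pairs (map (\<lambda>(x, y). (y, x)) l)" using l(1) by auto
    from I[OF this] show "(astar L a, astar B b) \<in> R" using l by (simp add: rk_swap tau_swap)
    fix a' b' assume "(a', b') \<in> R"
    then obtain l' where l': "pairs l'" "a' = rk l'" "b' = tau l'" using E by blast
    show "(vadd L a a', vadd B b b') \<in> R" using I[of "l @ l'"] l l' by (simp add: rk_append tau_append)
    show "(amult L a a', amult B b b') \<in> R"
      using I[OF pairs_lact[OF rk_closed[OF l(1)] l'(1)]] rk_lact[OF rk_closed[OF l(1)] l'(1)] tau_lact[OF l(1) l'(1)] l l' by simp
  qed
  moreover have "fst ` R = vspan L rank_ones" unfolding range_rk[symmetric] by (force simp: R_def image_def)
  ultimately obtain h where h: "h \<in> star_homs (compacts A X) B" "\<And>a b. (a, b) \<in> R \<Longrightarrow> h a = b"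
    unfolding compacts_def by fastforce
  have "h (rank_one X x y) = \<psi> x \<odot>\<^bsub>B\<^esub> (\<psi> y)\<^sup>\<star>\<^bsub>B\<^esub>" if xy: "x \<in> carrier X" "y \<in> carrier X" for x y
    using h(2)[OF I[of "[(x, y)]"]] xy by (simp add: rk_simps tau_simps op.add_zero rank_one_mem B.add_zero B.cl psi_closed)
  then show "\<exists>h. h \<in> star_homs (compacts A X) B \<and>
     (\<forall>x\<in>carrier X. \<forall>y\<in>carrier X. h (rank_one X x y) = \<psi> x \<odot>\<^bsub>B\<^esub> (\<psi> y)\<^sup>\<star>\<^bsub>B\<^esub>)" using h(1) by blast
next
  fix h g
  assume h: "h \<in> star_homs (compacts A X) B \<and> (\<forall>x\<in>carrier X. \<forall>y\<in>carrier X. h (rank_one X x y) = \<psi> x \<odot>\<^bsub>B\<^esub> (\<psi> y)\<^sup>\<star>\<^bsub>B\<^esub>)"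
    and g: "g \<in> star_homs (compacts A X) B \<and> (\<forall>x\<in>carrier X. \<forall>y\<in>carrier X. g (rank_one X x y) = \<psi> x \<odot>\<^bsub>B\<^esub> (\<psi> y)\<^sup>\<star>\<^bsub>B\<^esub>)"
  show "h = g"
  proof (rule star_homs_eq_dense[OF compacts_cstar B.cstar_algebra_axioms])
    show "{rk l | l. pairs l} \<subseteq> carrier (compacts A X)" using rk_compact by blast
    show "\<exists>y\<in>{rk l | l. pairs l}. anorm (compacts A X) (vdiff (compacts A X) x y) < \<epsilon>"
      if "x \<in> carrier (compacts A X)" "0 < \<epsilon>" for x \<epsilon>
      using rk_dense[OF that] by (auto simp: compacts_simps)
    show "h x = g x" if "x \<in> {rk l | l. pairs l}" for x
      using that compacts_hom_rk[of h] compacts_hom_rk[of g] h g by auto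
  qed (use h g in auto)
qed

end

section \<open>Balanced tensor products\<close>

context cvector_space begin

lemma vlsum_map_closed: "(\<And>x. x \<in> set xs \<Longrightarrow> f x \<in> carrier V) \<Longrightarrow> vlsum V (map f xs) \<in> carrier V"
  by (rule vlsum_closed) auto

lemma vlsum_map_add:
  "(\<And>x. x \<in> set xs \<Longrightarrow> f x \<in> carrier V) \<Longrightarrow> (\<And>x. x \<in> set xs \<Longrightarrow> g x \<in> carrier V) \<Longrightarrow>
    vlsum V (map (\<lambda>x. f x \<boxplus> g x) xs) = vlsum V (map f xs) \<boxplus> vlsum V (map g xs)"
proof (induction xs)
  case (Cons x xs)
  have "f x \<in> carrier V" "g x \<in> carrier V" "vlsum V (map f xs) \<in> carrier V" "vlsum V (map g xs) \<in> carrier V"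
    using Cons.prems by (auto intro!: vlsum_map_closed)
  then show ?case using Cons by (simp add: add_assoc add_left_commute add_closed)
qed (simp add: zero_add zero_closed)

lemma vlsum_map_scale:
  "(\<And>x. x \<in> set xs \<Longrightarrow> f x \<in> carrier V) \<Longrightarrow> vlsum V (map (\<lambda>x. c \<cdot> f x) xs) = c \<cdot> vlsum V (map f xs)"
proof (induction xs)
  case (Cons x xs)
  have "f x \<in> carrier V" "vlsum V (map f xs) \<in> carrier V" using Cons.prems by (auto intro!: vlsum_map_closed)
  then show ?case using Cons by (simp add: scale_right_distrib)
qed (simp add: scale_zero_right)

lemma vlsum_map_zero: "vlsum V (map (\<lambda>x. \<zero>\<^sub>v) xs) = \<zero>\<^sub>v"
  by (induction xs) (simp_all add: zero_add zero_closed)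

end

lemma (in cnormed) nrm_vlsum_le:
  "(\<And>x. x \<in> set xs \<Longrightarrow> f x \<in> carrier V \<and> nrm (f x) \<le> b x) \<Longrightarrow> nrm (vlsum V (map f xs)) \<le> sum_list (map b xs)"
proof (induction xs)
  case (Cons x xs)
  have "f x \<in> carrier V" "vlsum V (map f xs) \<in> carrier V" using Cons.prems by (auto intro!: vlsum_map_closed)
  then show ?case using Cons nrm_triangle[of "f x" "vlsum V (map f xs)"] by fastforce
qed (simp add: nrm_zero)

lemma (in cstar_algebra) mult_vlsum_map:
  "a \<in> carrier A \<Longrightarrow> (\<And>x. x \<in> set xs \<Longrightarrow> f x \<in> carrier A) \<Longrightarrow>
    vlsum A (map (\<lambda>x. f x \<odot> a) xs) = vlsum A (map f xs) \<odot> a"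
proof (induction xs)
  case (Cons x xs)
  have "f x \<in> carrier A" "vlsum A (map f xs) \<in> carrier A" using Cons.prems by (auto intro!: vlsum_map_closed)
  then show ?case using Cons by (simp add: mult_add_left)
qed (simp add: mult_zero)

lemma (in hilbert_module) inner_vlsum:
  assumes "set ys \<subseteq> carrier X" "x \<in> carrier X"
  shows "hinner X x (vlsum X ys) = vlsum A (map (hinner X x) ys)"
    "hinner X (vlsum X ys) x = vlsum A (map (\<lambda>y. hinner X y x) ys)"
  using assms by (induction ys) (auto simp: inner_zero inner_add_right inner_add_left vlsum_closed)

context hilbert_bimodule begin

definition act :: "'a \<Rightarrow> 'x \<Rightarrow> 'x" where "act = left_hom A X"

lemma act_mem: "a \<in> carrier A \<Longrightarrow> act a \<in> carrier L"
  using star_homsD(1)[OF left_hom] by (simp add: act_def)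

lemma act_apply: "a \<in> carrier A \<Longrightarrow> y \<in> carrier X \<Longrightarrow> act a y = lact X a y"
  by (simp add: act_def left_hom_def)

lemma lact_closed: "a \<in> carrier A \<Longrightarrow> y \<in> carrier X \<Longrightarrow> lact X a y \<in> carrier X"
  using L_closed[OF act_mem] act_apply by metis

lemma lact_add_left: "a \<in> carrier A \<Longrightarrow> b \<in> carrier A \<Longrightarrow> y \<in> carrier X \<Longrightarrow>
    lact X (a \<boxplus>\<^bsub>A\<^esub> b) y = lact X a y \<boxplus>\<^bsub>X\<^esub> lact X b y"
  using arg_cong[OF star_homsD(2)[OF left_hom, of a b], of "\<lambda>f. f y"]
  by (simp add: act_def[symmetric] act_apply L_apply A.cl)

lemma lact_scale_left: "a \<in> carrier A \<Longrightarrow> y \<in> carrier X \<Longrightarrow> lact X (c \<cdot>\<^bsub>A\<^esub> a) y = c \<cdot>\<^bsub>X\<^esub> lact X a y"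
  using arg_cong[OF star_homsD(3)[OF left_hom, of a c], of "\<lambda>f. f y"]
  by (simp add: act_def[symmetric] act_apply L_apply A.cl)

lemma lact_mult: "a \<in> carrier A \<Longrightarrow> b \<in> carrier A \<Longrightarrow> y \<in> carrier X \<Longrightarrow>
    lact X (a \<odot>\<^bsub>A\<^esub> b) y = lact X a (lact X b y)"
  using arg_cong[OF star_homsD(4)[OF left_hom, of a b], of "\<lambda>f. f y"]
  by (simp add: act_def[symmetric] act_apply L_apply A.cl lact_closed)

lemma lact_adjoint: "a \<in> carrier A \<Longrightarrow> x \<in> carrier X \<Longrightarrow> y \<in> carrier X \<Longrightarrow>
    hinner X x (lact X a y) = hinner X (lact X (a\<^sup>\<star>\<^bsub>A\<^esub>) x) y"
  using inner_adjoint_right[OF act_mem, of a x y] star_homsD(5)[OF left_hom, of a]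
    act_apply[of "a\<^sup>\<star>\<^bsub>A\<^esub>" x]
  by (simp add: act_def[symmetric] act_apply A.cl)

lemma lact_ract: "a \<in> carrier A \<Longrightarrow> b \<in> carrier A \<Longrightarrow> y \<in> carrier X \<Longrightarrow> lact X a (ract X y b) = ract X (lact X a y) b"
  using L_linear(3)[OF act_mem, of a y b] by (simp add: act_apply ract_closed)

lemma lact_norm_le:
  assumes a: "a \<in> carrier A" and y: "y \<in> carrier X"
  shows "hnorm A X (lact X a y) \<le> anorm A a * hnorm A X y"
proof -
  interpret h: star_hom A L "left_hom A X"
    using A.cstar_algebra_axioms op.cstar_algebra_axioms left_hom by (simp add: star_hom_def star_hom_axioms_def)
  have "hnorm A X (act a y) \<le> anorm L (act a) * hnorm A X y" by (rule op_le[OF act_mem[OF a] y])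
  also have "\<dots> \<le> anorm A a * hnorm A X y"
    using h.norm_hom_le[OF a] hnorm_nonneg[OF y] unfolding act_def by (rule mult_right_mono)
  finally show ?thesis using act_apply[OF a y] by simp
qed

end

section \<open>The semi-inner product on formal tensors\<close>

locale tensor_pair = A: cstar_algebra A + X: hilbert_module A X + Y: hilbert_bimodule A Y
  for A :: "'a cstar" and X :: "('a, 'x) hbimod" and Y :: "('a, 'y) hbimod"
begin

abbreviation V :: "('a, ('x \<times> 'y) list) hbimod" where "V \<equiv> formal_tensors A X Y"

abbreviation tens :: "('x \<times> 'y) list \<Rightarrow> bool" where "tens l \<equiv> set l \<subseteq> carrier X \<times> carrier Y"

definition f :: "'x \<times> 'y \<Rightarrow> 'x \<times> 'y \<Rightarrow> 'a" where
  "f p q = hinner Y (snd p) (lact Y (hinner X (fst p) (fst q)) (snd q))"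

text \<open>Nested sums permit induction on either list, unlike the sum over
  \<open>List.product\<close> in \<open>formal_tensors\<close>; \<open>hinner_V\<close> identifies
  the two.\<close>

definition ip :: "('x \<times> 'y) list \<Rightarrow> ('x \<times> 'y) list \<Rightarrow> 'a" where
  "ip l l' = vlsum A (map (\<lambda>p. vlsum A (map (f p) l')) l)"

lemma ip_simps: "ip [] l' = \<zero>\<^sub>v\<^bsub>A\<^esub>" "ip (p # l) l' = vlsum A (map (f p) l') \<boxplus>\<^bsub>A\<^esub> ip l l'"
  by (simp_all add: ip_def)

lemma f_closed: "p \<in> carrier X \<times> carrier Y \<Longrightarrow> q \<in> carrier X \<times> carrier Y \<Longrightarrow> f p q \<in> carrier A"
  by (auto simp: f_def X.inner_closed Y.inner_closed Y.lact_closed)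

lemma f_sum_closed: "p \<in> carrier X \<times> carrier Y \<Longrightarrow> tens l \<Longrightarrow> vlsum A (map (f p) l) \<in> carrier A"
  by (rule A.vlsum_map_closed) (use f_closed in blast)

lemma ip_closed: "tens l \<Longrightarrow> tens l' \<Longrightarrow> ip l l' \<in> carrier A"
  unfolding ip_def by (rule A.vlsum_map_closed) (use f_sum_closed in blast)

lemma V_simps: "carrier V = {l. tens l}" "vadd V = (@)" "vscale V c l = map (\<lambda>(x, y). (c \<cdot>\<^bsub>X\<^esub> x, y)) l"
  "ract V l a = map (\<lambda>(x, y). (x, ract Y y a)) l"
  by (auto simp: formal_tensors_def)

lemma hinner_V: assumes "tens l" "tens l'" shows "hinner V l l' = ip l l'"
proof -
  let ?g = "\<lambda>((x, y), (x', y')). hinner Y y (lact Y (hinner X x x') y')"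
  have "hinner V l l' = vlsum A (map ?g (List.product l l'))" by (simp add: formal_tensors_def vlsum_def)
  also have "\<dots> = ip l l'"
    using assms(1)
  proof (induction l)
    case Nil
    then show ?case by (simp add: ip_simps)
  next
    case (Cons p l)
    obtain x y where p: "p = (x, y)" by force
    have "map ?g (map (Pair p) l') = map (f p) l'" by (auto simp: p f_def)
    moreover have "set (map ?g (map (Pair p) l')) \<subseteq> carrier A" "set (map ?g (List.product l l')) \<subseteq> carrier A"
      using Cons.prems assms(2) by (auto simp: p X.inner_closed Y.inner_closed Y.lact_closed subset_iff)
    ultimately show ?case using Cons A.vlsum_append by (simp add: ip_simps del: map_map)
  qed
  finally show ?thesis .
qed

lemma ip_append_left: "tens l \<Longrightarrow> tens m \<Longrightarrow> tens k \<Longrightarrow> ip (l @ m) k = ip l k \<boxplus>\<^bsub>A\<^esub> ip m k"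
  by (induction l) (auto simp: ip_simps A.zero_add ip_closed f_sum_closed A.add_assoc)

lemma f_star: assumes "p \<in> carrier X \<times> carrier Y" "q \<in> carrier X \<times> carrier Y" shows "(f p q)\<^sup>\<star>\<^bsub>A\<^esub> = f q p"
proof -
  obtain x y x' y' where p: "p = (x, y)" "q = (x', y')" by force
  have c: "x \<in> carrier X" "y \<in> carrier Y" "x' \<in> carrier X" "y' \<in> carrier Y" using assms p by auto
  have "f q p = hinner Y (lact Y (hinner X x x') y') y"
    using Y.lact_adjoint[of "hinner X x' x" y' y] c by (simp add: p f_def X.inner_closed X.inner_star)
  then show ?thesis using c by (simp add: p f_def Y.inner_star Y.lact_closed X.inner_closed)
qed

lemma ip_single_right: "tens l \<Longrightarrow> q \<in> carrier X \<times> carrier Y \<Longrightarrow> ip l [q] = vlsum A (map (\<lambda>p. f p q) l)"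
  unfolding ip_def using f_closed by (induction l) (auto simp: A.add_zero)

lemma ip_cons_right: "tens l \<Longrightarrow> q \<in> carrier X \<times> carrier Y \<Longrightarrow> tens m \<Longrightarrow>
    ip l (q # m) = ip l [q] \<boxplus>\<^bsub>A\<^esub> ip l m"
proof (induction l)
  case (Cons p l)
  have c: "f p q \<in> carrier A" "vlsum A (map (f p) m) \<in> carrier A" "ip l [q] \<in> carrier A" "ip l m \<in> carrier A"
    using Cons.prems by (auto intro!: f_closed f_sum_closed ip_closed)
  then show ?case
    using Cons by (simp add: ip_simps A.add_zero A.add_assoc A.add_left_commute A.add_closed)
qed (simp add: ip_simps A.zero_add A.zero_closed)

lemma ip_star: "tens l \<Longrightarrow> tens m \<Longrightarrow> (ip l m)\<^sup>\<star>\<^bsub>A\<^esub> = ip m l"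
proof (induction l)
  case Nil
  then show ?case by (simp add: ip_simps ip_def A.vlsum_map_zero A.star_zero)
next
  case (Cons p l)
  have p: "p \<in> carrier X \<times> carrier Y" "tens l" using Cons.prems by auto
  have "(vlsum A (map (f p) m))\<^sup>\<star>\<^bsub>A\<^esub> = vlsum A (map (\<lambda>q. f q p) m)"
    using Cons.prems(2)
  proof (induction m)
    case (Cons q m)
    then have "f p q \<in> carrier A" "vlsum A (map (f p) m) \<in> carrier A" using p by (auto intro!: f_closed f_sum_closed)
    then show ?case using Cons p f_star by (simp add: A.star_add)
  qed (simp add: A.star_zero)
  then show ?case
    using Cons p ip_cons_right[OF Cons.prems(2) p] ip_single_right[OF Cons.prems(2) p(1)]
    by (simp add: ip_simps A.star_add f_sum_closed ip_closed)
qed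

lemma ip_append_right: "tens l \<Longrightarrow> tens m \<Longrightarrow> tens k \<Longrightarrow> ip k (l @ m) = ip k l \<boxplus>\<^bsub>A\<^esub> ip k m"
proof -
  assume c: "tens l" "tens m" "tens k"
  have "(ip (l @ m) k)\<^sup>\<star>\<^bsub>A\<^esub> = (ip l k \<boxplus>\<^bsub>A\<^esub> ip m k)\<^sup>\<star>\<^bsub>A\<^esub>" using ip_append_left c by simp
  then show ?thesis using c by (simp add: ip_star ip_closed A.star_add)
qed

lemma tens_scale: "tens l \<Longrightarrow> tens (vscale V c l)" and tens_ract: "a \<in> carrier A \<Longrightarrow> tens l \<Longrightarrow> tens (ract V l a)"
  and tens_diff: "tens l \<Longrightarrow> tens m \<Longrightarrow> tens (vdiff V l m)"
  by (auto simp: V_simps vdiff_def X.scale_closed Y.ract_closed)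

lemma ip_scale_right: "tens l \<Longrightarrow> tens m \<Longrightarrow> ip l (vscale V c m) = c \<cdot>\<^bsub>A\<^esub> ip l m"
proof (induction l)
  case Nil
  then show ?case by (simp add: ip_simps A.scale_zero_right)
next
  case (Cons p l)
  have p: "p \<in> carrier X \<times> carrier Y" "tens l" using Cons.prems by auto
  have "map (f p) (vscale V c m) = map (\<lambda>q. c \<cdot>\<^bsub>A\<^esub> f p q) m"
    using p Cons.prems(2) by (auto simp: V_simps f_def X.inner_scale_right X.inner_closed Y.lact_scale_left
        Y.inner_scale_right Y.lact_closed subset_iff)
  moreover have "vlsum A (map (\<lambda>q. c \<cdot>\<^bsub>A\<^esub> f p q) m) = c \<cdot>\<^bsub>A\<^esub> vlsum A (map (f p) m)"
    by (rule A.vlsum_map_scale) (use f_closed[OF p(1)] Cons.prems(2) in blast)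
  ultimately have "vlsum A (map (f p) (vscale V c m)) = c \<cdot>\<^bsub>A\<^esub> vlsum A (map (f p) m)" by simp
  then show ?case using Cons p by (simp add: ip_simps A.scale_right_distrib f_sum_closed ip_closed)
qed

lemma ip_ract_right: "tens l \<Longrightarrow> tens m \<Longrightarrow> a \<in> carrier A \<Longrightarrow> ip l (ract V m a) = ip l m \<odot>\<^bsub>A\<^esub> a"
proof (induction l)
  case Nil
  then show ?case by (simp add: ip_simps A.mult_zero)
next
  case (Cons p l)
  have p: "p \<in> carrier X \<times> carrier Y" "tens l" using Cons.prems by auto
  have "map (f p) (ract V m a) = map (\<lambda>q. f p q \<odot>\<^bsub>A\<^esub> a) m"
    using p Cons.prems by (auto simp: V_simps f_def X.inner_closed Y.lact_ract Y.inner_ract_right Y.lact_closed subset_iff)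
  moreover have "vlsum A (map (\<lambda>q. f p q \<odot>\<^bsub>A\<^esub> a) m) = vlsum A (map (f p) m) \<odot>\<^bsub>A\<^esub> a"
    by (rule A.mult_vlsum_map) (use f_closed[OF p(1)] Cons.prems in blast)+
  ultimately have "vlsum A (map (f p) (ract V m a)) = vlsum A (map (f p) m) \<odot>\<^bsub>A\<^esub> a" by simp
  then show ?case using Cons p by (simp add: ip_simps A.mult_add_left f_sum_closed ip_closed)
qed

lemma ip_diff_right: "tens l \<Longrightarrow> tens m \<Longrightarrow> tens k \<Longrightarrow> ip k (vdiff V l m) = vdiff A (ip k l) (ip k m)"
  using ip_append_right[OF _ tens_scale] ip_scale_right by (simp add: vdiff_def V_simps(2))

lemma ip_diff_left:
  assumes "tens l" "tens m" "tens k" shows "ip (vdiff V l m) k = vdiff A (ip l k) (ip m k)"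
proof -
  have "(ip k (vdiff V l m))\<^sup>\<star>\<^bsub>A\<^esub> = (vdiff A (ip k l) (ip k m))\<^sup>\<star>\<^bsub>A\<^esub>" using ip_diff_right assms by simp
  then show ?thesis using assms by (simp add: ip_star ip_closed A.star_diff tens_diff)
qed

lemma ip_ract_left:
  assumes "tens l" "tens k" "a \<in> carrier A" shows "ip (ract V l a) k = a\<^sup>\<star>\<^bsub>A\<^esub> \<odot>\<^bsub>A\<^esub> ip l k"
proof -
  have "(ip k (ract V l a))\<^sup>\<star>\<^bsub>A\<^esub> = (ip k l \<odot>\<^bsub>A\<^esub> a)\<^sup>\<star>\<^bsub>A\<^esub>" using ip_ract_right assms by simp
  then show ?thesis using assms by (simp add: ip_star ip_closed A.star_mult tens_ract)
qed

definition frame_sum :: "'x list \<Rightarrow> 'x \<Rightarrow> 'x" where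
  "frame_sum us x = vlsum X (map (\<lambda>u. ract X u (hinner X u x)) us)"

text \<open>Replacing \<open>x'\<close> by \<open>\<Sum>u\<langle>u, x'\<rangle>\<close> for a frame \<open>u\<close> turns \<open>\<Sum>\<langle>y, \<langle>x, x'\<rangle>y'\<rangle>\<close> into a sum of squares
  \<open>\<langle>e\<^sub>u, e\<^sub>u\<rangle>\<close> with \<open>e\<^sub>u = \<Sum>\<langle>u, x\<rangle>y\<close>.\<close>

lemma ip_frame:
  assumes l: "tens l" and us: "set us \<subseteq> carrier X"
  shows "A.apos (ip l (map (\<lambda>(x, y). (frame_sum us x, y)) l))"
  using us
proof (induction us)
  case Nil
  have z: "f p (frame_sum [] x, y) = \<zero>\<^sub>v\<^bsub>A\<^esub>" if "p \<in> carrier X \<times> carrier Y" "y \<in> carrier Y" for p x y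
    using that Y.lact_scale_left[of "\<zero>\<^sub>v\<^bsub>A\<^esub>" y 0]
    by (auto simp: frame_sum_def f_def X.inner_zero A.scale_zero_left A.zero_closed Y.scale_zero_left Y.lact_closed Y.inner_zero)
  have "ip l (map (\<lambda>(x, y). (frame_sum [] x, y)) l) = vlsum A (map (\<lambda>p. \<zero>\<^sub>v\<^bsub>A\<^esub>) l)"
    unfolding ip_def
  proof (rule arg_cong[of _ _ "vlsum A"], rule map_cong[OF refl])
    fix p assume "p \<in> set l"
    then have "map (f p) (map (\<lambda>(x, y). (frame_sum [] x, y)) l) = map (\<lambda>_. \<zero>\<^sub>v\<^bsub>A\<^esub>) l" using l z[of p] by auto
    then show "vlsum A (map (f p) (map (\<lambda>(x, y). (frame_sum [] x, y)) l)) = \<zero>\<^sub>v\<^bsub>A\<^esub>"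
      by (simp only: A.vlsum_map_zero)
  qed
  then show ?case by (simp add: A.vlsum_map_zero A.apos_zero)
next
  case (Cons u us)
  have u: "u \<in> carrier X" "set us \<subseteq> carrier X" using Cons.prems by auto
  have Kc: "frame_sum us x \<in> carrier X" if "x \<in> carrier X" for x
    unfolding frame_sum_def using that u by (intro X.vlsum_map_closed) (auto simp: X.ract_closed X.inner_closed subset_iff)
  let ?e = "vlsum Y (map (\<lambda>(x, y). lact Y (hinner X u x) y) l)"
  have e: "set (map (\<lambda>(x, y). lact Y (hinner X u x) y) l) \<subseteq> carrier Y"
    using l u by (auto simp: Y.lact_closed X.inner_closed)
  then have ec: "?e \<in> carrier Y" by (rule Y.vlsum_closed)
  \<comment> \<open>The vector u contributes <x,u><u,x'> to the coefficient; moving <x,u> into the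
    left argument produces a term of the square belonging to u.\<close>
  have fK: "f (x, y) (frame_sum (u # us) x', y') = hinner Y (lact Y (hinner X u x) y) (lact Y (hinner X u x') y') \<boxplus>\<^bsub>A\<^esub> f (x, y) (frame_sum us x', y')"
    if c: "x \<in> carrier X" "y \<in> carrier Y" "x' \<in> carrier X" "y' \<in> carrier Y" for x y x' y'
  proof -
    have "f (x, y) (frame_sum (u # us) x', y') =
        hinner Y y (lact Y (hinner X x u \<odot>\<^bsub>A\<^esub> hinner X u x') y') \<boxplus>\<^bsub>A\<^esub> f (x, y) (frame_sum us x', y')"
      using c u Kc[OF c(3)] by (simp add: f_def frame_sum_def X.inner_add_right X.ract_closed X.inner_closed X.inner_ract_right
          Y.lact_add_left A.cl Y.inner_add_right Y.lact_closed)
    also have "hinner Y y (lact Y (hinner X x u \<odot>\<^bsub>A\<^esub> hinner X u x') y') = hinner Y (lact Y (hinner X u x) y) (lact Y (hinner X u x') y')"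
      using c u by (simp add: Y.lact_mult Y.lact_adjoint X.inner_closed X.inner_star Y.lact_closed)
    finally show ?thesis .
  qed
  have row: "vlsum A (map (f p) (map (\<lambda>(x, y). (frame_sum (u # us) x, y)) l)) =
      hinner Y (lact Y (hinner X u (fst p)) (snd p)) ?e \<boxplus>\<^bsub>A\<^esub> vlsum A (map (f p) (map (\<lambda>(x, y). (frame_sum us x, y)) l))"
    if p: "p \<in> carrier X \<times> carrier Y" for p
  proof -
    obtain x y where xy: "p = (x, y)" "x \<in> carrier X" "y \<in> carrier Y" using p by auto
    have ly: "lact Y (hinner X u x) y \<in> carrier Y" using xy u by (simp add: Y.lact_closed X.inner_closed)
    have "vlsum A (map (f p) (map (\<lambda>(x, y). (frame_sum (u # us) x, y)) l)) =
        vlsum A (map (\<lambda>q. hinner Y (lact Y (hinner X u x) y) (lact Y (hinner X u (fst q)) (snd q)) \<boxplus>\<^bsub>A\<^esub> f p (frame_sum us (fst q), snd q)) l)"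
      unfolding map_map by (rule arg_cong[of _ _ "vlsum A"], rule map_cong) (use l fK xy in auto)
    also have "\<dots> = vlsum A (map (\<lambda>q. hinner Y (lact Y (hinner X u x) y) (lact Y (hinner X u (fst q)) (snd q))) l) \<boxplus>\<^bsub>A\<^esub>
        vlsum A (map (\<lambda>q. f p (frame_sum us (fst q), snd q)) l)"
      by (rule A.vlsum_map_add) (use l Kc u ly p in \<open>auto simp: Y.inner_closed Y.lact_closed X.inner_closed intro!: f_closed\<close>)
    also have "vlsum A (map (\<lambda>q. hinner Y (lact Y (hinner X u x) y) (lact Y (hinner X u (fst q)) (snd q))) l) = hinner Y (lact Y (hinner X u x) y) ?e"
      unfolding Y.inner_vlsum(1)[OF e ly] by (simp add: o_def case_prod_unfold)
    finally show ?thesis by (simp add: xy o_def case_prod_unfold)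
  qed
  have "ip l (map (\<lambda>(x, y). (frame_sum (u # us) x, y)) l) =
      vlsum A (map (\<lambda>p. hinner Y (lact Y (hinner X u (fst p)) (snd p)) ?e \<boxplus>\<^bsub>A\<^esub> vlsum A (map (f p) (map (\<lambda>(x, y). (frame_sum us x, y)) l))) l)"
    unfolding ip_def by (rule arg_cong[of _ _ "vlsum A"], rule map_cong) (use l row in auto)
  also have "\<dots> = vlsum A (map (\<lambda>p. hinner Y (lact Y (hinner X u (fst p)) (snd p)) ?e) l) \<boxplus>\<^bsub>A\<^esub> ip l (map (\<lambda>(x, y). (frame_sum us x, y)) l)"
    unfolding ip_def
  proof (rule A.vlsum_map_add)
    fix p assume "p \<in> set l"
    then show "hinner Y (lact Y (hinner X u (fst p)) (snd p)) ?e \<in> carrier A"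
      using l u ec by (auto simp: Y.inner_closed Y.lact_closed X.inner_closed)
    show "vlsum A (map (f p) (map (\<lambda>(x, y). (frame_sum us x, y)) l)) \<in> carrier A"
      by (rule f_sum_closed) (use l Kc \<open>p \<in> set l\<close> in auto)
  qed
  also have "vlsum A (map (\<lambda>p. hinner Y (lact Y (hinner X u (fst p)) (snd p)) ?e) l) = hinner Y ?e ?e"
    using Y.inner_vlsum(2)[OF e ec] by (simp add: o_def case_prod_unfold)
  finally show ?case using Cons.IH[OF u(2)] Y.inner_apos[OF ec] A.apos_add by simp
qed

text \<open>By \<open>frame\<close>, the vectors of X in the second list are close to their frame
  sums, for which \<open>ip_frame\<close> gives positivity, and positivity survives limits.\<close>

lemma ip_pos: assumes l: "tens l" shows "A.apos (ip l l)"
proof (rule A.apos_limit[OF ip_closed[OF l l] ip_star[OF l l]])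
  fix \<epsilon> :: real assume e: "\<epsilon> > 0"
  \<comment> \<open>The error in \<open>ip l l\<close> is at most C times the error allowed for each
    vector of X.\<close>
  define C where "C = sum_list (map (\<lambda>p. sum_list (map (\<lambda>q. hnorm A Y (snd p) * (hnorm A X (fst p) * hnorm A Y (snd q))) l)) l)"
  have "0 \<le> hnorm A X x" "0 \<le> hnorm A Y y" if "(x, y) \<in> set l" for x y
    using that l by (auto intro!: X.hnorm_nonneg Y.hnorm_nonneg)
  then have C: "0 \<le> C" unfolding C_def by (auto intro!: sum_list_nonneg mult_nonneg_nonneg)
  define d where "d = \<epsilon> / (C + 1)"
  have d: "0 < d" "d * C < \<epsilon>" using e C by (simp_all add: d_def field_simps)
  obtain us where us: "set us \<subseteq> carrier X"
      "\<And>x. x \<in> fst ` set l \<Longrightarrow> hnorm A X (vdiff X x (vlsum X (map (\<lambda>u. ract X u (hinner X u x)) us))) \<le> d"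
  proof -
    have "set (map fst l) \<subseteq> carrier X" using l by auto
    from X.frame[OF this d(1)] show ?thesis using that by auto
  qed
  define K where "K x = vlsum X (map (\<lambda>u. ract X u (hinner X u x)) us)" for x
  have Kc: "K x \<in> carrier X" if "x \<in> carrier X" for x
    unfolding K_def using that us by (intro X.vlsum_map_closed) (auto simp: X.ract_closed X.inner_closed subset_iff)
  let ?l' = "map (\<lambda>(x, y). (K x, y)) l"
  let ?g = "\<lambda>p q. f p (vdiff X (fst q) (K (fst q)), snd q)"
  have l': "tens ?l'" using l Kc by auto
  have split: "f p q = ?g p q \<boxplus>\<^bsub>A\<^esub> f p (K (fst q), snd q)"
    if "p \<in> carrier X \<times> carrier Y" "q \<in> carrier X \<times> carrier Y" for p q
  proof -
    obtain x y x' y' where p: "p = (x, y)" "q = (x', y')" by force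
    have c: "x \<in> carrier X" "y \<in> carrier Y" "x' \<in> carrier X" "y' \<in> carrier Y" "K x' \<in> carrier X" using that p Kc by auto
    have "vdiff X x' (K x') \<boxplus>\<^bsub>X\<^esub> K x' = x'"
      using X.lin.nc_identity[of "[x', K x']" "(#0 [-] #1) [+] #1" "#0"] c by (simp add: vdiff_def)
    then have "f p q = f p (vdiff X x' (K x') \<boxplus>\<^bsub>X\<^esub> K x', y')" by (simp add: p)
    then show ?thesis using c by (simp add: p f_def X.inner_add_right X.diff_closed X.inner_closed Y.lact_add_left
          Y.inner_add_right Y.lact_closed)
  qed
  have gc: "?g p q \<in> carrier A" "f p (K (fst q), snd q) \<in> carrier A"
    if "p \<in> carrier X \<times> carrier Y" "q \<in> carrier X \<times> carrier Y" for p q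
  proof -
    have "(vdiff X (fst q) (K (fst q)), snd q) \<in> carrier X \<times> carrier Y" "(K (fst q), snd q) \<in> carrier X \<times> carrier Y"
      using that(2) Kc[of "fst q"] X.diff_closed[of "fst q" "K (fst q)"] by (simp_all add: mem_Times_iff)
    then show "?g p q \<in> carrier A" "f p (K (fst q), snd q) \<in> carrier A" using f_closed[OF that(1)] by simp_all
  qed
  have gn: "anorm A (?g p q) \<le> d * (hnorm A Y (snd p) * (hnorm A X (fst p) * hnorm A Y (snd q)))"
    if "p \<in> carrier X \<times> carrier Y" "q \<in> set l" for p q
  proof -
    obtain x y x' y' where p: "p = (x, y)" "q = (x', y')" by force
    have c: "x \<in> carrier X" "y \<in> carrier Y" "x' \<in> carrier X" "y' \<in> carrier Y" "K x' \<in> carrier X" using that p Kc l by auto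
    let ?v = "vdiff X x' (K x')"
    have v: "?v \<in> carrier X" "hnorm A X ?v \<le> d" 
    proof -
      show "?v \<in> carrier X" using c by (simp add: X.diff_closed)
      have "x' \<in> fst ` set l" using that(2) p by force
      from us(2)[OF this] show "hnorm A X ?v \<le> d" by (simp add: K_def)
    qed
    have ix: "hinner X x ?v \<in> carrier A" using c v by (simp add: X.inner_closed)
    have "anorm A (?g p q) \<le> hnorm A Y y * hnorm A Y (lact Y (hinner X x ?v) y')"
      using Y.cauchy_schwarz[OF c(2) Y.lact_closed[OF ix c(4)]] by (simp add: p f_def)
    also have "\<dots> \<le> hnorm A Y y * (anorm A (hinner X x ?v) * hnorm A Y y')"
      by (rule mult_left_mono[OF Y.lact_norm_le[OF ix c(4)] Y.hnorm_nonneg[OF c(2)]])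
    also have "\<dots> \<le> hnorm A Y y * ((hnorm A X x * d) * hnorm A Y y')"
      using X.cauchy_schwarz[OF c(1) v(1)] mult_left_mono[OF v(2) X.hnorm_nonneg[OF c(1)]] Y.hnorm_nonneg c
      by (intro mult_left_mono mult_right_mono) auto
    finally show ?thesis by (simp add: p mult.commute mult.left_commute)
  qed
  define D where "D = vlsum A (map (\<lambda>p. vlsum A (map (?g p) l)) l)"
  have rowc: "vlsum A (map (?g p) l) \<in> carrier A" if "p \<in> set l" for p
    by (rule A.vlsum_map_closed) (use that l gc in blast)
  have "ip l l = vlsum A (map (\<lambda>p. vlsum A (map (?g p) l) \<boxplus>\<^bsub>A\<^esub> vlsum A (map (f p) ?l')) l)"
    unfolding ip_def
  proof (rule arg_cong[of _ _ "vlsum A"], rule map_cong[OF refl])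
    fix p assume p: "p \<in> set l"
    then have pc: "p \<in> carrier X \<times> carrier Y" using l by blast
    have "vlsum A (map (f p) l) = vlsum A (map (\<lambda>q. ?g p q \<boxplus>\<^bsub>A\<^esub> f p (K (fst q), snd q)) l)"
      by (rule arg_cong[of _ _ "vlsum A"], rule map_cong[OF refl], rule split[OF pc]) (use l in blast)
    also have "\<dots> = vlsum A (map (?g p) l) \<boxplus>\<^bsub>A\<^esub> vlsum A (map (\<lambda>q. f p (K (fst q), snd q)) l)"
      by (rule A.vlsum_map_add) (use gc[OF pc] l in blast)+
    finally show "vlsum A (map (f p) l) = vlsum A (map (?g p) l) \<boxplus>\<^bsub>A\<^esub> vlsum A (map (f p) ?l')"
      by (simp add: o_def case_prod_unfold)
  qed
  also have "\<dots> = D \<boxplus>\<^bsub>A\<^esub> ip l ?l'"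
    unfolding D_def ip_def by (rule A.vlsum_map_add) (use rowc f_sum_closed l l' in blast)+
  finally have eq: "ip l l = D \<boxplus>\<^bsub>A\<^esub> ip l ?l'" .
  have Dc: "D \<in> carrier A" unfolding D_def by (rule A.vlsum_map_closed) (rule rowc)
  have "vdiff A (ip l l) (ip l ?l') = D"
    unfolding eq using A.lin.nc_identity[of "[D, ip l ?l']" "(#0 [+] #1) [-] #1" "#0"] Dc ip_closed[OF l l'] by (simp add: vdiff_def)
  moreover have "anorm A D \<le> sum_list (map (\<lambda>p. sum_list (map (\<lambda>q. d * (hnorm A Y (snd p) * (hnorm A X (fst p) * hnorm A Y (snd q)))) l)) l)"
    unfolding D_def
  proof (rule A.nv.nrm_vlsum_le, intro conjI)
    fix p assume p: "p \<in> set l"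
    then have pc: "p \<in> carrier X \<times> carrier Y" using l by blast
    show "vlsum A (map (?g p) l) \<in> carrier A" by (rule rowc[OF p])
    show "anorm A (vlsum A (map (?g p) l)) \<le> sum_list (map (\<lambda>q. d * (hnorm A Y (snd p) * (hnorm A X (fst p) * hnorm A Y (snd q)))) l)"
      by (rule A.nv.nrm_vlsum_le) (use gc(1)[OF pc] gn[OF pc] l in blast)
  qed
  then have "anorm A D \<le> d * C" by (simp add: C_def sum_list_const_mult)
  ultimately have "anorm A (vdiff A (ip l l) (ip l ?l')) < \<epsilon>" using d by simp
  moreover have "A.apos (ip l ?l')" using ip_frame[OF l us(1)] by (simp add: K_def frame_sum_def)
  ultimately show "\<exists>b. A.apos b \<and> anorm A (vdiff A (ip l l) b) < \<epsilon>" by blast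
qed

section \<open>Seminorm, Cauchy sequences and the inner product of the completion\<close>

definition sn :: "('x \<times> 'y) list \<Rightarrow> real" where "sn l = sqrt (anorm A (ip l l))"

lemma sn_nonneg: "tens l \<Longrightarrow> 0 \<le> sn l"
  by (simp add: sn_def A.norm_nonneg ip_closed)

lemma sn_square: "tens l \<Longrightarrow> (sn l)\<^sup>2 = anorm A (ip l l)"
  by (simp add: sn_def A.norm_nonneg ip_closed)

lemma ip_cauchy_schwarz: assumes l: "tens l" and m: "tens m" shows "anorm A (ip l m) \<le> sn l * sn m"
proof -
  let ?r = "ip l m"
  have rc: "?r \<in> carrier A" "?r\<^sup>\<star>\<^bsub>A\<^esub> = ip m l" using l m by (simp_all add: ip_closed ip_star)
  have "(anorm A ?r)\<^sup>2 \<le> anorm A (ip l l) * anorm A (ip m m)"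
  proof (rule A.cauchy_schwarz_general)
    fix s :: real assume s: "0 < s"
    let ?s = "complex_of_real s"
    let ?v = "ract V m (?s \<cdot>\<^bsub>A\<^esub> ip m l)"
    have v: "tens ?v" using l m by (intro tens_ract) (simp_all add: A.cl ip_closed)
    have "ip (vdiff V l ?v) (vdiff V l ?v) = vdiff A (vdiff A (ip l l) (?s \<cdot>\<^bsub>A\<^esub> (?r \<odot>\<^bsub>A\<^esub> ip m l)))
        (vdiff A (?s \<cdot>\<^bsub>A\<^esub> (?r \<odot>\<^bsub>A\<^esub> ip m l)) ((?s * ?s) \<cdot>\<^bsub>A\<^esub> (?r \<odot>\<^bsub>A\<^esub> ip m m \<odot>\<^bsub>A\<^esub> ip m l)))"
      using l m v by (simp add: ip_diff_left ip_diff_right ip_ract_left ip_ract_right tens_diff A.cl ip_closed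
          A.star_simps ip_star A.mult_scale_left A.mult_scale_right A.scale_scale A.mult_assoc A.mult_diff_left A.scale_diff)
    also have "\<dots> = vdiff A (ip l l) (complex_of_real (2 * s) \<cdot>\<^bsub>A\<^esub> (?r \<odot>\<^bsub>A\<^esub> ?r\<^sup>\<star>\<^bsub>A\<^esub>)) \<boxplus>\<^bsub>A\<^esub>
        complex_of_real (s\<^sup>2) \<cdot>\<^bsub>A\<^esub> (?r \<odot>\<^bsub>A\<^esub> ip m m \<odot>\<^bsub>A\<^esub> ?r\<^sup>\<star>\<^bsub>A\<^esub>)"
      unfolding rc(2)
      using A.lin.nc_identity[of "[ip l l, ?r \<odot>\<^bsub>A\<^esub> ip m l, ?r \<odot>\<^bsub>A\<^esub> ip m m \<odot>\<^bsub>A\<^esub> ip m l]"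
          "(#0 [-] ?s [.] #1) [-] (?s [.] #1 [-] (?s * ?s) [.] #2)"
          "(#0 [-] complex_of_real (2 * s) [.] #1) [+] complex_of_real (s\<^sup>2) [.] #2"] l m
      by (simp add: vdiff_def[of A] A.cl ip_closed power2_eq_square)
    finally show "A.apos (vdiff A (ip l l) (complex_of_real (2 * s) \<cdot>\<^bsub>A\<^esub> (?r \<odot>\<^bsub>A\<^esub> ?r\<^sup>\<star>\<^bsub>A\<^esub>)) \<boxplus>\<^bsub>A\<^esub>
        complex_of_real (s\<^sup>2) \<cdot>\<^bsub>A\<^esub> (?r \<odot>\<^bsub>A\<^esub> ip m m \<odot>\<^bsub>A\<^esub> ?r\<^sup>\<star>\<^bsub>A\<^esub>))"
      using ip_pos[OF tens_diff[OF l v]] by simp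
  qed (use l m ip_pos in \<open>simp_all add: ip_closed\<close>)
  also have "\<dots> = (sn l * sn m)\<^sup>2" using l m by (simp add: power_mult_distrib sn_square)
  finally show ?thesis by (rule power2_le_imp_le) (use sn_nonneg l m in simp)
qed

text \<open>Lists under concatenation satisfy the vector space laws only up to seminorm zero, so the
  lemmas on normed spaces do not apply. The inequality is drawn from <l,l> = <m,l> + <l - m,l> and
  Cauchy-Schwarz.\<close>

lemma sn_le_diff: assumes l: "tens l" and m: "tens m" shows "sn l \<le> sn m + sn (vdiff V l m)"
proof (cases "sn l = 0")
  case True
  then show ?thesis using sn_nonneg[OF m] sn_nonneg[OF tens_diff[OF l m]] by simp
next
  case False
  then have p: "sn l > 0" using sn_nonneg[OF l] by simp
  note d = tens_diff[OF l m]
  have "ip l l = ip m l \<boxplus>\<^bsub>A\<^esub> ip (vdiff V l m) l"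
    unfolding ip_diff_left[OF l m l]
    using A.lin.nc_identity[of "[ip l l, ip m l]" "#0" "#1 [+] (#0 [-] #1)"] l m by (simp add: vdiff_def[of A] ip_closed)
  then have "sn l * sn l \<le> sn m * sn l + sn (vdiff V l m) * sn l"
    using sn_square[OF l] A.norm_triangle[OF ip_closed[OF m l] ip_closed[OF d l]] ip_cauchy_schwarz[OF m l] ip_cauchy_schwarz[OF d l]
    by (simp add: power2_eq_square)
  then have "sn l * sn l \<le> (sn m + sn (vdiff V l m)) * sn l" by (simp add: distrib_right)
  then show ?thesis using p by simp
qed

lemma hdist_V: "tens l \<Longrightarrow> tens m \<Longrightarrow> hdist A V l m = sn (vdiff V l m)"
  using hinner_V[OF tens_diff tens_diff] by (simp add: hdist_def hnorm_def V_simps(1) sn_def)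

lemma sn_diff_self: assumes l: "tens l" shows "sn (vdiff V l l) = 0"
  using ip_diff_left[OF l l tens_diff[OF l l]] l by (simp add: sn_def A.diff_self ip_closed tens_diff A.nv.nrm_zero)

lemma hcauchyD:
  assumes "s \<in> hcauchy A V"
  shows "tens (s n)" "\<epsilon> > 0 \<Longrightarrow> \<exists>N. \<forall>m\<ge>N. \<forall>n\<ge>N. sn (vdiff V (s m) (s n)) < \<epsilon>"
proof -
  show c: "tens (s n)" for n using assms by (simp add: hcauchy_def V_simps)
  show "\<exists>N. \<forall>m\<ge>N. \<forall>n\<ge>N. sn (vdiff V (s m) (s n)) < \<epsilon>" if "\<epsilon> > 0"
    using assms that hdist_V[OF c c] by (simp add: hcauchy_def)
qed

lemma hcauchy_const: "tens l \<Longrightarrow> (\<lambda>_. l) \<in> hcauchy A V"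
  by (simp add: hcauchy_def V_simps(1) hdist_V sn_diff_self)

lemma hcauchy_bounded: assumes "s \<in> hcauchy A V" shows "\<exists>B\<ge>0. \<forall>\<^sub>F n in sequentially. sn (s n) \<le> B"
proof -
  note c = hcauchyD(1)[OF assms]
  obtain N where N: "\<And>m n. m \<ge> N \<Longrightarrow> n \<ge> N \<Longrightarrow> sn (vdiff V (s m) (s n)) < 1"
    using hcauchyD(2)[OF assms, of 1] by auto
  have "sn (s n) \<le> sn (s N) + 1" if "n \<ge> N" for n using sn_le_diff[OF c[of n] c[of N]] N[OF that] by fastforce
  then show ?thesis using sn_nonneg[OF c[of N]]
    by (intro exI[of _ "sn (s N) + 1"]) (auto simp: eventually_sequentially)
qed

lemma ip_difference:
  assumes "tens l" "tens m" "tens l'" "tens m'" "sn m \<le> B" "sn l' \<le> B'"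
  shows "anorm A (vdiff A (ip l m) (ip l' m')) \<le> B * sn (vdiff V l l') + B' * sn (vdiff V m m')"
proof -
  have "vdiff A (ip l m) (ip l' m') = ip (vdiff V l l') m \<boxplus>\<^bsub>A\<^esub> ip l' (vdiff V m m')"
    unfolding ip_diff_left[OF assms(1,3,2)] ip_diff_right[OF assms(2,4,3)]
    using A.lin.nc_identity[of "[ip l m, ip l' m, ip l' m']" "#0 [-] #2" "(#0 [-] #1) [+] (#1 [-] #2)"] assms
    by (simp add: vdiff_def[of A] ip_closed)
  moreover have "anorm A (ip (vdiff V l l') m) \<le> B * sn (vdiff V l l')"
    using ip_cauchy_schwarz[OF tens_diff[OF assms(1,3)] assms(2)] mult_right_mono[OF assms(5) sn_nonneg[OF tens_diff[OF assms(1,3)]]]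
    by (simp add: mult.commute)
  moreover have "anorm A (ip l' (vdiff V m m')) \<le> B' * sn (vdiff V m m')"
    using ip_cauchy_schwarz[OF assms(3) tens_diff[OF assms(2,4)]] mult_right_mono[OF assms(6) sn_nonneg[OF tens_diff[OF assms(2,4)]]]
    by simp
  ultimately show ?thesis
    using A.norm_triangle[of "ip (vdiff V l l') m" "ip l' (vdiff V m m')"] assms by (simp add: ip_closed tens_diff)
qed

lemma ip_ncauchy:
  assumes s: "s \<in> hcauchy A V" and t: "t \<in> hcauchy A V" shows "A.nv.ncauchy (\<lambda>n. ip (s n) (t n))"
  unfolding A.nv.ncauchy_def
proof (intro conjI allI impI)
  note c = hcauchyD(1)[OF s] hcauchyD(1)[OF t]
  show "ip (s n) (t n) \<in> carrier A" for n using c by (simp add: ip_closed)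
  fix \<epsilon> :: real assume e: "\<epsilon> > 0"
  obtain B N where B: "B \<ge> 0" "\<And>n. n \<ge> N \<Longrightarrow> sn (s n) \<le> B" using hcauchy_bounded[OF s] by (auto simp: eventually_sequentially)
  obtain B' N' where B': "B' \<ge> 0" "\<And>n. n \<ge> N' \<Longrightarrow> sn (t n) \<le> B'" using hcauchy_bounded[OF t] by (auto simp: eventually_sequentially)
  define d where "d = \<epsilon> / (B + B' + 1)"
  have d: "d > 0" "(B + B') * d < \<epsilon>" using e B(1) B'(1) by (simp_all add: d_def field_simps)
  obtain M where M: "\<And>m n. m \<ge> M \<Longrightarrow> n \<ge> M \<Longrightarrow> sn (vdiff V (s m) (s n)) < d" using hcauchyD(2)[OF s d(1)] by blast
  obtain M' where M': "\<And>m n. m \<ge> M' \<Longrightarrow> n \<ge> M' \<Longrightarrow> sn (vdiff V (t m) (t n)) < d" using hcauchyD(2)[OF t d(1)] by blast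
  show "\<exists>K. \<forall>m\<ge>K. \<forall>n\<ge>K. anorm A (vdiff A (ip (s m) (t m)) (ip (s n) (t n))) < \<epsilon>"
  proof (intro exI allI impI)
    fix m n assume m: "Max {N, N', M, M'} \<le> m" and n: "Max {N, N', M, M'} \<le> n"
    have "anorm A (vdiff A (ip (s m) (t m)) (ip (s n) (t n))) \<le> B' * sn (vdiff V (s m) (s n)) + B * sn (vdiff V (t m) (t n))"
      using m n B(2)[of n] B'(2)[of m] by (intro ip_difference c) auto
    also have "\<dots> \<le> B' * d + B * d"
      using M[of m n] M'[of m n] m n B(1) B'(1) by (intro add_mono mult_left_mono) auto
    also have "\<dots> < \<epsilon>" using d(2) by (simp add: algebra_simps)
    finally show "anorm A (vdiff A (ip (s m) (t m)) (ip (s n) (t n))) < \<epsilon>" .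
  qed
qed

lemma null_rel_iff: "(s, t) \<in> hnull_rel A V \<longleftrightarrow> s \<in> hcauchy A V \<and> t \<in> hcauchy A V \<and> (\<lambda>n. sn (vdiff V (s n) (t n))) \<longlonglongrightarrow> 0"
proof -
  have "(\<lambda>n. hdist A V (s n) (t n)) = (\<lambda>n. sn (vdiff V (s n) (t n)))" if "s \<in> hcauchy A V" "t \<in> hcauchy A V"
    using hdist_V[OF hcauchyD(1)[OF that(1)] hcauchyD(1)[OF that(2)]] by auto
  then show ?thesis by (auto simp: hnull_rel_def)
qed

lemma null_rel_refl: "s \<in> hcauchy A V \<Longrightarrow> s \<in> hnull_rel A V `` {s}"
  using sn_diff_self[OF hcauchyD(1)] by (simp add: null_rel_iff)

lemma null_rel_ip:
  assumes s: "s' \<in> hnull_rel A V `` {s}" and t: "t' \<in> hnull_rel A V `` {t}"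
    and b: "A.nv.conv (\<lambda>n. ip (s n) (t n)) b"
  shows "A.nv.conv (\<lambda>n. ip (s' n) (t' n)) b"
proof -
  have h: "s \<in> hcauchy A V" "s' \<in> hcauchy A V" "t \<in> hcauchy A V" "t' \<in> hcauchy A V"
    and z: "(\<lambda>n. sn (vdiff V (s n) (s' n))) \<longlonglongrightarrow> 0" "(\<lambda>n. sn (vdiff V (t n) (t' n))) \<longlonglongrightarrow> 0"
    using s t by (auto simp: null_rel_iff)
  note c = hcauchyD(1)[OF h(1)] hcauchyD(1)[OF h(2)] hcauchyD(1)[OF h(3)] hcauchyD(1)[OF h(4)]
  obtain b' where b': "A.nv.conv (\<lambda>n. ip (s' n) (t' n)) b'" using A.nv.ncauchy_conv[OF ip_ncauchy[OF h(2,4)]] by blast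
  obtain B where B: "B \<ge> 0" "\<forall>\<^sub>F n in sequentially. sn (t n) \<le> B" using hcauchy_bounded[OF h(3)] by blast
  obtain B' where B': "B' \<ge> 0" "\<forall>\<^sub>F n in sequentially. sn (s' n) \<le> B'" using hcauchy_bounded[OF h(2)] by blast
  have ev: "\<forall>\<^sub>F n in sequentially. anorm A (vdiff A (ip (s n) (t n)) (ip (s' n) (t' n))) \<le>
      B * sn (vdiff V (s n) (s' n)) + B' * sn (vdiff V (t n) (t' n))"
    using B(2) B'(2) by eventually_elim (intro ip_difference c)
  have l1: "(\<lambda>n. anorm A (vdiff A (ip (s n) (t n)) (ip (s' n) (t' n)))) \<longlonglongrightarrow> anorm A (vdiff A b b')"
    by (rule A.nv.conv_norm[OF A.nv.conv_diff[OF b b']])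
  have l2: "(\<lambda>n. B * sn (vdiff V (s n) (s' n)) + B' * sn (vdiff V (t n) (t' n))) \<longlonglongrightarrow> B * 0 + B' * 0"
    by (intro tendsto_add tendsto_mult tendsto_const z)
  have "anorm A (vdiff A b b') \<le> B * 0 + B' * 0"
    by (rule tendsto_le[OF trivial_limit_sequentially l2 l1 ev])
  moreover have bc: "b \<in> carrier A" "b' \<in> carrier A" using A.nv.convD(2) b b' by blast+
  ultimately have "anorm A (vdiff A b b') = 0" using A.norm_nonneg[OF A.diff_closed[OF bc]] by simp
  then have "b = b'" using A.norm_eq_zero[OF A.diff_closed[OF bc]] A.diff_eq_zero[OF bc] by simp
  then show ?thesis using b' by simp
qed

text \<open>The description in \<open>hausdorff_completion\<close> asks for a limit common to all
  representatives: \<open>ip_ncauchy\<close> provides one, and \<open>null_rel_ip\<close> shows that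
  it does not depend on the choice.\<close>

lemma tensor_inner:
  assumes s: "s \<in> hcauchy A V" and t: "t \<in> hcauchy A V"
  shows "A.nv.conv (\<lambda>n. ip (s n) (t n)) (hinner (balanced_tensor A X Y) (hnull_rel A V `` {s}) (hnull_rel A V `` {t}))"
proof -
  let ?S = "hnull_rel A V `` {s}" and ?T = "hnull_rel A V `` {t}"
  obtain b where b: "A.nv.conv (\<lambda>n. ip (s n) (t n)) b" using A.nv.ncauchy_conv[OF ip_ncauchy[OF s t]] by blast
  have lim: "limitin (cstar_topology A) (\<lambda>n. hinner V (s' n) (t' n)) c sequentially \<longleftrightarrow> A.nv.conv (\<lambda>n. ip (s' n) (t' n)) c"
    if "s' \<in> ?S" "t' \<in> ?T" for s' t' c
  proof -
    have c: "tens (s' n)" "tens (t' n)" for n using that hcauchyD(1) by (auto simp: null_rel_iff)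
    then have "(\<lambda>n. hinner V (s' n) (t' n)) = (\<lambda>n. ip (s' n) (t' n))" using hinner_V by blast
    then show ?thesis using A.nv.limitin_iff_conv[of "\<lambda>n. ip (s' n) (t' n)" c] c by (simp add: cstar_dist_eq ip_closed)
  qed
  have "hinner (balanced_tensor A X Y) ?S ?T = (THE b. \<forall>s\<in>?S. \<forall>t\<in>?T. limitin (cstar_topology A) (\<lambda>n. hinner V (s n) (t n)) b sequentially)"
    by (simp add: balanced_tensor_def hausdorff_completion_def Let_def)
  also have "\<dots> = b"
  proof (rule the_equality)
    show "\<forall>s\<in>?S. \<forall>t\<in>?T. limitin (cstar_topology A) (\<lambda>n. hinner V (s n) (t n)) b sequentially"
      using lim null_rel_ip[OF _ _ b] by blast
    fix c assume "\<forall>s\<in>?S. \<forall>t\<in>?T. limitin (cstar_topology A) (\<lambda>n. hinner V (s n) (t n)) c sequentially"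
    then have "A.nv.conv (\<lambda>n. ip (s n) (t n)) c" using lim null_rel_refl s t by blast
    then show "c = b" using b by (rule A.nv.conv_unique)
  qed
  finally show ?thesis using b by simp
qed

text \<open>If z is the image of the class of s, the sums of products named by the terms of s
  converge to z. The proof compares inner products: for w named by \<open>s N\<close>, <z - w, z -
  w> is the limit of the semi-inner squares of the differences of \<open>s n\<close> and
  \<open>s N\<close>.\<close>

theorem elementary_tensors_dense:
  assumes Z: "hilbert_module A Z" and M: "M \<in> bimodule_isos A (balanced_tensor A X Y) Z"
    and pm: "\<And>x y. x \<in> carrier X \<Longrightarrow> y \<in> carrier Y \<Longrightarrow> M (elem_tensor A X Y x y) = pm x y"
    and z: "z \<in> carrier Z" and e: "0 < \<epsilon>"
  shows "\<exists>l. tens l \<and> hnorm A Z (vdiff Z z (vlsum Z (map (\<lambda>(x, y). pm x y) l))) < \<epsilon>"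
proof -
  interpret Z: hilbert_module A Z by fact
  let ?T = "balanced_tensor A X Y"
  have carT: "carrier ?T = hcauchy A V // hnull_rel A V" by (simp add: balanced_tensor_def hausdorff_completion_def Let_def)
  have bij: "bij_betw M (carrier ?T) (carrier Z)"
    and inner: "\<And>u v. u \<in> carrier ?T \<Longrightarrow> v \<in> carrier ?T \<Longrightarrow> hinner Z (M u) (M v) = hinner ?T u v"
    using M by (auto simp: bimodule_isos_def)
  obtain U where U: "U \<in> carrier ?T" "z = M U" using bij z by (auto simp: bij_betw_def)
  then obtain s where s: "s \<in> hcauchy A V" "U = hnull_rel A V `` {s}" unfolding carT by (auto elim: quotientE)
  note sc = hcauchyD(1)[OF s(1)]
  have el: "elem_tensor A X Y x y = hnull_rel A V `` {\<lambda>_. [(x, y)]}" "(\<lambda>_. [(x, y)]) \<in> hcauchy A V"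
      "elem_tensor A X Y x y \<in> carrier ?T" if "x \<in> carrier X" "y \<in> carrier Y" for x y
    using that hcauchy_const[of "[(x, y)]"] by (auto simp: elem_tensor_def carT intro: quotientI)
  have pmc: "pm x y \<in> carrier Z" if "x \<in> carrier X" "y \<in> carrier Y" for x y
    using bij el(3)[OF that] pm[OF that] by (metis bij_betwE)
  have zx: "A.nv.conv (\<lambda>n. ip (s n) [(x, y)]) (hinner Z z (pm x y))" if "x \<in> carrier X" "y \<in> carrier Y" for x y
    using tensor_inner[OF s(1) el(2)[OF that]] inner[OF U(1) el(3)[OF that]] pm[OF that] by (simp add: U(2) s(2) el(1)[OF that])
  have xx: "hinner Z (pm x y) (pm x' y') = f (x, y) (x', y')"
    if c: "x \<in> carrier X" "y \<in> carrier Y" "x' \<in> carrier X" "y' \<in> carrier Y" for x y x' y'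
  proof -
    have "A.nv.conv (\<lambda>n. ip [(x, y)] [(x', y')]) (hinner Z (pm x y) (pm x' y'))"
      using tensor_inner[OF el(2)[OF c(1,2)] el(2)[OF c(3,4)]] inner[OF el(3)[OF c(1,2)] el(3)[OF c(3,4)]] pm c by (simp add: el(1))
    moreover have "ip [(x, y)] [(x', y')] = f (x, y) (x', y')" using c f_closed by (simp add: ip_simps A.add_zero A.add_closed A.zero_closed)
    ultimately show ?thesis using A.nv.conv_unique A.nv.conv_const f_closed c by (metis SigmaI)
  qed
  let ?pm = "\<lambda>l. vlsum Z (map (\<lambda>(x, y). pm x y) l)"
  have wc: "?pm l \<in> carrier Z" if "tens l" for l by (rule Z.vlsum_map_closed) (use that pmc in auto)
  have zw: "A.nv.conv (\<lambda>n. ip (s n) l) (hinner Z z (?pm l))" if "tens l" for l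
    using that
  proof (induction l)
    case Nil
    have "ip (s n) [] = \<zero>\<^sub>v\<^bsub>A\<^esub>" for n by (simp add: ip_def A.vlsum_map_zero)
    then show ?case using A.nv.conv_const[OF A.zero_closed] z by (simp add: Z.inner_zero)
  next
    case (Cons p l)
    obtain x y where p: "p = (x, y)" by force
    have c: "x \<in> carrier X" "y \<in> carrier Y" "tens l" using Cons.prems p by auto
    have "ip (s n) (p # l) = ip (s n) [(x, y)] \<boxplus>\<^bsub>A\<^esub> ip (s n) l" for n using ip_cons_right[OF sc, of p l] c p by simp
    then show ?case
      using A.nv.conv_add[OF zx[OF c(1,2)] Cons.IH[OF c(3)]] c z wc[OF c(3)] pmc by (simp add: p Z.inner_add_right)
  qed
  have ww: "hinner Z (?pm m) (?pm l) = ip m l" if l: "tens l" and m: "tens m" for l m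
  proof -
    have row: "hinner Z (pm x y) (?pm l) = vlsum A (map (f (x, y)) l)" if c: "x \<in> carrier X" "y \<in> carrier Y" for x y
    proof -
      have "hinner Z (pm x y) (?pm l) = vlsum A (map (hinner Z (pm x y)) (map (\<lambda>(x, y). pm x y) l))"
        by (rule Z.inner_vlsum(1)) (use l c pmc in auto)
      also have "map (hinner Z (pm x y)) (map (\<lambda>(x, y). pm x y) l) = map (f (x, y)) l" using l c xx by auto
      finally show ?thesis .
    qed
    have "hinner Z (?pm m) (?pm l) = vlsum A (map (\<lambda>v. hinner Z v (?pm l)) (map (\<lambda>(x, y). pm x y) m))"
      by (rule Z.inner_vlsum(2)) (use m pmc wc[OF l] in auto)
    also have "map (\<lambda>v. hinner Z v (?pm l)) (map (\<lambda>(x, y). pm x y) m) = map (\<lambda>p. vlsum A (map (f p) l)) m"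
      using m row by auto
    finally show ?thesis by (simp add: ip_def)
  qed
  obtain N where N: "\<And>m n. m \<ge> N \<Longrightarrow> n \<ge> N \<Longrightarrow> sn (vdiff V (s m) (s n)) < \<epsilon> / 2"
    using hcauchyD(2)[OF s(1), of "\<epsilon> / 2"] e by auto
  let ?l = "s N"
  let ?w = "?pm ?l"
  have zz: "A.nv.conv (\<lambda>n. ip (s n) (s n)) (hinner Z z z)"
    using tensor_inner[OF s(1) s(1)] inner[OF U(1) U(1)] by (simp add: U(2) s(2))
  have wz: "A.nv.conv (\<lambda>n. ip ?l (s n)) (hinner Z ?w z)"
    using A.conv_star[OF zw[OF sc[of N]]] ip_star[OF sc sc[of N]] Z.inner_star[OF z wc[OF sc[of N]]] by simp
  have "A.nv.conv (\<lambda>n. vdiff A (vdiff A (ip (s n) (s n)) (ip ?l (s n))) (vdiff A (ip (s n) ?l) (ip ?l ?l)))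
      (vdiff A (vdiff A (hinner Z z z) (hinner Z ?w z)) (vdiff A (hinner Z z ?w) (hinner Z ?w ?w)))"
    using A.nv.conv_diff[OF A.nv.conv_diff[OF zz wz] A.nv.conv_diff[OF zw[OF sc[of N]] A.nv.conv_const[OF ip_closed[OF sc[of N] sc[of N]]]]]
      ww[OF sc[of N] sc[of N]] by simp
  moreover have "vdiff A (vdiff A (ip (s n) (s n)) (ip ?l (s n))) (vdiff A (ip (s n) ?l) (ip ?l ?l)) = ip (vdiff V (s n) ?l) (vdiff V (s n) ?l)" for n
    using sc by (simp add: ip_diff_left ip_diff_right tens_diff)
  moreover have "vdiff A (vdiff A (hinner Z z z) (hinner Z ?w z)) (vdiff A (hinner Z z ?w) (hinner Z ?w ?w)) = hinner Z (vdiff Z z ?w) (vdiff Z z ?w)"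
    using z wc[OF sc[of N]] by (simp add: Z.inner_diff_left Z.inner_diff_right Z.diff_closed)
  ultimately have lim: "A.nv.conv (\<lambda>n. ip (vdiff V (s n) ?l) (vdiff V (s n) ?l)) (hinner Z (vdiff Z z ?w) (vdiff Z z ?w))" by simp
  have "anorm A (hinner Z (vdiff Z z ?w) (vdiff Z z ?w)) \<le> (\<epsilon> / 2)\<^sup>2"
  proof (rule LIMSEQ_le_const2[OF A.nv.conv_norm[OF lim]], intro exI allI impI)
    fix n assume "N \<le> n"
    then have "(sn (vdiff V (s n) ?l))\<^sup>2 \<le> (\<epsilon> / 2)\<^sup>2"
      using N[of n N] sn_nonneg[OF tens_diff[OF sc sc]] by (intro power_mono) (auto simp: less_imp_le)
    then show "anorm A (ip (vdiff V (s n) ?l) (vdiff V (s n) ?l)) \<le> (\<epsilon> / 2)\<^sup>2" using sn_square[OF tens_diff[OF sc sc]] by simp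
  qed
  then have "(hnorm A Z (vdiff Z z ?w))\<^sup>2 \<le> (\<epsilon> / 2)\<^sup>2" using Z.hnorm_square z wc[OF sc[of N]] by (simp add: Z.diff_closed)
  then have "hnorm A Z (vdiff Z z ?w) \<le> \<epsilon> / 2" by (rule power2_le_imp_le) (use e in simp)
  then have "hnorm A Z (vdiff Z z ?w) < \<epsilon>" using e by simp
  then show ?thesis using sc[of N] by blast
qed

end

section \<open>Representations of product systems\<close>

lemma (in cstar_algebra) cspan_sandwich:
  assumes S: "nv.scale_invariant S" and Z: "nv.csubspace Z" "nv.nclosed Z" and a: "a \<in> carrier A" and b: "b \<in> carrier A"
    and s: "\<And>s. s \<in> S \<Longrightarrow> a \<odot> s \<odot> b \<in> Z" and c: "c \<in> nv.cspan S"
  shows "a \<odot> c \<odot> b \<in> Z"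
proof -
  let ?U = "{c \<in> carrier A. a \<odot> c \<odot> b \<in> Z}"
  have "nv.csubspace ?U"
    using Z(1) a b by (auto simp: nv.csubspace_def cl mult_zero mult_add_right mult_add_left mult_scale_right mult_scale_left)
  moreover have "nv.nclosed ?U"
  proof (rule nv.nclosedI)
    fix t x assume t: "\<And>n. t n \<in> ?U" and x: "nv.conv t x"
    have "a \<odot> x \<odot> b \<in> Z"
      by (rule nv.nclosed_conv[OF Z(2) _ conv_mult[OF conv_mult[OF nv.conv_const[OF a] x] nv.conv_const[OF b]]]) (use t in blast)
    then show "x \<in> ?U" using nv.convD(2)[OF x] by blast
  qed blast
  ultimately have "nv.cspan S \<subseteq> ?U" using S s by (intro nv.cspan_minimal) (auto simp: nv.scale_invariant_def)
  then show ?thesis using c by blast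
qed

context product_system begin

lemma one_P: "\<one>\<^bsub>G\<^esub> \<in> P"
  using P_inter_inverse by blast

lemma P_carrier: "p \<in> P \<Longrightarrow> p \<in> carrier G"
  using P_subset by blast

lemma fibre_one_simps:
  "carrier (fibre X \<one>\<^bsub>G\<^esub>) = carrier A" "hinner (fibre X \<one>\<^bsub>G\<^esub>) = (\<lambda>a b. a\<^sup>\<star>\<^bsub>A\<^esub> \<odot>\<^bsub>A\<^esub> b)"
  "lact (fibre X \<one>\<^bsub>G\<^esub>) = amult A"
  by (simp_all add: fibre_one self_bimodule_simps)

lemma fibre_module: "p \<in> P \<Longrightarrow> hilbert_module A (fibre X p)"
  by (rule hilbert_bimodule.axioms(1)[OF fibre_bimodule])

lemma lower_diff: "p \<in> P \<Longrightarrow> q \<in> P \<Longrightarrow> p \<otimes>\<^bsub>G\<^esub> (inv\<^bsub>G\<^esub> p \<otimes>\<^bsub>G\<^esub> q) = q"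
  using P_carrier by (simp add: m_assoc[symmetric])

text \<open>Two joins lie below each other, and P meets its inverse only in the identity, so they
  agree.\<close>

lemma join_is_join: assumes p: "p \<in> P" and q: "q \<in> P" and ub: "has_ub G P p q" shows "is_join G P p q (join G P p q)"
proof -
  obtain r where r: "is_join G P p q r" using ex_join P_carrier p q ub by blast
  have "s = r" if s: "is_join G P p q s" for s
  proof -
    have c: "r \<in> carrier G" "s \<in> carrier G" using r s P_carrier by (auto simp: is_join_def)
    have "inv\<^bsub>G\<^esub> r \<otimes>\<^bsub>G\<^esub> s \<in> P" "inv\<^bsub>G\<^esub> s \<otimes>\<^bsub>G\<^esub> r \<in> P" using r s by (auto simp: is_join_def ple_def)
    moreover have "inv\<^bsub>G\<^esub> r \<otimes>\<^bsub>G\<^esub> s = inv\<^bsub>G\<^esub> (inv\<^bsub>G\<^esub> s \<otimes>\<^bsub>G\<^esub> r)" using c by (simp add: inv_mult_group)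
    ultimately have "inv\<^bsub>G\<^esub> r \<otimes>\<^bsub>G\<^esub> s \<in> P \<inter> m_inv G ` P" by blast
    then have "inv\<^bsub>G\<^esub> r \<otimes>\<^bsub>G\<^esub> s = \<one>\<^bsub>G\<^esub>" using P_inter_inverse by blast
    then have "r \<otimes>\<^bsub>G\<^esub> (inv\<^bsub>G\<^esub> r \<otimes>\<^bsub>G\<^esub> s) = r" using c by simp
    then show "s = r" using c by (simp add: m_assoc[symmetric])
  qed
  then have "join G P p q = r" unfolding join_def using r by (intro the_equality)
  then show ?thesis using r by simp
qed

end

section \<open>Representations, their homomorphisms on compacts, and words\<close>

locale psys_rep = product_system G P A X + B: cstar_algebra B
  for G :: "'g monoid" and P :: "'g set" and A :: "'a cstar" and X :: "('g, 'a) psys" and B :: "'b cstar" +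
  fixes \<psi> :: "'g \<Rightarrow> 'a \<Rightarrow> 'b"
  assumes rep: "representation G P A X B \<psi>"
begin

abbreviation \<pi> :: "'a \<Rightarrow> 'b" where "\<pi> \<equiv> restrict (\<psi> \<one>\<^bsub>G\<^esub>) (carrier A)"

abbreviation fib :: "'g \<Rightarrow> 'a set" where "fib p \<equiv> carrier (fibre X p)"

lemma pi_hom: "\<pi> \<in> star_homs A B"
  using rep by (simp add: representation_def)

lemma psi_mult: "p \<in> P \<Longrightarrow> q \<in> P \<Longrightarrow> x \<in> fib p \<Longrightarrow> y \<in> fib q \<Longrightarrow>
    \<psi> p x \<odot>\<^bsub>B\<^esub> \<psi> q y = \<psi> (p \<otimes>\<^bsub>G\<^esub> q) (pmult X p q x y)"
  using rep by (simp add: representation_def)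

lemma psi_inner: "p \<in> P \<Longrightarrow> x \<in> fib p \<Longrightarrow> y \<in> fib p \<Longrightarrow> \<psi> \<one>\<^bsub>G\<^esub> (hinner (fibre X p) x y) = (\<psi> p x)\<^sup>\<star>\<^bsub>B\<^esub> \<odot>\<^bsub>B\<^esub> \<psi> p y"
  using rep by (simp add: representation_def)

lemma module_rep_fibre: assumes p: "p \<in> P" shows "module_rep A (fibre X p) B (\<psi> p) \<pi>"
proof -
  interpret M: hilbert_module A "fibre X p" by (rule fibre_module[OF p])
  show ?thesis
  proof
    show "linear_map (fibre X p) B (\<psi> p)" using rep p by (simp add: representation_def)
    show "\<pi> \<in> star_homs A B" by (rule pi_hom)
    show "\<psi> p (ract (fibre X p) x a) = \<psi> p x \<odot>\<^bsub>B\<^esub> \<pi> a" if "x \<in> fib p" "a \<in> carrier A" for x a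
      using psi_mult[OF p one_P that(1), of a] that pmult_one_right[OF p that(2,1)] P_carrier[OF p]
      by (simp add: fibre_one_simps)
    show "\<pi> (hinner (fibre X p) x y) = (\<psi> p x)\<^sup>\<star>\<^bsub>B\<^esub> \<odot>\<^bsub>B\<^esub> \<psi> p y" if "x \<in> fib p" "y \<in> fib p" for x y
      using psi_inner[OF p that] that by (simp add: M.inner_closed)
  qed
qed

lemma psi_closed: "p \<in> P \<Longrightarrow> x \<in> fib p \<Longrightarrow> \<psi> p x \<in> carrier B"
  using module_rep.psi_closed[OF module_rep_fibre] .

abbreviation cr :: "'g \<Rightarrow> ('a \<Rightarrow> 'a) \<Rightarrow> 'b" where "cr p \<equiv> compact_rep A X B \<psi> p"

lemma compact_rep_props:
  assumes p: "p \<in> P"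
  shows "cr p \<in> star_homs (compacts A (fibre X p)) B"
    and "x \<in> fib p \<Longrightarrow> y \<in> fib p \<Longrightarrow> cr p (rank_one (fibre X p) x y) = \<psi> p x \<odot>\<^bsub>B\<^esub> (\<psi> p y)\<^sup>\<star>\<^bsub>B\<^esub>"
  using theI'[OF module_rep.compact_rep_ex1[OF module_rep_fibre[OF p]]] unfolding compact_rep_def[symmetric] by blast+

lemma compact_rep_unique:
  assumes p: "p \<in> P" and h: "h \<in> star_homs (compacts A (fibre X p)) B"
    and "\<And>x y. x \<in> fib p \<Longrightarrow> y \<in> fib p \<Longrightarrow> h (rank_one (fibre X p) x y) = \<psi> p x \<odot>\<^bsub>B\<^esub> (\<psi> p y)\<^sup>\<star>\<^bsub>B\<^esub>"
  shows "h = cr p"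
  using module_rep.compact_rep_ex1[OF module_rep_fibre[OF p]] compact_rep_props[OF p] assms(2,3) by metis

lemma compact_rep_closed: "p \<in> P \<Longrightarrow> T \<in> carrier (compacts A (fibre X p)) \<Longrightarrow> cr p T \<in> carrier B"
  by (rule star_homsD(1)[OF compact_rep_props(1)])

text \<open>The argument has the entry type of the lists in \<open>sum_seqs\<close>, so that a
  sequence of lists of letters can name an element of the algebra.\<close>

definition word :: "(('g \<times> 'a) \<times> ('g \<times> 'a)) \<Rightarrow> 'b" where
  "word = (\<lambda>((p, x), (q, y)). \<psi> p x \<odot>\<^bsub>B\<^esub> (\<psi> q y)\<^sup>\<star>\<^bsub>B\<^esub>)"

abbreviation letters :: "(('g \<times> 'a) \<times> ('g \<times> 'a)) set" where
  "letters \<equiv> (SIGMA p:P. fib p) \<times> (SIGMA p:P. fib p)"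

abbreviation words :: "'b set" where
  "words \<equiv> {\<psi> p x \<odot>\<^bsub>B\<^esub> (\<psi> q y)\<^sup>\<star>\<^bsub>B\<^esub> | p q x y. p \<in> P \<and> q \<in> P \<and> x \<in> fib p \<and> y \<in> fib q}"

lemma words_eq: "words = word ` letters"
  by (force simp: word_def image_def)

lemma word_closed: "l \<in> letters \<Longrightarrow> word l \<in> carrier B"
  by (auto simp: word_def psi_closed B.cl)

lemma scale_invariant_words: "B.nv.scale_invariant words"
proof -
  have "\<exists>p' q' x' y'. c \<cdot>\<^bsub>B\<^esub> (\<psi> p x \<odot>\<^bsub>B\<^esub> (\<psi> q y)\<^sup>\<star>\<^bsub>B\<^esub>) = \<psi> p' x' \<odot>\<^bsub>B\<^esub> (\<psi> q' y')\<^sup>\<star>\<^bsub>B\<^esub> \<and> p' \<in> P \<and> q' \<in> P \<and> x' \<in> fib p' \<and> y' \<in> fib q'"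
    if "p \<in> P" "q \<in> P" "x \<in> fib p" "y \<in> fib q" for c p q x y
  proof -
    interpret M: module_rep A "fibre X p" B "\<psi> p" \<pi> by (rule module_rep_fibre[OF that(1)])
    have "c \<cdot>\<^bsub>B\<^esub> (\<psi> p x \<odot>\<^bsub>B\<^esub> (\<psi> q y)\<^sup>\<star>\<^bsub>B\<^esub>) = \<psi> p (c \<cdot>\<^bsub>fibre X p\<^esub> x) \<odot>\<^bsub>B\<^esub> (\<psi> q y)\<^sup>\<star>\<^bsub>B\<^esub>"
      using that by (simp add: M.psi_scale B.mult_scale_left psi_closed B.cl)
    then show ?thesis using that M.scale_closed by blast
  qed
  note sc = this
  show ?thesis
    unfolding B.nv.scale_invariant_def
  proof (intro conjI allI ballI subsetI)
    fix s assume "s \<in> words"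
    then obtain p q x y where *: "s = \<psi> p x \<odot>\<^bsub>B\<^esub> (\<psi> q y)\<^sup>\<star>\<^bsub>B\<^esub>" "p \<in> P" "q \<in> P" "x \<in> fib p" "y \<in> fib q" by blast
    then show "s \<in> carrier B" by (simp add: psi_closed B.cl)
  next
    fix c s assume "s \<in> words"
    then obtain p q x y where *: "s = \<psi> p x \<odot>\<^bsub>B\<^esub> (\<psi> q y)\<^sup>\<star>\<^bsub>B\<^esub>" "p \<in> P" "q \<in> P" "x \<in> fib p" "y \<in> fib q" by blast
    show "c \<cdot>\<^bsub>B\<^esub> s \<in> words" using sc[OF *(2-5), of c] unfolding *(1) by blast
  qed
qed

lemma vspan_words: "vspan B words = {vlsum B (map word l) | l. set l \<subseteq> letters}"
proof -
  have iff: "set xs \<subseteq> words \<longleftrightarrow> (\<exists>l. set l \<subseteq> letters \<and> xs = map word l)" for xs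
  proof
    assume "set xs \<subseteq> words"
    then show "\<exists>l. set l \<subseteq> letters \<and> xs = map word l"
      unfolding words_eq
    proof (induction xs)
      case (Cons a xs)
      then obtain l k where "set l \<subseteq> letters" "xs = map word l" "k \<in> letters" "a = word k" by auto
      then show ?case by (intro exI[of _ "k # l"]) simp
    qed simp
  next
    assume "\<exists>l. set l \<subseteq> letters \<and> xs = map word l"
    then obtain l where l: "set l \<subseteq> letters" "xs = map word l" by blast
    show "set xs \<subseteq> words" unfolding words_eq l(2) set_map by (rule image_mono[OF l(1)])
  qed
  show ?thesis unfolding B.nv.vspan_eq[OF scale_invariant_words] iff by blast
qed

lemma generated_iff:
  "generated P X B \<psi> \<longleftrightarrow> (\<forall>b\<in>carrier B. \<forall>\<epsilon>>0. \<exists>l. set l \<subseteq> letters \<and> anorm B (vdiff B b (vlsum B (map word l))) < \<epsilon>)"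
proof -
  have sub: "vspan B words \<subseteq> carrier B"
    using B.nv.csubspace_vspan[OF scale_invariant_words] by (simp add: B.nv.csubspace_def)
  have "generated P X B \<psi> \<longleftrightarrow> carrier B = B.nv.nclosure (vspan B words)"
    by (simp add: generated_def cstar_dist_eq)
  also have "\<dots> \<longleftrightarrow> (\<forall>b\<in>carrier B. \<forall>\<epsilon>>0. \<exists>y\<in>vspan B words. anorm B (vdiff B b y) < \<epsilon>)"
    using B.nv.in_closure[OF sub] by blast
  finally show ?thesis unfolding vspan_words by blast
qed

lemma homs_eq:
  assumes gen: "generated P X B \<psi>" and C: "cstar_algebra C" and h: "h \<in> star_homs B C" and g: "g \<in> star_homs B C"
    and eq: "\<And>p x. p \<in> P \<Longrightarrow> x \<in> fib p \<Longrightarrow> h (\<psi> p x) = g (\<psi> p x)"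
  shows "h = g"
proof (rule star_homs_eq_dense[OF B.cstar_algebra_axioms C h g])
  interpret H: star_hom B C h using C h B.cstar_algebra_axioms by (simp add: star_hom_def star_hom_axioms_def)
  interpret K: star_hom B C g using C g B.cstar_algebra_axioms by (simp add: star_hom_def star_hom_axioms_def)
  let ?D = "{vlsum B (map word l) | l. set l \<subseteq> letters}"
  have word_c: "set (map word l) \<subseteq> carrier B" if "set l \<subseteq> letters" for l
    unfolding set_map by (rule image_subsetI) (use that in \<open>blast intro: word_closed\<close>)
  show "?D \<subseteq> carrier B"
  proof
    fix b assume "b \<in> ?D"
    then obtain l where l: "set l \<subseteq> letters" "b = vlsum B (map word l)" by blast
    show "b \<in> carrier B" unfolding l(2) by (rule B.vlsum_closed[OF word_c[OF l(1)]])
  qed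
  show "\<exists>y\<in>?D. anorm B (vdiff B b y) < \<epsilon>" if "b \<in> carrier B" "0 < \<epsilon>" for b \<epsilon>
    using gen that unfolding generated_iff by blast
  show "h b = g b" if b: "b \<in> ?D" for b
  proof -
    obtain l where l: "set l \<subseteq> letters" "b = vlsum B (map word l)" using b by blast
    have "h (word k) = g (word k)" if "k \<in> letters" for k
      using that eq by (auto simp: word_def H.hom_mult K.hom_mult H.hom_star K.hom_star psi_closed B.cl)
    then have "map h (map word l) = map g (map word l)" using l(1) by auto
    then show ?thesis unfolding l(2) H.hom_vlsum[OF word_c[OF l(1)]] K.hom_vlsum[OF word_c[OF l(1)]] by (rule arg_cong)
  qed
qed

text \<open>The frame of \<open>y\<close> yields both \<open>y \<approx> Ty\<close> with \<open>T\<close> compact and \<open>y \<approx> \<Sum>u\<langle>u, y\<rangle>\<close>.\<close>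

lemma psi_approx:
  assumes p: "p \<in> P" and y: "y \<in> fib p" and e: "0 < \<epsilon>"
  shows "\<exists>T\<in>carrier (compacts A (fibre X p)). anorm B (vdiff B (cr p T \<odot>\<^bsub>B\<^esub> \<psi> p y) (\<psi> p y)) \<le> \<epsilon> \<and>
    cr p T \<odot>\<^bsub>B\<^esub> \<psi> p y \<in> B.nv.cspan words"
proof -
  interpret M: module_rep A "fibre X p" B "\<psi> p" \<pi> by (rule module_rep_fibre[OF p])
  obtain us where us: "set us \<subseteq> fib p"
    and le: "hnorm A (fibre X p) (vdiff (fibre X p) y (vlsum (fibre X p) (map (\<lambda>u. ract (fibre X p) u (hinner (fibre X p) u y)) us))) \<le> \<epsilon>"
    using M.frame[of "[y]" \<epsilon>] y e by auto
  let ?l = "map (\<lambda>u. (u, u)) us"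
  have l: "M.pairs ?l" using us by auto
  let ?T = "M.rk ?l"
  have Ty: "?T y = vlsum (fibre X p) (map (\<lambda>u. ract (fibre X p) u (hinner (fibre X p) u y)) us)"
    using M.L_vlsum_apply[of "map (\<lambda>(x, y). rank_one (fibre X p) x y) ?l" y] y us M.rank_one_mem
    by (auto simp: M.rk_def M.rank_one_apply o_def)
  have Tc: "?T y \<in> fib p" by (rule M.L_closed[OF M.rk_closed[OF l] y])
  have eq: "cr p ?T \<odot>\<^bsub>B\<^esub> \<psi> p y = \<psi> p (?T y)"
    using M.compacts_hom_rk[OF compact_rep_props[OF p] l] M.psi_rk[OF l y] by simp
  have "anorm B (vdiff B (\<psi> p y) (\<psi> p (?T y))) \<le> \<epsilon>"
    using M.psi_norm_le[OF M.diff_closed[OF y Tc]] le M.psi_diff[OF y Tc] unfolding Ty by simp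
  then have "anorm B (vdiff B (cr p ?T \<odot>\<^bsub>B\<^esub> \<psi> p y) (\<psi> p y)) \<le> \<epsilon>"
    unfolding eq using B.nv.nrm_diff_commute[OF psi_closed[OF p Tc] psi_closed[OF p y]] by simp
  moreover have "\<psi> p (?T y) \<in> B.nv.cspan words"
  proof -
    have "\<psi> p (?T y) = vlsum B (map (\<lambda>u. \<psi> p (ract (fibre X p) u (hinner (fibre X p) u y))) us)"
      unfolding Ty using us y by (subst M.psi_vlsum) (auto simp: M.ract_closed M.inner_closed o_def)
    \<comment> \<open>Each u<u,y> is sent to psi(u) times the adjoint of the image of <y,u>, a word
      whose second letter lies over the identity.\<close>
    also have "map (\<lambda>u. \<psi> p (ract (fibre X p) u (hinner (fibre X p) u y))) us =
        map (\<lambda>u. \<psi> p u \<odot>\<^bsub>B\<^esub> (\<psi> \<one>\<^bsub>G\<^esub> (hinner (fibre X p) y u))\<^sup>\<star>\<^bsub>B\<^esub>) us"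
    proof (rule map_cong[OF refl])
      fix u assume "u \<in> set us"
      then have u: "u \<in> fib p" using us by blast
      have h: "hinner (fibre X p) y u \<in> carrier A" "(hinner (fibre X p) y u)\<^sup>\<star>\<^bsub>A\<^esub> = hinner (fibre X p) u y"
        using u y by (simp_all add: M.inner_closed M.inner_star)
      show "\<psi> p (ract (fibre X p) u (hinner (fibre X p) u y)) = \<psi> p u \<odot>\<^bsub>B\<^esub> (\<psi> \<one>\<^bsub>G\<^esub> (hinner (fibre X p) y u))\<^sup>\<star>\<^bsub>B\<^esub>"
        using M.psi_ract[OF u M.inner_closed[OF u y]] star_homsD(5)[OF pi_hom h(1)] h u y by (simp add: M.inner_closed)
    qed
    finally have "\<psi> p (?T y) = vlsum B (map (\<lambda>u. \<psi> p u \<odot>\<^bsub>B\<^esub> (\<psi> \<one>\<^bsub>G\<^esub> (hinner (fibre X p) y u))\<^sup>\<star>\<^bsub>B\<^esub>) us)" .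
    moreover have "set (map (\<lambda>u. \<psi> p u \<odot>\<^bsub>B\<^esub> (\<psi> \<one>\<^bsub>G\<^esub> (hinner (fibre X p) y u))\<^sup>\<star>\<^bsub>B\<^esub>) us) \<subseteq> words"
    proof -
      have "hinner (fibre X p) y u \<in> fib \<one>\<^bsub>G\<^esub>" if "u \<in> set us" for u
        using that us y M.inner_closed by (auto simp: fibre_one_simps)
      then show ?thesis using us p one_P by fastforce
    qed
    ultimately show ?thesis
      using B.nv.csubspace_vlsum[OF B.nv.csubspace_cspan[OF scale_invariant_words] order_trans[OF _ B.nv.cspan_superset[OF scale_invariant_words]]]
      by simp
  qed
  ultimately show ?thesis using M.rk_compact[OF l] eq by (intro bexI[of _ ?T]) simp_all
qed

lemma psi_approx_conv:
  assumes p: "p \<in> P" and y: "y \<in> fib p"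
  shows "\<exists>T. (\<forall>n. T n \<in> carrier (compacts A (fibre X p)) \<and> cr p (T n) \<odot>\<^bsub>B\<^esub> \<psi> p y \<in> B.nv.cspan words) \<and>
    B.nv.conv (\<lambda>n. cr p (T n) \<odot>\<^bsub>B\<^esub> \<psi> p y) (\<psi> p y)"
proof -
  have "\<exists>T. T \<in> carrier (compacts A (fibre X p)) \<and> anorm B (vdiff B (cr p T \<odot>\<^bsub>B\<^esub> \<psi> p y) (\<psi> p y)) \<le> inverse (real (Suc n)) \<and>
    cr p T \<odot>\<^bsub>B\<^esub> \<psi> p y \<in> B.nv.cspan words" for n
  proof -
    have "0 < inverse (real (Suc n))" by simp
    from psi_approx[OF p y this] show ?thesis by blast
  qed
  note ex = this
  define T where "T n = (SOME T. T \<in> carrier (compacts A (fibre X p)) \<and> anorm B (vdiff B (cr p T \<odot>\<^bsub>B\<^esub> \<psi> p y) (\<psi> p y)) \<le> inverse (real (Suc n)) \<and>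
    cr p T \<odot>\<^bsub>B\<^esub> \<psi> p y \<in> B.nv.cspan words)" for n
  have T: "T n \<in> carrier (compacts A (fibre X p))" "cr p (T n) \<odot>\<^bsub>B\<^esub> \<psi> p y \<in> B.nv.cspan words"
    and le: "anorm B (vdiff B (cr p (T n) \<odot>\<^bsub>B\<^esub> \<psi> p y) (\<psi> p y)) \<le> inverse (real (Suc n))" for n
    using someI_ex[OF ex[of n]] unfolding T_def[symmetric] by simp_all
  have "B.nv.conv (\<lambda>n. cr p (T n) \<odot>\<^bsub>B\<^esub> \<psi> p y) (\<psi> p y)"
    by (rule B.nv.convI_bound[OF _ psi_closed[OF p y] le LIMSEQ_inverse_real_of_nat])
      (intro B.mult_closed compact_rep_closed p T psi_closed y)
  then show ?thesis using T by blast
qed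

text \<open>A may lack a unit, so psi(y) is not visibly of the form psi(x)psi(z)*; it is a limit of
  sums of such words.\<close>

lemma psi_in_cspan: assumes "p \<in> P" "y \<in> fib p" shows "\<psi> p y \<in> B.nv.cspan words"
proof -
  obtain T where T: "\<forall>n. T n \<in> carrier (compacts A (fibre X p)) \<and> cr p (T n) \<odot>\<^bsub>B\<^esub> \<psi> p y \<in> B.nv.cspan words"
    "B.nv.conv (\<lambda>n. cr p (T n) \<odot>\<^bsub>B\<^esub> \<psi> p y) (\<psi> p y)" using psi_approx_conv[OF assms] by blast
  show ?thesis by (rule B.nv.nclosed_conv[OF B.nv.nclosed_cspan[OF scale_invariant_words] _ T(2)]) (use T(1) in blast)
qed

section \<open>Products psi(y)* psi(z) and the algebra of words\<close>

abbreviation psi_range :: "'g \<Rightarrow> 'b set" where "psi_range p \<equiv> {\<psi> p x | x. x \<in> fib p}"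

lemma scale_invariant_psi_range: assumes p: "p \<in> P" shows "B.nv.scale_invariant (psi_range p)"
proof -
  interpret M: module_rep A "fibre X p" B "\<psi> p" \<pi> by (rule module_rep_fibre[OF p])
  show ?thesis unfolding B.nv.scale_invariant_def using psi_closed[OF p] M.psi_scale[symmetric] M.scale_closed by fastforce
qed

lemma tensor_dense:
  assumes q: "q \<in> P" "q \<noteq> \<one>\<^bsub>G\<^esub>" and m: "m \<in> P" "m \<noteq> \<one>\<^bsub>G\<^esub>" and a: "a \<in> fib (q \<otimes>\<^bsub>G\<^esub> m)" and e: "0 < \<epsilon>"
  shows "\<exists>l. set l \<subseteq> fib q \<times> fib m \<and>
    hnorm A (fibre X (q \<otimes>\<^bsub>G\<^esub> m)) (vdiff (fibre X (q \<otimes>\<^bsub>G\<^esub> m)) a (vlsum (fibre X (q \<otimes>\<^bsub>G\<^esub> m)) (map (\<lambda>(x, y). pmult X q m x y) l))) < \<epsilon>"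
proof -
  interpret Y: hilbert_bimodule A "fibre X m" by (rule fibre_bimodule[OF m(1)])
  interpret T: tensor_pair A "fibre X q" "fibre X m"
    using cstar_algebra_axioms fibre_module[OF q(1)] fibre_bimodule[OF m(1)] by (simp add: tensor_pair_def)
  obtain M where M: "M \<in> bimodule_isos A (balanced_tensor A (fibre X q) (fibre X m)) (fibre X (q \<otimes>\<^bsub>G\<^esub> m))"
      "\<And>x y. x \<in> fib q \<Longrightarrow> y \<in> fib m \<Longrightarrow> M (elem_tensor A (fibre X q) (fibre X m) x y) = pmult X q m x y"
    using pmult_tensor[of q m] q m by blast
  show ?thesis by (rule T.elementary_tensors_dense[OF fibre_module[OF P_mult[OF q(1) m(1)]] M a e])
qed

text \<open>On a product a = xz one has psi(y)*psi(xz) = psi(<y,x>z), and sums of such products are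
  dense by \<open>tensor_dense\<close>. The cases q or m equal to the identity are separate because
  \<open>pmult_tensor\<close> speaks of the other elements.\<close>

lemma psi_star_psi_le:
  assumes q: "q \<in> P" and m: "m \<in> P" and y: "y \<in> fib q" and a: "a \<in> fib (q \<otimes>\<^bsub>G\<^esub> m)"
  shows "(\<psi> q y)\<^sup>\<star>\<^bsub>B\<^esub> \<odot>\<^bsub>B\<^esub> \<psi> (q \<otimes>\<^bsub>G\<^esub> m) a \<in> B.nv.cspan (psi_range m)"
proof -
  let ?Z = "B.nv.cspan (psi_range m)"
  note inv = scale_invariant_psi_range[OF m]
  note Z = B.nv.csubspace_cspan[OF inv] B.nv.nclosed_cspan[OF inv] B.nv.cspan_superset[OF inv]
  consider "q = \<one>\<^bsub>G\<^esub>" | "m = \<one>\<^bsub>G\<^esub>" | "q \<noteq> \<one>\<^bsub>G\<^esub>" "m \<noteq> \<one>\<^bsub>G\<^esub>" by blast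
  then show ?thesis
  proof cases
    case 1
    interpret Y: hilbert_bimodule A "fibre X m" by (rule fibre_bimodule[OF m])
    have ya: "y \<in> carrier A" "a \<in> fib m" using y a 1 P_carrier[OF m] by (simp_all add: fibre_one_simps)
    have "(\<psi> q y)\<^sup>\<star>\<^bsub>B\<^esub> = \<psi> \<one>\<^bsub>G\<^esub> (y\<^sup>\<star>\<^bsub>A\<^esub>)" using star_homsD(5)[OF pi_hom ya(1)] ya 1 by (simp add: star_closed)
    then have "(\<psi> q y)\<^sup>\<star>\<^bsub>B\<^esub> \<odot>\<^bsub>B\<^esub> \<psi> (q \<otimes>\<^bsub>G\<^esub> m) a = \<psi> m (lact (fibre X m) (y\<^sup>\<star>\<^bsub>A\<^esub>) a)"
      using psi_mult[OF one_P m, of "y\<^sup>\<star>\<^bsub>A\<^esub>" a] pmult_one_left[OF m, of "y\<^sup>\<star>\<^bsub>A\<^esub>" a] ya 1 P_carrier[OF m]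
      by (simp add: fibre_one_simps star_closed)
    then have eq: "(\<psi> q y)\<^sup>\<star>\<^bsub>B\<^esub> \<odot>\<^bsub>B\<^esub> \<psi> (q \<otimes>\<^bsub>G\<^esub> m) a = \<psi> m (lact (fibre X m) (y\<^sup>\<star>\<^bsub>A\<^esub>) a)" .
    have "lact (fibre X m) (y\<^sup>\<star>\<^bsub>A\<^esub>) a \<in> fib m" by (rule Y.lact_closed[OF star_closed[OF ya(1)] ya(2)])
    then show ?thesis unfolding eq by (intro subsetD[OF Z(3)]) blast
  next
    case 2
    interpret M: hilbert_module A "fibre X q" by (rule fibre_module[OF q])
    have a: "a \<in> fib q" using a 2 P_carrier[OF q] by simp
    have eq: "(\<psi> q y)\<^sup>\<star>\<^bsub>B\<^esub> \<odot>\<^bsub>B\<^esub> \<psi> (q \<otimes>\<^bsub>G\<^esub> m) a = \<psi> m (hinner (fibre X q) y a)"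
      using psi_inner[OF q y a] 2 P_carrier[OF q] by simp
    have "hinner (fibre X q) y a \<in> fib m" using 2 y a by (simp add: fibre_one_simps M.inner_closed)
    then show ?thesis unfolding eq by (intro subsetD[OF Z(3)]) blast
  next
    case 3
    let ?t = "q \<otimes>\<^bsub>G\<^esub> m"
    have t: "?t \<in> P" by (rule P_mult[OF q m])
    interpret Q: hilbert_module A "fibre X q" by (rule fibre_module[OF q])
    interpret Y: hilbert_bimodule A "fibre X m" by (rule fibre_bimodule[OF m])
    interpret T: module_rep A "fibre X ?t" B "\<psi> ?t" \<pi> by (rule module_rep_fibre[OF t])
    have ys: "(\<psi> q y)\<^sup>\<star>\<^bsub>B\<^esub> \<in> carrier B" using psi_closed[OF q y] by (simp add: B.cl)
    have elem: "(\<psi> q y)\<^sup>\<star>\<^bsub>B\<^esub> \<odot>\<^bsub>B\<^esub> \<psi> ?t (pmult X q m x z) \<in> ?Z" if xz: "x \<in> fib q" "z \<in> fib m" for x z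
    proof -
      have h: "hinner (fibre X q) y x \<in> carrier A" using Q.inner_closed y xz by simp
      have "(\<psi> q y)\<^sup>\<star>\<^bsub>B\<^esub> \<odot>\<^bsub>B\<^esub> \<psi> ?t (pmult X q m x z) = ((\<psi> q y)\<^sup>\<star>\<^bsub>B\<^esub> \<odot>\<^bsub>B\<^esub> \<psi> q x) \<odot>\<^bsub>B\<^esub> \<psi> m z"
        using psi_mult[OF q m xz] ys psi_closed q m xz by (simp add: B.mult_assoc)
      also have "\<dots> = \<psi> m (lact (fibre X m) (hinner (fibre X q) y x) z)"
        using psi_inner[OF q y xz(1)] psi_mult[OF one_P m, of "hinner (fibre X q) y x" z] pmult_one_left[OF m h xz(2)] h xz P_carrier[OF m]
        by (simp add: fibre_one_simps)
      finally have eq: "(\<psi> q y)\<^sup>\<star>\<^bsub>B\<^esub> \<odot>\<^bsub>B\<^esub> \<psi> ?t (pmult X q m x z) = \<psi> m (lact (fibre X m) (hinner (fibre X q) y x) z)" .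
      show ?thesis unfolding eq by (intro subsetD[OF Z(3)]) (use Y.lact_closed[OF h xz(2)] in blast)
    qed
    have sums: "(\<psi> q y)\<^sup>\<star>\<^bsub>B\<^esub> \<odot>\<^bsub>B\<^esub> \<psi> ?t (vlsum (fibre X ?t) (map (\<lambda>(x, y). pmult X q m x y) l)) \<in> ?Z"
      if l: "set l \<subseteq> fib q \<times> fib m" for l
    proof -
      have c: "set (map (\<lambda>(x, y). pmult X q m x y) l) \<subseteq> fib ?t" using l pmult_closed[OF q m] by auto
      have c': "set (map \<psi>' (map (\<lambda>(x, y). pmult X q m x y) l)) \<subseteq> carrier B" if "\<psi>' = \<psi> ?t" for \<psi>'
        using c psi_closed[OF t] that by auto
      have "(\<psi> q y)\<^sup>\<star>\<^bsub>B\<^esub> \<odot>\<^bsub>B\<^esub> \<psi> ?t (vlsum (fibre X ?t) (map (\<lambda>(x, y). pmult X q m x y) l)) =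
          vlsum B (map (amult B ((\<psi> q y)\<^sup>\<star>\<^bsub>B\<^esub>)) (map (\<psi> ?t) (map (\<lambda>(x, y). pmult X q m x y) l)))"
        unfolding T.psi_vlsum[OF c] by (rule B.mult_vlsum(1)[OF ys c'[OF refl]])
      moreover have "set (map (amult B ((\<psi> q y)\<^sup>\<star>\<^bsub>B\<^esub>)) (map (\<psi> ?t) (map (\<lambda>(x, y). pmult X q m x y) l))) \<subseteq> ?Z"
        using l elem by auto
      ultimately show ?thesis using B.nv.csubspace_vlsum[OF Z(1)] by simp
    qed
    have "\<exists>w\<in>?Z. anorm B (vdiff B ((\<psi> q y)\<^sup>\<star>\<^bsub>B\<^esub> \<odot>\<^bsub>B\<^esub> \<psi> ?t a) w) < \<epsilon>" if e: "\<epsilon> > 0" for \<epsilon>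
    proof -
      define d where "d = \<epsilon> / (anorm B ((\<psi> q y)\<^sup>\<star>\<^bsub>B\<^esub>) + 1)"
      have d: "0 < d" "anorm B ((\<psi> q y)\<^sup>\<star>\<^bsub>B\<^esub>) * d < \<epsilon>" using e B.norm_nonneg[OF ys] by (simp_all add: d_def field_simps)
      obtain l where l: "set l \<subseteq> fib q \<times> fib m"
          "hnorm A (fibre X ?t) (vdiff (fibre X ?t) a (vlsum (fibre X ?t) (map (\<lambda>(x, y). pmult X q m x y) l))) < d"
        using tensor_dense[OF q 3(1) m 3(2) a d(1)] by blast
      let ?v = "vlsum (fibre X ?t) (map (\<lambda>(x, y). pmult X q m x y) l)"
      have v: "?v \<in> fib ?t" by (rule T.vlsum_closed) (use l pmult_closed[OF q m] in auto)
      have "vdiff B ((\<psi> q y)\<^sup>\<star>\<^bsub>B\<^esub> \<odot>\<^bsub>B\<^esub> \<psi> ?t a) ((\<psi> q y)\<^sup>\<star>\<^bsub>B\<^esub> \<odot>\<^bsub>B\<^esub> \<psi> ?t ?v) = (\<psi> q y)\<^sup>\<star>\<^bsub>B\<^esub> \<odot>\<^bsub>B\<^esub> \<psi> ?t (vdiff (fibre X ?t) a ?v)"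
        using T.psi_diff[OF a v] B.mult_diff_right[OF ys psi_closed[OF t a] psi_closed[OF t v]] by simp
      then have "anorm B (vdiff B ((\<psi> q y)\<^sup>\<star>\<^bsub>B\<^esub> \<odot>\<^bsub>B\<^esub> \<psi> ?t a) ((\<psi> q y)\<^sup>\<star>\<^bsub>B\<^esub> \<odot>\<^bsub>B\<^esub> \<psi> ?t ?v)) \<le>
          anorm B ((\<psi> q y)\<^sup>\<star>\<^bsub>B\<^esub>) * anorm B (\<psi> ?t (vdiff (fibre X ?t) a ?v))"
        using B.norm_mult[OF ys psi_closed[OF t T.diff_closed[OF a v]]] by simp
      also have "\<dots> \<le> anorm B ((\<psi> q y)\<^sup>\<star>\<^bsub>B\<^esub>) * d"
        using T.psi_norm_le[OF T.diff_closed[OF a v]] l(2) by (intro mult_left_mono B.norm_nonneg[OF ys]) simp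
      finally show ?thesis using sums[OF l(1)] d(2) by (intro bexI[of _ "(\<psi> q y)\<^sup>\<star>\<^bsub>B\<^esub> \<odot>\<^bsub>B\<^esub> \<psi> ?t ?v"]) auto
    qed
    then show ?thesis using Z(2) B.mult_closed[OF ys psi_closed[OF t a]] unfolding B.nv.nclosed_def by blast
  qed
qed

lemma compact_rep_in_cspan:
  assumes t: "t \<in> P" and R: "R \<in> carrier (compacts A (fibre X t))"
  shows "cr t R \<in> B.nv.cspan {\<psi> t a \<odot>\<^bsub>B\<^esub> (\<psi> t b)\<^sup>\<star>\<^bsub>B\<^esub> | a b. a \<in> fib t \<and> b \<in> fib t}"
    and "B.nv.scale_invariant {\<psi> t a \<odot>\<^bsub>B\<^esub> (\<psi> t b)\<^sup>\<star>\<^bsub>B\<^esub> | a b. a \<in> fib t \<and> b \<in> fib t}"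
proof -
  let ?S = "{\<psi> t a \<odot>\<^bsub>B\<^esub> (\<psi> t b)\<^sup>\<star>\<^bsub>B\<^esub> | a b. a \<in> fib t \<and> b \<in> fib t}"
  interpret M: module_rep A "fibre X t" B "\<psi> t" \<pi> by (rule module_rep_fibre[OF t])
  interpret H: star_hom "compacts A (fibre X t)" B "cr t"
    using M.compacts_cstar B.cstar_algebra_axioms compact_rep_props(1)[OF t] by (simp add: star_hom_def star_hom_axioms_def)
  have sc: "c \<cdot>\<^bsub>B\<^esub> (\<psi> t a \<odot>\<^bsub>B\<^esub> (\<psi> t b)\<^sup>\<star>\<^bsub>B\<^esub>) = \<psi> t (c \<cdot>\<^bsub>fibre X t\<^esub> a) \<odot>\<^bsub>B\<^esub> (\<psi> t b)\<^sup>\<star>\<^bsub>B\<^esub>" if "a \<in> fib t" "b \<in> fib t" for a b c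
    using that by (simp add: M.psi_scale B.mult_scale_left psi_closed[OF t] B.cl)
  show inv: "B.nv.scale_invariant ?S"
    unfolding B.nv.scale_invariant_def
  proof (intro conjI allI ballI subsetI)
    fix s assume "s \<in> ?S"
    then show "s \<in> carrier B" using psi_closed[OF t] by (auto simp: B.cl)
  next
    fix c s assume "s \<in> ?S"
    then show "c \<cdot>\<^bsub>B\<^esub> s \<in> ?S" using sc M.scale_closed by blast
  qed
  have tau: "M.tau l \<in> B.nv.cspan ?S" if "M.pairs l" for l
    unfolding M.tau_def
  proof (rule B.nv.csubspace_vlsum[OF B.nv.csubspace_cspan[OF inv]])
    show "set (map (\<lambda>(x, y). \<psi> t x \<odot>\<^bsub>B\<^esub> (\<psi> t y)\<^sup>\<star>\<^bsub>B\<^esub>) l) \<subseteq> B.nv.cspan ?S"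
      using that by (intro order_trans[OF _ B.nv.cspan_superset[OF inv]]) auto
  qed
  have "\<exists>w\<in>B.nv.cspan ?S. anorm B (vdiff B (cr t R) w) < \<epsilon>" if e: "\<epsilon> > 0" for \<epsilon>
  proof -
    obtain l where l: "M.pairs l" "anorm M.L (vdiff M.L R (M.rk l)) < \<epsilon>" using M.rk_dense[OF R e] by blast
    have "anorm B (vdiff B (cr t R) (cr t (M.rk l))) \<le> anorm M.L (vdiff M.L R (M.rk l))"
      using H.norm_hom_le[OF H.A.diff_closed[OF R M.rk_compact[OF l(1)]]] H.hom_diff[OF R M.rk_compact[OF l(1)]]
      by (simp add: M.compacts_simps)
    then show ?thesis
      using l(2) tau[OF l(1)] M.compacts_hom_rk[OF compact_rep_props[OF t] l(1)] by (intro bexI[of _ "M.tau l"]) auto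
  qed
  then show "cr t R \<in> B.nv.cspan ?S"
    using B.nv.nclosed_cspan[OF inv] compact_rep_closed[OF t R] unfolding B.nv.nclosed_def by blast
qed

end

locale nica_rep = psys_rep +
  assumes aligned: "compactly_aligned G P A X" and nica: "Nica_covariant G P A X B \<psi>"
begin

abbreviation Z :: "'c set" where "Z \<equiv> B.nv.cspan words"

lemmas Z_closed = B.nv.csubspace_cspan[OF scale_invariant_words] B.nv.nclosed_cspan[OF scale_invariant_words]
lemmas Z_words = subsetD[OF B.nv.cspan_superset[OF scale_invariant_words]]

lemma Z_subset: "Z \<subseteq> carrier B"
  using Z_closed(1) by (simp add: B.nv.csubspace_def)

lemma psi_range_mult_star:
  assumes m: "m \<in> P" and n: "n \<in> P" and v: "v \<in> B.nv.cspan (psi_range m)" and w: "w \<in> B.nv.cspan (psi_range n)"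
  shows "v \<odot>\<^bsub>B\<^esub> w\<^sup>\<star>\<^bsub>B\<^esub> \<in> Z"
proof -
  have wc: "w \<in> carrier B" using w B.nv.csubspace_cspan[OF scale_invariant_psi_range[OF n]] by (auto simp: B.nv.csubspace_def)
  let ?S = "{s\<^sup>\<star>\<^bsub>B\<^esub> | s. s \<in> psi_range n}"
  have inv: "B.nv.scale_invariant ?S"
    unfolding B.nv.scale_invariant_def
  proof (intro conjI allI ballI subsetI)
    fix s assume "s \<in> ?S"
    then show "s \<in> carrier B" using psi_closed[OF n] by (auto simp: B.cl)
  next
    fix c s assume "s \<in> ?S"
    then obtain x where x: "x \<in> psi_range n" "s = x\<^sup>\<star>\<^bsub>B\<^esub>" by blast
    have xc: "x \<in> carrier B" using x psi_closed[OF n] by blast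
    have "cnj c \<cdot>\<^bsub>B\<^esub> x \<in> psi_range n" using scale_invariant_psi_range[OF n] x(1) unfolding B.nv.scale_invariant_def by blast
    moreover have "c \<cdot>\<^bsub>B\<^esub> s = (cnj c \<cdot>\<^bsub>B\<^esub> x)\<^sup>\<star>\<^bsub>B\<^esub>" using xc by (simp add: x(2) B.star_scale)
    ultimately show "c \<cdot>\<^bsub>B\<^esub> s \<in> ?S" by blast
  qed
  have ws: "w\<^sup>\<star>\<^bsub>B\<^esub> \<in> B.nv.cspan ?S"
    by (rule B.cspan_star[OF scale_invariant_psi_range[OF n] B.nv.csubspace_cspan[OF inv] B.nv.nclosed_cspan[OF inv] _ w])
      (rule subsetD[OF B.nv.cspan_superset[OF inv]], blast)
  show ?thesis
    by (rule B.cspan_mult[OF scale_invariant_psi_range[OF m] inv Z_closed _ v ws]) (rule Z_words, use m n in blast)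
qed

text \<open>Nica covariance speaks of compact operators, so y and z are first approximated by Ty and
  Sz with T and S compact. The product of the two compact images then vanishes or lies over the join
  of q and r, where \<open>psi_star_psi_le\<close> shortens the outer factors.\<close>

lemma psi_star_psi:
  assumes q: "q \<in> P" and r: "r \<in> P" and y: "y \<in> fib q" and z: "z \<in> fib r"
  shows "(\<psi> q y)\<^sup>\<star>\<^bsub>B\<^esub> \<odot>\<^bsub>B\<^esub> \<psi> r z \<in> Z"
proof -
  have yc: "\<psi> q y \<in> carrier B" "(\<psi> q y)\<^sup>\<star>\<^bsub>B\<^esub> \<in> carrier B" and zc: "\<psi> r z \<in> carrier B"
    using psi_closed q r y z by (simp_all add: B.cl)
  have comp: "(\<psi> q y)\<^sup>\<star>\<^bsub>B\<^esub> \<odot>\<^bsub>B\<^esub> (cr q T \<odot>\<^bsub>B\<^esub> cr r S) \<odot>\<^bsub>B\<^esub> \<psi> r z \<in> Z"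
    if T: "T \<in> carrier (compacts A (fibre X q))" and S: "S \<in> carrier (compacts A (fibre X r))" for T S
  proof (cases "has_ub G P q r")
    case False
    then have "cr q T \<odot>\<^bsub>B\<^esub> cr r S = \<zero>\<^sub>v\<^bsub>B\<^esub>" using nica q r T S by (simp add: Nica_covariant_def)
    then show ?thesis using Z_closed(1) yc zc by (simp add: B.mult_zero B.nv.csubspace_def)
  next
    case True
    let ?t = "join G P q r"
    let ?R = "iota_join G P A X q r T S"
    have t: "?t \<in> P" "inv\<^bsub>G\<^esub> q \<otimes>\<^bsub>G\<^esub> ?t \<in> P" "inv\<^bsub>G\<^esub> r \<otimes>\<^bsub>G\<^esub> ?t \<in> P"
      using join_is_join[OF q r True] by (auto simp: is_join_def ple_def)
    have R: "?R \<in> carrier (compacts A (fibre X ?t))" using aligned True q r T S by (simp add: compactly_aligned_def)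
    have "(\<psi> q y)\<^sup>\<star>\<^bsub>B\<^esub> \<odot>\<^bsub>B\<^esub> cr ?t ?R \<odot>\<^bsub>B\<^esub> \<psi> r z \<in> Z"
    proof (rule B.cspan_sandwich[OF compact_rep_in_cspan(2)[OF t(1) R] Z_closed yc(2) zc _ compact_rep_in_cspan(1)[OF t(1) R]])
      fix s assume "s \<in> {\<psi> ?t a \<odot>\<^bsub>B\<^esub> (\<psi> ?t b)\<^sup>\<star>\<^bsub>B\<^esub> | a b. a \<in> fib ?t \<and> b \<in> fib ?t}"
      then obtain a b where ab: "a \<in> fib ?t" "b \<in> fib ?t" "s = \<psi> ?t a \<odot>\<^bsub>B\<^esub> (\<psi> ?t b)\<^sup>\<star>\<^bsub>B\<^esub>" by blast
      have v: "(\<psi> q y)\<^sup>\<star>\<^bsub>B\<^esub> \<odot>\<^bsub>B\<^esub> \<psi> ?t a \<in> B.nv.cspan (psi_range (inv\<^bsub>G\<^esub> q \<otimes>\<^bsub>G\<^esub> ?t))"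
        using psi_star_psi_le[OF q t(2) y] ab(1) lower_diff[OF q t(1)] by simp
      have w: "(\<psi> r z)\<^sup>\<star>\<^bsub>B\<^esub> \<odot>\<^bsub>B\<^esub> \<psi> ?t b \<in> B.nv.cspan (psi_range (inv\<^bsub>G\<^esub> r \<otimes>\<^bsub>G\<^esub> ?t))"
        using psi_star_psi_le[OF r t(3) z] ab(2) lower_diff[OF r t(1)] by simp
      have "(\<psi> q y)\<^sup>\<star>\<^bsub>B\<^esub> \<odot>\<^bsub>B\<^esub> s \<odot>\<^bsub>B\<^esub> \<psi> r z = ((\<psi> q y)\<^sup>\<star>\<^bsub>B\<^esub> \<odot>\<^bsub>B\<^esub> \<psi> ?t a) \<odot>\<^bsub>B\<^esub> ((\<psi> r z)\<^sup>\<star>\<^bsub>B\<^esub> \<odot>\<^bsub>B\<^esub> \<psi> ?t b)\<^sup>\<star>\<^bsub>B\<^esub>"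
        using ab yc zc psi_closed[OF t(1)] by (simp add: B.star_simps B.mult_assoc B.cl)
      then show "(\<psi> q y)\<^sup>\<star>\<^bsub>B\<^esub> \<odot>\<^bsub>B\<^esub> s \<odot>\<^bsub>B\<^esub> \<psi> r z \<in> Z" using psi_range_mult_star[OF t(2,3) v w] by simp
    qed
    moreover have "cr q T \<odot>\<^bsub>B\<^esub> cr r S = cr ?t ?R" using nica True q r T S by (simp add: Nica_covariant_def)
    ultimately show ?thesis by simp
  qed
  obtain T where T: "\<And>n. T n \<in> carrier (compacts A (fibre X q))" "B.nv.conv (\<lambda>n. cr q (T n) \<odot>\<^bsub>B\<^esub> \<psi> q y) (\<psi> q y)"
    using psi_approx_conv[OF q y] by blast
  obtain S where S: "\<And>n. S n \<in> carrier (compacts A (fibre X r))" "B.nv.conv (\<lambda>n. cr r (S n) \<odot>\<^bsub>B\<^esub> \<psi> r z) (\<psi> r z)"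
    using psi_approx_conv[OF r z] by blast
  show ?thesis
  proof (rule B.nv.nclosed_conv[OF Z_closed(2) _ B.conv_mult[OF B.conv_star[OF T(2)] S(2)]])
    fix n
    interpret M: hilbert_module A "fibre X q" by (rule fibre_module[OF q])
    interpret K: cstar_algebra "compacts A (fibre X q)" by (rule M.compacts_cstar)
    let ?T = "(T n)\<^sup>\<star>\<^bsub>compacts A (fibre X q)\<^esub>"
    have Tc: "?T \<in> carrier (compacts A (fibre X q))" by (rule K.star_closed[OF T(1)])
    have "(cr q (T n) \<odot>\<^bsub>B\<^esub> \<psi> q y)\<^sup>\<star>\<^bsub>B\<^esub> \<odot>\<^bsub>B\<^esub> (cr r (S n) \<odot>\<^bsub>B\<^esub> \<psi> r z) = (\<psi> q y)\<^sup>\<star>\<^bsub>B\<^esub> \<odot>\<^bsub>B\<^esub> (cr q ?T \<odot>\<^bsub>B\<^esub> cr r (S n)) \<odot>\<^bsub>B\<^esub> \<psi> r z"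
      using star_homsD(5)[OF compact_rep_props(1)[OF q] T(1)[of n]] compact_rep_closed[OF q T(1)] compact_rep_closed[OF q Tc] compact_rep_closed[OF r S(1)] yc zc
      by (simp add: B.star_simps B.mult_assoc B.cl)
    then show "(cr q (T n) \<odot>\<^bsub>B\<^esub> \<psi> q y)\<^sup>\<star>\<^bsub>B\<^esub> \<odot>\<^bsub>B\<^esub> (cr r (S n) \<odot>\<^bsub>B\<^esub> \<psi> r z) \<in> Z" using comp[OF Tc S(1)] by simp
  qed
qed

lemma Z_star: assumes "a \<in> Z" shows "a\<^sup>\<star>\<^bsub>B\<^esub> \<in> Z"
proof (rule B.cspan_star[OF scale_invariant_words Z_closed _ assms])
  fix s assume "s \<in> words"
  then obtain p q x y where s: "p \<in> P" "q \<in> P" "x \<in> fib p" "y \<in> fib q" "s = \<psi> p x \<odot>\<^bsub>B\<^esub> (\<psi> q y)\<^sup>\<star>\<^bsub>B\<^esub>" by blast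
  then have "s\<^sup>\<star>\<^bsub>B\<^esub> = \<psi> q y \<odot>\<^bsub>B\<^esub> (\<psi> p x)\<^sup>\<star>\<^bsub>B\<^esub>" by (simp add: B.star_simps psi_closed B.cl)
  then show "s\<^sup>\<star>\<^bsub>B\<^esub> \<in> Z" using s by (intro Z_words) blast
qed

text \<open>The inner factor psi(y)*psi(x') of a product of two words lies in \<open>Z\<close> by
  \<open>psi_star_psi\<close>, and a word absorbs the outer factors by multiplicativity of
  psi.\<close>

lemma Z_mult: assumes "a \<in> Z" "b \<in> Z" shows "a \<odot>\<^bsub>B\<^esub> b \<in> Z"
proof (rule B.cspan_mult[OF scale_invariant_words scale_invariant_words Z_closed _ assms])
  fix s t assume "s \<in> words" "t \<in> words"
  then obtain p q x y p' q' x' y' where s: "p \<in> P" "q \<in> P" "x \<in> fib p" "y \<in> fib q" "s = \<psi> p x \<odot>\<^bsub>B\<^esub> (\<psi> q y)\<^sup>\<star>\<^bsub>B\<^esub>"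
    and t: "p' \<in> P" "q' \<in> P" "x' \<in> fib p'" "y' \<in> fib q'" "t = \<psi> p' x' \<odot>\<^bsub>B\<^esub> (\<psi> q' y')\<^sup>\<star>\<^bsub>B\<^esub>" by blast
  note c = psi_closed[OF s(1,3)] psi_closed[OF s(2,4)] psi_closed[OF t(1,3)] psi_closed[OF t(2,4)]
  have "\<psi> p x \<odot>\<^bsub>B\<^esub> ((\<psi> q y)\<^sup>\<star>\<^bsub>B\<^esub> \<odot>\<^bsub>B\<^esub> \<psi> p' x') \<odot>\<^bsub>B\<^esub> (\<psi> q' y')\<^sup>\<star>\<^bsub>B\<^esub> \<in> Z"
  proof (rule B.cspan_sandwich[OF scale_invariant_words Z_closed c(1) B.star_closed[OF c(4)] _ psi_star_psi[OF s(2) t(1) s(4) t(3)]])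
    fix w assume "w \<in> words"
    then obtain r r' v v' where w: "r \<in> P" "r' \<in> P" "v \<in> fib r" "v' \<in> fib r'" "w = \<psi> r v \<odot>\<^bsub>B\<^esub> (\<psi> r' v')\<^sup>\<star>\<^bsub>B\<^esub>" by blast
    note d = psi_closed[OF w(1,3)] psi_closed[OF w(2,4)]
    have "\<psi> p x \<odot>\<^bsub>B\<^esub> w \<odot>\<^bsub>B\<^esub> (\<psi> q' y')\<^sup>\<star>\<^bsub>B\<^esub> = (\<psi> p x \<odot>\<^bsub>B\<^esub> \<psi> r v) \<odot>\<^bsub>B\<^esub> (\<psi> q' y' \<odot>\<^bsub>B\<^esub> \<psi> r' v')\<^sup>\<star>\<^bsub>B\<^esub>"
      using c d by (simp add: w(5) B.star_simps B.mult_assoc B.cl)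
    also have "\<dots> = \<psi> (p \<otimes>\<^bsub>G\<^esub> r) (pmult X p r x v) \<odot>\<^bsub>B\<^esub> (\<psi> (q' \<otimes>\<^bsub>G\<^esub> r') (pmult X q' r' y' v'))\<^sup>\<star>\<^bsub>B\<^esub>"
      using psi_mult s t w by simp
    finally show "\<psi> p x \<odot>\<^bsub>B\<^esub> w \<odot>\<^bsub>B\<^esub> (\<psi> q' y')\<^sup>\<star>\<^bsub>B\<^esub> \<in> Z"
      using P_mult[OF s(1) w(1)] P_mult[OF t(2) w(2)] pmult_closed[OF s(1) w(1) s(3) w(3)] pmult_closed[OF t(2) w(2) t(4) w(4)]
      by (auto intro!: Z_words)
  qed
  then show "s \<odot>\<^bsub>B\<^esub> t \<in> Z" using c by (simp add: s(5) t(5) B.mult_assoc B.cl)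
qed

lemma cstar_Z: "cstar_algebra (B\<lparr>carrier := Z\<rparr>)"
  by (rule B.subalgebra_cstar[OF Z_closed Z_mult Z_star])

end

section \<open>Transfer of covariance along homomorphisms\<close>

lemma (in star_hom) hom_vsum:
  assumes "finite F" "\<And>i. i \<in> F \<Longrightarrow> f i \<in> carrier A" "\<And>i. i \<in> F \<Longrightarrow> g i = h (f i)"
  shows "h (vsum A f F) = vsum B g F"
  using assms
proof (induction F rule: finite_induct)
  case empty
  then show ?case by (simp add: A.vsum_empty B.vsum_empty hom_zero)
next
  case (insert i F)
  have c: "vsum A f F \<in> carrier A" "f i \<in> carrier A" using insert.prems by (auto intro: A.vsum_closed)
  have "f \<in> insert i F \<rightarrow> carrier A" "g \<in> insert i F \<rightarrow> carrier B" using insert.prems hom_closed by auto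
  then have "vsum A f (insert i F) = f i \<boxplus>\<^bsub>A\<^esub> vsum A f F" "vsum B g (insert i F) = g i \<boxplus>\<^bsub>B\<^esub> vsum B g F"
    using insert.hyps by (simp_all add: A.vsum_insert B.vsum_insert)
  then show ?case using insert.IH insert.prems c by (simp add: hom_add)
qed

lemma star_homI: "cstar_algebra A \<Longrightarrow> cstar_algebra B \<Longrightarrow> h \<in> star_homs A B \<Longrightarrow> star_hom A B h"
  by (simp add: star_hom_def star_hom_axioms_def)

context psys_rep begin

context
  fixes D :: "'d cstar" and h :: "'b \<Rightarrow> 'd"
  assumes D: "cstar_algebra D" and h: "h \<in> star_homs B D"
begin

interpretation H: star_hom B D h by (rule star_homI[OF B.cstar_algebra_axioms D h])

lemma push_representation: "representation G P A X D (\<lambda>p x. h (\<psi> p x))"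
  unfolding representation_def
proof (intro conjI ballI)
  fix p assume p: "p \<in> P"
  have "linear_map (fibre X p) B (\<psi> p)" using rep p by (simp add: representation_def)
  then show "linear_map (fibre X p) D (\<lambda>x. h (\<psi> p x))"
    unfolding linear_map_def using H.hom_closed H.hom_add H.hom_scale by (simp add: Pi_iff)
next
  have "restrict (\<lambda>x. h (\<psi> \<one>\<^bsub>G\<^esub> x)) (carrier A) = compose (carrier A) h \<pi>" by (auto simp: compose_def fun_eq_iff)
  then show "restrict (\<lambda>x. h (\<psi> \<one>\<^bsub>G\<^esub> x)) (carrier A) \<in> star_homs A D"
    using star_hom_compose[OF cstar_algebra_axioms pi_hom h] by simp
next
  fix p q x y assume *: "p \<in> P" "q \<in> P" "x \<in> fib p" "y \<in> fib q"
  show "h (\<psi> p x) \<odot>\<^bsub>D\<^esub> h (\<psi> q y) = h (\<psi> (p \<otimes>\<^bsub>G\<^esub> q) (pmult X p q x y))"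
    using H.hom_mult[OF psi_closed[OF *(1,3)] psi_closed[OF *(2,4)]] psi_mult[OF *] by simp
next
  fix p x y assume *: "p \<in> P" "x \<in> fib p" "y \<in> fib p"
  note c = psi_closed[OF *(1,2)] psi_closed[OF *(1,3)]
  show "h (\<psi> \<one>\<^bsub>G\<^esub> (hinner (fibre X p) x y)) = (h (\<psi> p x))\<^sup>\<star>\<^bsub>D\<^esub> \<odot>\<^bsub>D\<^esub> h (\<psi> p y)"
    unfolding psi_inner[OF *] using c by (simp add: H.hom_mult H.hom_star B.cl)
qed

lemma push_psys_rep: "psys_rep G P A X D (\<lambda>p x. h (\<psi> p x))"
  using product_system_axioms D push_representation by (simp add: psys_rep_def psys_rep_axioms_def)

text \<open>The composite of h with the homomorphism for psi takes the values on rank-one operators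
  that characterise the homomorphism for the composed representation.\<close>

lemma push_compact_rep:
  assumes p: "p \<in> P" and T: "T \<in> carrier (compacts A (fibre X p))"
  shows "compact_rep A X D (\<lambda>p x. h (\<psi> p x)) p T = h (cr p T)"
proof -
  interpret D: psys_rep G P A X D "\<lambda>p x. h (\<psi> p x)" by (rule push_psys_rep)
  interpret M: module_rep A "fibre X p" B "\<psi> p" \<pi> by (rule module_rep_fibre[OF p])
  have "compose (carrier (compacts A (fibre X p))) h (cr p) = D.cr p"
  proof (rule D.compact_rep_unique[OF p])
    show "compose (carrier (compacts A (fibre X p))) h (cr p) \<in> star_homs (compacts A (fibre X p)) D"
      by (rule star_hom_compose[OF M.compacts_cstar compact_rep_props(1)[OF p] h])
    fix x y assume xy: "x \<in> fib p" "y \<in> fib p"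
    show "compose (carrier (compacts A (fibre X p))) h (cr p) (rank_one (fibre X p) x y) =
        h (\<psi> p x) \<odot>\<^bsub>D\<^esub> (h (\<psi> p y))\<^sup>\<star>\<^bsub>D\<^esub>"
      using M.rank_one_compact[OF xy] compact_rep_props(2)[OF p xy] psi_closed[OF p] xy
      by (simp add: compose_def H.hom_mult H.hom_star B.cl)
  qed
  from fun_cong[OF this, of T] show ?thesis using T by (simp add: compose_def)
qed

lemma push_generated:
  assumes gen: "generated P X B \<psi>" and surj: "carrier D \<subseteq> h ` carrier B"
  shows "generated P X D (\<lambda>p x. h (\<psi> p x))"
proof -
  interpret D: psys_rep G P A X D "\<lambda>p x. h (\<psi> p x)" by (rule push_psys_rep)
  have w: "D.word k = h (word k)" if "k \<in> letters" for k
    using that psi_closed by (auto simp: D.word_def word_def H.hom_mult H.hom_star B.cl)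
  show ?thesis unfolding D.generated_iff
  proof (intro ballI allI impI)
    fix d and \<epsilon> :: real assume d: "d \<in> carrier D" and e: "0 < \<epsilon>"
    then obtain b where b: "b \<in> carrier B" "d = h b" using surj by blast
    then obtain l where l: "set l \<subseteq> letters" "anorm B (vdiff B b (vlsum B (map word l))) < \<epsilon>"
      using gen e unfolding generated_iff by blast
    have c: "set (map word l) \<subseteq> carrier B"
      unfolding set_map by (rule image_subsetI) (use l(1) in \<open>blast intro: word_closed\<close>)
    have eq: "map D.word l = map h (map word l)" using w l(1) by auto
    have "anorm D (vdiff D d (vlsum D (map D.word l))) = anorm D (h (vdiff B b (vlsum B (map word l))))"
      unfolding eq b(2) H.hom_vlsum[OF c, symmetric] by (simp only: H.hom_diff[OF b(1) B.vlsum_closed[OF c]])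
    also have "\<dots> < \<epsilon>" using H.norm_hom_le[OF B.diff_closed[OF b(1) B.vlsum_closed[OF c]]] l(2) by simp
    finally show "\<exists>l. set l \<subseteq> letters \<and> anorm D (vdiff D d (vlsum D (map D.word l))) < \<epsilon>" using l(1) by blast
  qed
qed

end

end

section \<open>Covariance detected by families of homomorphisms\<close>

context product_system begin

lemma psys_repI: "cstar_algebra B \<Longrightarrow> representation G P A X B \<psi> \<Longrightarrow> psys_rep G P A X B \<psi>"
  using product_system_axioms by (simp add: psys_rep_def psys_rep_axioms_def)

lemma joint_representation:
  fixes B :: "'b cstar" and D :: "'i \<Rightarrow> 'd cstar"
  assumes B: "cstar_algebra B" and cls: "\<And>p x. p \<in> P \<Longrightarrow> x \<in> carrier (fibre X p) \<Longrightarrow> \<psi> p x \<in> carrier B"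
    and h: "\<And>i. i \<in> I \<Longrightarrow> h i \<in> star_homs B (D i)"
    and rep: "\<And>i. i \<in> I \<Longrightarrow> representation G P A X (D i) (\<phi> i)"
    and eq: "\<And>i p x. i \<in> I \<Longrightarrow> p \<in> P \<Longrightarrow> x \<in> carrier (fibre X p) \<Longrightarrow> h i (\<psi> p x) = \<phi> i p x"
    and inj: "\<And>a b. a \<in> carrier B \<Longrightarrow> b \<in> carrier B \<Longrightarrow> (\<And>i. i \<in> I \<Longrightarrow> h i a = h i b) \<Longrightarrow> a = b"
  shows "representation G P A X B \<psi>"
proof -
  interpret B: cstar_algebra B by fact
  have cl1: "a \<in> carrier A \<Longrightarrow> \<psi> \<one>\<^bsub>G\<^esub> a \<in> carrier B" for a
    using cls[OF one_P] by (simp add: fibre_one_simps)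
  have eq1: "i \<in> I \<Longrightarrow> a \<in> carrier A \<Longrightarrow> h i (\<psi> \<one>\<^bsub>G\<^esub> a) = \<phi> i \<one>\<^bsub>G\<^esub> a" for i a
    using eq[OF _ one_P] by (simp add: fibre_one_simps)
  show ?thesis unfolding representation_def
  proof (intro conjI ballI)
    fix p assume p: "p \<in> P"
    interpret M: hilbert_module A "fibre X p" by (rule fibre_module[OF p])
    have lin: "linear_map (fibre X p) (D i) (\<phi> i p)" if "i \<in> I" for i
      using rep[OF that] p by (simp add: representation_def)
    show "linear_map (fibre X p) B (\<psi> p)"
      unfolding linear_map_def
    proof (intro conjI ballI allI)
      show "\<psi> p \<in> carrier (fibre X p) \<rightarrow> carrier B" using cls[OF p] by blast
      show "\<psi> p (x \<boxplus>\<^bsub>fibre X p\<^esub> y) = \<psi> p x \<boxplus>\<^bsub>B\<^esub> \<psi> p y"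
        if "x \<in> carrier (fibre X p)" "y \<in> carrier (fibre X p)" for x y
        using that lin star_homsD(2)[OF h] cls[OF p] eq[OF _ p]
        by (intro inj) (auto simp: linear_map_def M.add_closed B.cl)
      show "\<psi> p (c \<cdot>\<^bsub>fibre X p\<^esub> x) = c \<cdot>\<^bsub>B\<^esub> \<psi> p x" if "x \<in> carrier (fibre X p)" for x c
        using that lin star_homsD(3)[OF h] cls[OF p] eq[OF _ p]
        by (intro inj) (auto simp: linear_map_def M.scale_closed B.cl)
    qed
  next
    note r = rep[unfolded representation_def, THEN conjunct2, THEN conjunct1]
    show "restrict (\<psi> \<one>\<^bsub>G\<^esub>) (carrier A) \<in> star_homs A B"
    proof (rule star_homsI)
      fix a b assume ab: "a \<in> carrier A" "b \<in> carrier A"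
      show "restrict (\<psi> \<one>\<^bsub>G\<^esub>) (carrier A) (a \<boxplus>\<^bsub>A\<^esub> b) = restrict (\<psi> \<one>\<^bsub>G\<^esub>) (carrier A) a \<boxplus>\<^bsub>B\<^esub> restrict (\<psi> \<one>\<^bsub>G\<^esub>) (carrier A) b"
        using star_homsD(2)[OF r ab] star_homsD(2)[OF h] ab cl1 eq1 by (simp add: cl) (intro inj, simp_all add: cl B.cl)
      show "restrict (\<psi> \<one>\<^bsub>G\<^esub>) (carrier A) (a \<odot>\<^bsub>A\<^esub> b) = restrict (\<psi> \<one>\<^bsub>G\<^esub>) (carrier A) a \<odot>\<^bsub>B\<^esub> restrict (\<psi> \<one>\<^bsub>G\<^esub>) (carrier A) b"
        using star_homsD(4)[OF r ab] star_homsD(4)[OF h] ab cl1 eq1 by (simp add: cl) (intro inj, simp_all add: cl B.cl)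
    next
      fix a c assume a: "a \<in> carrier A"
      show "restrict (\<psi> \<one>\<^bsub>G\<^esub>) (carrier A) (c \<cdot>\<^bsub>A\<^esub> a) = c \<cdot>\<^bsub>B\<^esub> restrict (\<psi> \<one>\<^bsub>G\<^esub>) (carrier A) a"
        using star_homsD(3)[OF r a] star_homsD(3)[OF h] a cl1 eq1 by (simp add: cl) (intro inj, simp_all add: cl B.cl)
    next
      fix a assume a: "a \<in> carrier A"
      show "restrict (\<psi> \<one>\<^bsub>G\<^esub>) (carrier A) (a\<^sup>\<star>\<^bsub>A\<^esub>) = (restrict (\<psi> \<one>\<^bsub>G\<^esub>) (carrier A) a)\<^sup>\<star>\<^bsub>B\<^esub>"
        using star_homsD(5)[OF r a] star_homsD(5)[OF h] a cl1 eq1 by (simp add: cl) (intro inj, simp_all add: cl B.cl)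
    qed (simp_all add: cl1)
  next
    fix p q x y assume *: "p \<in> P" "q \<in> P" "x \<in> carrier (fibre X p)" "y \<in> carrier (fibre X q)"
    have "h i (\<psi> p x) \<odot>\<^bsub>D i\<^esub> h i (\<psi> q y) = h i (\<psi> (p \<otimes>\<^bsub>G\<^esub> q) (pmult X p q x y))" if "i \<in> I" for i
      using rep[OF that] * P_mult pmult_closed by (simp add: representation_def eq[OF that])
    then show "\<psi> p x \<odot>\<^bsub>B\<^esub> \<psi> q y = \<psi> (p \<otimes>\<^bsub>G\<^esub> q) (pmult X p q x y)"
      using star_homsD(4)[OF h] * cls P_mult pmult_closed by (intro inj) (simp_all add: B.cl)
  next
    fix p x y assume *: "p \<in> P" "x \<in> carrier (fibre X p)" "y \<in> carrier (fibre X p)"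
    interpret M: hilbert_module A "fibre X p" by (rule fibre_module[OF *(1)])
    have "h i (\<psi> \<one>\<^bsub>G\<^esub> (hinner (fibre X p) x y)) = (h i (\<psi> p x))\<^sup>\<star>\<^bsub>D i\<^esub> \<odot>\<^bsub>D i\<^esub> h i (\<psi> p y)" if "i \<in> I" for i
      using rep[OF that] * by (simp add: representation_def eq[OF that] eq1[OF that] M.inner_closed)
    then show "\<psi> \<one>\<^bsub>G\<^esub> (hinner (fibre X p) x y) = (\<psi> p x)\<^sup>\<star>\<^bsub>B\<^esub> \<odot>\<^bsub>B\<^esub> \<psi> p y"
      using star_homsD(4,5)[OF h] * cls cl1 by (intro inj) (simp_all add: B.cl M.inner_closed)
  qed
qed

text \<open>\<open>compact_rep\<close> is controlled only on compact operators; compact alignment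
  places the argument on the right-hand side of Nica covariance there.\<close>

lemma iota_join_compact:
  assumes "compactly_aligned G P A X" "p \<in> P" "q \<in> P" "has_ub G P p q"
    and "S \<in> carrier (compacts A (fibre X p))" "T \<in> carrier (compacts A (fibre X q))"
  shows "join G P p q \<in> P" "iota_join G P A X p q S T \<in> carrier (compacts A (fibre X (join G P p q)))"
  using join_is_join[OF assms(2-4)] assms by (auto simp: is_join_def compactly_aligned_def)

lemma compact_rep_cong:
  assumes "\<And>x. x \<in> carrier (fibre X p) \<Longrightarrow> \<psi> p x = \<phi> p x"
  shows "compact_rep A X B \<psi> p = compact_rep A X B \<phi> p"
  using assms by (simp add: compact_rep_def cong: conj_cong)

text \<open>Both conditions are equations in \<open>B\<close>, checked after each
  \<open>h i\<close>. The premise of (CP) does not refer to the target, so it serves every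
  \<open>\<phi> i\<close> at once. Applied to a product with its projections and to a subalgebra
  with its inclusion.\<close>

lemma joint_CNP:
  fixes B :: "'b cstar" and D :: "'i \<Rightarrow> 'd cstar"
  assumes al: "compactly_aligned G P A X"
    and B: "cstar_algebra B" and cls: "\<And>p x. p \<in> P \<Longrightarrow> x \<in> carrier (fibre X p) \<Longrightarrow> \<psi> p x \<in> carrier B"
    and D: "\<And>i. i \<in> I \<Longrightarrow> cstar_algebra (D i)" and h: "\<And>i. i \<in> I \<Longrightarrow> h i \<in> star_homs B (D i)"
    and cnp: "\<And>i. i \<in> I \<Longrightarrow> CNP_covariant G P A X (D i) (\<phi> i)"
    and eq: "\<And>i p x. i \<in> I \<Longrightarrow> p \<in> P \<Longrightarrow> x \<in> carrier (fibre X p) \<Longrightarrow> h i (\<psi> p x) = \<phi> i p x"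
    and inj: "\<And>a b. a \<in> carrier B \<Longrightarrow> b \<in> carrier B \<Longrightarrow> (\<And>i. i \<in> I \<Longrightarrow> h i a = h i b) \<Longrightarrow> a = b"
  shows "CNP_covariant G P A X B \<psi>"
proof -
  have rep: "representation G P A X B \<psi>"
    by (rule joint_representation[OF B cls h _ eq inj]) (use cnp in \<open>auto simp: CNP_covariant_def\<close>)
  interpret R: psys_rep G P A X B \<psi> by (rule psys_repI[OF B rep])
  have cr: "compact_rep A X (D i) (\<phi> i) p T = h i (R.cr p T)"
    if "i \<in> I" "p \<in> P" "T \<in> carrier (compacts A (fibre X p))" for i p T
    using R.push_compact_rep[OF D[OF that(1)] h[OF that(1)] that(2,3)] 
      compact_rep_cong[where \<psi> = "\<lambda>p x. h i (\<psi> p x)" and \<phi> = "\<phi> i" and p = p and B = "D i", OF eq[OF that(1,2)]] by simp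
  have "Nica_covariant G P A X B \<psi>"
    unfolding Nica_covariant_def
  proof (intro ballI)
    fix p q S T assume *: "p \<in> P" "q \<in> P" "S \<in> carrier (compacts A (fibre X p))" "T \<in> carrier (compacts A (fibre X q))"
    let ?r = "if has_ub G P p q then R.cr (join G P p q) (iota_join G P A X p q S T) else \<zero>\<^sub>v\<^bsub>B\<^esub>"
    show "R.cr p S \<odot>\<^bsub>B\<^esub> R.cr q T = ?r"
    proof (rule inj)
      show "R.cr p S \<odot>\<^bsub>B\<^esub> R.cr q T \<in> carrier B" using * by (simp add: R.B.cl R.compact_rep_closed)
      show "?r \<in> carrier B" using iota_join_compact[OF al *(1,2) _ *(3,4)] by (simp add: R.B.cl R.compact_rep_closed)
      fix i assume i: "i \<in> I"
      interpret H: star_hom B "D i" "h i" by (rule star_homI[OF B D[OF i] h[OF i]])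
      have "Nica_covariant G P A X (D i) (\<phi> i)" using cnp[OF i] by (simp add: CNP_covariant_def)
      then have "h i (R.cr p S) \<odot>\<^bsub>D i\<^esub> h i (R.cr q T) =
          (if has_ub G P p q then compact_rep A X (D i) (\<phi> i) (join G P p q) (iota_join G P A X p q S T) else \<zero>\<^sub>v\<^bsub>D i\<^esub>)"
        unfolding Nica_covariant_def cr[OF i *(1,3), symmetric] cr[OF i *(2,4), symmetric] using * by blast
      also have "\<dots> = h i ?r" using iota_join_compact[OF al *(1,2) _ *(3,4)] cr[OF i] by (simp add: H.hom_zero)
      finally show "h i (R.cr p S \<odot>\<^bsub>B\<^esub> R.cr q T) = h i ?r"
        using H.hom_mult[OF R.compact_rep_closed[OF *(1,3)] R.compact_rep_closed[OF *(2,4)]] by simp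
    qed
  qed
  moreover have "CP_covariant G P A X B \<psi>"
    unfolding CP_covariant_def
  proof (intro allI impI)
    fix F T assume F: "finite F" "F \<subseteq> P" and T: "\<forall>p\<in>F. T p \<in> carrier (compacts A (fibre X p))"
      and large: "for_large G P (\<lambda>s. vsum (adjointables A (Xtilde G P A X s)) (\<lambda>p. iota_tilde G P A X p s (T p)) F =
            \<zero>\<^sub>v\<^bsub>adjointables A (Xtilde G P A X s)\<^esub>)"
    have c: "R.cr p (T p) \<in> carrier B" if "p \<in> F" for p using R.compact_rep_closed F T that by blast
    show "vsum B (\<lambda>p. R.cr p (T p)) F = \<zero>\<^sub>v\<^bsub>B\<^esub>"
    proof (rule inj)
      show "vsum B (\<lambda>p. R.cr p (T p)) F \<in> carrier B" using c by (intro R.B.vsum_closed) blast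
      show "\<zero>\<^sub>v\<^bsub>B\<^esub> \<in> carrier B" by (rule R.B.zero_closed)
      fix i assume i: "i \<in> I"
      interpret H: star_hom B "D i" "h i" by (rule star_homI[OF B D[OF i] h[OF i]])
      have "CP_covariant G P A X (D i) (\<phi> i)" using cnp[OF i] by (simp add: CNP_covariant_def)
      then have "vsum (D i) (\<lambda>p. compact_rep A X (D i) (\<phi> i) p (T p)) F = \<zero>\<^sub>v\<^bsub>D i\<^esub>"
        unfolding CP_covariant_def using F T large by blast
      moreover have "h i (vsum B (\<lambda>p. R.cr p (T p)) F) = vsum (D i) (\<lambda>p. compact_rep A X (D i) (\<phi> i) p (T p)) F"
        using c F T by (intro H.hom_vsum) (auto simp: cr[OF i])
      ultimately show "h i (vsum B (\<lambda>p. R.cr p (T p)) F) = h i \<zero>\<^sub>v\<^bsub>B\<^esub>" by (simp add: H.hom_zero)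
    qed
  qed
  ultimately show ?thesis using rep by (simp add: CNP_covariant_def)
qed

lemma push_CNP:
  fixes B :: "'b cstar" and D :: "'d cstar"
  assumes al: "compactly_aligned G P A X" and B: "cstar_algebra B" and D: "cstar_algebra D" and h: "h \<in> star_homs B D"
    and cnp: "CNP_covariant G P A X B \<psi>"
  shows "CNP_covariant G P A X D (\<lambda>p x. h (\<psi> p x))"
proof -
  have rep: "representation G P A X B \<psi>" using cnp by (simp add: CNP_covariant_def)
  interpret R: psys_rep G P A X B \<psi> by (rule psys_repI[OF B rep])
  interpret H: star_hom B D h by (rule star_homI[OF B D h])
  note cr = R.push_compact_rep[OF D h]
  have "Nica_covariant G P A X D (\<lambda>p x. h (\<psi> p x))"
    unfolding Nica_covariant_def
  proof (intro ballI)
    fix p q S T assume *: "p \<in> P" "q \<in> P" "S \<in> carrier (compacts A (fibre X p))" "T \<in> carrier (compacts A (fibre X q))"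
    have "R.cr p S \<odot>\<^bsub>B\<^esub> R.cr q T = (if has_ub G P p q then R.cr (join G P p q) (iota_join G P A X p q S T) else \<zero>\<^sub>v\<^bsub>B\<^esub>)"
      using cnp * unfolding CNP_covariant_def Nica_covariant_def by blast
    from arg_cong[OF this, of h]
    show "compact_rep A X D (\<lambda>p x. h (\<psi> p x)) p S \<odot>\<^bsub>D\<^esub> compact_rep A X D (\<lambda>p x. h (\<psi> p x)) q T =
      (if has_ub G P p q then compact_rep A X D (\<lambda>p x. h (\<psi> p x)) (join G P p q) (iota_join G P A X p q S T) else \<zero>\<^sub>v\<^bsub>D\<^esub>)"
      using iota_join_compact[OF al *(1,2) _ *(3,4)] cr[OF *(1,3)] cr[OF *(2,4)] cr
        H.hom_mult[OF R.compact_rep_closed[OF *(1,3)] R.compact_rep_closed[OF *(2,4)]]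
      by (simp add: H.hom_zero split: if_splits)
  qed
  moreover have "CP_covariant G P A X D (\<lambda>p x. h (\<psi> p x))"
    unfolding CP_covariant_def
  proof (intro allI impI)
    fix F T assume F: "finite F" "F \<subseteq> P" and T: "\<forall>p\<in>F. T p \<in> carrier (compacts A (fibre X p))"
      and large: "for_large G P (\<lambda>s. vsum (adjointables A (Xtilde G P A X s)) (\<lambda>p. iota_tilde G P A X p s (T p)) F =
            \<zero>\<^sub>v\<^bsub>adjointables A (Xtilde G P A X s)\<^esub>)"
    have "vsum B (\<lambda>p. R.cr p (T p)) F = \<zero>\<^sub>v\<^bsub>B\<^esub>"
      using cnp F T large unfolding CNP_covariant_def CP_covariant_def by blast
    moreover have "h (vsum B (\<lambda>p. R.cr p (T p)) F) = vsum D (\<lambda>p. compact_rep A X D (\<lambda>p x. h (\<psi> p x)) p (T p)) F"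
      using F T R.compact_rep_closed by (intro H.hom_vsum) (auto simp: cr)
    ultimately show "vsum D (\<lambda>p. compact_rep A X D (\<lambda>p x. h (\<psi> p x)) p (T p)) F = \<zero>\<^sub>v\<^bsub>D\<^esub>" by (simp add: H.hom_zero)
  qed
  ultimately show ?thesis using R.push_representation[OF D h] by (simp add: CNP_covariant_def)
qed

end

section \<open>Bounded families in a product of C*-algebras\<close>

text \<open>The inserted 0 gives norm 0 over an empty index set, where \<open>Sup\<close> of the
  empty set of reals carries no information; over other index sets it is harmless because norms are
  nonnegative.\<close>

definition sup_norm :: "'i set \<Rightarrow> ('i \<Rightarrow> 'b cstar) \<Rightarrow> ('i \<Rightarrow> 'b) \<Rightarrow> real" where
  "sup_norm I B x = Sup (insert 0 ((\<lambda>i. anorm (B i) (x i)) ` I))"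

definition cstar_product :: "'i set \<Rightarrow> ('i \<Rightarrow> 'b cstar) \<Rightarrow> ('i \<Rightarrow> 'b) cstar" where
  "cstar_product I B =
    \<lparr>carrier = {x \<in> (\<Pi>\<^sub>E i\<in>I. carrier (B i)). bdd_above ((\<lambda>i. anorm (B i) (x i)) ` I)},
     vadd = (\<lambda>x y. \<lambda>i\<in>I. x i \<boxplus>\<^bsub>B i\<^esub> y i),
     vzero = (\<lambda>i\<in>I. \<zero>\<^sub>v\<^bsub>B i\<^esub>),
     vscale = (\<lambda>c x. \<lambda>i\<in>I. c \<cdot>\<^bsub>B i\<^esub> x i),
     amult = (\<lambda>x y. \<lambda>i\<in>I. x i \<odot>\<^bsub>B i\<^esub> y i),
     astar = (\<lambda>x. \<lambda>i\<in>I. (x i)\<^sup>\<star>\<^bsub>B i\<^esub>),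
     anorm = sup_norm I B\<rparr>"

locale cstar_family =
  fixes I :: "'i set" and B :: "'i \<Rightarrow> 'b cstar"
  assumes cstar: "i \<in> I \<Longrightarrow> cstar_algebra (B i)"
begin

abbreviation C :: "('i \<Rightarrow> 'b) cstar" where "C \<equiv> cstar_product I B"

lemma apply_simps:
  "i \<in> I \<Longrightarrow> (x \<boxplus>\<^bsub>C\<^esub> y) i = x i \<boxplus>\<^bsub>B i\<^esub> y i" "i \<in> I \<Longrightarrow> \<zero>\<^sub>v\<^bsub>C\<^esub> i = \<zero>\<^sub>v\<^bsub>B i\<^esub>"
  "i \<in> I \<Longrightarrow> (c \<cdot>\<^bsub>C\<^esub> x) i = c \<cdot>\<^bsub>B i\<^esub> x i" "i \<in> I \<Longrightarrow> (x \<odot>\<^bsub>C\<^esub> y) i = x i \<odot>\<^bsub>B i\<^esub> y i"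
  "i \<in> I \<Longrightarrow> (x\<^sup>\<star>\<^bsub>C\<^esub>) i = (x i)\<^sup>\<star>\<^bsub>B i\<^esub>" "i \<in> I \<Longrightarrow> vdiff C x y i = vdiff (B i) (x i) (y i)"
  by (simp_all add: cstar_product_def vdiff_def)

lemma ops_extensional:
  "x \<boxplus>\<^bsub>C\<^esub> y \<in> extensional I" "\<zero>\<^sub>v\<^bsub>C\<^esub> \<in> extensional I" "c \<cdot>\<^bsub>C\<^esub> x \<in> extensional I"
  "x \<odot>\<^bsub>C\<^esub> y \<in> extensional I" "x\<^sup>\<star>\<^bsub>C\<^esub> \<in> extensional I" "vdiff C x y \<in> extensional I"
  by (simp_all add: cstar_product_def vdiff_def)

lemma carrierD: "x \<in> carrier C \<Longrightarrow> i \<in> I \<Longrightarrow> x i \<in> carrier (B i)" "x \<in> carrier C \<Longrightarrow> x \<in> extensional I"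
  by (auto simp: cstar_product_def PiE_def)

lemma norm_coord: "x \<in> carrier C \<Longrightarrow> i \<in> I \<Longrightarrow> anorm (B i) (x i) \<le> anorm C x"
  by (auto simp: cstar_product_def sup_norm_def intro!: cSup_upper)

lemma norm_pos: "x \<in> carrier C \<Longrightarrow> 0 \<le> anorm C x"
  by (auto simp: cstar_product_def sup_norm_def intro!: cSup_upper)

lemma norm_le: "0 \<le> c \<Longrightarrow> (\<And>i. i \<in> I \<Longrightarrow> anorm (B i) (x i) \<le> c) \<Longrightarrow> anorm C x \<le> c"
  by (auto simp: cstar_product_def sup_norm_def intro!: cSup_least)

lemma carrierI:
  "x \<in> extensional I \<Longrightarrow> (\<And>i. i \<in> I \<Longrightarrow> x i \<in> carrier (B i)) \<Longrightarrow> (\<And>i. i \<in> I \<Longrightarrow> anorm (B i) (x i) \<le> c) \<Longrightarrow> x \<in> carrier C"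
  by (auto simp: cstar_product_def PiE_def intro!: bdd_aboveI2[where M = c])

lemma eqI: "x \<in> extensional I \<Longrightarrow> y \<in> extensional I \<Longrightarrow> (\<And>i. i \<in> I \<Longrightarrow> x i = y i) \<Longrightarrow> x = y"
  by (rule extensionalityI)

lemmas law = cstar_algebra.cl[OF cstar] cstar_algebra.star_simps[OF cstar]

lemma norms:
  assumes i: "i \<in> I" and x: "x \<in> carrier C" and y: "y \<in> carrier C"
  shows "anorm (B i) ((x \<boxplus>\<^bsub>C\<^esub> y) i) \<le> anorm C x + anorm C y"
    and "anorm (B i) ((x \<odot>\<^bsub>C\<^esub> y) i) \<le> anorm C x * anorm C y"
    and "anorm (B i) ((c \<cdot>\<^bsub>C\<^esub> x) i) \<le> cmod c * anorm C x"
    and "anorm (B i) ((x\<^sup>\<star>\<^bsub>C\<^esub>) i) \<le> anorm C x"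
proof -
  interpret B: cstar_algebra "B i" by (rule cstar[OF i])
  note c = carrierD(1)[OF x i] carrierD(1)[OF y i] and n = norm_coord[OF x i] norm_coord[OF y i]
  show "anorm (B i) ((x \<boxplus>\<^bsub>C\<^esub> y) i) \<le> anorm C x + anorm C y"
    using B.norm_triangle[OF c] n by (simp add: apply_simps[OF i])
  show "anorm (B i) ((x \<odot>\<^bsub>C\<^esub> y) i) \<le> anorm C x * anorm C y"
    unfolding apply_simps[OF i]
    by (rule order_trans[OF B.norm_mult[OF c] mult_mono[OF n norm_pos[OF x] B.norm_nonneg[OF c(2)]]])
  show "anorm (B i) ((c \<cdot>\<^bsub>C\<^esub> x) i) \<le> cmod c * anorm C x"
    using n(1) by (simp add: apply_simps[OF i] B.norm_scale[OF c(1)] mult_left_mono)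
  show "anorm (B i) ((x\<^sup>\<star>\<^bsub>C\<^esub>) i) \<le> anorm C x"
    using n(1) by (simp add: apply_simps[OF i] B.norm_star[OF c(1)])
qed

lemma closed:
  "x \<in> carrier C \<Longrightarrow> y \<in> carrier C \<Longrightarrow> x \<boxplus>\<^bsub>C\<^esub> y \<in> carrier C" "\<zero>\<^sub>v\<^bsub>C\<^esub> \<in> carrier C"
  "x \<in> carrier C \<Longrightarrow> c \<cdot>\<^bsub>C\<^esub> x \<in> carrier C"
  "x \<in> carrier C \<Longrightarrow> y \<in> carrier C \<Longrightarrow> x \<odot>\<^bsub>C\<^esub> y \<in> carrier C" "x \<in> carrier C \<Longrightarrow> x\<^sup>\<star>\<^bsub>C\<^esub> \<in> carrier C"
proof -
  show "x \<boxplus>\<^bsub>C\<^esub> y \<in> carrier C" if "x \<in> carrier C" "y \<in> carrier C"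
    by (rule carrierI[OF ops_extensional(1) _ norms(1)[OF _ that]]) (simp add: apply_simps law carrierD(1) that)
  show "x \<odot>\<^bsub>C\<^esub> y \<in> carrier C" if "x \<in> carrier C" "y \<in> carrier C"
    by (rule carrierI[OF ops_extensional(4) _ norms(2)[OF _ that]]) (simp add: apply_simps law carrierD(1) that)
  show "c \<cdot>\<^bsub>C\<^esub> x \<in> carrier C" if "x \<in> carrier C"
    by (rule carrierI[OF ops_extensional(3) _ norms(3)[OF _ that that]]) (simp add: apply_simps law carrierD(1) that)
  show "x\<^sup>\<star>\<^bsub>C\<^esub> \<in> carrier C" if "x \<in> carrier C"
    by (rule carrierI[OF ops_extensional(5) _ norms(4)[OF _ that that]]) (simp add: apply_simps law carrierD(1) that)
  show "\<zero>\<^sub>v\<^bsub>C\<^esub> \<in> carrier C"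
  proof (rule carrierI[OF ops_extensional(2), where c = 0])
    fix i assume i: "i \<in> I"
    interpret B: cstar_algebra "B i" by (rule cstar[OF i])
    show "\<zero>\<^sub>v\<^bsub>C\<^esub> i \<in> carrier (B i)" "anorm (B i) (\<zero>\<^sub>v\<^bsub>C\<^esub> i) \<le> 0"
      by (simp_all add: apply_simps[OF i] B.cl B.nv.nrm_zero)
  qed
qed

lemma cvector_space_C: "cvector_space C"
proof (rule cvector_spaceI)
  fix x y z c d assume "x \<in> carrier C" "y \<in> carrier C" "z \<in> carrier C"
  note c = carrierD(1)[OF this(1)] carrierD(1)[OF this(2)] carrierD(1)[OF this(3)]
  note B = cstar_algebra.axioms(1)[OF cstar]
  show "(x \<boxplus>\<^bsub>C\<^esub> y) \<boxplus>\<^bsub>C\<^esub> z = x \<boxplus>\<^bsub>C\<^esub> (y \<boxplus>\<^bsub>C\<^esub> z)"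
    by (rule eqI[OF ops_extensional(1) ops_extensional(1)]) (simp add: apply_simps c cvector_space.add_assoc[OF B])
next
  fix x y assume x: "x \<in> carrier C" "y \<in> carrier C"
  note c = carrierD(1)[OF x(1)] carrierD(1)[OF x(2)]
  note B = cstar_algebra.axioms(1)[OF cstar]
  show "x \<boxplus>\<^bsub>C\<^esub> y = y \<boxplus>\<^bsub>C\<^esub> x"
    by (rule eqI[OF ops_extensional(1) ops_extensional(1)]) (simp add: apply_simps c cvector_space.add_commute[OF B, of _ "x _" "y _"])
  show "a \<cdot>\<^bsub>C\<^esub> (x \<boxplus>\<^bsub>C\<^esub> y) = a \<cdot>\<^bsub>C\<^esub> x \<boxplus>\<^bsub>C\<^esub> a \<cdot>\<^bsub>C\<^esub> y" for a
    by (rule eqI[OF ops_extensional(3) ops_extensional(1)]) (simp add: apply_simps c cvector_space.scale_right_distrib[OF B])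
next
  fix x assume x: "x \<in> carrier C"
  note c = carrierD(1)[OF x] and B = cstar_algebra.axioms(1)[OF cstar]
  show "\<zero>\<^sub>v\<^bsub>C\<^esub> \<boxplus>\<^bsub>C\<^esub> x = x"
    by (rule eqI[OF ops_extensional(1) carrierD(2)[OF x]]) (simp add: apply_simps c cvector_space.zero_add[OF B])
  show "0 \<cdot>\<^bsub>C\<^esub> x = \<zero>\<^sub>v\<^bsub>C\<^esub>"
    by (rule eqI[OF ops_extensional(3,2)]) (simp add: apply_simps c cvector_space.scale_zero_left[OF B])
  show "(a + b) \<cdot>\<^bsub>C\<^esub> x = a \<cdot>\<^bsub>C\<^esub> x \<boxplus>\<^bsub>C\<^esub> b \<cdot>\<^bsub>C\<^esub> x" for a b
    by (rule eqI[OF ops_extensional(3,1)]) (simp add: apply_simps c cvector_space.scale_left_distrib[OF B])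
  show "a \<cdot>\<^bsub>C\<^esub> b \<cdot>\<^bsub>C\<^esub> x = (a * b) \<cdot>\<^bsub>C\<^esub> x" for a b
    by (rule eqI[OF ops_extensional(3,3)]) (simp add: apply_simps c cvector_space.scale_scale[OF B])
  show "1 \<cdot>\<^bsub>C\<^esub> x = x"
    by (rule eqI[OF ops_extensional(3) carrierD(2)[OF x]]) (simp add: apply_simps c cvector_space.scale_one[OF B])
qed (simp_all add: closed)

interpretation C: cvector_space C by (rule cvector_space_C)

lemma norm_scale_C: assumes x: "x \<in> carrier C" shows "anorm C (z \<cdot>\<^bsub>C\<^esub> x) = cmod z * anorm C x"
proof (rule antisym)
  have le: "anorm C (z \<cdot>\<^bsub>C\<^esub> x) \<le> cmod z * anorm C x" if x: "x \<in> carrier C" for z x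
    by (rule norm_le[OF _ norms(3)[OF _ x x]]) (simp add: norm_pos[OF x])
  show "anorm C (z \<cdot>\<^bsub>C\<^esub> x) \<le> cmod z * anorm C x" by (rule le[OF x])
  show "cmod z * anorm C x \<le> anorm C (z \<cdot>\<^bsub>C\<^esub> x)"
  proof (cases "z = 0")
    case True
    then show ?thesis using norm_pos[OF closed(3)[OF x]] by simp
  next
    case False
    have "inverse z \<cdot>\<^bsub>C\<^esub> z \<cdot>\<^bsub>C\<^esub> x = x" using False x by (simp add: C.scale_scale C.scale_one)
    then have "anorm C x \<le> cmod (inverse z) * anorm C (z \<cdot>\<^bsub>C\<^esub> x)" using le[OF closed(3)[OF x], of "inverse z" z] by simp
    then show ?thesis using False by (simp add: norm_inverse inverse_eq_divide norm_divide pos_le_divide_eq mult.commute)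
  qed
qed

lemma cnormed_C: "cnormed C (anorm C)"
proof (intro cnormed.intro cnormed_axioms.intro)
  fix x assume x: "x \<in> carrier C"
  show "anorm C x = 0 \<longleftrightarrow> x = \<zero>\<^sub>v\<^bsub>C\<^esub>"
  proof
    assume n: "anorm C x = 0"
    show "x = \<zero>\<^sub>v\<^bsub>C\<^esub>"
    proof (rule eqI[OF carrierD(2)[OF x] ops_extensional(2)])
      fix i assume i: "i \<in> I"
      interpret B: cstar_algebra "B i" by (rule cstar[OF i])
      show "x i = \<zero>\<^sub>v\<^bsub>C\<^esub> i"
        using norm_coord[OF x i] n B.norm_nonneg[OF carrierD(1)[OF x i]] B.norm_eq_zero[OF carrierD(1)[OF x i]]
        by (simp add: apply_simps[OF i])
    qed
  next
    assume "x = \<zero>\<^sub>v\<^bsub>C\<^esub>"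
    then have "x = 0 \<cdot>\<^bsub>C\<^esub> x" using C.scale_zero_left[OF x] by simp
    then show "anorm C x = 0" using norm_scale_C[OF x, of 0] by simp
  qed
next
  fix x y assume *: "x \<in> carrier C" "y \<in> carrier C"
  show "anorm C (x \<boxplus>\<^bsub>C\<^esub> y) \<le> anorm C x + anorm C y"
    by (rule norm_le[OF _ norms(1)[OF _ *]]) (simp add: norm_pos *)
qed (simp_all add: norm_pos norm_scale_C cvector_space_C)

interpretation N: cnormed C "anorm C" by (rule cnormed_C)

lemma cbanach_C: "cbanach C (anorm C)"
proof (rule cbanachI[OF cnormed_C])
  fix t assume t: "N.ncauchy t"
  then have tc: "t n \<in> carrier C" for n by (simp add: N.ncauchy_def)
  have coord: "anorm (B i) (vdiff (B i) (t m i) (t n i)) \<le> anorm C (vdiff C (t m) (t n))" if "i \<in> I" for i m n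
    using norm_coord[OF C.diff_closed[OF tc tc] that, of m n] by (simp add: apply_simps[OF that])
  have "\<exists>y. cnormed.conv (B i) (anorm (B i)) (\<lambda>n. t n i) y" if i: "i \<in> I" for i
  proof -
    interpret B: cstar_algebra "B i" by (rule cstar[OF i])
    have "B.nv.ncauchy (\<lambda>n. t n i)"
      unfolding B.nv.ncauchy_def
    proof (intro conjI allI impI)
      show "t n i \<in> carrier (B i)" for n by (rule carrierD(1)[OF tc i])
      fix \<epsilon> :: real assume "0 < \<epsilon>"
      then obtain M where "\<And>m n. m \<ge> M \<Longrightarrow> n \<ge> M \<Longrightarrow> anorm C (vdiff C (t m) (t n)) < \<epsilon>"
        using t unfolding N.ncauchy_def by blast
      then show "\<exists>M. \<forall>m\<ge>M. \<forall>n\<ge>M. anorm (B i) (vdiff (B i) (t m i) (t n i)) < \<epsilon>"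
        using order.strict_trans1[OF coord[OF i]] by blast
    qed
    then show ?thesis by (rule B.nv.ncauchy_conv)
  qed
  then obtain y where y: "\<And>i. i \<in> I \<Longrightarrow> cnormed.conv (B i) (anorm (B i)) (\<lambda>n. t n i) (y i)" by metis
  define x where "x = restrict y I"
  obtain c where c: "\<And>n. anorm C (t n) \<le> c" using N.ncauchy_bounded[OF t] by blast
  \<comment> \<open>Bounds survive the passage to the coordinate limit. Taking z = 0 shows that x is
    a bounded family, and taking z = \<open>t n i\<close> gives convergence in the supremum
    norm.\<close>
  have lim: "anorm (B i) (vdiff (B i) z (x i)) \<le> b"
    if i: "i \<in> I" and z: "z \<in> carrier (B i)" and b: "\<And>n. n \<ge> M \<Longrightarrow> anorm (B i) (vdiff (B i) z (t n i)) \<le> b" for i z b M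
  proof -
    interpret B: cstar_algebra "B i" by (rule cstar[OF i])
    have "B.nv.conv (\<lambda>n. vdiff (B i) z (t n i)) (vdiff (B i) z (x i))"
      using y[OF i] i unfolding x_def by (simp add: B.nv.conv_diff[OF B.nv.conv_const[OF z]])
    then have "(\<lambda>n. anorm (B i) (vdiff (B i) z (t n i))) \<longlonglongrightarrow> anorm (B i) (vdiff (B i) z (x i))" by (rule B.nv.conv_norm)
    then show ?thesis by (rule LIMSEQ_le_const2) (use b in blast)
  qed
  have xc: "x i \<in> carrier (B i)" if i: "i \<in> I" for i
  proof -
    interpret B: cstar_algebra "B i" by (rule cstar[OF i])
    show ?thesis using B.nv.convD(2)[OF y[OF i]] i by (simp add: x_def)
  qed
  have x: "x \<in> carrier C"
  proof (rule carrierI[OF _ xc])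
    show "x \<in> extensional I" by (simp add: x_def)
    fix i assume i: "i \<in> I"
    interpret B: cstar_algebra "B i" by (rule cstar[OF i])
    have "anorm (B i) (vdiff (B i) \<zero>\<^sub>v\<^bsub>B i\<^esub> (t n i)) \<le> c" for n
      using B.nv.nrm_diff_le[OF B.zero_closed carrierD(1)[OF tc i], of n] norm_coord[OF tc i, of n] c[of n] B.nv.nrm_zero by simp
    then have "anorm (B i) (vdiff (B i) \<zero>\<^sub>v\<^bsub>B i\<^esub> (x i)) \<le> c" by (rule lim[OF i B.zero_closed])
    then show "anorm (B i) (x i) \<le> c"
      using B.nv.nrm_le_diff[OF xc[OF i] B.zero_closed] B.nv.nrm_diff_commute[OF xc[OF i] B.zero_closed] B.nv.nrm_zero by simp
  qed
  have "N.conv t x"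
    unfolding N.conv_def
  proof (intro conjI allI tc x LIMSEQ_I)
    fix r :: real assume "0 < r"
    then obtain M where M: "\<And>m n. m \<ge> M \<Longrightarrow> n \<ge> M \<Longrightarrow> anorm C (vdiff C (t m) (t n)) < r / 2"
      using t unfolding N.ncauchy_def by (meson half_gt_zero)
    have "anorm C (vdiff C (t n) x) \<le> r / 2" if n: "n \<ge> M" for n
    proof (rule norm_le)
      fix i assume i: "i \<in> I"
      show "anorm (B i) (vdiff C (t n) x i) \<le> r / 2"
        unfolding apply_simps(6)[OF i]
      proof (rule lim[OF i carrierD(1)[OF tc i]])
        show "anorm (B i) (vdiff (B i) (t n i) (t m i)) \<le> r / 2" if "m \<ge> M" for m
          using order.strict_trans1[OF coord[OF i] M[OF n that]] by simp
      qed
    qed (use \<open>0 < r\<close> in simp)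
    then show "\<exists>no. \<forall>n\<ge>no. norm (anorm C (vdiff C (t n) x) - 0) < r"
      using \<open>0 < r\<close> norm_pos[OF C.diff_closed[OF tc x]] by (intro exI[of _ M]) fastforce
  qed
  then show "\<exists>x. N.conv t x" by blast
qed

lemma cstar_C: "cstar_algebra C"
proof (intro cstar_algebra.intro cstar_algebra_axioms.intro cvector_space_C)
  show "Metric_space.mcomplete (carrier C) (cstar_dist C)"
    using cbanach.mcomplete_ndist[OF cbanach_C] by (simp add: cstar_dist_eq)
next
  fix x assume x: "x \<in> carrier C"
  note xx = closed(4)[OF closed(5)[OF x] x]
  have eq: "anorm (B i) ((x\<^sup>\<star>\<^bsub>C\<^esub> \<odot>\<^bsub>C\<^esub> x) i) = (anorm (B i) (x i))\<^sup>2" if i: "i \<in> I" for i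
    using cstar_algebra.cstar_identity[OF cstar[OF i] carrierD(1)[OF x i]] by (simp add: apply_simps[OF i])
  show "anorm C (x\<^sup>\<star>\<^bsub>C\<^esub> \<odot>\<^bsub>C\<^esub> x) = (anorm C x)\<^sup>2"
  proof (rule antisym)
    show "anorm C (x\<^sup>\<star>\<^bsub>C\<^esub> \<odot>\<^bsub>C\<^esub> x) \<le> (anorm C x)\<^sup>2"
      using cstar_algebra.norm_nonneg[OF cstar carrierD(1)[OF x]] norm_coord[OF x]
      by (intro norm_le) (simp_all add: eq power_mono)
    have "anorm C x \<le> sqrt (anorm C (x\<^sup>\<star>\<^bsub>C\<^esub> \<odot>\<^bsub>C\<^esub> x))"
      using norm_coord[OF xx] norm_pos[OF xx] by (intro norm_le real_le_rsqrt) (simp_all add: eq)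
    then show "(anorm C x)\<^sup>2 \<le> anorm C (x\<^sup>\<star>\<^bsub>C\<^esub> \<odot>\<^bsub>C\<^esub> x)"
      using power_mono[OF _ norm_pos[OF x], of _ 2] norm_pos[OF xx] by fastforce
  qed
next
  fix x y assume *: "x \<in> carrier C" "y \<in> carrier C"
  show "anorm C (x \<odot>\<^bsub>C\<^esub> y) \<le> anorm C x * anorm C y"
    by (rule norm_le[OF _ norms(2)[OF _ *]]) (simp add: norm_pos *)
next
  fix x y z assume "x \<in> carrier C" "y \<in> carrier C" "z \<in> carrier C"
  note c = carrierD(1)[OF this(1)] carrierD(1)[OF this(2)] carrierD(1)[OF this(3)]
  show "(x \<odot>\<^bsub>C\<^esub> y) \<odot>\<^bsub>C\<^esub> z = x \<odot>\<^bsub>C\<^esub> (y \<odot>\<^bsub>C\<^esub> z)"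
    by (rule eqI[OF ops_extensional(4,4)]) (simp add: apply_simps c cstar_algebra.mult_assoc[OF cstar])
  show "x \<odot>\<^bsub>C\<^esub> (y \<boxplus>\<^bsub>C\<^esub> z) = x \<odot>\<^bsub>C\<^esub> y \<boxplus>\<^bsub>C\<^esub> x \<odot>\<^bsub>C\<^esub> z"
    by (rule eqI[OF ops_extensional(4,1)]) (simp add: apply_simps c cstar_algebra.mult_add_right[OF cstar])
  show "(x \<boxplus>\<^bsub>C\<^esub> y) \<odot>\<^bsub>C\<^esub> z = x \<odot>\<^bsub>C\<^esub> z \<boxplus>\<^bsub>C\<^esub> y \<odot>\<^bsub>C\<^esub> z"
    by (rule eqI[OF ops_extensional(4,1)]) (simp add: apply_simps c cstar_algebra.mult_add_left[OF cstar])
next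
  fix x y z assume "x \<in> carrier C" "y \<in> carrier C"
  note c = carrierD(1)[OF this(1)] carrierD(1)[OF this(2)]
  show "x \<odot>\<^bsub>C\<^esub> (z \<cdot>\<^bsub>C\<^esub> y) = z \<cdot>\<^bsub>C\<^esub> (x \<odot>\<^bsub>C\<^esub> y)"
    by (rule eqI[OF ops_extensional(4,3)]) (simp add: apply_simps c cstar_algebra.mult_scale_right[OF cstar])
  show "(z \<cdot>\<^bsub>C\<^esub> x) \<odot>\<^bsub>C\<^esub> y = z \<cdot>\<^bsub>C\<^esub> (x \<odot>\<^bsub>C\<^esub> y)"
    by (rule eqI[OF ops_extensional(4,3)]) (simp add: apply_simps c cstar_algebra.mult_scale_left[OF cstar])
  show "(x \<boxplus>\<^bsub>C\<^esub> y)\<^sup>\<star>\<^bsub>C\<^esub> = x\<^sup>\<star>\<^bsub>C\<^esub> \<boxplus>\<^bsub>C\<^esub> y\<^sup>\<star>\<^bsub>C\<^esub>"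
    by (rule eqI[OF ops_extensional(5,1)]) (simp add: apply_simps c law)
  show "(x \<odot>\<^bsub>C\<^esub> y)\<^sup>\<star>\<^bsub>C\<^esub> = y\<^sup>\<star>\<^bsub>C\<^esub> \<odot>\<^bsub>C\<^esub> x\<^sup>\<star>\<^bsub>C\<^esub>"
    by (rule eqI[OF ops_extensional(5,4)]) (simp add: apply_simps c law)
next
  fix x z assume x: "x \<in> carrier C"
  note c = carrierD(1)[OF x]
  show "(x\<^sup>\<star>\<^bsub>C\<^esub>)\<^sup>\<star>\<^bsub>C\<^esub> = x"
    by (rule eqI[OF ops_extensional(5) carrierD(2)[OF x]]) (simp add: apply_simps c law)
  show "(z \<cdot>\<^bsub>C\<^esub> x)\<^sup>\<star>\<^bsub>C\<^esub> = cnj z \<cdot>\<^bsub>C\<^esub> x\<^sup>\<star>\<^bsub>C\<^esub>"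
    by (rule eqI[OF ops_extensional(5,3)]) (simp add: apply_simps c law)
qed (simp_all add: closed N.nrm_nonneg N.nrm_eq_zero N.nrm_scale N.nrm_triangle)

lemma proj_hom: assumes i: "i \<in> I" shows "(\<lambda>x\<in>carrier C. x i) \<in> star_homs C (B i)"
  by (rule star_homsI) (simp_all add: closed apply_simps[OF i] carrierD(1)[OF _ i])

end

section \<open>Moving a C*-algebra to another type\<close>

text \<open>Serves to place a generated algebra on the one type over which the universal property is
  stated. An injection of the carrier is enough; the operations are carried over through its
  inverse.\<close>

lemma cstar_transport:
  fixes B :: "'b cstar" and f :: "'b \<Rightarrow> 'd"
  assumes B: "cstar_algebra B" and f: "inj_on f (carrier B)"
  shows "\<exists>(D :: 'd cstar) h g. cstar_algebra D \<and> h \<in> star_homs B D \<and> g \<in> star_homs D B \<and>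
    (\<forall>b\<in>carrier B. g (h b) = b) \<and> (\<forall>d\<in>carrier D. g d \<in> carrier B \<and> h (g d) = d)"
proof -
  interpret B: cstar_algebra B by fact
  define g where "g = inv_into (carrier B) f"
  define D where "D = \<lparr>carrier = f ` carrier B, vadd = (\<lambda>x y. f (g x \<boxplus>\<^bsub>B\<^esub> g y)), vzero = f \<zero>\<^sub>v\<^bsub>B\<^esub>,
    vscale = (\<lambda>c x. f (c \<cdot>\<^bsub>B\<^esub> g x)), amult = (\<lambda>x y. f (g x \<odot>\<^bsub>B\<^esub> g y)), astar = (\<lambda>x. f ((g x)\<^sup>\<star>\<^bsub>B\<^esub>)),
    anorm = (\<lambda>x. anorm B (g x))\<rparr>"
  have gf [simp]: "g (f b) = b" if "b \<in> carrier B" for b using f that by (simp add: g_def)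
  have car: "carrier D = f ` carrier B" by (simp add: D_def)
  have ops: "a \<in> carrier B \<Longrightarrow> b \<in> carrier B \<Longrightarrow> f a \<boxplus>\<^bsub>D\<^esub> f b = f (a \<boxplus>\<^bsub>B\<^esub> b)" "\<zero>\<^sub>v\<^bsub>D\<^esub> = f \<zero>\<^sub>v\<^bsub>B\<^esub>"
    "a \<in> carrier B \<Longrightarrow> c \<cdot>\<^bsub>D\<^esub> f a = f (c \<cdot>\<^bsub>B\<^esub> a)" "a \<in> carrier B \<Longrightarrow> b \<in> carrier B \<Longrightarrow> f a \<odot>\<^bsub>D\<^esub> f b = f (a \<odot>\<^bsub>B\<^esub> b)"
    "a \<in> carrier B \<Longrightarrow> (f a)\<^sup>\<star>\<^bsub>D\<^esub> = f (a\<^sup>\<star>\<^bsub>B\<^esub>)" "a \<in> carrier B \<Longrightarrow> anorm D (f a) = anorm B a" for a b c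
    by (simp_all add: D_def)
  have vd: "a \<in> carrier B \<Longrightarrow> b \<in> carrier B \<Longrightarrow> vdiff D (f a) (f b) = f (vdiff B a b)" for a b
    by (simp add: vdiff_def ops B.cl)
  have V: "cvector_space D"
    by (rule cvector_spaceI)
      (auto simp: car ops B.cl B.add_assoc B.zero_add B.scale_zero_left B.scale_right_distrib B.scale_left_distrib
        B.scale_scale B.scale_one intro: arg_cong[OF B.add_commute])
  have N: "cnormed D (anorm D)"
    by (intro cnormed.intro cnormed_axioms.intro V)
      (auto simp: car ops B.cl B.norm_nonneg B.norm_eq_zero B.norm_scale B.norm_triangle inj_on_eq_iff[OF f])
  interpret N: cnormed D "anorm D" by (rule N)
  have "cbanach D (anorm D)"
  proof (rule cbanachI[OF N])
    fix t assume t: "N.ncauchy t"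
    then have "\<forall>n. \<exists>b\<in>carrier B. t n = f b" by (auto simp: N.ncauchy_def car)
    then obtain s where s: "\<And>n. s n \<in> carrier B" "\<And>n. t n = f (s n)" by metis
    have "B.nv.ncauchy s" using t s by (simp add: N.ncauchy_def B.nv.ncauchy_def vd ops B.cl)
    then obtain b where b: "B.nv.conv s b" using B.nv.ncauchy_conv by blast
    then have "N.conv t (f b)" by (simp add: N.conv_def B.nv.conv_def car s vd ops B.cl)
    then show "\<exists>x. N.conv t x" by blast
  qed
  then have comp: "Metric_space.mcomplete (carrier D) (cstar_dist D)"
    using cbanach.mcomplete_ndist by (simp add: cstar_dist_eq)
  have D: "cstar_algebra D"
    by (intro cstar_algebra.intro cstar_algebra_axioms.intro V comp)
      (auto simp: car ops B.cl B.mult_assoc B.mult_add_right B.mult_add_left B.mult_scale_right B.mult_scale_left B.star_simps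
        B.norm_nonneg B.norm_eq_zero B.norm_scale B.norm_triangle B.norm_mult B.cstar_identity inj_on_eq_iff[OF f])
  have "restrict f (carrier B) \<in> star_homs B D"
    by (rule star_homsI) (simp_all add: car ops B.cl)
  moreover have "restrict g (carrier D) \<in> star_homs D B"
  proof (rule star_homsI)
    fix a b assume "a \<in> carrier D" "b \<in> carrier D"
    then obtain x y where xy: "x \<in> carrier B" "y \<in> carrier B" "a = f x" "b = f y" by (auto simp: car)
    show "restrict g (carrier D) (a \<boxplus>\<^bsub>D\<^esub> b) = restrict g (carrier D) a \<boxplus>\<^bsub>B\<^esub> restrict g (carrier D) b"
      "restrict g (carrier D) (a \<odot>\<^bsub>D\<^esub> b) = restrict g (carrier D) a \<odot>\<^bsub>B\<^esub> restrict g (carrier D) b"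
      unfolding xy(3,4) using xy(1,2) by (simp_all add: ops B.cl car)
  qed (auto simp: car ops B.cl inj_on_eq_iff[OF f])
  ultimately show ?thesis using D
    by (intro exI[of _ D] exI[of _ "restrict f (carrier B)"] exI[of _ "restrict g (carrier D)"]) (auto simp: car)
qed

section \<open>The universal covariant representation\<close>

context product_system begin

text \<open>Passing to the closed span of the elements \<open>\<psi>(x)\<psi>(y)*\<close>, every element is encoded by a sequence of
  formal sums that converges to it.\<close>

lemma CNP_small:
  fixes B :: "'b cstar"
  assumes al: "compactly_aligned G P A X" and B: "cstar_algebra B" and cnp: "CNP_covariant G P A X B \<psi>"
  shows "\<exists>(D :: ('g, 'a) sum_seqs cstar) \<psi>' \<iota>. cstar_algebra D \<and> CNP_covariant G P A X D \<psi>' \<and> generated P X D \<psi>' \<and>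
    \<iota> \<in> star_homs D B \<and> (\<forall>p\<in>P. \<forall>x\<in>carrier (fibre X p). \<iota> (\<psi>' p x) = \<psi> p x)"
proof -
  interpret R: psys_rep G P A X B \<psi> using cnp by (intro psys_repI B) (simp add: CNP_covariant_def)
  interpret R: nica_rep G P A X B \<psi> using cnp al by unfold_locales (simp_all add: CNP_covariant_def)
  let ?B0 = "B\<lparr>carrier := R.Z\<rparr>"
  have B0: "cstar_algebra ?B0" by (rule R.cstar_Z)
  have in_Z: "\<psi> p x \<in> R.Z" if "p \<in> P" "x \<in> carrier (fibre X p)" for p x by (rule R.psi_in_cspan[OF that])
  have inc: "(\<lambda>b\<in>R.Z. b) \<in> star_homs ?B0 B"
    by (rule star_homsI) (use R.Z_subset cstar_algebra.cl[OF B0] in auto)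
  \<comment> \<open>A one-element family: the inclusion of the subalgebra is injective and therefore
    reflects covariance.\<close>
  have cnp0: "CNP_covariant G P A X ?B0 \<psi>"
    by (rule joint_CNP[OF al B0, where I = "{()}" and D = "\<lambda>_. B" and h = "\<lambda>_. \<lambda>b\<in>R.Z. b" and \<phi> = "\<lambda>_. \<psi>"])
      (use in_Z inc B cnp in auto)
  interpret R0: psys_rep G P A X ?B0 \<psi> using cnp0 by (intro psys_repI B0) (simp add: CNP_covariant_def)
  have dense: "\<exists>w. (\<forall>n. set (w n) \<subseteq> R.letters) \<and> R.B.nv.conv (\<lambda>n. vlsum B (map R.word (w n))) b" if b: "b \<in> R.Z" for b
  proof -
    have sub: "vspan B R.words \<subseteq> carrier B"
      using R.B.nv.csubspace_vspan[OF R.scale_invariant_words] by (simp add: R.B.nv.csubspace_def)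
    obtain s where s: "\<And>n. s n \<in> vspan B R.words" "R.B.nv.conv s b"
      using R.B.nv.closure_conv[OF sub] b unfolding R.B.nv.cspan_def by blast
    then have "\<forall>n. \<exists>l. set l \<subseteq> R.letters \<and> s n = vlsum B (map R.word l)" unfolding R.vspan_words by blast
    then obtain w where w: "\<And>n. set (w n) \<subseteq> R.letters" "\<And>n. s n = vlsum B (map R.word (w n))" by metis
    have "s = (\<lambda>n. vlsum B (map R.word (w n)))" using w(2) by blast
    then show ?thesis using w(1) s(2) by blast
  qed
  have gen0: "generated P X ?B0 \<psi>"
    unfolding R0.generated_iff
  proof (intro ballI allI impI)
    fix b and \<epsilon> :: real assume "b \<in> carrier ?B0" and e: "0 < \<epsilon>"
    then have "b \<in> R.Z" by simp
    from dense[OF this] obtain w where w: "\<And>n. set (w n) \<subseteq> R.letters" "R.B.nv.conv (\<lambda>n. vlsum B (map R.word (w n))) b" by blast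
    have "(\<lambda>n. anorm B (vdiff B (vlsum B (map R.word (w n))) b)) \<longlonglongrightarrow> 0" using w(2) by (simp add: R.B.nv.conv_def)
    from order_tendstoD(2)[OF this e] obtain n where n: "anorm B (vdiff B (vlsum B (map R.word (w n))) b) < \<epsilon>"
      unfolding eventually_sequentially by blast
    have "R0.word = R.word" by (simp add: R0.word_def R.word_def fun_eq_iff)
    then have "anorm ?B0 (vdiff ?B0 b (vlsum ?B0 (map R0.word (w n)))) < \<epsilon>"
      using n R.B.nv.nrm_diff_commute[OF R.B.nv.convD(1)[OF w(2)] R.B.nv.convD(2)[OF w(2)]]
      by (simp add: vdiff_def vlsum_def)
    then show "\<exists>l. set l \<subseteq> R.letters \<and> anorm ?B0 (vdiff ?B0 b (vlsum ?B0 (map R0.word l))) < \<epsilon>" using w(1) by blast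
  qed
  \<comment> \<open>Uniqueness of limits makes this choice injective, which is what
    \<open>cstar_transport\<close> asks for.\<close>
  define f where "f b = (SOME w. (\<forall>n. set (w n) \<subseteq> R.letters) \<and> R.B.nv.conv (\<lambda>n. vlsum B (map R.word (w n))) b)" for b
  have f: "R.B.nv.conv (\<lambda>n. vlsum B (map R.word (f b n))) b" if "b \<in> R.Z" for b
    using someI_ex[OF dense[OF that]] unfolding f_def[symmetric] by blast
  have "inj_on f (carrier ?B0)"
  proof (rule inj_onI)
    fix a b assume ab: "a \<in> carrier ?B0" "b \<in> carrier ?B0" "f a = f b"
    have a: "R.B.nv.conv (\<lambda>n. vlsum B (map R.word (f b n))) a" using f[of a] ab by simp
    have b: "R.B.nv.conv (\<lambda>n. vlsum B (map R.word (f b n))) b" using f[of b] ab by simp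
    show "a = b" by (rule R.B.nv.conv_unique[OF a b])
  qed
  from cstar_transport[OF B0 this] obtain D :: "('g, 'a) sum_seqs cstar" and h g where
    D: "cstar_algebra D" and h: "h \<in> star_homs ?B0 D" and g: "g \<in> star_homs D ?B0"
    and gh: "\<forall>b\<in>carrier ?B0. g (h b) = b" and hg: "\<forall>d\<in>carrier D. g d \<in> carrier ?B0 \<and> h (g d) = d" by blast
  have surj: "carrier D \<subseteq> h ` carrier ?B0"
  proof
    fix d assume "d \<in> carrier D"
    then have "g d \<in> carrier ?B0" "d = h (g d)" using hg by auto
    then show "d \<in> h ` carrier ?B0" by blast
  qed
  let ?\<iota> = "compose (carrier D) (\<lambda>b\<in>R.Z. b) g"
  have "?\<iota> (h (\<psi> p x)) = \<psi> p x" if "p \<in> P" "x \<in> carrier (fibre X p)" for p x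
    using in_Z[OF that] gh star_homsD(1)[OF h, of "\<psi> p x"] by (simp add: compose_def)
  then show ?thesis
    using D push_CNP[OF al B0 D h cnp0] R0.push_generated[OF D h gen0 surj] star_hom_compose[OF D g inc]
    by (intro exI[of _ D] exI[of _ "\<lambda>p x. h (\<psi> p x)"] exI[of _ ?\<iota>]) blast
qed

section \<open>The universal property and uniqueness of the universal pair\<close>

lemma CNP_hom_unique:
  assumes "cstar_algebra N" "CNP_covariant G P A X N j" "generated P X N j" "cstar_algebra B"
    and "h \<in> star_homs N B" "g \<in> star_homs N B" "\<And>p x. p \<in> P \<Longrightarrow> x \<in> carrier (fibre X p) \<Longrightarrow> h (j p x) = g (j p x)"
  shows "h = g"
proof -
  interpret R: psys_rep G P A X N j using assms by (intro psys_repI) (simp_all add: CNP_covariant_def)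
  show ?thesis by (rule R.homs_eq[OF assms(3-7)])
qed

lemma universal_overI:
  assumes "cstar_algebra N" "CNP_covariant G P A X N j" "generated P X N j"
    and "\<And>(B :: 'b cstar) \<psi>. cstar_algebra B \<Longrightarrow> CNP_covariant G P A X B \<psi> \<Longrightarrow>
      \<exists>h\<in>star_homs N B. \<forall>p\<in>P. \<forall>x\<in>carrier (fibre X p). h (j p x) = \<psi> p x"
  shows "universal_over TYPE('b) G P A X N j"
  unfolding universal_over_def
proof (intro allI impI)
  fix B :: "'b cstar" and \<psi> assume B: "cstar_algebra B" "CNP_covariant G P A X B \<psi>"
  then obtain h where h: "h \<in> star_homs N B" "\<forall>p\<in>P. \<forall>x\<in>carrier (fibre X p). h (j p x) = \<psi> p x" using assms(4) by blast
  show "\<exists>!h. h \<in> star_homs N B \<and> (\<forall>p\<in>P. \<forall>x\<in>carrier (fibre X p). \<psi> p x = h (j p x))"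
  proof (rule ex1I[of _ h])
    show "h \<in> star_homs N B \<and> (\<forall>p\<in>P. \<forall>x\<in>carrier (fibre X p). \<psi> p x = h (j p x))" using h by simp
    fix g assume "g \<in> star_homs N B \<and> (\<forall>p\<in>P. \<forall>x\<in>carrier (fibre X p). \<psi> p x = g (j p x))"
    then show "g = h" using h by (intro CNP_hom_unique[OF assms(1-3) B(1)]) simp_all
  qed
qed

lemma universal_overD:
  assumes "universal_over TYPE('b) G P A X N j" "cstar_algebra (B :: 'b cstar)" "CNP_covariant G P A X B \<psi>"
  shows "\<exists>h\<in>star_homs N B. \<forall>p\<in>P. \<forall>x\<in>carrier (fibre X p). h (j p x) = \<psi> p x"
  using assms unfolding universal_over_def by metis

lemma universal_exists:
  assumes al: "compactly_aligned G P A X"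
  shows "\<exists>(N :: ('g, 'a) sum_seqs cstar) j. cstar_algebra N \<and> CNP_covariant G P A X N j \<and> generated P X N j \<and>
    universal_over TYPE(('g, 'a) sum_seqs) G P A X N j"
proof -
  \<comment> \<open>The covariant representations on the fixed type form a set and can index a
    product. Their common bound norm(x) places the tuple \<open>j p x\<close> among the bounded
    families.\<close>
  let ?I = "{(B :: ('g, 'a) sum_seqs cstar, \<psi>). cstar_algebra B \<and> CNP_covariant G P A X B \<psi>}"
  have I: "cstar_algebra (fst i)" "CNP_covariant G P A X (fst i) (snd i)" if "i \<in> ?I" for i using that by auto
  interpret F: cstar_family ?I fst by (rule cstar_family.intro) (rule I)
  define j where "j p x = (\<lambda>i\<in>?I. snd i p x)" for p x
  have ji: "j p x i = snd i p x" if "i \<in> ?I" for p x i using that by (simp add: j_def)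
  have jc: "j p x \<in> carrier F.C" if px: "p \<in> P" "x \<in> carrier (fibre X p)" for p x
  proof (rule F.carrierI)
    show "j p x \<in> extensional ?I" unfolding j_def by simp
    fix i assume i: "i \<in> ?I"
    interpret R: psys_rep G P A X "fst i" "snd i" using I[OF i] by (intro psys_repI) (simp_all add: CNP_covariant_def)
    interpret M: module_rep A "fibre X p" "fst i" "snd i p" R.\<pi> by (rule R.module_rep_fibre[OF px(1)])
    show "j p x i \<in> carrier (fst i)" "anorm (fst i) (j p x i) \<le> hnorm A (fibre X p) x"
      unfolding ji[OF i] by (rule M.psi_closed[OF px(2)], rule M.psi_norm_le[OF px(2)])
  qed
  let ?h = "\<lambda>i. \<lambda>x\<in>carrier F.C. x i"
  have cnp: "CNP_covariant G P A X F.C j"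
  proof (rule joint_CNP[OF al F.cstar_C jc I(1) F.proj_hom I(2)])
    show "?h i (j p x) = snd i p x" if "i \<in> ?I" "p \<in> P" "x \<in> carrier (fibre X p)" for i p x
      using jc[OF that(2,3)] ji[OF that(1)] by simp
    fix a b assume "a \<in> carrier F.C" "b \<in> carrier F.C" "\<And>i. i \<in> ?I \<Longrightarrow> ?h i a = ?h i b"
    then show "a = b" by (intro F.eqI F.carrierD(2)) simp_all
  qed
  \<comment> \<open>The product lives on functions over \<open>?I\<close>, a larger type. Its
    generated part returns to the fixed type together with a homomorphism into the product, through
    which the projections act.\<close>
  from CNP_small[OF al F.cstar_C cnp] obtain N :: "('g, 'a) sum_seqs cstar" and k \<iota> where
    N: "cstar_algebra N" "CNP_covariant G P A X N k" "generated P X N k"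
    and \<iota>: "\<iota> \<in> star_homs N F.C" "\<forall>p\<in>P. \<forall>x\<in>carrier (fibre X p). \<iota> (k p x) = j p x" by blast
  have "universal_over TYPE(('g, 'a) sum_seqs) G P A X N k"
  proof (rule universal_overI[OF N])
    fix B :: "('g, 'a) sum_seqs cstar" and \<psi> assume "cstar_algebra B" "CNP_covariant G P A X B \<psi>"
    then have i: "(B, \<psi>) \<in> ?I" by simp
    interpret R: psys_rep G P A X N k using N by (intro psys_repI) (simp_all add: CNP_covariant_def)
    show "\<exists>h\<in>star_homs N B. \<forall>p\<in>P. \<forall>x\<in>carrier (fibre X p). h (k p x) = \<psi> p x"
    proof (intro bexI ballI)
      show "compose (carrier N) (?h (B, \<psi>)) \<iota> \<in> star_homs N B"
        using star_hom_compose[OF N(1) \<iota>(1) F.proj_hom[OF i]] by simp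
      fix p x assume px: "p \<in> P" "x \<in> carrier (fibre X p)"
      then show "compose (carrier N) (?h (B, \<psi>)) \<iota> (k p x) = \<psi> p x"
        using R.psi_closed[OF px] \<iota>(2) jc[OF px] ji[OF i, of p x] by (simp add: compose_def)
    qed
  qed
  then show ?thesis using N by blast
qed

text \<open>A representation on any type factors through its generated part, of which
  \<open>CNP_small\<close> supplies a copy on the fixed type, where the universal property
  applies.\<close>

lemma universal_over_any:
  fixes N :: "'n cstar"
  assumes al: "compactly_aligned G P A X"
    and N: "cstar_algebra N" "CNP_covariant G P A X N j" "generated P X N j"
    and univ: "universal_over TYPE(('g, 'a) sum_seqs) G P A X N j"
  shows "universal_over TYPE('b) G P A X N j"
proof (rule universal_overI[OF N])
  fix B :: "'b cstar" and \<psi> assume B: "cstar_algebra B" "CNP_covariant G P A X B \<psi>"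
  interpret R: psys_rep G P A X N j using N by (intro psys_repI) (simp_all add: CNP_covariant_def)
  from CNP_small[OF al B] obtain D :: "('g, 'a) sum_seqs cstar" and \<psi>' \<iota> where
    D: "cstar_algebra D" "CNP_covariant G P A X D \<psi>'"
    and \<iota>: "\<iota> \<in> star_homs D B" "\<forall>p\<in>P. \<forall>x\<in>carrier (fibre X p). \<iota> (\<psi>' p x) = \<psi> p x" by blast
  from universal_overD[OF univ D] obtain h where
    h: "h \<in> star_homs N D" "\<forall>p\<in>P. \<forall>x\<in>carrier (fibre X p). h (j p x) = \<psi>' p x" by blast
  show "\<exists>h\<in>star_homs N B. \<forall>p\<in>P. \<forall>x\<in>carrier (fibre X p). h (j p x) = \<psi> p x"
    using star_hom_compose[OF N(1) h(1) \<iota>(1)] h(2) \<iota>(2) R.psi_closed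
    by (intro bexI[of _ "compose (carrier N) \<iota> h"]) (simp_all add: compose_def)
qed

text \<open>The composite fixes every j(x), as the identity does, and homomorphisms that agree there
  are equal by \<open>CNP_hom_unique\<close>.\<close>

lemma universal_left_inverse:
  assumes N: "cstar_algebra N" "CNP_covariant G P A X N j" "generated P X N j" and C: "cstar_algebra C"
    and f: "f \<in> star_homs N C" "\<forall>p\<in>P. \<forall>x\<in>carrier (fibre X p). f (j p x) = \<rho> p x"
    and g: "g \<in> star_homs C N" "\<forall>p\<in>P. \<forall>x\<in>carrier (fibre X p). g (\<rho> p x) = j p x"
    and a: "a \<in> carrier N"
  shows "g (f a) = a"
proof -
  interpret R: psys_rep G P A X N j using N by (intro psys_repI) (simp_all add: CNP_covariant_def)
  have "compose (carrier N) g f = (\<lambda>a\<in>carrier N. a)"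
  proof (rule CNP_hom_unique[OF N N(1) star_hom_compose[OF N(1) f(1) g(1)]])
    show "(\<lambda>a\<in>carrier N. a) \<in> star_homs N N" by (rule star_homsI) (simp_all add: R.B.cl)
    show "compose (carrier N) g f (j p x) = (\<lambda>a\<in>carrier N. a) (j p x)" if "p \<in> P" "x \<in> carrier (fibre X p)" for p x
      using that f(2) g(2) R.psi_closed[OF that] by (simp add: compose_def)
  qed
  from fun_cong[OF this, of a] show ?thesis using a by (simp add: compose_def)
qed

text \<open>Each pair is universal over the carrier type of the other, which provides homomorphisms
  in both directions; they invert each other.\<close>

lemma universal_unique:
  fixes N :: "'n cstar" and C :: "'c cstar"
  assumes N: "cstar_algebra N" "CNP_covariant G P A X N j" "generated P X N j" "universal_over TYPE('c) G P A X N j"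
    and C: "cstar_algebra C" "CNP_covariant G P A X C \<rho>" "generated P X C \<rho>" "universal_over TYPE('n) G P A X C \<rho>"
  shows "\<exists>\<theta>\<in>star_isos N C. \<forall>p\<in>P. \<forall>x\<in>carrier (fibre X p). \<theta> (j p x) = \<rho> p x"
proof -
  obtain f where f: "f \<in> star_homs N C" "\<forall>p\<in>P. \<forall>x\<in>carrier (fibre X p). f (j p x) = \<rho> p x"
    using universal_overD[OF N(4) C(1,2)] by blast
  obtain g where g: "g \<in> star_homs C N" "\<forall>p\<in>P. \<forall>x\<in>carrier (fibre X p). g (\<rho> p x) = j p x"
    using universal_overD[OF C(4) N(1,2)] by blast
  have "bij_betw f (carrier N) (carrier C)"
    by (rule bij_betw_byWitness[where f' = g])
      (use universal_left_inverse[OF N(1-3) C(1) f g] universal_left_inverse[OF C(1-3) N(1) g f]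
        star_homsD(1)[OF f(1)] star_homsD(1)[OF g(1)] in auto)
  then show ?thesis using f by (auto simp: star_isos_def)
qed

end

theorem proposition3p12:
  fixes G :: "'g monoid" and P :: "'g set" and A :: "'a cstar" and X :: "('g, 'a) psys"
  assumes "quasi_lattice_ordered G P"
    and "cstar_algebra A"
    and "product_system G P A X"
    and "compactly_aligned G P A X"
    and "\<forall>q\<in>P. inj_on (phi_tilde G P A X q) (carrier A)"
  shows
    "(\<exists>(NO :: ('g, 'a) sum_seqs cstar) j.
        cstar_algebra NO \<and> CNP_covariant G P A X NO j \<and>
        generated P X NO j \<and> universal_over TYPE(('g, 'a) sum_seqs) G P A X NO j) \<and>
     (\<forall>(NO :: ('g, 'a) sum_seqs cstar) j.
        cstar_algebra NO \<and> CNP_covariant G P A X NO j \<and>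
        generated P X NO j \<and> universal_over TYPE(('g, 'a) sum_seqs) G P A X NO j \<longrightarrow>
          universal_over TYPE('b) G P A X NO j \<and>
          (\<forall>(C :: 'c cstar) \<rho>.
             cstar_algebra C \<and> CNP_covariant G P A X C \<rho> \<and>
             generated P X C \<rho> \<and> universal_over TYPE(('g, 'a) sum_seqs) G P A X C \<rho> \<longrightarrow>
               (\<exists>\<theta> \<in> star_isos NO C.
                  \<forall>p\<in>P. \<forall>x\<in>carrier (fibre X p). \<theta> (j p x) = \<rho> p x)))"
proof -
  interpret product_system G P A X by fact
  note univ_any = universal_over_any[OF assms(4)]
  show ?thesis
  proof (intro conjI universal_exists[OF assms(4)] allI impI; elim conjE)
    fix NO :: "('g, 'a) sum_seqs cstar" and j
    assume N: "cstar_algebra NO" "CNP_covariant G P A X NO j" "generated P X NO j"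
      "universal_over TYPE(('g, 'a) sum_seqs) G P A X NO j"
    show "universal_over TYPE('b) G P A X NO j" by (rule univ_any[OF N])
    fix C :: "'c cstar" and \<rho>
    assume C: "cstar_algebra C" "CNP_covariant G P A X C \<rho>" "generated P X C \<rho>"
      "universal_over TYPE(('g, 'a) sum_seqs) G P A X C \<rho>"
    show "\<exists>\<theta>\<in>star_isos NO C. \<forall>p\<in>P. \<forall>x\<in>carrier (fibre X p). \<theta> (j p x) = \<rho> p x"
      \<comment> \<open>For \<open>C\<close>, universality over the type of \<open>NO\<close> is
        assumed; for \<open>NO\<close>, universality over the type of \<open>C\<close> comes from
        \<open>universal_over_any\<close>.\<close>
      by (rule universal_unique[OF N(1-3) univ_any[OF N] C])
  qed
qed

end
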